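(* Let $A$ be a Koszul DG algebra over a field $k$. Then: (i) the Ext-algebra $E=\operatorname{Ext}_A^*({}_Ak,{}_Ak)$ of $A$ is an augmented algebra; (ii) there is a filtration $$\mathbf{F}:\quad E=F_0\supseteq F_1\supseteq\cdots\supseteq F_n\supseteq\cdots$$ on $E$ such that $E$ is a filtered algebra with respect to $\mathbf{F}$. Moreover, if the cohomology algebra $H(A)$ is a Koszul algebra, then the associated graded algebra $gr_{\mathbf F}(E)$ is isomorphic to the dual Koszul algebra $(H(A))^!$.
   Context: $k$ is a field and all algebras are $k$-algebras. A connected DG algebra is a cochain DG algebra $A=\bigoplus_{n\ge 0}A^n$ with $A^0=k$ and differential $d$ of degree $1$ which is a graded derivation. ${}_Ak$ is the trivial left DG $A$-module $A/A^{\ge1}$. A left DG $A$-module $P$ is semifree if it has a semibasis: a basis $B$ of the underlying graded $A$-module with a decomposition $B=\bigsqcup_{n\ge0}B^n$ into graded subsets such that $d(B^0)=0$ and $d(B^n)\subseteq\bigoplus_{e\in\bigsqcup_{i<n}B^i}Ae$ for $n>0$. $P$ is minimal if $d(P)\subseteq A^{\geq 1}P$. A connected DG algebra $A$ is a Koszul DG algebra if ${}_Ak$ has a minimal semifree resolution $P\to{}_Ak$ (a quasi-isomorphism with $P$ minimal semifree) with a semibasis consisting of elements of degree $0$. $\operatorname{Ext}^n_A(M,N)=H^n(\operatorname{RHom}_A(M,N))$, and $\operatorname{Ext}_A^*({}_Ak,{}_Ak)=\bigoplus_n\operatorname{Ext}^n_A({}_Ak,{}_Ak)$ is an algebra under composition.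 Filtered algebra means $F_nF_m\subseteq F_{n+m}$, and $gr_{\mathbf F}(E)=\bigoplus_{n\ge0}F_n/F_{n+1}$. An augmented algebra is an algebra with an algebra morphism to $k$. A quadratic algebra is $R=T(V)/(U)$ with $V$ a finite dimensional vector space and $U\subseteq V\otimes V$ a subspace; its quadratic dual is $R^!=T(V^* )/(U^\perp)$ with $U^\perp\subseteq (V\otimes V)^*\cong V^*\otimes V^*$ the orthogonal complement of $U$. A quadratic algebra $R$ is Koszul if the trivial module ${}_Rk$ has a graded free resolution $\cdots\to Q_n\to\cdots\to Q_0\to{}_Rk\to0$ with $Q_n$ generated in degree $n$ for all $n\geq 0$. *)

theory Defs
  imports "HOL-Algebra.QuotRing" "HOL-Algebra.Module" "HOL-Algebra.Generated_Groups" "HOL-Library.Disjoint_Sets"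
begin

text \<open>
  The ground field is a type \<^typ>\<open>'k\<close> of class \<^class>\<open>field\<close>. A DG algebra and the modules over
  the algebras below live on types of class \<^class>\<open>ring_1\<close> and \<^class>\<open>ab_group_add\<close>. The algebras
  built by quotients (\<open>H(A)\<close>, \<open>Ext\<close>, \<open>gr\<close>, \<open>T(V)/(U)\<close>) are records of the
  HOL-Algebra type \<^typ>\<open>('k, 'a) module\<close>: a ring together with a scalar multiplication.
\<close>

section \<open>Associative algebras over a field\<close>

definition type_alg :: "('k \<Rightarrow> 'a \<Rightarrow> 'a) \<Rightarrow> ('k, 'a::ring_1) module" where
  "type_alg s = \<lparr>carrier = UNIV, mult = (*), one = 1, zero = 0, add = (+), smult = s\<rparr>"

definition ground :: "('k::field, 'k) module" where
  "ground = type_alg (*)"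

definition kalgebra :: "('k::field, 'a) module \<Rightarrow> bool" where
  "kalgebra R \<longleftrightarrow> ring R \<and> Module.module ground R \<and>
     (\<forall>c. \<forall>x\<in>carrier R. \<forall>y\<in>carrier R.
        c \<odot>\<^bsub>R\<^esub> (x \<otimes>\<^bsub>R\<^esub> y) = (c \<odot>\<^bsub>R\<^esub> x) \<otimes>\<^bsub>R\<^esub> y \<and>
        c \<odot>\<^bsub>R\<^esub> (x \<otimes>\<^bsub>R\<^esub> y) = x \<otimes>\<^bsub>R\<^esub> (c \<odot>\<^bsub>R\<^esub> y))"

definition alg_hom :: "('k::field, 'a) module \<Rightarrow> ('k, 'b) module \<Rightarrow> ('a \<Rightarrow> 'b) set" where
  "alg_hom R S = {h \<in> ring_hom R S. \<forall>c. \<forall>x\<in>carrier R. h (c \<odot>\<^bsub>R\<^esub> x) = c \<odot>\<^bsub>S\<^esub> h x}"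

definition augmented_algebra :: "('k::field, 'a) module \<Rightarrow> bool" where
  "augmented_algebra R \<longleftrightarrow> kalgebra R \<and> (\<exists>h. h \<in> alg_hom R ground)"

text \<open>The library quotient ring \<^term>\<open>R Quot I\<close> with the induced scalar multiplication.\<close>

definition alg_quot :: "('k, 'a) module \<Rightarrow> 'a set \<Rightarrow> ('k, 'a set) module" where
  "alg_quot R I =
     ring.extend (R Quot I) (module.fields (\<lambda>c X. \<Union>x\<in>X. I +>\<^bsub>R\<^esub> (c \<odot>\<^bsub>R\<^esub> x)))"

text \<open>Isomorphism of graded algebras; the second components are the homogeneous parts.\<close>

definition graded_alg_iso ::
  "('k::field, 'a) module \<Rightarrow> (nat \<Rightarrow> 'a set) \<Rightarrow> ('k, 'b) module \<Rightarrow> (nat \<Rightarrow> 'b set) \<Rightarrow> bool" where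
  "graded_alg_iso R gR S gS \<longleftrightarrow>
     (\<exists>h \<in> alg_hom R S. bij_betw h (carrier R) (carrier S) \<and> (\<forall>n. h ` gR n = gS n))"

section \<open>Graded modules over a graded algebra\<close>

definition add_subgroup :: "'m::ab_group_add set \<Rightarrow> bool" where
  "add_subgroup S \<longleftrightarrow> 0 \<in> S \<and> (\<forall>x\<in>S. \<forall>y\<in>S. x - y \<in> S)"

definition internal_direct_sum :: "'m::ab_group_add set \<Rightarrow> ('i \<Rightarrow> 'm set) \<Rightarrow> bool" where
  "internal_direct_sum C G \<longleftrightarrow> (\<forall>i. add_subgroup (G i) \<and> G i \<subseteq> C) \<and>
     (\<forall>x\<in>C. \<exists>!c. (\<forall>i. c i \<in> G i) \<and> finite {i. c i \<noteq> 0} \<and> x = (\<Sum>i | c i \<noteq> 0. c i))"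

definition left_module ::
  "('k, 'a) module \<Rightarrow> ('a \<Rightarrow> 'm \<Rightarrow> 'm) \<Rightarrow> 'm::ab_group_add set \<Rightarrow> bool" where
  "left_module R act C \<longleftrightarrow> add_subgroup C \<and>
     (\<forall>r\<in>carrier R. \<forall>x\<in>C. act r x \<in> C) \<and>
     (\<forall>r\<in>carrier R. \<forall>x\<in>C. \<forall>y\<in>C. act r (x + y) = act r x + act r y) \<and>
     (\<forall>r\<in>carrier R. \<forall>s\<in>carrier R. \<forall>x\<in>C. act (r \<oplus>\<^bsub>R\<^esub> s) x = act r x + act s x) \<and>
     (\<forall>r\<in>carrier R. \<forall>s\<in>carrier R. \<forall>x\<in>C. act (r \<otimes>\<^bsub>R\<^esub> s) x = act r (act s x)) \<and>
     (\<forall>x\<in>C. act \<one>\<^bsub>R\<^esub> x = x)"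

definition graded_left_module ::
  "('k, 'a) module \<Rightarrow> (nat \<Rightarrow> 'a set) \<Rightarrow> ('a \<Rightarrow> 'm \<Rightarrow> 'm) \<Rightarrow> 'm::ab_group_add set \<Rightarrow>
    (int \<Rightarrow> 'm set) \<Rightarrow> bool" where
  "graded_left_module R gR act C G \<longleftrightarrow> left_module R act C \<and> internal_direct_sum C G \<and>
     (\<forall>i j. \<forall>r\<in>gR i. \<forall>x\<in>G j. act r x \<in> G (int i + j))"

text \<open>Homomorphisms of degree zero.\<close>

definition graded_hom ::
  "('k, 'a) module \<Rightarrow>
    ('a \<Rightarrow> 'm \<Rightarrow> 'm) \<Rightarrow> 'm::ab_group_add set \<Rightarrow> (int \<Rightarrow> 'm set) \<Rightarrow>
    ('a \<Rightarrow> 'n \<Rightarrow> 'n) \<Rightarrow> 'n::ab_group_add set \<Rightarrow> (int \<Rightarrow> 'n set) \<Rightarrow> ('m \<Rightarrow> 'n) \<Rightarrow> bool" where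
  "graded_hom R act C G act' C' G' f \<longleftrightarrow>
     f ` C \<subseteq> C' \<and> (\<forall>j. f ` G j \<subseteq> G' j) \<and>
     (\<forall>x\<in>C. \<forall>y\<in>C. f (x + y) = f x + f y) \<and>
     (\<forall>r\<in>carrier R. \<forall>x\<in>C. f (act r x) = act' r (f x))"

definition left_span ::
  "('k, 'a) module \<Rightarrow> ('a \<Rightarrow> 'm \<Rightarrow> 'm) \<Rightarrow> 'm::ab_group_add set \<Rightarrow> 'm set" where
  "left_span R act S =
     {\<Sum>b\<in>F. act (c b) b | F c. finite F \<and> F \<subseteq> S \<and> (\<forall>b. c b \<in> carrier R)}"

definition module_basis ::
  "('k, 'a) module \<Rightarrow> ('a \<Rightarrow> 'm \<Rightarrow> 'm) \<Rightarrow> 'm::ab_group_add set \<Rightarrow> 'm set \<Rightarrow> bool" where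
  "module_basis R act C B \<longleftrightarrow> B \<subseteq> C \<and>
     (\<forall>x\<in>C. \<exists>!c. (\<forall>b. c b \<in> carrier R) \<and> finite {b. c b \<noteq> \<zero>\<^bsub>R\<^esub>} \<and> {b. c b \<noteq> \<zero>\<^bsub>R\<^esub>} \<subseteq> B \<and>
        x = (\<Sum>b | c b \<noteq> \<zero>\<^bsub>R\<^esub>. act (c b) b))"

text \<open>
  For an algebra \<open>R\<close> graded by \<open>\<nat>\<close> with \<open>R\<^sub>0 = k\<close>, the trivial module \<open>R/R\<^sub>\<ge>\<^sub>1\<close> is realised on \<open>k\<close>
  itself: \<open>r\<close> acts as multiplication by the unique scalar \<open>c\<close> with \<open>r - c\<cdot>1 \<in> R\<^sub>\<ge>\<^sub>1\<close>.
\<close>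

definition pos_part :: "('k, 'a) module \<Rightarrow> (nat \<Rightarrow> 'a set) \<Rightarrow> 'a set" where
  "pos_part R gR = generate (add_monoid R) (\<Union>n\<in>{0<..}. gR n)"

definition trivial_act :: "('k::field, 'a) module \<Rightarrow> (nat \<Rightarrow> 'a set) \<Rightarrow> 'a \<Rightarrow> 'k \<Rightarrow> 'k" where
  "trivial_act R gR r x = (THE c. r \<ominus>\<^bsub>R\<^esub> (c \<odot>\<^bsub>R\<^esub> \<one>\<^bsub>R\<^esub>) \<in> pos_part R gR) * x"

definition trivial_grading :: "int \<Rightarrow> 'k::field set" where
  "trivial_grading j = (if j = 0 then UNIV else {0})"

section \<open>DG algebras and DG modules\<close>

definition ksign :: "int \<Rightarrow> 'm::ab_group_add \<Rightarrow> 'm" where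
  "ksign n x = (if even n then x else - x)"

locale connected_dg_algebra =
  fixes scale :: "'k::field \<Rightarrow> 'a::ring_1 \<Rightarrow> 'a"
    and A :: "nat \<Rightarrow> 'a set"
    and d :: "'a \<Rightarrow> 'a"
  assumes algebra: "kalgebra (type_alg scale)"
    and grading: "internal_direct_sum UNIV A"
    and grading_mult: "x \<in> A m \<Longrightarrow> y \<in> A n \<Longrightarrow> x * y \<in> A (m + n)"
    and connected: "A 0 = range (\<lambda>c. scale c 1)"
    and d_add: "d (x + y) = d x + d y"
    and d_scale: "d (scale c x) = scale c (d x)"
    and d_degree: "x \<in> A n \<Longrightarrow> d x \<in> A (Suc n)"
    and d_square: "d (d x) = 0"
    and d_leibniz: "x \<in> A n \<Longrightarrow> d (x * y) = d x * y + ksign (int n) (x * d y)"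

locale dg_module = connected_dg_algebra scale A d
  for scale :: "'k::field \<Rightarrow> 'a::ring_1 \<Rightarrow> 'a" and A d +
  fixes act :: "'a \<Rightarrow> 'm::ab_group_add \<Rightarrow> 'm"
    and M :: "int \<Rightarrow> 'm set"
    and dM :: "'m \<Rightarrow> 'm"
  assumes graded_module: "graded_left_module (type_alg scale) A act UNIV M"
    and dM_add: "dM (x + y) = dM x + dM y"
    and dM_degree: "x \<in> M j \<Longrightarrow> dM x \<in> M (j + 1)"
    and dM_square: "dM (dM x) = 0"
    and dM_leibniz: "a \<in> A i \<Longrightarrow> dM (act a x) = act (d a) x + ksign (int i) (act a (dM x))"

text \<open>\<open>f\<close> induces an isomorphism in cohomology in each degree (injectivity, then surjectivity).\<close>

definition quasi_iso ::
  "(int \<Rightarrow> 'm set) \<Rightarrow> ('m \<Rightarrow> 'm) \<Rightarrow> (int \<Rightarrow> 'n set) \<Rightarrow> ('n \<Rightarrow> 'n) \<Rightarrow>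
    ('m::ab_group_add \<Rightarrow> 'n::ab_group_add) \<Rightarrow> bool" where
  "quasi_iso M dM N dN f \<longleftrightarrow>
     (\<forall>n. (\<forall>x\<in>M n. dM x = 0 \<longrightarrow> f x \<in> dN ` N (n - 1) \<longrightarrow> x \<in> dM ` M (n - 1)) \<and>
          (\<forall>y\<in>N n. dN y = 0 \<longrightarrow> (\<exists>x\<in>M n. dM x = 0 \<and> y - f x \<in> dN ` N (n - 1))))"

context connected_dg_algebra
begin

definition resolves_trivial ::
  "('a \<Rightarrow> 'm \<Rightarrow> 'm) \<Rightarrow> (int \<Rightarrow> 'm set) \<Rightarrow> ('m \<Rightarrow> 'm) \<Rightarrow> ('m::ab_group_add \<Rightarrow> 'k) \<Rightarrow> bool" where
  "resolves_trivial act M dM e \<longleftrightarrow>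
     graded_hom (type_alg scale) act UNIV M
       (trivial_act (type_alg scale) A) UNIV trivial_grading e \<and>
     (\<forall>x. e (dM x) = 0) \<and>
     quasi_iso M dM trivial_grading (\<lambda>_. 0) e"

definition semibasis ::
  "('a \<Rightarrow> 'm \<Rightarrow> 'm) \<Rightarrow> (int \<Rightarrow> 'm set) \<Rightarrow> ('m \<Rightarrow> 'm) \<Rightarrow> (nat \<Rightarrow> 'm::ab_group_add set) \<Rightarrow> bool" where
  "semibasis act M dM B \<longleftrightarrow>
     disjoint_family B \<and> (\<forall>n. B n \<subseteq> (\<Union>j. M j)) \<and>
     module_basis (type_alg scale) act UNIV (\<Union>n. B n) \<and>
     (\<forall>b\<in>B 0. dM b = 0) \<and>
     (\<forall>n>0. \<forall>b\<in>B n. dM b \<in> left_span (type_alg scale) act (\<Union>i<n. B i))"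

definition minimal :: "('a \<Rightarrow> 'm \<Rightarrow> 'm) \<Rightarrow> ('m \<Rightarrow> 'm::ab_group_add) \<Rightarrow> bool" where
  "minimal act dM \<longleftrightarrow>
     (\<forall>x. dM x \<in> {\<Sum>(a, y)\<leftarrow>l. act a y | l. fst ` set l \<subseteq> pos_part (type_alg scale) A})"

definition semifree_resolution ::
  "('a \<Rightarrow> 'm \<Rightarrow> 'm) \<Rightarrow> (int \<Rightarrow> 'm set) \<Rightarrow> ('m \<Rightarrow> 'm::ab_group_add) \<Rightarrow> bool" where
  "semifree_resolution act M dM \<longleftrightarrow> dg_module scale A d act M dM \<and>
     (\<exists>B. semibasis act M dM B) \<and> (\<exists>e. resolves_trivial act M dM e)"

text \<open>
  The type argument is the type on which the resolution lives. In the theorem it is a type variable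
  occurring in this hypothesis only, so that the hypothesis amounts to the existence of a
  resolution on some type.
\<close>

definition koszul_dg :: "'m::ab_group_add itself \<Rightarrow> bool" where
  "koszul_dg _ \<longleftrightarrow>
     (\<exists>(act :: 'a \<Rightarrow> 'm \<Rightarrow> 'm) M dM e B. dg_module scale A d act M dM \<and>
        semibasis act M dM B \<and> (\<Union>n. B n) \<subseteq> M 0 \<and> minimal act dM \<and>
        resolves_trivial act M dM e)"

subsection \<open>The cohomology algebra\<close>

definition cocycle_alg :: "('k, 'a) module" where
  "cocycle_alg = (type_alg scale)\<lparr>carrier := {x. d x = 0}\<rparr>"

definition cohomology_alg :: "('k, 'a set) module" where
  "cohomology_alg = alg_quot cocycle_alg (range d)"

definition cohomology_part :: "nat \<Rightarrow> 'a set set" where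
  "cohomology_part n = {range d +>\<^bsub>cocycle_alg\<^esub> x | x. x \<in> A n \<and> d x = 0}"

end

subsection \<open>The Ext-algebra\<close>

text \<open>
  For a semifree resolution \<open>M\<close> of the trivial module, \<open>RHom\<^sub>A(k, k)\<close> is represented by the complex
  \<open>Hom\<^sub>A(M, M)\<close>, whose part of degree \<open>n\<close> is \<open>end_part n\<close> and whose differential is
  \<open>f \<mapsto> dM \<circ> f - (-1)\<^sup>n f \<circ> dM\<close>.
\<close>

context dg_module
begin

definition end_part :: "int \<Rightarrow> ('m \<Rightarrow> 'm) set" where
  "end_part n = {f. (\<forall>x y. f (x + y) = f x + f y) \<and> (\<forall>j. f ` M j \<subseteq> M (j + n)) \<and>
     (\<forall>i. \<forall>a\<in>A i. \<forall>x. f (act a x) = ksign (n * int i) (act a (f x)))}"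

definition end_diff :: "int \<Rightarrow> ('m \<Rightarrow> 'm) \<Rightarrow> ('m \<Rightarrow> 'm)" where
  "end_diff n f = (\<lambda>x. dM (f x) - ksign n (f (dM x)))"

definition end_cocycles :: "int \<Rightarrow> ('m \<Rightarrow> 'm) set" where
  "end_cocycles n = {f \<in> end_part n. end_diff n f = (\<lambda>_. 0)}"

definition end_coboundaries :: "int \<Rightarrow> ('m \<Rightarrow> 'm) set" where
  "end_coboundaries n = end_diff (n - 1) ` end_part (n - 1)"

definition sum_parts :: "(int \<Rightarrow> ('m \<Rightarrow> 'm) set) \<Rightarrow> ('m \<Rightarrow> 'm) set" where
  "sum_parts Z = {\<lambda>x. \<Sum>n\<in>N. f n x | N f. finite N \<and> (\<forall>n\<in>N. f n \<in> Z n)}"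

definition end_cocycle_alg :: "('k, 'm \<Rightarrow> 'm) module" where
  "end_cocycle_alg =
     \<lparr>carrier = sum_parts end_cocycles, mult = (\<circ>), one = id, zero = (\<lambda>_. 0),
      add = (\<lambda>f g x. f x + g x), smult = (\<lambda>c f x. act (scale c 1) (f x))\<rparr>"

text \<open>
  Homogeneous maps of distinct degrees are linearly independent, so this quotient is
  \<open>\<Oplus>\<^sub>n H\<^sup>n(Hom\<^sub>A(M, M))\<close>.
\<close>

definition ext_alg :: "('k, ('m \<Rightarrow> 'm) set) module" where
  "ext_alg = alg_quot end_cocycle_alg (sum_parts end_coboundaries)"

end

section \<open>Filtrations and associated graded algebras\<close>

definition alg_filtration :: "('k::field, 'e) module \<Rightarrow> (nat \<Rightarrow> 'e set) \<Rightarrow> bool" where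
  "alg_filtration E F \<longleftrightarrow> F 0 = carrier E \<and> (\<forall>n. F (Suc n) \<subseteq> F n) \<and>
     (\<forall>n. submodule (F n) ground E) \<and>
     (\<forall>m n. \<forall>x\<in>F m. \<forall>y\<in>F n. x \<otimes>\<^bsub>E\<^esub> y \<in> F (m + n))"

text \<open>
  Elements of \<open>gr\<close> are finitely supported families of cosets \<open>\<phi> n \<in> F\<^sub>n/F\<^sub>n\<^sub>+\<^sub>1\<close>. The degree \<open>n\<close> part of a
  product is the coset of \<open>\<Sum>\<^sub>i\<^sub>\<le>\<^sub>n x\<^sub>i y\<^sub>n\<^sub>-\<^sub>i\<close>, for arbitrary representatives \<open>x\<^sub>i\<close> and \<open>y\<^sub>j\<close>.
\<close>

definition gr_alg :: "('k, 'e) module \<Rightarrow> (nat \<Rightarrow> 'e set) \<Rightarrow> ('k, nat \<Rightarrow> 'e set) module" where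
  "gr_alg E F =
     \<lparr>carrier = {\<phi>. (\<forall>n. \<phi> n \<in> (\<lambda>x. F (Suc n) +>\<^bsub>E\<^esub> x) ` F n) \<and> finite {n. \<phi> n \<noteq> F (Suc n)}},
      mult = (\<lambda>\<phi> \<psi> n. \<Union>{F (Suc n) +>\<^bsub>E\<^esub> (\<Oplus>\<^bsub>E\<^esub>i\<in>{..n}. x i \<otimes>\<^bsub>E\<^esub> y (n - i)) | x y.
                 \<forall>i\<le>n. x i \<in> \<phi> i \<and> y i \<in> \<psi> i}),
      one = (\<lambda>n. if n = 0 then F (Suc 0) +>\<^bsub>E\<^esub> \<one>\<^bsub>E\<^esub> else F (Suc n)),
      zero = (\<lambda>n. F (Suc n)),
      add = (\<lambda>\<phi> \<psi> n. \<phi> n <+>\<^bsub>E\<^esub> \<psi> n),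
      smult = (\<lambda>c \<phi> n. \<Union>x\<in>\<phi> n. F (Suc n) +>\<^bsub>E\<^esub> (c \<odot>\<^bsub>E\<^esub> x))\<rparr>"

definition gr_part :: "('k, 'e) module \<Rightarrow> (nat \<Rightarrow> 'e set) \<Rightarrow> nat \<Rightarrow> (nat \<Rightarrow> 'e set) set" where
  "gr_part E F n = {\<phi> \<in> carrier (gr_alg E F). \<forall>m. m \<noteq> n \<longrightarrow> \<phi> m = F (Suc m)}"

section \<open>Quadratic algebras and Koszul algebras\<close>

text \<open>
  \<open>V\<close> has a basis indexed by \<open>0, \<dots>, m - 1\<close>, so \<open>T(V)\<close> consists of the finitely supported \<open>k\<close>-valued
  functions on words in these letters. Using the dual basis, \<open>T(V\<^sup>*)\<close> is the same algebra.
\<close>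

definition tensor_alg :: "nat \<Rightarrow> ('k::field, nat list \<Rightarrow> 'k) module" where
  "tensor_alg m =
     \<lparr>carrier = {f. finite {w. f w \<noteq> 0} \<and> {w. f w \<noteq> 0} \<subseteq> lists {..<m}},
      mult = (\<lambda>f g w. \<Sum>i\<le>length w. f (take i w) * g (drop i w)),
      one = (\<lambda>w. if w = [] then 1 else 0),
      zero = (\<lambda>_. 0),
      add = (\<lambda>f g w. f w + g w),
      smult = (\<lambda>c f w. c * f w)\<rparr>"

definition tensor_part :: "nat \<Rightarrow> nat \<Rightarrow> (nat list \<Rightarrow> 'k::field) set" where
  "tensor_part m n = {f \<in> carrier (tensor_alg m). \<forall>w. f w \<noteq> 0 \<longrightarrow> length w = n}"

definition quadratic_relations :: "nat \<Rightarrow> (nat list \<Rightarrow> 'k::field) set \<Rightarrow> bool" where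
  "quadratic_relations m U \<longleftrightarrow> submodule U ground (tensor_alg m) \<and> U \<subseteq> tensor_part m 2"

definition quadratic_alg ::
  "nat \<Rightarrow> (nat list \<Rightarrow> 'k::field) set \<Rightarrow> ('k, (nat list \<Rightarrow> 'k) set) module" where
  "quadratic_alg m U = alg_quot (tensor_alg m) (Idl\<^bsub>tensor_alg m\<^esub> U)"

definition quadratic_part ::
  "nat \<Rightarrow> (nat list \<Rightarrow> 'k::field) set \<Rightarrow> nat \<Rightarrow> (nat list \<Rightarrow> 'k) set set" where
  "quadratic_part m U n = {Idl\<^bsub>tensor_alg m\<^esub> U +>\<^bsub>tensor_alg m\<^esub> f | f. f \<in> tensor_part m n}"

text \<open>
  The orthogonal complement for the pairing \<open>\<langle>f \<otimes> g, v \<otimes> w\<rangle> = f(v) g(w)\<close>. With left modules and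
  \<open>Ext\<close> multiplied by composition of maps, this is the convention giving \<open>R\<^sup>!\<close>, not its opposite.
\<close>

definition orthogonal_relations ::
  "nat \<Rightarrow> (nat list \<Rightarrow> 'k::field) set \<Rightarrow> (nat list \<Rightarrow> 'k) set" where
  "orthogonal_relations m U =
     {g \<in> tensor_part m 2. \<forall>u\<in>U. (\<Sum>i<m. \<Sum>j<m. g [i, j] * u [i, j]) = 0}"

text \<open>
  Existence of a graded free resolution of the trivial module over a graded algebra \<open>R\<close>, with \<open>Q n\<close>
  generated in degree \<open>n\<close>. The map \<open>dQ n\<close> goes from \<open>Q (n + 1)\<close> to \<open>Q n\<close>, and \<open>G n\<close> is the internal grading of
  \<open>Q n\<close>. The type argument has the same role as in \<open>koszul_dg\<close>.
\<close>

definition has_koszul_resolution ::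
  "'q::ab_group_add itself \<Rightarrow> ('k::field, 'a) module \<Rightarrow> (nat \<Rightarrow> 'a set) \<Rightarrow> bool" where
  "has_koszul_resolution _ R gR \<longleftrightarrow>
     (\<exists>(act :: nat \<Rightarrow> 'a \<Rightarrow> 'q \<Rightarrow> 'q) Q G dQ (e :: 'q \<Rightarrow> 'k).
        (\<forall>n. graded_left_module R gR (act n) (Q n) (G n) \<and>
             (\<exists>B. module_basis R (act n) (Q n) B \<and> B \<subseteq> (\<Union>j. G n j)) \<and>
             Q n = left_span R (act n) (G n (int n))) \<and>
        (\<forall>n. graded_hom R (act (Suc n)) (Q (Suc n)) (G (Suc n)) (act n) (Q n) (G n) (dQ n)) \<and>
        graded_hom R (act 0) (Q 0) (G 0) (trivial_act R gR) UNIV trivial_grading e \<and>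
        e ` Q 0 = UNIV \<and>
        {x \<in> Q 0. e x = 0} = dQ 0 ` Q (Suc 0) \<and>
        (\<forall>n. {x \<in> Q (Suc n). dQ n x = 0} = dQ (Suc n) ` Q (Suc (Suc n))))"

end

theory Submission
  imports Defs "HOL.Vector_Spaces" "HOL-Library.Function_Algebras"
begin

text \<open>
  Let \<open>K\<close> be the resolution of the trivial module with a semibasis in degree zero, and \<open>M\<close> the
  semifree resolution that defines the Ext-algebra. Since \<open>K\<close> is the free module on the vector space
  \<open>W = K\<^sup>0\<close>, every functional on \<open>W\<close> gives a cocycle \<open>K \<rightarrow> k\<close> of degree zero, and there are no others of any
  degree. Comparing \<open>K\<close> with \<open>M\<close> (locale \<open>comparison\<close>), one finds that
  \<open>Ext\<close> is the dual of \<open>W\<close>: a class \<open>X\<close> corresponds to a functional \<open>ext_functional X\<close> on \<open>W\<close>. The unit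
  corresponds to the augmentation of \<open>K\<close>, and the product with \<open>Y\<close> on the right corresponds to composition
  with an endomorphism \<open>f\<close> of \<open>K\<close> that lifts the functional of \<open>Y\<close> (\<open>ext_functional_mult\<close>).

  The differential maps \<open>W\<close> to \<open>A\<^sup>1 \<otimes> W\<close>, so \<open>W\<close> carries a filtration by subspaces
  \<open>0 = socle 0 \<subseteq> socle 1 \<subseteq> \<dots>\<close>, where \<open>socle (n + 1)\<close> is the preimage of \<open>A\<^sup>1 \<otimes> socle n\<close>. Here \<open>socle 1\<close> is
  a line, on which every endomorphism of \<open>K\<close> acts by a scalar; this is the augmentation of \<open>Ext\<close>. The subspace
  \<open>F\<^sub>n\<close> of \<open>Ext\<close> consists of the functionals that vanish on \<open>socle n\<close>. An endomorphism that lifts a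
  functional in \<open>F\<^sub>n\<close> maps \<open>socle (p + n)\<close> to \<open>socle p\<close> (\<open>chain_endo_shift\<close>), so the filtration is
  multiplicative.

  Iterating the differential gives an embedding \<open>mu\<close> of \<open>socle (n + 1) / socle n\<close> into \<open>V\<^sup>\<otimes>\<^sup>n\<close>, where
  \<open>V = H\<^sup>1(A)\<close> is the space of cocycles of \<open>A\<^sup>1\<close> (\<open>socle_detect\<close>). As the differential squares to zero, the
  image lies in the intersection \<open>C\<^sub>n\<close> of the subspaces \<open>V\<^sup>\<otimes>\<^sup>i \<otimes> U \<otimes> V\<^sup>\<otimes>\<^sup>j\<close>, where \<open>U\<close> is the kernel of
  the multiplication \<open>V \<otimes> V \<rightarrow> H\<^sup>2\<close> (\<open>mu_relational\<close>). If \<open>H(A)\<close> is a Koszul algebra, then every element of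
  \<open>C\<^sub>n\<close> is attained (\<open>all_realizable\<close>). To lift a given element, one has to solve an equation \<open>d w = z\<close> in
  \<open>K\<close>; the first approximation to \<open>z\<close> is a cocycle only up to coboundaries and lower steps of the filtration, and
  the obstructions are cocycles of degree two in the Koszul complex \<open>H \<otimes> C\<close>, which is exact
  there. This exactness is derived in \<open>koszul_complex_exact\<close> from the given linear resolution over \<open>H(A)\<close>, by
  embedding its \<open>n\<close>-th module into \<open>H \<otimes> V\<^sup>\<otimes>\<^sup>n\<close>, with \<open>C\<^sub>n\<close> as the image of the generators.

  Hence \<open>F\<^sub>n / F\<^sub>n\<^sub>+\<^sub>1\<close> is the dual of \<open>C\<^sub>n\<close>. By linear algebra (\<open>orthogonal_ideal\<close>), this dual is the
  part of degree \<open>n\<close> of \<open>T(V\<^sup>*)/(U\<^sup>\<bottom>)\<close>. The product agrees with the concatenation of tensors, since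
  an endomorphism that lifts a functional with tensor \<open>t\<close> contracts the last letters with \<open>t\<close> (\<open>mu_chain_endo\<close>). The relation
  between classes and tensors is turned into an isomorphism of algebras in the locale \<open>symbol_relation\<close>.
\<close>

section \<open>Linear functionals\<close>

definition functional :: "('k::field \<Rightarrow> 'b::ab_group_add \<Rightarrow> 'b) \<Rightarrow> ('b \<Rightarrow> 'k) \<Rightarrow> bool" where
  "functional s f \<longleftrightarrow> (\<forall>x y. f (x + y) = f x + f y) \<and> (\<forall>c x. f (s c x) = c * f x)"

lemma functionalD:
  assumes "functional s f"
  shows "f (x + y) = f x + f y" "f (s c x) = c * f x"
  using assms by (auto simp: functional_def)

lemma functional_zero: "functional s f \<Longrightarrow> f 0 = 0"
  by (metis add_cancel_right_right functionalD(1))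

lemma functional_minus: "functional s f \<Longrightarrow> f (- x) = - f x"
  by (metis add.right_inverse add_eq_0_iff functionalD(1) functional_zero)

lemma functional_diff: "functional s f \<Longrightarrow> f (x - y) = f x - f y"
  by (metis add_uminus_conv_diff functionalD(1) functional_minus)

lemma functional_sum: "functional s f \<Longrightarrow> f (\<Sum>i\<in>I. g i) = (\<Sum>i\<in>I. f (g i))"
  by (induction I rule: infinite_finite_induct) (auto simp: functional_zero functionalD)

lemma functional_combination:
  assumes "\<And>i. i \<in> I \<Longrightarrow> functional s (f i)"
  shows "functional s (\<lambda>x. \<Sum>i\<in>I. c i * f i x)"
  using assms
  by (auto simp: functional_def sum.distrib algebra_simps sum_distrib_left intro!: sum.cong)

context vector_space
begin

lemma representation_functional:
  assumes B: "independent B" "span B = UNIV"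
  shows "functional scale (\<lambda>x. representation B x b)"
  using representation_add[OF B(1)] representation_scale[OF B(1)] B(2) by (simp add: functional_def)

text \<open>
  Complements of subspaces, in terms of coordinates: extend a basis of \<open>Y\<close> to one of \<open>X\<close>, then to
  one of the whole space. The new vectors in \<open>X\<close> are \<open>C\<close>, and their coordinates are the \<open>lam c\<close>.
\<close>

lemma relative_dual_basis:
  assumes X: "subspace X" and Y: "subspace Y" and YX: "Y \<subseteq> X"
  obtains C lam where "C \<subseteq> X" "\<And>c. c \<in> C \<Longrightarrow> functional scale (lam c)"
    "\<And>c y. c \<in> C \<Longrightarrow> y \<in> Y \<Longrightarrow> lam c y = 0"
    "\<And>x. x \<in> X \<Longrightarrow> finite {c\<in>C. lam c x \<noteq> 0}"
    "\<And>x. x \<in> X \<Longrightarrow> x - (\<Sum>c | c \<in> C \<and> lam c x \<noteq> 0. scale (lam c x) c) \<in> Y"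
proof -
  obtain BY where BY: "BY \<subseteq> Y" "independent BY" "Y \<subseteq> span BY"
    using maximal_independent_subset[of Y] by blast
  obtain BX where BX: "BY \<subseteq> BX" "BX \<subseteq> X" "independent BX" "X \<subseteq> span BX"
    using maximal_independent_subset_extend[of BY X] BY YX by blast
  obtain B where B: "BX \<subseteq> B" "independent B" "UNIV \<subseteq> span B"
    by (rule maximal_independent_subset_extend[OF subset_UNIV BX(3)]) blast
  have spB: "span B = UNIV" using B by auto
  define lam where "lam c x = representation B x c" for c x
  define C where "C = BX - BY"
  have f: "functional scale (lam c)" for c
    unfolding lam_def using representation_functional[OF B(2) spB] .
  have repX: "representation B x c = 0" if "x \<in> span D" "D \<subseteq> B" "c \<notin> D" for x D c
  proof -
    have "representation B x = representation D x"
      using representation_extend[OF B(2) that(1,2)] .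
    then show ?thesis using representation_ne_zero that(3) by fastforce
  qed
  have fin: "finite {c. lam c x \<noteq> 0}" for x
    unfolding lam_def using finite_representation by simp
  have dec: "x - (\<Sum>c | c \<in> C \<and> lam c x \<noteq> 0. scale (lam c x) c) \<in> Y" if x: "x \<in> X" for x
  proof -
    have "x = (\<Sum>c | lam c x \<noteq> 0. scale (lam c x) c)"
      using sum_nonzero_representation_eq[OF B(2), of x] spB by (simp add: lam_def)
    also have "{c. lam c x \<noteq> 0} = {c. c \<in> C \<and> lam c x \<noteq> 0} \<union> {c. c \<in> BY \<and> lam c x \<noteq> 0}"
      using repX[of x BX] x BX B by (auto simp: C_def lam_def)
    also have "(\<Sum>c\<in>\<dots>. scale (lam c x) c) = (\<Sum>c | c \<in> C \<and> lam c x \<noteq> 0. scale (lam c x) c)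
        + (\<Sum>c | c \<in> BY \<and> lam c x \<noteq> 0. scale (lam c x) c)"
      by (rule sum.union_disjoint) (auto simp: C_def intro: finite_subset[OF _ fin[of x]])
    finally have "x - (\<Sum>c | c \<in> C \<and> lam c x \<noteq> 0. scale (lam c x) c)
        = (\<Sum>c | c \<in> BY \<and> lam c x \<noteq> 0. scale (lam c x) c)" by (simp add: algebra_simps)
    also have "\<dots> \<in> Y"
      using BY(1) by (auto intro!: subspace_sum[OF Y] subspace_scale[OF Y])
    finally show ?thesis .
  qed
  have kill: "lam c y = 0" if "c \<in> C" "y \<in> Y" for c y
    unfolding lam_def using repX[of y BY c] that BY BX B by (auto simp: C_def)
  show ?thesis
    by (rule that[of C lam]) (use f kill dec fin BX in \<open>auto simp: C_def intro: finite_subset[OF _ fin]\<close>)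
qed

text \<open>A vector outside of a subspace has a nonzero coordinate with respect to a basis of a complement.\<close>

lemma separating_functional:
  assumes S: "subspace S" and t: "t \<notin> S"
  obtains f where "functional scale f" "f t = 1" "\<And>x. x \<in> S \<Longrightarrow> f x = 0"
proof -
  obtain C lam where "C \<subseteq> UNIV" and C: "\<And>c. c \<in> C \<Longrightarrow> functional scale (lam c)"
    "\<And>c y. c \<in> C \<Longrightarrow> y \<in> S \<Longrightarrow> lam c y = 0"
    "\<And>x. x \<in> UNIV \<Longrightarrow> finite {c\<in>C. lam c x \<noteq> 0}"
    "\<And>x. x \<in> UNIV \<Longrightarrow> x - (\<Sum>c | c \<in> C \<and> lam c x \<noteq> 0. scale (lam c x) c) \<in> S"
    by (rule relative_dual_basis[OF subspace_UNIV S subset_UNIV]) (rule that)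
  have "{c. c \<in> C \<and> lam c t \<noteq> 0} \<noteq> {}"
  proof
    assume "{c. c \<in> C \<and> lam c t \<noteq> 0} = {}"
    with C(4)[of t] t show False by (simp only: sum.empty) simp
  qed
  then obtain c where c: "c \<in> C" "lam c t \<noteq> 0" by auto
  have "functional scale (\<lambda>x. inverse (lam c t) * lam c x)"
    using C(1)[OF c(1)] by (auto simp: functional_def algebra_simps)
  with c C(2) show ?thesis by (intro that[of "\<lambda>x. inverse (lam c t) * lam c x"]) auto
qed

text \<open>
  Induction on the number of functionals: on the kernel of one of them, the given functional is a
  combination of the others, and the difference vanishes on that kernel.
\<close>

lemma functional_in_span:
  assumes "finite I" and "subspace X" and "\<And>i. i \<in> I \<Longrightarrow> functional scale (f i)"
    and "functional scale g" and "\<And>x. x \<in> X \<Longrightarrow> (\<And>i. i \<in> I \<Longrightarrow> f i x = 0) \<Longrightarrow> g x = 0"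
  shows "\<exists>c. \<forall>x\<in>X. g x = (\<Sum>i\<in>I. c i * f i x)"
  using assms
proof (induction I arbitrary: X rule: finite_induct)
  case empty
  then show ?case by auto
next
  case (insert j I)
  let ?X = "{x\<in>X. f j x = 0}"
  have fj: "functional scale (f j)" using insert by auto
  have sub: "subspace ?X"
    using insert.prems(1) fj by (auto simp: subspace_def functionalD functional_zero)
  obtain c where c: "\<And>x. x \<in> ?X \<Longrightarrow> g x = (\<Sum>i\<in>I. c i * f i x)"
    using insert.IH[OF sub _ insert.prems(3)] insert.prems(2,4) by blast
  define g' where "g' x = g x - (\<Sum>i\<in>I. c i * f i x)" for x
  have g': "functional scale g'"
    using insert.prems(3) functional_combination[of I scale f c] insert.prems(2)
    by (auto simp: g'_def functional_def algebra_simps)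
  show ?case
  proof (cases "\<exists>x0\<in>X. f j x0 \<noteq> 0")
    case True
    then obtain x0 where x0: "x0 \<in> X" "f j x0 \<noteq> 0" by blast
    define q where "q = g' x0 / f j x0"
    have "g' x = q * f j x" if "x \<in> X" for x
    proof -
      let ?y = "x - scale (f j x / f j x0) x0"
      have "?y \<in> ?X"
        using that x0 insert.prems(1) fj by (auto simp: functional_diff functionalD
            intro!: subspace_diff subspace_scale)
      then have "g' ?y = 0" using c by (simp add: g'_def)
      then show ?thesis using g' x0 by (simp add: functional_diff functionalD q_def field_simps)
    qed
    then have "g x = (\<Sum>i\<in>insert j I. (c(j := q)) i * f i x)" if "x \<in> X" for x
    proof -
      have "(\<Sum>i\<in>I. (c(j := q)) i * f i x) = (\<Sum>i\<in>I. c i * f i x)"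
        using insert.hyps by (intro sum.cong) auto
      then show ?thesis using \<open>\<And>x. x \<in> X \<Longrightarrow> g' x = q * f j x\<close>[OF that] insert.hyps
        by (simp add: g'_def algebra_simps)
    qed
    then show ?thesis by blast
  next
    case False
    have "g x = (\<Sum>i\<in>insert j I. (c(j := 0)) i * f i x)" if "x \<in> X" for x
    proof -
      have "(\<Sum>i\<in>I. (c(j := 0)) i * f i x) = (\<Sum>i\<in>I. c i * f i x)"
        using insert.hyps by (intro sum.cong) auto
      then show ?thesis using c[of x] False insert.hyps that by simp
    qed
    then show ?thesis by blast
  qed
qed

text \<open>
  Each \<open>v i\<close> lies outside of the sum of \<open>Y\<close> and the span of the other vectors, so it can be separated from
  this sum.
\<close>

lemma coordinate_functionals:
  assumes Y: "subspace Y"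
    and ind: "\<And>c. (\<Sum>i<m. scale (c i) (v i)) \<in> Y \<Longrightarrow> \<forall>i<m. c i = 0"
  obtains vco :: "nat \<Rightarrow> 'b \<Rightarrow> 'a"
  where "\<And>i. i < m \<Longrightarrow> functional scale (vco i)" "\<And>i y. i < m \<Longrightarrow> y \<in> Y \<Longrightarrow> vco i y = 0"
    "\<And>i j. i < m \<Longrightarrow> j < m \<Longrightarrow> vco i (v j) = (if i = j then 1 else 0)"
proof -
  have "\<exists>f. functional scale f \<and> (\<forall>y\<in>Y. f y = 0) \<and> (\<forall>j<m. f (v j) = (if i = j then 1 else 0))"
    if i: "i < m" for i
  proof -
    define S where "S = {y + x | y x. y \<in> Y \<and> x \<in> span (v ` ({..<m} - {i}))}"
    have S: "subspace S" unfolding S_def by (rule subspace_sums[OF Y subspace_span])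
    have "v i \<notin> S"
    proof
      assume "v i \<in> S"
      then obtain y x where y: "y \<in> Y" and x: "x \<in> span (v ` ({..<m} - {i}))" and eq: "v i = y + x"
        by (auto simp: S_def)
      have "\<exists>c. x = (\<Sum>j\<in>{..<m} - {i}. scale (c j) (v j))"
        using x
      proof (induction rule: span_induct_alt)
        case base
        show ?case by (rule exI[of _ "\<lambda>_. 0"]) simp
      next
        case (step c z w)
        then obtain j c' where j: "j \<in> {..<m} - {i}" "z = v j"
          and w: "w = (\<Sum>j\<in>{..<m} - {i}. scale (c' j) (v j))" by auto
        show ?case
        proof (rule exI[of _ "\<lambda>l. c' l + (if l = j then c else 0)"])
          have "(\<Sum>l\<in>{..<m} - {i}. scale (if l = j then c else 0) (v l)) = scale c (v j)"
            using j(1) by (simp add: if_distrib[of "\<lambda>c. scale c _"] sum.delta' sum.delta cong: if_cong)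
          then show "scale c z + w
              = (\<Sum>l\<in>{..<m} - {i}. scale (c' l + (if l = j then c else 0)) (v l))"
            using j w by (simp add: scale_left_distrib sum.distrib)
        qed
      qed
      then obtain c where c: "x = (\<Sum>j\<in>{..<m} - {i}. scale (c j) (v j))" by blast
      define c' where "c' = (\<lambda>j. - c j)(i := 1)"
      have "(\<Sum>j<m. scale (c' j) (v j)) = v i + (\<Sum>j\<in>{..<m} - {i}. scale (c' j) (v j))"
        using i by (subst sum.remove[of _ i]) (auto simp: c'_def)
      also have "(\<Sum>j\<in>{..<m} - {i}. scale (c' j) (v j)) = - x"
        unfolding c sum_negf[symmetric] by (intro sum.cong) (auto simp: c'_def)
      finally have "(\<Sum>j<m. scale (c' j) (v j)) \<in> Y" using y eq by simp
      from ind[OF this] i show False by (auto simp: c'_def)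
    qed
    from separating_functional[OF S this] obtain f where
      f: "functional scale f" "f (v i) = 1" "\<And>x. x \<in> S \<Longrightarrow> f x = 0" by blast
    have "f y = 0" if "y \<in> Y" for y
      using f(3)[of y] that span_zero by (force simp: S_def)
    moreover have "f (v j) = 0" if "j < m" "j \<noteq> i" for j
    proof -
      have "v j \<in> S" unfolding S_def using that subspace_0[OF Y]
        by (intro CollectI exI[of _ 0] exI[of _ "v j"]) (auto intro!: span_base)
      then show ?thesis using f(3) by blast
    qed
    ultimately show ?thesis using f by (intro exI[of _ f]) auto
  qed
  then obtain vco where "\<And>i. i < m \<Longrightarrow> functional scale (vco i) \<and> (\<forall>y\<in>Y. vco i y = 0) \<and>
      (\<forall>j<m. vco i (v j) = (if i = j then 1 else 0))" by metis
  then show ?thesis by (intro that[of vco]) auto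
qed

end

section \<open>Homogeneous components\<close>

definition component :: "('i \<Rightarrow> 'm::ab_group_add set) \<Rightarrow> 'i \<Rightarrow> 'm \<Rightarrow> 'm" where
  "component G i x =
     (THE c. (\<forall>i. c i \<in> G i) \<and> finite {i. c i \<noteq> 0} \<and> x = (\<Sum>i | c i \<noteq> 0. c i)) i"

lemma add_subgroupD:
  assumes "add_subgroup S"
  shows "0 \<in> S" "x \<in> S \<Longrightarrow> - x \<in> S" "x \<in> S \<Longrightarrow> y \<in> S \<Longrightarrow> x + y \<in> S"
    "x \<in> S \<Longrightarrow> y \<in> S \<Longrightarrow> x - y \<in> S"
proof -
  show zero: "0 \<in> S" and diff: "x \<in> S \<Longrightarrow> y \<in> S \<Longrightarrow> x - y \<in> S" for x y
    using assms by (auto simp: add_subgroup_def)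
  show neg: "- x \<in> S" if "x \<in> S" for x using diff[OF zero that] by simp
  show "x + y \<in> S" if "x \<in> S" "y \<in> S" for x y using diff[OF that(1) neg[OF that(2)]] by simp
qed

lemma add_subgroup_sum:
  assumes "add_subgroup S" "\<And>i. i \<in> I \<Longrightarrow> f i \<in> S"
  shows "(\<Sum>i\<in>I. f i) \<in> S"
  using assms(2)
  by (induction I rule: infinite_finite_induct) (auto intro: add_subgroupD[OF assms(1)])

lemma direct_sum_subgroup: "internal_direct_sum C G \<Longrightarrow> add_subgroup (G i)"
  and direct_sum_subset: "internal_direct_sum C G \<Longrightarrow> G i \<subseteq> C"
  by (simp_all add: internal_direct_sum_def)

lemma
  assumes "internal_direct_sum C G" "x \<in> C"
  shows component_in: "component G i x \<in> G i"
    and component_finite: "finite {i. component G i x \<noteq> 0}"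
    and component_sum: "x = (\<Sum>i | component G i x \<noteq> 0. component G i x)"
proof -
  have "\<exists>!c. (\<forall>i. c i \<in> G i) \<and> finite {i. c i \<noteq> 0} \<and> x = (\<Sum>i | c i \<noteq> 0. c i)"
    using assms unfolding internal_direct_sum_def by blast
  from theI'[OF this]
  show "component G i x \<in> G i" "finite {i. component G i x \<noteq> 0}"
    "x = (\<Sum>i | component G i x \<noteq> 0. component G i x)"
    unfolding component_def by blast+
qed

lemma component_eqI:
  assumes G: "internal_direct_sum C G" and x: "x \<in> C" and c: "\<And>i. c i \<in> G i"
    and I: "finite I" "\<And>i. i \<notin> I \<Longrightarrow> c i = 0" and eq: "x = (\<Sum>i\<in>I. c i)"
  shows "component G i x = c i"
proof -
  have "\<exists>!c. (\<forall>i. c i \<in> G i) \<and> finite {i. c i \<noteq> 0} \<and> x = (\<Sum>i | c i \<noteq> 0. c i)"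
    using G x unfolding internal_direct_sum_def by blast
  moreover have "finite {i. c i \<noteq> 0}" by (rule finite_subset[OF _ I(1)]) (use I(2) in auto)
  moreover have "x = (\<Sum>i | c i \<noteq> 0. c i)"
    unfolding eq using I by (intro sum.mono_neutral_right) auto
  ultimately have "(THE c. (\<forall>i. c i \<in> G i) \<and> finite {i. c i \<noteq> 0} \<and> x = (\<Sum>i | c i \<noteq> 0. c i)) = c"
    using c by (intro the1_equality) auto
  then show ?thesis by (simp add: component_def)
qed

lemma component_homogeneous:
  assumes "internal_direct_sum C G" "x \<in> G j"
  shows "component G i x = (if i = j then x else 0)"
  by (rule component_eqI[OF assms(1), where I="{j}"])
    (use assms direct_sum_subset[OF assms(1)] in
      \<open>auto intro: add_subgroupD(1)[OF direct_sum_subgroup[OF assms(1)]]\<close>)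

lemma component_sum_superset:
  assumes "internal_direct_sum C G" "x \<in> C" "finite I" "{i. component G i x \<noteq> 0} \<subseteq> I"
  shows "x = (\<Sum>i\<in>I. component G i x)"
  by (subst component_sum[OF assms(1,2)], rule sum.mono_neutral_left) (use assms in auto)

lemma component_add:
  assumes G: "internal_direct_sum C G" and x: "x \<in> C" and y: "y \<in> C" and xy: "x + y \<in> C"
  shows "component G i (x + y) = component G i x + component G i y"
proof -
  let ?I = "{i. component G i x \<noteq> 0} \<union> {i. component G i y \<noteq> 0}"
  have fin: "finite ?I" using component_finite[OF G x] component_finite[OF G y] by simp
  have "x + y = (\<Sum>i\<in>?I. component G i x + component G i y)"
    by (subst component_sum_superset[OF G x fin], force,
        subst component_sum_superset[OF G y fin], force, simp add: sum.distrib)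
  then show ?thesis
    by (intro component_eqI[OF G xy _ fin])
      (auto intro: add_subgroupD[OF direct_sum_subgroup[OF G]] component_in[OF G] x y)
qed

lemma component_sum_commute:
  assumes G: "internal_direct_sum C G" and C: "add_subgroup C" and "\<And>k. k \<in> K \<Longrightarrow> f k \<in> C"
  shows "component G i (\<Sum>k\<in>K. f k) = (\<Sum>k\<in>K. component G i (f k))"
  using assms(3)
proof (induction K rule: infinite_finite_induct)
  case (insert k K)
  then show ?case
    by (simp add: component_add[OF G] add_subgroup_sum[OF C] add_subgroupD[OF C])
next
  case (infinite K)
  then show ?case
    by (simp, subst component_eqI[OF G, where I="{}" and c="\<lambda>_. 0"])
      (auto intro: add_subgroupD[OF C] add_subgroupD[OF direct_sum_subgroup[OF G]])
next
  case empty
  then show ?case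
    by (simp, subst component_eqI[OF G, where I="{}" and c="\<lambda>_. 0"])
      (auto intro: add_subgroupD[OF C] add_subgroupD[OF direct_sum_subgroup[OF G]])
qed

lemma homogeneous_induct:
  assumes G: "internal_direct_sum C G" and x: "x \<in> C"
    and hom: "\<And>i x. x \<in> G i \<Longrightarrow> P x" and add: "\<And>x y. P x \<Longrightarrow> P y \<Longrightarrow> P (x + y)"
  shows "P x"
proof -
  have zero: "P 0"
    by (rule hom[of _ undefined]) (rule add_subgroupD(1)[OF direct_sum_subgroup[OF G]])
  have "P (\<Sum>i\<in>I. component G i x)" for I
    by (induction I rule: infinite_finite_induct)
      (auto intro: zero add hom component_in[OF G x])
  then show ?thesis by (subst component_sum[OF G x])
qed

section \<open>Signs\<close>

lemma ksign_simps [simp]: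
  "ksign n 0 = 0" "ksign 0 x = x" "ksign n (x + y) = ksign n x + ksign n y"
  "ksign n (x - y) = ksign n x - ksign n y" "ksign n (- x) = - ksign n x"
  "ksign m (ksign n x) = ksign (m + n) x"
  by (simp_all add: ksign_def)

lemma ksign_mem: "add_subgroup S \<Longrightarrow> x \<in> S \<Longrightarrow> ksign n x \<in> S"
  by (simp add: ksign_def add_subgroupD)

lemma ksign_mult: "ksign n (x :: 'a::ring_1) * y = ksign n (x * y)"
  "x * ksign n y = ksign n (x * y)"
  by (simp_all add: ksign_def)

section \<open>Elementary rules in a DG algebra\<close>

context connected_dg_algebra
begin

lemma scale_simps:
  "scale c (x + y) = scale c x + scale c y" "scale (b + c) x = scale b x + scale c x"
  "scale b (scale c x) = scale (b * c) x" "scale 1 x = x"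
  "scale c x * y = scale c (x * y)" "x * scale c y = scale c (x * y)"
proof -
  have m: "Module.module ground (type_alg scale)" using algebra by (simp add: kalgebra_def)
  show "scale c (x + y) = scale c x + scale c y" "scale (b + c) x = scale b x + scale c x"
    "scale b (scale c x) = scale (b * c) x" "scale 1 x = x"
    using Module.module.smult_r_distr[OF m, of c x y] Module.module.smult_l_distr[OF m, of b c x]
      Module.module.smult_assoc1[OF m, of b c x] Module.module.smult_one[OF m, of x]
    by (simp_all add: ground_def type_alg_def)
  show "scale c x * y = scale c (x * y)" "x * scale c y = scale c (x * y)"
    using algebra unfolding kalgebra_def type_alg_def by (simp, simp, metis)
qed

sublocale alg: vector_space scale
  by unfold_locales (simp_all add: scale_simps)

lemma d_zero [simp]: "d 0 = 0"
  using d_add[of 0 0] by simp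

lemma d_minus: "d (- x) = - d x"
  using d_add[of x "- x"] by (simp add: eq_neg_iff_add_eq_0 add.commute)

lemma d_diff: "d (x - y) = d x - d y"
  using d_add[of x "- y"] by (simp add: d_minus)

lemma d_sum: "d (\<Sum>i\<in>I. f i) = (\<Sum>i\<in>I. d (f i))"
  by (induction I rule: infinite_finite_induct) (auto simp: d_add)

lemma A_subgroup: "add_subgroup (A n)"
  by (rule direct_sum_subgroup[OF grading])

lemmas A_zero = add_subgroupD(1)[OF A_subgroup]
  and A_minus = add_subgroupD(2)[OF A_subgroup]
  and A_add = add_subgroupD(3)[OF A_subgroup]
  and A_diff = add_subgroupD(4)[OF A_subgroup]
  and A_sum = add_subgroup_sum[OF A_subgroup]

lemma scale_one_in: "scale c 1 \<in> A 0"
  using connected by blast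

lemma one_in: "1 \<in> A 0"
  using scale_one_in[of 1] by simp

lemma scale_one_mult: "scale c 1 * x = scale c x"
  by (simp add: scale_simps)

lemma A_scale: "x \<in> A n \<Longrightarrow> scale c x \<in> A n"
  using grading_mult[OF scale_one_in, of x n c] by (simp add: scale_one_mult)

lemma d_one: "d 1 = 0"
  using d_leibniz[OF one_in, of 1] by simp

lemma boundary_degree_zero:
  assumes "d x \<in> A 0" shows "d x = 0"
proof -
  have "component A 0 (d x) = 0"
    using grading UNIV_I
  proof (rule homogeneous_induct[of UNIV A x])
    fix i y assume "y \<in> A i"
    then show "component A 0 (d y) = 0" using component_homogeneous[OF grading d_degree] by simp
  qed (simp add: component_add[OF grading] d_add)
  then show ?thesis using component_homogeneous[OF grading assms] by simp
qed

lemma boundary_homogeneous: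
  assumes "d x \<in> A (Suc n)"
  shows "\<exists>y\<in>A n. d y = d x"
proof -
  have "component A (Suc n) (d x) = d (component A n x)"
    using grading UNIV_I
  proof (rule homogeneous_induct[of UNIV A x])
    fix i y assume "y \<in> A i"
    then show "component A (Suc n) (d y) = d (component A n y)"
      using component_homogeneous[OF grading d_degree] component_homogeneous[OF grading] by simp
  qed (simp add: component_add[OF grading] d_add)
  then show ?thesis
    using component_homogeneous[OF grading assms, of "Suc n"] component_in[OF grading] by auto
qed

lemma boundary_degree_one:
  assumes "d x \<in> A 1" shows "d x = 0"
proof -
  obtain y where y: "y \<in> A 0" "d y = d x" using boundary_homogeneous[of x 0] assms by auto
  then show ?thesis using connected by (auto simp: d_scale d_one)
qed

lemma boundaries_subspace: "alg.subspace (range d)"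
proof (rule alg.subspaceI)
  show "0 \<in> range d" using d_zero by (metis rangeI)
  show "x + y \<in> range d" if "x \<in> range d" "y \<in> range d" for x y
    using that by (auto simp flip: d_add)
  show "scale c x \<in> range d" if "x \<in> range d" for c x
    using that by (auto simp flip: d_scale)
qed

lemma boundaries_subgroup: "add_subgroup (range d)"
  using alg.subspace_0[OF boundaries_subspace] alg.subspace_diff[OF boundaries_subspace]
  by (auto simp: add_subgroup_def)


text \<open>
  The automorphism \<open>a \<mapsto> (-1)\<^sup>i a\<close> for \<open>a \<in> A\<^sup>i\<close>. A map of degree \<open>n\<close> between left DG modules is linear
  up to its \<open>n\<close>-th power, which is \<open>twist n\<close>.
\<close>

definition twist :: "int \<Rightarrow> 'a \<Rightarrow> 'a" where
  "twist n a = (\<Sum>i | component A i a \<noteq> 0. ksign (n * int i) (component A i a))"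

lemma twist_superset:
  assumes "finite I" "{i. component A i a \<noteq> 0} \<subseteq> I"
  shows "twist n a = (\<Sum>i\<in>I. ksign (n * int i) (component A i a))"
  unfolding twist_def by (rule sum.mono_neutral_left) (use assms in auto)

lemma twist_homogeneous: "a \<in> A i \<Longrightarrow> twist n a = ksign (n * int i) a"
  by (subst twist_superset[of "{i}"]) (auto simp: component_homogeneous[OF grading] split: if_splits)

lemma twist_add: "twist n (a + b) = twist n a + twist n b"
proof -
  let ?I = "{i. component A i a \<noteq> 0} \<union> {i. component A i b \<noteq> 0}"
  have fin: "finite ?I" using component_finite[OF grading] by simp
  have "{i. component A i (a + b) \<noteq> 0} \<subseteq> ?I" by (auto simp: component_add[OF grading])
  then show ?thesis
    by (simp add: twist_superset[OF fin] component_add[OF grading] sum.distrib)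
qed

lemma twist_zero [simp]: "twist n 0 = 0"
  using twist_add[of n 0 0] by simp

lemma twist_mult: "twist n (a * b) = twist n a * twist n b"
proof -
  have hom: "twist n (a * b) = twist n a * twist n b" if a: "a \<in> A i" for a b i
    using grading UNIV_I
  proof (rule homogeneous_induct[of UNIV A b])
    fix j b assume b: "b \<in> A j"
    show "twist n (a * b) = twist n a * twist n b"
      by (simp add: twist_homogeneous[OF a] twist_homogeneous[OF b]
          twist_homogeneous[OF grading_mult[OF a b]] ksign_mult algebra_simps)
  qed (simp add: twist_add distrib_left)
  show ?thesis
    using grading UNIV_I
    by (rule homogeneous_induct[of UNIV A a]) (auto simp: hom twist_add distrib_right)
qed

text \<open>
  The component of degree zero is the unique scalar in the description of the trivial module, because
  \<open>pos_part\<close> consists of the elements whose component of degree zero vanishes.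
\<close>

lemma trivial_act_component:
  assumes a: "component A 0 a = scale c 1"
  shows "trivial_act (type_alg scale) A a x = c * x"
proof -
  interpret R: ring "type_alg scale" using algebra by (simp add: kalgebra_def)
  have minus: "a \<ominus>\<^bsub>type_alg scale\<^esub> b = a - b" for a b
  proof -
    have "\<ominus>\<^bsub>type_alg scale\<^esub> b = - b"
      by (rule R.minus_equality) (auto simp: type_alg_def)
    then show ?thesis by (simp add: a_minus_def type_alg_def)
  qed
  have neg: "inv\<^bsub>add_monoid (type_alg scale)\<^esub> h = - h" for h
    using minus[of 0 h] by (simp add: a_minus_def a_inv_def type_alg_def)
  have pos: "component A 0 h = 0" if "h \<in> pos_part (type_alg scale) A" for h
    using that unfolding pos_part_def
  proof (induction rule: generate.induct)
    case one
    show ?case using component_homogeneous[OF grading A_zero] by (simp add: type_alg_def)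
  next
    case (incl h)
    then show ?case by (auto simp: component_homogeneous[OF grading])
  next
    case (inv h)
    then show ?case
      by (auto simp only: neg) (metis A_minus component_homogeneous[OF grading] greaterThan_iff less_irrefl)
  next
    case (eng h1 h2)
    then show ?case by (simp add: type_alg_def component_add[OF grading])
  qed
  have c: "component A 0 (a - scale c' 1) = scale (c - c') 1" for c'
  proof -
    have "component A 0 a = component A 0 (a - scale c' 1) + component A 0 (scale c' 1)"
      by (subst component_add[OF grading, symmetric]) simp_all
    then show ?thesis
      using a component_homogeneous[OF grading scale_one_in] by (simp add: alg.scale_left_diff_distrib)
  qed
  have sum: "(\<Sum>i\<in>I. f i) \<in> pos_part (type_alg scale) A"
    if "\<And>i. i \<in> I \<Longrightarrow> f i \<in> A i" "0 \<notin> I" "finite I" for I and f :: "nat \<Rightarrow> 'a"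
    using that(3,1,2)
  proof (induction I rule: finite_induct)
    case empty
    show ?case using generate.one[of "add_monoid (type_alg scale)" "\<Union>n\<in>{0<..}. A n"]
      by (simp add: pos_part_def type_alg_def)
  next
    case (insert i I)
    have "f i \<in> pos_part (type_alg scale) A" unfolding pos_part_def
      using insert.prems by (intro generate.incl) (auto intro: gr0I)
    then show ?case
      using generate.eng[of "f i" "add_monoid (type_alg scale)" "\<Union>n\<in>{0<..}. A n" "\<Sum>i\<in>I. f i"] insert
      by (simp add: pos_part_def type_alg_def)
  qed
  have "(THE c. a \<ominus>\<^bsub>type_alg scale\<^esub> (c \<odot>\<^bsub>type_alg scale\<^esub> \<one>\<^bsub>type_alg scale\<^esub>)
      \<in> pos_part (type_alg scale) A) = c"
  proof (rule the_equality)
    have zero: "component A 0 (a - scale c 1) = 0" using c[of c] by simp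
    have "(\<Sum>i | component A i (a - scale c 1) \<noteq> 0. component A i (a - scale c 1))
        \<in> pos_part (type_alg scale) A"
      by (rule sum) (use zero component_finite[OF grading] component_in[OF grading] in auto)
    then have "a - scale c 1 \<in> pos_part (type_alg scale) A"
      by (simp flip: component_sum[OF grading])
    then show "a \<ominus>\<^bsub>type_alg scale\<^esub> (c \<odot>\<^bsub>type_alg scale\<^esub> \<one>\<^bsub>type_alg scale\<^esub>)
        \<in> pos_part (type_alg scale) A" unfolding minus by (simp add: type_alg_def)
  next
    fix c' assume "a \<ominus>\<^bsub>type_alg scale\<^esub> (c' \<odot>\<^bsub>type_alg scale\<^esub> \<one>\<^bsub>type_alg scale\<^esub>)
      \<in> pos_part (type_alg scale) A"
    then have "component A 0 (a - scale c' 1) = 0" using pos minus by (simp add: type_alg_def)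
    then show "c' = c" using c[of c'] by simp
  qed
  then show ?thesis by (simp add: trivial_act_def)
qed

lemma trivial_act_type_alg:
  shows "trivial_act (type_alg scale) A (scale c 1) x = c * x"
    and "a \<in> A i \<Longrightarrow> i > 0 \<Longrightarrow> trivial_act (type_alg scale) A a x = 0"
  using trivial_act_component[of "scale c 1" c x] trivial_act_component[of a 0 x]
  by (simp_all add: component_homogeneous[OF grading scale_one_in] component_homogeneous[OF grading])

lemma degree_zero_scalar: "\<exists>c. component A 0 a = scale c 1"
  using component_in[OF grading, of a 0] connected by auto

lemma trivial_act_add:
  "trivial_act (type_alg scale) A (a + b) x
    = trivial_act (type_alg scale) A a x + trivial_act (type_alg scale) A b x"
proof -
  obtain c c' where c: "component A 0 a = scale c 1" "component A 0 b = scale c' 1"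
    using degree_zero_scalar by metis
  then have "component A 0 (a + b) = scale (c + c') 1"
    by (simp add: component_add[OF grading] scale_simps)
  then show ?thesis using c by (simp add: trivial_act_component distrib_right)
qed

end

section \<open>DG modules and their graded homomorphisms\<close>

context
  fixes f :: "'a::ab_group_add \<Rightarrow> 'b::ab_group_add"
  assumes add: "\<And>x y. f (x + y) = f x + f y"
begin

lemma additive_zero: "f 0 = 0"
  by (metis add add_cancel_right_right)

lemma additive_minus: "f (- x) = - f x"
  by (metis add add.right_inverse add_eq_0_iff additive_zero)

lemma additive_diff: "f (x - y) = f x - f y"
  by (metis add add_uminus_conv_diff additive_minus)

lemma additive_ksign: "f (ksign n x) = ksign n (f x)"
  by (simp add: ksign_def additive_minus)

lemma additive_sum: "f (\<Sum>i\<in>I. g i) = (\<Sum>i\<in>I. f (g i))"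
  by (induction I rule: infinite_finite_induct) (auto simp: additive_zero add)

end

context connected_dg_algebra
begin

definition dg_hom ::
  "('a \<Rightarrow> 'm \<Rightarrow> 'm) \<Rightarrow> (int \<Rightarrow> 'm set) \<Rightarrow> ('a \<Rightarrow> 'n \<Rightarrow> 'n) \<Rightarrow> (int \<Rightarrow> 'n set) \<Rightarrow> int \<Rightarrow>
    ('m::ab_group_add \<Rightarrow> 'n::ab_group_add) set" where
  "dg_hom actP P actN N n = {f. (\<forall>x y. f (x + y) = f x + f y) \<and> (\<forall>j. f ` P j \<subseteq> N (j + n)) \<and>
     (\<forall>i. \<forall>a\<in>A i. \<forall>x. f (actP a x) = ksign (n * int i) (actN a (f x)))}"

lemma dg_homD:
  assumes "f \<in> dg_hom actP P actN N n"
  shows "f (x + y) = f x + f y" "x \<in> P j \<Longrightarrow> f x \<in> N (j + n)"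
    "a \<in> A i \<Longrightarrow> f (actP a x) = ksign (n * int i) (actN a (f x))"
  using assms unfolding dg_hom_def by blast+

lemma dg_hom_compose:
  assumes f: "f \<in> dg_hom actP P actN N m" and g: "g \<in> dg_hom actN N actL L n"
  shows "g \<circ> f \<in> dg_hom actP P actL L (n + m)"
proof -
  have "g (f x) \<in> L (j + (n + m))" if "x \<in> P j" for x j
    using dg_homD(2)[OF g dg_homD(2)[OF f that]] by (simp add: algebra_simps)
  then show ?thesis
    using dg_homD[OF f] dg_homD[OF g]
    unfolding dg_hom_def by (auto simp: additive_ksign[OF dg_homD(1)[OF g]] algebra_simps)
qed

end

context dg_module
begin

lemma act_simps:
  "act a (x + y) = act a x + act a y" "act (a + b) x = act a x + act b x"
  "act (a * b) x = act a (act b x)" "act 1 x = x"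
  using graded_module
  by (simp_all add: graded_left_module_def left_module_def type_alg_def)

lemma act_degree: "a \<in> A i \<Longrightarrow> x \<in> M j \<Longrightarrow> act a x \<in> M (int i + j)"
  using graded_module by (simp add: graded_left_module_def)

lemma module_grading: "internal_direct_sum UNIV M"
  using graded_module by (simp add: graded_left_module_def)

lemma M_subgroup: "add_subgroup (M j)"
  by (rule direct_sum_subgroup[OF module_grading])

lemmas M_zero = add_subgroupD(1)[OF M_subgroup]
  and M_minus = add_subgroupD(2)[OF M_subgroup]
  and M_add = add_subgroupD(3)[OF M_subgroup]
  and M_diff = add_subgroupD(4)[OF M_subgroup]
  and M_sum = add_subgroup_sum[OF M_subgroup]

lemma act_zero [simp]: "act a 0 = 0" "act 0 x = 0"
  using additive_zero[of "act a"] additive_zero[of "\<lambda>a. act a x"] by (simp_all add: act_simps)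

lemma act_minus: "act a (- x) = - act a x" "act (- a) x = - act a x"
  using additive_minus[of "act a"] additive_minus[of "\<lambda>a. act a x"] by (simp_all add: act_simps)

lemma act_diff: "act a (x - y) = act a x - act a y" "act (a - b) x = act a x - act b x"
  using additive_diff[of "act a"] additive_diff[of "\<lambda>a. act a x"] by (simp_all add: act_simps)

lemma act_sum: "act a (\<Sum>i\<in>I. f i) = (\<Sum>i\<in>I. act a (f i))"
    "act (\<Sum>i\<in>I. h i) x = (\<Sum>i\<in>I. act (h i) x)"
  using additive_sum[of "act a"] additive_sum[of "\<lambda>a. act a x"] by (simp_all add: act_simps)

lemma act_ksign: "act a (ksign n x) = ksign n (act a x)" "act (ksign n a) x = ksign n (act a x)"
  by (simp_all add: ksign_def act_minus)

lemma dM_zero [simp]: "dM 0 = 0"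
  by (rule additive_zero[OF dM_add])

lemmas dM_minus = additive_minus[OF dM_add]
  and dM_diff = additive_diff[OF dM_add]
  and dM_ksign = additive_ksign[OF dM_add]
  and dM_sum = additive_sum[OF dM_add]

sublocale mod: vector_space "\<lambda>c x. act (scale c 1) x"
  by unfold_locales (simp_all add: scale_simps act_simps mult.commute flip: act_simps(3))

lemma act_scale: "act (scale c a) x = act (scale c 1) (act a x)"
  "act (scale c a) x = act a (act (scale c 1) x)"
  by (simp_all add: scale_simps flip: act_simps(3))

lemma act_commute: "act (scale c 1) (act a x) = act a (act (scale c 1) x)"
  by (simp flip: act_scale)

lemma dM_scale: "dM (act (scale c 1) x) = act (scale c 1) (dM x)"
  using dM_leibniz[OF scale_one_in, of c x] by (simp add: d_scale d_one)

lemma M_scale: "x \<in> M j \<Longrightarrow> act (scale c 1) x \<in> M j"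
  using act_degree[OF scale_one_in, of x j c] by simp

end

locale dg_module_pair = P: dg_module scale A d actP P dP + N: dg_module scale A d actN N dN
  for scale :: "'k::field \<Rightarrow> 'a::ring_1 \<Rightarrow> 'a" and A d
    and actP :: "'a \<Rightarrow> 'p::ab_group_add \<Rightarrow> 'p" and P dP
    and actN :: "'a \<Rightarrow> 'n::ab_group_add \<Rightarrow> 'n" and N dN
begin

abbreviation Hom :: "int \<Rightarrow> ('p \<Rightarrow> 'n) set" where
  "Hom \<equiv> P.dg_hom actP P actN N"

definition hom_diff :: "int \<Rightarrow> ('p \<Rightarrow> 'n) \<Rightarrow> 'p \<Rightarrow> 'n" where
  "hom_diff n f = (\<lambda>x. dN (f x) - ksign n (f (dP x)))"

lemma hom_zero: "(\<lambda>x. 0) \<in> Hom n"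
  unfolding P.dg_hom_def using N.M_zero by auto

lemma hom_add: "f \<in> Hom n \<Longrightarrow> g \<in> Hom n \<Longrightarrow> (\<lambda>x. f x + g x) \<in> Hom n"
  unfolding P.dg_hom_def by (auto simp: image_subset_iff N.act_simps intro!: N.M_add)

lemma hom_minus: "f \<in> Hom n \<Longrightarrow> (\<lambda>x. - f x) \<in> Hom n"
  unfolding P.dg_hom_def by (auto simp: image_subset_iff N.act_minus intro!: N.M_minus)

lemma hom_subtract: "f \<in> Hom n \<Longrightarrow> g \<in> Hom n \<Longrightarrow> (\<lambda>x. f x - g x) \<in> Hom n"
  using hom_add[OF _ hom_minus] by simp

lemma hom_ksign: "f \<in> Hom n \<Longrightarrow> (\<lambda>x. ksign m (f x)) \<in> Hom n"
  by (cases "even m") (simp_all add: ksign_def hom_minus)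

lemma hom_twist: "f \<in> Hom n \<Longrightarrow> f (actP a x) = actN (P.twist n a) (f x)"
  using P.grading UNIV_I
proof (rule homogeneous_induct[of UNIV A a])
  fix i a assume "f \<in> Hom n" "a \<in> A i"
  then show "f (actP a x) = actN (P.twist n a) (f x)"
    by (simp add: P.dg_homD(3) P.twist_homogeneous N.act_ksign)
qed (simp add: P.dg_homD(1) P.twist_add P.act_simps N.act_simps)

lemma hom_scale: "f \<in> Hom n \<Longrightarrow> f (actP (scale c 1) x) = actN (scale c 1) (f x)"
  using P.dg_homD(3)[OF _ P.scale_one_in] by simp

lemma hom_smult: "f \<in> Hom n \<Longrightarrow> (\<lambda>x. actN (scale c 1) (f x)) \<in> Hom n"
  unfolding P.dg_hom_def
  by (auto simp: image_subset_iff N.act_simps N.act_ksign N.act_commute intro!: N.M_scale)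

lemma hom_diff_in:
  assumes "h \<in> Hom n" shows "hom_diff n h \<in> Hom (n + 1)"
proof -
  note h = P.dg_homD[OF assms]
  have "hom_diff n h (actP a x) = ksign ((n + 1) * int i) (actN a (hom_diff n h x))"
    if a: "a \<in> A i" for a i x
  proof -
    have 1: "dN (h (actP a x))
        = ksign (n * int i) (actN (d a) (h x)) + ksign (n * int i + int i) (actN a (dN (h x)))"
      using a by (simp add: h(3) N.dM_ksign N.dM_leibniz)
    have 2: "h (dP (actP a x))
        = ksign (n * int (Suc i)) (actN (d a) (h x)) + ksign (int i + n * int i) (actN a (h (dP x)))"
      using a P.d_degree[OF a]
      by (simp add: h(1) h(3) P.dM_leibniz additive_ksign[OF h(1)] del: of_nat_Suc)
    have 3: "ksign (n + n * int (Suc i)) z = ksign (n * int i) z" for z :: 'n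
      by (simp add: ksign_def)
    have 4: "ksign (n + (int i + n * int i)) z = ksign n (ksign (n * int i + int i) z)" for z :: 'n
      by (simp add: algebra_simps)
    have 5: "ksign ((n + 1) * int i) z = ksign (n * int i + int i) z" for z :: 'n
      by (simp add: algebra_simps)
    have "hom_diff n h (actP a x) = ksign (n * int i + int i) (actN a (dN (h x)))
        - ksign n (ksign (n * int i + int i) (actN a (h (dP x))))"
      by (simp add: hom_diff_def 1 2 3 4 del: of_nat_Suc ksign_simps(6)) (simp add: 3 add.commute add.left_commute del: of_nat_Suc)
    then show ?thesis
      by (simp add: hom_diff_def 5 N.act_diff N.act_ksign algebra_simps)
  qed
  moreover have "hom_diff n h x \<in> N (j + (n + 1))" if x: "x \<in> P j" for x j
  proof -
    have "dN (h x) \<in> N (j + (n + 1))" using N.dM_degree[OF h(2)[OF x]] by (simp add: algebra_simps)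
    moreover have "h (dP x) \<in> N (j + (n + 1))"
      using h(2)[OF P.dM_degree[OF x]] by (simp add: algebra_simps)
    ultimately show ?thesis unfolding hom_diff_def
      by (intro N.M_diff ksign_mem[OF N.M_subgroup])
  qed
  ultimately show ?thesis
    unfolding P.dg_hom_def
    by (auto simp: hom_diff_def N.dM_add h(1) P.dM_add algebra_simps)
qed

lemma hom_diff_square: "h \<in> Hom n \<Longrightarrow> hom_diff (n + 1) (hom_diff n h) = (\<lambda>_. 0)"
  by (rule ext, cases "even n")
    (simp_all add: hom_diff_def ksign_def N.dM_add N.dM_diff N.dM_minus N.dM_square P.dM_square
      additive_zero[OF P.dg_homD(1)])

end

lemma eq_on_left_span:
  assumes f: "\<And>x y. f (x + y) = f x + (f y :: 'n::ab_group_add)"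
      "\<And>a x. a \<in> carrier R \<Longrightarrow> f (act a x) = \<phi> a (f x)"
    and g: "\<And>x y. g (x + y) = g x + g y" "\<And>a x. a \<in> carrier R \<Longrightarrow> g (act a x) = \<phi> a (g x)"
    and eq: "\<And>b. b \<in> S \<Longrightarrow> f b = g b" and x: "x \<in> left_span R act S"
  shows "f x = g x"
proof -
  obtain F c where "F \<subseteq> S" "\<And>b. c b \<in> carrier R" "x = (\<Sum>b\<in>F. act (c b) b)"
    using x unfolding left_span_def by auto
  then show ?thesis
    using eq by (simp add: additive_sum[OF f(1)] additive_sum[OF g(1)] f(2) g(2) subset_iff)
qed

section \<open>Linear extension from a homogeneous basis\<close>

locale free_dg_module = dg_module scale A d act M dM
  for scale :: "'k::field \<Rightarrow> 'a::ring_1 \<Rightarrow> 'a" and A d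
    and act :: "'a \<Rightarrow> 'm::ab_group_add \<Rightarrow> 'm" and M dM +
  fixes B :: "'m set"
  assumes basis: "module_basis (type_alg scale) act UNIV B"
    and basis_homogeneous: "B \<subseteq> (\<Union>j. M j)"
begin

definition coord :: "'m \<Rightarrow> 'm \<Rightarrow> 'a" where
  "coord x = (THE c. finite {b. c b \<noteq> 0} \<and> {b. c b \<noteq> 0} \<subseteq> B \<and> x = (\<Sum>b | c b \<noteq> 0. act (c b) b))"

lemma coord_ex1:
  "\<exists>!c. finite {b. c b \<noteq> 0} \<and> {b. c b \<noteq> 0} \<subseteq> B \<and> x = (\<Sum>b | c b \<noteq> 0. act (c b) b)"
  using basis by (simp add: module_basis_def type_alg_def)

lemma coord_finite: "finite {b. coord x b \<noteq> 0}"
  and coord_support: "{b. coord x b \<noteq> 0} \<subseteq> B"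
  and coord_sum: "x = (\<Sum>b | coord x b \<noteq> 0. act (coord x b) b)"
  using theI'[OF coord_ex1[of x]] unfolding coord_def by auto

lemma coord_eqI:
  assumes "finite F" "F \<subseteq> B" "\<And>b. b \<notin> F \<Longrightarrow> c b = 0" "x = (\<Sum>b\<in>F. act (c b) b)"
  shows "coord x = c"
proof -
  have "finite {b. c b \<noteq> 0}" "{b. c b \<noteq> 0} \<subseteq> F" using assms by (auto intro: finite_subset)
  moreover have "x = (\<Sum>b | c b \<noteq> 0. act (c b) b)"
    unfolding assms(4) by (rule sum.mono_neutral_right) (use assms in auto)
  ultimately show ?thesis unfolding coord_def
    using assms(2) by (intro the1_equality[OF coord_ex1]) auto
qed

lemma coord_superset:
  assumes "finite F" "{b. coord x b \<noteq> 0} \<subseteq> F"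
  shows "x = (\<Sum>b\<in>F. act (coord x b) b)"
  by (subst coord_sum, rule sum.mono_neutral_left) (use assms in auto)

lemma coord_add: "coord (x + y) b = coord x b + coord y b"
proof -
  let ?F = "{b. coord x b \<noteq> 0} \<union> {b. coord y b \<noteq> 0}"
  have "coord (x + y) = (\<lambda>b. coord x b + coord y b)"
  proof (rule coord_eqI[of ?F])
    show "x + y = (\<Sum>b\<in>?F. act (coord x b + coord y b) b)"
      by (subst coord_superset[of ?F x], simp_all add: coord_finite,
          subst coord_superset[of ?F y], simp_all add: coord_finite act_simps sum.distrib)
  qed (use coord_finite coord_support in auto)
  then show ?thesis by simp
qed

lemma coord_act: "coord (act a x) b = a * coord x b"
proof -
  have "coord (act a x) = (\<lambda>b. a * coord x b)"
    by (rule coord_eqI[OF coord_finite[of x] coord_support[of x]])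
      (simp, subst coord_sum[of x], simp add: act_sum act_simps)
  then show ?thesis by simp
qed

lemma coord_basis: "b \<in> B \<Longrightarrow> coord b b' = (if b' = b then 1 else 0)"
  by (subst coord_eqI[of "{b}" "\<lambda>b'. if b' = b then 1 else 0"]) (auto simp: act_simps)

lemma left_span_basis: "x \<in> left_span (type_alg scale) act B"
  using coord_sum[of x] coord_finite[of x] coord_support[of x]
  unfolding left_span_def by (auto simp: type_alg_def)

text \<open>The sum over the basis of a function that is additive in the coordinate.\<close>

definition basis_sum :: "('a \<Rightarrow> 'm \<Rightarrow> 'n::ab_group_add) \<Rightarrow> 'm \<Rightarrow> 'n" where
  "basis_sum \<phi> x = (\<Sum>b | coord x b \<noteq> 0. \<phi> (coord x b) b)"

lemma basis_sum_superset:
  assumes "\<And>b. \<phi> 0 b = 0" "finite F" "{b. coord x b \<noteq> 0} \<subseteq> F"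
  shows "basis_sum \<phi> x = (\<Sum>b\<in>F. \<phi> (coord x b) b)"
  unfolding basis_sum_def by (rule sum.mono_neutral_left) (use assms in auto)

lemma basis_sum_add:
  assumes "\<And>a a' b. \<phi> (a + a') b = \<phi> a b + \<phi> a' b"
  shows "basis_sum \<phi> (x + y) = basis_sum \<phi> x + basis_sum \<phi> y"
proof -
  let ?F = "{b. coord x b \<noteq> 0} \<union> {b. coord y b \<noteq> 0}"
  have zero: "\<phi> 0 b = 0" for b using additive_zero[of "\<lambda>a. \<phi> a b"] assms by simp
  have fin: "finite ?F" using coord_finite by simp
  have "{b. coord (x + y) b \<noteq> 0} \<subseteq> ?F" by (auto simp: coord_add)
  then show ?thesis
    by (simp add: basis_sum_superset[of \<phi>, OF zero fin] coord_add assms sum.distrib)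
qed

lemma basis_sum_basis:
  "b \<in> B \<Longrightarrow> (\<And>b. \<phi> 0 b = 0) \<Longrightarrow> basis_sum \<phi> b = \<phi> 1 b"
  by (subst basis_sum_superset[of _ "{b}"]) (auto simp: coord_basis)

end

locale free_pair = free_dg_module scale A d actP P dP B + N: dg_module scale A d actN N dN
  for scale :: "'k::field \<Rightarrow> 'a::ring_1 \<Rightarrow> 'a" and A d
    and actP :: "'a \<Rightarrow> 'p::ab_group_add \<Rightarrow> 'p" and P dP and B
    and actN :: "'a \<Rightarrow> 'n::ab_group_add \<Rightarrow> 'n" and N dN
begin

sublocale dg_module_pair scale A d actP P dP actN N dN ..

definition extension :: "int \<Rightarrow> ('p \<Rightarrow> 'n) \<Rightarrow> 'p \<Rightarrow> 'n" where
  "extension n v = basis_sum (\<lambda>a b. actN (twist n a) (v b))"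

lemma extension_add: "extension n v (x + y) = extension n v x + extension n v y"
  unfolding extension_def by (rule basis_sum_add) (simp add: twist_add N.act_simps)

lemma extension_act: "extension n v (actP a x) = actN (twist n a) (extension n v x)"
proof -
  have "{b. coord (actP a x) b \<noteq> 0} \<subseteq> {b. coord x b \<noteq> 0}" by (auto simp: coord_act)
  then show ?thesis
    unfolding extension_def
    by (subst (1 2) basis_sum_superset[of _ "{b. coord x b \<noteq> 0}"])
      (simp_all add: coord_finite coord_act twist_mult N.act_simps N.act_sum)
qed

lemma extension_basis: "b \<in> B \<Longrightarrow> extension n v b = v b"
  unfolding extension_def
  by (subst basis_sum_basis) (simp_all add: twist_homogeneous[OF one_in] N.act_simps)

lemma extension_in:
  assumes v: "\<And>b. b \<in> B \<Longrightarrow> \<exists>j. b \<in> P j \<and> v b \<in> N (j + n)"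
  shows "extension n v \<in> Hom n"
proof -
  have "extension n v x \<in> N (j + n)" if x: "x \<in> P j" for x j
  proof -
    \<comment> \<open>It suffices to extend the components of degree \<open>j\<close> of the terms \<open>c\<^sub>i b\<close>, with \<open>c\<^sub>i\<close> homogeneous.\<close>
    have *: "extension n v (component P j (actP a b)) \<in> N (j + n)" if b: "b \<in> B" for a b
      using grading UNIV_I
    proof (rule homogeneous_induct[of UNIV A a])
      fix i a assume a: "a \<in> A i"
      obtain l where l: "b \<in> P l" "v b \<in> N (l + n)" using v[OF b] by blast
      have "extension n v (actP a b) \<in> N (int i + (l + n))"
        using N.act_degree[OF a l(2)] b
        by (simp add: extension_act twist_homogeneous[OF a] N.act_ksign extension_basis
            ksign_mem[OF N.M_subgroup])
      then show "extension n v (component P j (actP a b)) \<in> N (j + n)"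
        using component_homogeneous[OF module_grading act_degree[OF a l(1)], of j]
          additive_zero[of "extension n v", OF extension_add] N.M_zero
        by (auto simp: algebra_simps)
    next
      fix a a' assume "extension n v (component P j (actP a b)) \<in> N (j + n)"
        "extension n v (component P j (actP a' b)) \<in> N (j + n)"
      then show "extension n v (component P j (actP (a + a') b)) \<in> N (j + n)"
        by (simp add: act_simps component_add[OF module_grading] extension_add N.M_add)
    qed
    have "x = component P j x" using component_homogeneous[OF module_grading x] by simp
    also have "\<dots> = (\<Sum>b | coord x b \<noteq> 0. component P j (actP (coord x b) b))"
      by (subst coord_sum[of x], rule component_sum_commute[OF module_grading])
        (auto simp: add_subgroup_def)
    finally have "extension n v x
        = (\<Sum>b | coord x b \<noteq> 0. extension n v (component P j (actP (coord x b) b)))"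
      by (metis additive_sum[of "extension n v", OF extension_add])
    also have "\<dots> \<in> N (j + n)" by (rule N.M_sum) (use coord_support * in blast)
    finally show ?thesis .
  qed
  then show ?thesis
    unfolding dg_hom_def
    by (auto simp: extension_add extension_act twist_homogeneous N.act_ksign)
qed

lemma hom_eq_on_span:
  assumes "f \<in> Hom n" "g \<in> Hom n" "\<And>b. b \<in> S \<Longrightarrow> f b = g b"
    "x \<in> left_span (type_alg scale) actP S"
  shows "f x = g x"
  using assms(3,4)
  by (rule eq_on_left_span[where \<phi>="\<lambda>a. actN (twist n a)", rotated 4])
    (auto simp: dg_homD(1)[OF assms(1)] dg_homD(1)[OF assms(2)]
      hom_twist[OF assms(1)] hom_twist[OF assms(2)])

end

section \<open>Lifting along a resolution of the trivial module\<close>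

context dg_module
begin

text \<open>The cocycles of degree zero in \<open>Hom\<^sub>A(M, k)\<close>.\<close>

definition trivial_cocycle :: "('m \<Rightarrow> 'k) \<Rightarrow> bool" where
  "trivial_cocycle \<eta> \<longleftrightarrow>
     graded_hom (type_alg scale) act UNIV M
       (trivial_act (type_alg scale) A) UNIV trivial_grading \<eta> \<and> (\<forall>x. \<eta> (dM x) = 0)"

lemma trivial_cocycleD:
  assumes "trivial_cocycle \<eta>"
  shows "\<eta> (x + y) = \<eta> x + \<eta> y" "\<eta> (act a x) = trivial_act (type_alg scale) A a (\<eta> x)"
    "x \<in> M j \<Longrightarrow> j \<noteq> 0 \<Longrightarrow> \<eta> x = 0" "\<eta> (dM x) = 0"
    "\<eta> (act (scale c 1) x) = c * \<eta> x" "a \<in> A i \<Longrightarrow> 0 < i \<Longrightarrow> \<eta> (act a x) = 0"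
proof -
  have *: "\<eta> (x + y) = \<eta> x + \<eta> y" "\<eta> (act a x) = trivial_act (type_alg scale) A a (\<eta> x)"
    "x \<in> M j \<Longrightarrow> \<eta> x \<in> trivial_grading j" "\<eta> (dM x) = 0" for x y a j
    using assms unfolding trivial_cocycle_def graded_hom_def by (auto simp: type_alg_def)
  from * show "\<eta> (x + y) = \<eta> x + \<eta> y" "\<eta> (act a x) = trivial_act (type_alg scale) A a (\<eta> x)"
    "\<eta> (dM x) = 0" by auto
  show "x \<in> M j \<Longrightarrow> j \<noteq> 0 \<Longrightarrow> \<eta> x = 0" using *(3)[of x j] by (simp add: trivial_grading_def)
  show "\<eta> (act (scale c 1) x) = c * \<eta> x" "a \<in> A i \<Longrightarrow> 0 < i \<Longrightarrow> \<eta> (act a x) = 0"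
    using *(2) trivial_act_type_alg by simp_all
qed

lemma trivial_cocycle_functional:
  "trivial_cocycle \<eta> \<Longrightarrow> functional (\<lambda>c x. act (scale c 1) x) \<eta>"
  by (simp add: functional_def trivial_cocycleD(1,5))

end

locale resolution = dg_module scale A d act M dM
  for scale :: "'k::field \<Rightarrow> 'a::ring_1 \<Rightarrow> 'a" and A d
    and act :: "'a \<Rightarrow> 'm::ab_group_add \<Rightarrow> 'm" and M dM +
  fixes e :: "'m \<Rightarrow> 'k"
  assumes resolves: "resolves_trivial act M dM e"
begin

lemma e_cocycle: "trivial_cocycle e"
  using resolves by (simp add: resolves_trivial_def trivial_cocycle_def)

lemmas e_simps = trivial_cocycleD[OF e_cocycle]

lemma e_surjective: "\<exists>x\<in>M 0. dM x = 0 \<and> e x = c"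
proof -
  have "c \<in> trivial_grading 0" by (simp add: trivial_grading_def)
  then obtain x where "x \<in> M 0" "dM x = 0" "c - e x \<in> (\<lambda>_. 0) ` (trivial_grading (0 - 1) :: 'k set)"
    using resolves unfolding resolves_trivial_def quasi_iso_def by blast
  then show ?thesis by auto
qed

lemma kernel_acyclic:
  assumes "x \<in> M j" "dM x = 0" "e x = 0"
  shows "\<exists>y\<in>M (j - 1). dM y = x \<and> e y = 0"
proof -
  have "e x \<in> (\<lambda>_. 0) ` (trivial_grading (j - 1) :: 'k set)"
    using assms(3) by (auto simp: trivial_grading_def)
  then obtain y where y: "y \<in> M (j - 1)" "dM y = x"
    using resolves assms(1,2) unfolding resolves_trivial_def quasi_iso_def by blast
  show ?thesis
  proof (cases "j - 1 = 0")
    case True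
    obtain z where z: "z \<in> M 0" "dM z = 0" "e z = e y" using e_surjective by blast
    have "y - z \<in> M (j - 1)" using y z True by (simp add: M_diff)
    then show ?thesis using y z
      by (intro bexI[of _ "y - z"]) (auto simp: dM_diff additive_diff[of e, OF e_simps(1)])
  qed (use y e_simps(3)[OF y(1)] in auto)
qed

end

locale semifree_dg_module = dg_module scale A d act M dM
  for scale :: "'k::field \<Rightarrow> 'a::ring_1 \<Rightarrow> 'a" and A d
    and act :: "'a \<Rightarrow> 'm::ab_group_add \<Rightarrow> 'm" and M dM +
  fixes Bs :: "nat \<Rightarrow> 'm set"
  assumes semibasis: "semibasis act M dM Bs"
begin

sublocale free_dg_module scale A d act M dM "\<Union>n. Bs n"
  by unfold_locales (use semibasis in \<open>auto simp: semibasis_def\<close>)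

lemma differential_semibasis:
  "b \<in> Bs l \<Longrightarrow> dM b \<in> left_span (type_alg scale) act (\<Union>i<l. Bs i)"
proof (cases "l = 0")
  case True
  assume "b \<in> Bs l"
  then have "dM b = 0" using semibasis True by (auto simp: semibasis_def)
  then show ?thesis unfolding left_span_def
    by (auto intro!: exI[of _ "{}"] exI[of _ "\<lambda>_. 0"] simp: type_alg_def)
qed (use semibasis in \<open>auto simp: semibasis_def\<close>)

lemma stage_unique: "b \<in> Bs i \<Longrightarrow> b \<in> Bs j \<Longrightarrow> i = j"
  using semibasis by (auto simp: semibasis_def disjoint_family_on_def)

end

locale lifting_pair = semifree_dg_module scale A d actP P dP Bs + N: resolution scale A d actN N dN e
  for scale :: "'k::field \<Rightarrow> 'a::ring_1 \<Rightarrow> 'a" and A d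
    and actP :: "'a \<Rightarrow> 'p::ab_group_add \<Rightarrow> 'p" and P dP Bs
    and actN :: "'a \<Rightarrow> 'n::ab_group_add \<Rightarrow> 'n" and N dN and e :: "'n \<Rightarrow> 'k"
begin

sublocale free_pair scale A d actP P dP "\<Union>n. Bs n" actN N dN ..

lemma extension_stage: "b \<in> Bs l \<Longrightarrow> extension n v b = v b"
  by (rule extension_basis) blast

text \<open>
  The sign in the twisted linearity of \<open>f\<close> disappears on the trivial module, where elements of
  positive degree act by zero. So \<open>e \<circ> f\<close> is linear whatever the degree of \<open>f\<close> is.
\<close>

lemma composite_trivial_act:
  assumes f: "f \<in> Hom n"
  shows "e (f (actP a x)) = trivial_act (type_alg scale) A a (e (f x))"
  using grading UNIV_I
proof (rule homogeneous_induct[of UNIV A a])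
  fix i a assume a: "a \<in> A i"
  show "e (f (actP a x)) = trivial_act (type_alg scale) A a (e (f x))"
  proof (cases "i = 0")
    case True
    then show ?thesis using a by (simp add: dg_homD(3)[OF f] N.e_simps(2))
  next
    case False
    then show ?thesis
      using trivial_act_type_alg(2)[OF a] N.e_simps(6)[OF a]
      by (simp add: dg_homD(3)[OF f a] additive_ksign[of e, OF N.e_simps(1)])
  qed
next
  fix a a' assume "e (f (actP a x)) = trivial_act (type_alg scale) A a (e (f x))"
    "e (f (actP a' x)) = trivial_act (type_alg scale) A a' (e (f x))"
  then show "e (f (actP (a + a') x)) = trivial_act (type_alg scale) A (a + a') (e (f x))"
    by (simp add: act_simps dg_homD(1)[OF f] N.e_simps(1) flip: N.e_simps(2))
      (simp add: N.act_simps N.e_simps(1))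
qed

lemma kills_resolution:
  assumes f: "f \<in> Hom n" and "\<And>b. b \<in> (\<Union>n. Bs n) \<Longrightarrow> e (f b) = 0"
  shows "e (f x) = 0"
proof -
  have "e (f x) = (\<lambda>_. 0) x"
    by (rule eq_on_left_span[where \<phi>="trivial_act (type_alg scale) A", OF _ _ _ _ _ left_span_basis])
      (simp_all add: dg_homD(1)[OF f] N.e_simps(1) composite_trivial_act[OF f] assms(2) trivial_act_def)
  then show ?thesis by simp
qed

text \<open>
  The kernel of \<open>e\<close> is acyclic, so a cocycle \<open>g\<close> in \<open>Hom(P, ker e)\<close> is the differential of a map \<open>h\<close>
  that is found on one stage of the semibasis after the other: on a basis element \<open>b\<close> the value of
  \<open>h\<close> has to solve \<open>d (h b) = g b \<plusminus> h (d b)\<close>, where \<open>h (d b)\<close> is known from the stages below.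
\<close>

theorem null_homotopic:
  assumes g: "g \<in> Hom n" and closed: "hom_diff n g = (\<lambda>_. 0)" and eg: "\<And>x. e (g x) = 0"
  shows "\<exists>h\<in>Hom (n - 1). hom_diff (n - 1) h = g \<and> (\<forall>x. e (h x) = 0)"
proof -
  let ?S = "\<lambda>l. \<Union>i<l. Bs i"
  \<comment> \<open>\<open>ok v b\<close>: the value of \<open>v\<close> at \<open>b\<close> solves the equation at \<open>b\<close>. As the differential of \<open>b\<close> lies in
    lower stages, this depends only on \<open>v b\<close> and the values of \<open>v\<close> there.\<close>
  define ok where "ok v b \<longleftrightarrow> (\<exists>j. b \<in> P j \<and> v b \<in> N (j + (n - 1))) \<and> e (v b) = 0 \<and>
    dN (v b) = g b + ksign (n - 1) (extension (n - 1) v (dP b))" for v b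
  \<comment> \<open>\<open>good l v\<close>: all equations on the stages below \<open>l\<close> are solved, and \<open>v\<close> is zero elsewhere, so that
    \<open>v\<close> extends to a graded map.\<close>
  define good where "good l v \<longleftrightarrow> (\<forall>b\<in>?S l. ok v b) \<and> (\<forall>b. b \<notin> ?S l \<longrightarrow> v b = 0)" for l v
  have goodD: "b \<in> ?S l \<Longrightarrow> ok v b" "b \<notin> ?S l \<Longrightarrow> v b = 0" if "good l v" for l v b
    using that unfolding good_def by blast+
  have local: "extension (n - 1) v x = extension (n - 1) v' x"
    if "\<And>b. b \<in> ?S l \<Longrightarrow> v b = v' b" "x \<in> left_span (type_alg scale) actP (?S l)" for v v' l x
  proof (rule eq_on_left_span[where \<phi>="\<lambda>a. actN (twist (n - 1) a)", OF _ _ _ _ _ that(2)])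
    fix b assume b: "b \<in> ?S l"
    then show "extension (n - 1) v b = extension (n - 1) v' b"
      using that(1)[OF b] by (auto simp: extension_stage)
  qed (simp_all add: extension_add extension_act)
  have ok_cong: "ok v b \<longleftrightarrow> ok v' b"
    if "b \<in> Bs l" "v b = v' b" "\<And>b. b \<in> ?S l \<Longrightarrow> v b = v' b" for v v' b l
  proof -
    have "extension (n - 1) v (dP b) = extension (n - 1) v' (dP b)"
      by (rule local[OF _ differential_semibasis[OF that(1)]]) (rule that(3))
    then show ?thesis using that(2) by (simp add: ok_def)
  qed
  have degree: "\<exists>j. b \<in> P j" if "b \<in> Bs l" for b l using basis_homogeneous that by blast
  have good_hom: "extension (n - 1) v \<in> Hom (n - 1)" if v: "good l v" for l v
  proof (rule extension_in)
    fix b assume b: "b \<in> (\<Union>n. Bs n)"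
    then obtain j where "b \<in> P j" using degree by auto
    then show "\<exists>j. b \<in> P j \<and> v b \<in> N (j + (n - 1))"
      using goodD[OF v, of b] N.M_zero by (cases "b \<in> ?S l") (auto simp: ok_def)
  qed
  \<comment> \<open>The right hand side of the equation is a cocycle in the kernel of \<open>e\<close>, which is acyclic.\<close>
  have solve: "\<exists>y. y \<in> N (j + (n - 1)) \<and> e y = 0 \<and>
      dN y = g b + ksign (n - 1) (extension (n - 1) v (dP b))"
    if v: "good l v" and b: "b \<in> Bs l" "b \<in> P j" for l v b j
  proof -
    let ?h = "extension (n - 1) v" and ?z = "g b + ksign (n - 1) (extension (n - 1) v (dP b))"
    have h: "?h \<in> Hom (n - 1)" using good_hom[OF v] .
    have Dh: "hom_diff (n - 1) ?h \<in> Hom n" using hom_diff_in[OF h] by simp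
    have "hom_diff (n - 1) ?h (dP b) = g (dP b)"
    proof (rule hom_eq_on_span[OF Dh g _ differential_semibasis[OF b(1)]])
      fix b' assume b': "b' \<in> ?S l"
      then obtain i where "b' \<in> Bs i" by auto
      then show "hom_diff (n - 1) ?h b' = g b'"
        using goodD(1)[OF v b'] by (simp add: ok_def hom_diff_def extension_stage)
    qed
    then have dh: "dN (?h (dP b)) = g (dP b)"
      by (simp add: hom_diff_def dM_square additive_zero[OF dg_homD(1)[OF h]])
    have "dN (g b) = ksign n (g (dP b))" using fun_cong[OF closed, of b] by (simp add: hom_diff_def)
    then have "dN ?z = 0" by (simp add: N.dM_add N.dM_ksign dh) (simp add: ksign_def)
    moreover have "?z \<in> N (j + n)"
      using dg_homD(2)[OF g b(2)] dg_homD(2)[OF h dM_degree[OF b(2)]]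
      by (intro N.M_add ksign_mem[OF N.M_subgroup]) auto
    moreover have "e (?h x) = 0" for x
    proof (rule kills_resolution[OF h])
      fix b' assume "b' \<in> (\<Union>n. Bs n)"
      then show "e (?h b') = 0"
        using goodD[OF v, of b'] additive_zero[of e, OF N.e_simps(1)] extension_basis[of b']
        by (cases "b' \<in> ?S l") (simp_all add: ok_def)
    qed
    then have "e ?z = 0" by (simp add: N.e_simps(1) eg additive_ksign[of e, OF N.e_simps(1)])
    ultimately show ?thesis using N.kernel_acyclic[of ?z "j + n"] by (auto simp: algebra_simps)
  qed
  have "\<exists>v. \<forall>l. good l (v l) \<and> (\<forall>b\<in>?S l. v (Suc l) b = v l b)"
  proof (rule dependent_nat_choice)
    show "\<exists>v. good 0 v" by (rule exI[of _ "\<lambda>_. 0"]) (simp add: good_def)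
  next
    fix v l assume v: "good l v"
    define dg where "dg b = (SOME j. b \<in> P j)" for b
    define v' where "v' b = (if b \<in> Bs l then SOME y. y \<in> N (dg b + (n - 1)) \<and> e y = 0 \<and>
        dN y = g b + ksign (n - 1) (extension (n - 1) v (dP b)) else v b)" for b
    have old: "v' b = v b" if "b \<in> ?S l" for b
      using that stage_unique by (auto simp: v'_def)
    have "ok v' b" if b: "b \<in> ?S (Suc l)" for b
    proof (cases "b \<in> Bs l")
      case True
      have dg: "b \<in> P (dg b)" unfolding dg_def using degree[OF True] by (rule someI_ex)
      have "v' b \<in> N (dg b + (n - 1)) \<and> e (v' b) = 0 \<and>
          dN (v' b) = g b + ksign (n - 1) (extension (n - 1) v (dP b))"
        using someI_ex[OF solve[OF v True dg]] True by (simp add: v'_def)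
      then show ?thesis
        using dg local[of l v' v, OF old differential_semibasis[OF True]] by (auto simp: ok_def)
    next
      case False
      then obtain i where i: "i < l" "b \<in> Bs i" using b by (auto simp: less_Suc_eq)
      then have "ok v b" by (intro goodD(1)[OF v]) auto
      moreover have "v' b = v b" by (rule old) (use i in auto)
      moreover have "v' b' = v b'" if "b' \<in> ?S i" for b'
        by (rule old) (use that i in \<open>auto intro: less_trans\<close>)
      ultimately show ?thesis using ok_cong[OF i(2), of v' v] by blast
    qed
    moreover have "v' b = 0" if "b \<notin> ?S (Suc l)" for b
      using that goodD(2)[OF v, of b] by (auto simp: v'_def less_Suc_eq)
    ultimately show "\<exists>v'. good (Suc l) v' \<and> (\<forall>b\<in>?S l. v' b = v b)"
      using old unfolding good_def by blast
  qed
  then obtain v where v: "\<And>l. good l (v l)" and step: "\<And>l b. b \<in> ?S l \<Longrightarrow> v (Suc l) b = v l b"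
    by blast
  \<comment> \<open>A basis element of stage \<open>l\<close> keeps the value that it gets in step \<open>l + 1\<close>.\<close>
  define w where "w b = v (Suc (THE l. b \<in> Bs l)) b" for b
  have w: "w b = v (Suc l) b" if "b \<in> Bs l" for b l
    using that stage_unique by (auto simp: w_def the_equality)
  have w': "v m b = w b" if "b \<in> Bs l" "l < m" for m l b
    using that(2)
  proof (induction m)
    case (Suc m)
    have "v (Suc m) b = v m b" if "l < m" by (rule step) (use that \<open>b \<in> Bs l\<close> in auto)
    then show ?case using Suc w[OF that(1)] by (cases "m = l") auto
  qed simp
  have ok: "ok w b" if bB: "b \<in> (\<Union>l. Bs l)" for b
  proof -
    obtain l where l: "b \<in> Bs l" using bB by blast
    have "ok (v (Suc l)) b" by (rule goodD(1)[OF v[of "Suc l"]]) (use l in auto)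
    moreover have "w b' = v (Suc l) b'" if "b' \<in> ?S l" for b'
      using that w'[of b' _ "Suc l"] by auto
    ultimately show ?thesis using ok_cong[OF l, of w "v (Suc l)"] w[OF l] by blast
  qed
  let ?h = "extension (n - 1) w"
  have h: "?h \<in> Hom (n - 1)" by (rule extension_in) (use ok in \<open>auto simp: ok_def\<close>)
  have "hom_diff (n - 1) ?h x = g x" for x
  proof (rule hom_eq_on_span[OF _ g _ left_span_basis])
    show "hom_diff (n - 1) ?h \<in> Hom n" using hom_diff_in[OF h] by simp
    show "hom_diff (n - 1) ?h b = g b" if "b \<in> (\<Union>l. Bs l)" for b
      using ok[OF that] extension_basis[OF that] by (simp add: ok_def hom_diff_def)
  qed
  then have "hom_diff (n - 1) ?h = g" by blast
  moreover have "e (?h x) = 0" for x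
  proof (rule kills_resolution[OF h])
    fix b assume b: "b \<in> (\<Union>n. Bs n)"
    show "e (?h b) = 0" using ok[OF b] extension_basis[OF b] by (simp add: ok_def)
  qed
  ultimately show ?thesis using h by blast
qed

text \<open>A graded lift along \<open>e\<close> exists on the basis; its failure to commute with the differentials is
  a cocycle with values in \<open>ker e\<close>, hence the differential of a map that can be subtracted.\<close>

theorem lift_trivial_cocycle:
  assumes \<eta>: "trivial_cocycle \<eta>"
  shows "\<exists>f\<in>Hom 0. (\<forall>x. dN (f x) = f (dP x)) \<and> (\<forall>x. e (f x) = \<eta> x)"
proof -
  note eta = trivial_cocycleD[OF \<eta>]
  have "\<exists>y. (\<exists>j. b \<in> P j \<and> y \<in> N j) \<and> e y = \<eta> b" if bB: "b \<in> (\<Union>n. Bs n)" for b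
  proof -
    obtain j where j: "b \<in> P j" using basis_homogeneous bB by blast
    show ?thesis
    proof (cases "j = 0")
      case True
      then show ?thesis using N.e_surjective[of "\<eta> b"] j by blast
    next
      case False
      then show ?thesis using eta(3)[OF j] N.M_zero j additive_zero[of e, OF N.e_simps(1)]
        by (intro exI[of _ 0]) auto
    qed
  qed
  then obtain v where v: "\<And>b. b \<in> (\<Union>n. Bs n) \<Longrightarrow> (\<exists>j. b \<in> P j \<and> v b \<in> N j) \<and> e (v b) = \<eta> b"
    by metis
  let ?f = "extension 0 v"
  have f: "?f \<in> Hom 0" by (rule extension_in) (use v in auto)
  have ef: "e (?f x) = \<eta> x" for x
    by (rule eq_on_left_span[where \<phi>="trivial_act (type_alg scale) A", OF _ _ _ _ _ left_span_basis])
      (use v extension_basis in \<open>simp_all add: dg_homD(1)[OF f] N.e_simps(1)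
        composite_trivial_act[OF f] eta(1,2) del: UN_iff\<close>)
  have "\<exists>h\<in>Hom (1 - 1). hom_diff (1 - 1) h = hom_diff 0 ?f \<and> (\<forall>x. e (h x) = 0)"
  proof (rule null_homotopic)
    show "hom_diff 0 ?f \<in> Hom 1" using hom_diff_in[OF f] by simp
    show "hom_diff 1 (hom_diff 0 ?f) = (\<lambda>_. 0)" using hom_diff_square[OF f] by simp
    show "e (hom_diff 0 ?f x) = 0" for x
      by (simp add: hom_diff_def additive_diff[of e, OF N.e_simps(1)] N.e_simps(4) ef eta(4))
  qed
  then obtain h where h: "h \<in> Hom 0" "hom_diff 0 h = hom_diff 0 ?f" "\<And>x. e (h x) = 0" by auto
  have "dN (?f x - h x) = ?f (dP x) - h (dP x)" for x
    using fun_cong[OF h(2), of x] by (simp add: hom_diff_def N.dM_diff algebra_simps)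
  then show ?thesis
    using hom_subtract[OF f h(1)] h(3) ef
    by (intro bexI[of _ "\<lambda>x. ?f x - h x"]) (auto simp: additive_diff[of e, OF N.e_simps(1)])
qed

end

section \<open>Minimal resolutions with a semibasis in degree zero\<close>

locale koszul_resolution = semifree_dg_module scale A d act K dK Bs + resolution scale A d act K dK e
  for scale :: "'k::field \<Rightarrow> 'a::ring_1 \<Rightarrow> 'a" and A d
    and act :: "'a \<Rightarrow> 'm::ab_group_add \<Rightarrow> 'm" and K dK Bs and e :: "'m \<Rightarrow> 'k" +
  assumes semibasis_degree: "(\<Union>n. Bs n) \<subseteq> K 0"
begin

abbreviation lin :: "('m \<Rightarrow> 'k) \<Rightarrow> bool" where
  "lin \<equiv> functional (\<lambda>c x. act (scale c 1) x)"

text \<open>The additive group generated by \<open>A\<^sup>p X\<close>, that is \<open>A\<^sup>p \<otimes> X\<close> if \<open>X\<close> is a subspace of \<open>K\<^sup>0\<close>.\<close>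

inductive_set prods :: "nat \<Rightarrow> 'm set \<Rightarrow> 'm set" for p X where
  zero: "0 \<in> prods p X"
| step: "a \<in> A p \<Longrightarrow> x \<in> X \<Longrightarrow> z \<in> prods p X \<Longrightarrow> act a x + z \<in> prods p X"

lemma prods_generator: "a \<in> A p \<Longrightarrow> x \<in> X \<Longrightarrow> act a x \<in> prods p X"
  using prods.step[OF _ _ prods.zero, of a p x X] by simp

lemma prods_add: "y \<in> prods p X \<Longrightarrow> z \<in> prods p X \<Longrightarrow> y + z \<in> prods p X"
  by (induction rule: prods.induct) (auto simp: add.assoc intro: prods.step)

lemma prods_minus: "z \<in> prods p X \<Longrightarrow> - z \<in> prods p X"
proof (induction rule: prods.induct)
  case (step a x z)
  then have "act (- a) x + - z \<in> prods p X" by (intro prods.step A_minus)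
  then show ?case by (simp add: act_minus)
qed (simp add: prods.zero)

lemma prods_subgroup: "add_subgroup (prods p X)"
  unfolding add_subgroup_def
  using prods.zero prods_add[OF _ prods_minus] by auto

lemmas prods_diff = add_subgroupD(4)[OF prods_subgroup]
  and prods_sum = add_subgroup_sum[OF prods_subgroup]

lemma prods_induct [consumes 1, case_names zero generator add]:
  assumes "z \<in> prods p X" "P 0" "\<And>a x. a \<in> A p \<Longrightarrow> x \<in> X \<Longrightarrow> P (act a x)"
    "\<And>y z. P y \<Longrightarrow> P z \<Longrightarrow> P (y + z)"
  shows "P z"
  using assms(1) by (induction rule: prods.induct) (auto intro: assms)

lemma prods_mono: "z \<in> prods p X \<Longrightarrow> X \<subseteq> Y \<Longrightarrow> z \<in> prods p Y"
  by (induction rule: prods_induct) (auto intro: prods.zero prods_generator prods_add)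

lemma prods_zero: "z \<in> prods p {0} \<Longrightarrow> z = 0"
  by (induction rule: prods_induct) auto

lemma act_prods: "z \<in> prods p X \<Longrightarrow> a \<in> A i \<Longrightarrow> act a z \<in> prods (i + p) X"
proof (induction rule: prods_induct)
  case (generator b x)
  have "act (a * b) x \<in> prods (i + p) X" using generator by (intro prods_generator grading_mult)
  then show ?case by (simp add: act_simps)
qed (auto simp: act_simps intro: prods.zero prods_add)

lemma prods_scale: "z \<in> prods p X \<Longrightarrow> act (scale c 1) z \<in> prods p X"
  using act_prods[OF _ scale_one_in, of z p X c] by simp

text \<open>
  As the semibasis has degree zero, \<open>K\<close> vanishes in negative degrees, and in degree \<open>p\<close> it is the span
  of \<open>A\<^sup>p K\<^sup>0\<close>.
\<close>

lemma component_term: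
  assumes b: "b \<in> K 0"
  shows "component K j (act a b) = (if j < 0 then 0 else act (component A (nat j) a) b)"
  using grading UNIV_I
proof (rule homogeneous_induct[of UNIV A a])
  fix i a assume a: "a \<in> A i"
  have "act a b \<in> K (int i)" using act_degree[OF a b] by simp
  then show "component K j (act a b) = (if j < 0 then 0 else act (component A (nat j) a) b)"
    using component_homogeneous[OF module_grading, of "act a b" "int i" j]
      component_homogeneous[OF grading a, of "nat j"] by auto
qed (simp_all add: act_simps component_add[OF module_grading] component_add[OF grading])

lemma homogeneous_expansion:
  assumes "x \<in> K j"
  shows "x = (\<Sum>b | coord x b \<noteq> 0. if j < 0 then 0 else act (component A (nat j) (coord x b)) b)"
proof -
  have "x = component K j x" using component_homogeneous[OF module_grading assms] by simp
  also have "\<dots> = (\<Sum>b | coord x b \<noteq> 0. component K j (act (coord x b) b))"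
    by (subst coord_sum[of x], rule component_sum_commute[OF module_grading])
      (auto simp: add_subgroup_def)
  also have "\<dots> = (\<Sum>b | coord x b \<noteq> 0. if j < 0 then 0 else act (component A (nat j) (coord x b)) b)"
    using coord_support[of x] semibasis_degree by (intro sum.cong component_term) auto
  finally show ?thesis .
qed

lemma negative_degree: "x \<in> K j \<Longrightarrow> j < 0 \<Longrightarrow> x = 0"
  by (subst homogeneous_expansion) auto

lemma degree_prods: "x \<in> K (int p) \<Longrightarrow> x \<in> prods p (K 0)"
  using coord_support[of x] semibasis_degree
  by (subst homogeneous_expansion[of x "int p"])
    (auto intro!: prods_sum prods_generator component_in[OF grading])

lemma prods_degree: "z \<in> prods p X \<Longrightarrow> X \<subseteq> K 0 \<Longrightarrow> z \<in> K (int p)"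
  by (induction rule: prods_induct) (use act_degree[of _ p _ 0] in \<open>auto intro: M_zero M_add\<close>)

lemma degree_zero_expansion:
  assumes "w \<in> K 0"
  obtains c where "w = (\<Sum>b | coord w b \<noteq> 0. act (scale (c b) 1) b)"
proof -
  have "\<exists>c. component A 0 a = scale c 1" for a
    using component_in[OF grading, of a 0] connected by auto
  then obtain c where "\<And>a. component A 0 a = scale (c a) 1" by metis
  then have "w = (\<Sum>b | coord w b \<noteq> 0. act (scale (c (coord w b)) 1) b)"
    using homogeneous_expansion[OF assms] by simp
  then show ?thesis by (rule that)
qed

text \<open>
  A functional on the vector space \<open>K\<^sup>0\<close> extends to an \<open>A\<close>-linear map \<open>K \<rightarrow> A\<close>, because \<open>K = A \<otimes> K\<^sup>0\<close>.
\<close>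

definition lext :: "('m \<Rightarrow> 'k) \<Rightarrow> 'm \<Rightarrow> 'a" where
  "lext lam = basis_sum (\<lambda>a b. scale (lam b) a)"

lemma lext_add: "lext lam (x + y) = lext lam x + lext lam y"
  unfolding lext_def by (rule basis_sum_add) (simp add: scale_simps)

lemma lext_act: "lext lam (act a x) = a * lext lam x"
proof -
  have "{b. coord (act a x) b \<noteq> 0} \<subseteq> {b. coord x b \<noteq> 0}" by (auto simp: coord_act)
  then show ?thesis
    unfolding lext_def
    by (subst (1 2) basis_sum_superset[of _ "{b. coord x b \<noteq> 0}"])
      (simp_all add: coord_finite coord_act scale_simps sum_distrib_left)
qed

lemmas lext_zero [simp] = additive_zero[of "lext lam" for lam, OF lext_add]
  and lext_diff = additive_diff[of "lext lam" for lam, OF lext_add]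
  and lext_sum = additive_sum[of "lext lam" for lam, OF lext_add]
  and lext_ksign = additive_ksign[of "lext lam" for lam, OF lext_add]

lemma lext_degree_zero:
  assumes lam: "lin lam" and w: "w \<in> K 0"
  shows "lext lam w = scale (lam w) 1"
proof -
  obtain c where c: "w = (\<Sum>b | coord w b \<noteq> 0. act (scale (c b) 1) b)"
    using degree_zero_expansion[OF w] .
  have "lext lam (act (scale (c b) 1) b) = scale (lam (act (scale (c b) 1) b)) 1"
    if "b \<in> (\<Union>n. Bs n)" for b
  proof -
    have "lext lam b = scale (lam b) 1" unfolding lext_def by (simp add: basis_sum_basis[OF that])
    then show ?thesis by (simp add: lext_act functionalD[OF lam] scale_simps)
  qed
  then have "lext lam w = (\<Sum>b | coord w b \<noteq> 0. scale (lam (act (scale (c b) 1) b)) 1)"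
    unfolding arg_cong[OF c, of "lext lam"] lext_sum
    using coord_support[of w] by (intro sum.cong) blast+
  also have "\<dots> = scale (lam w) 1"
    unfolding arg_cong[OF c, of lam] functional_sum[OF lam] by (simp add: alg.scale_sum_left)
  finally show ?thesis .
qed

lemma lext_generator: "lin lam \<Longrightarrow> w \<in> K 0 \<Longrightarrow> lext lam (act a w) = scale (lam w) a"
  by (simp add: lext_act lext_degree_zero scale_simps)

lemma lext_degree: "z \<in> prods p X \<Longrightarrow> X \<subseteq> K 0 \<Longrightarrow> lin lam \<Longrightarrow> lext lam z \<in> A p"
  by (induction rule: prods_induct)
    (auto simp: lext_generator subset_iff lext_add intro: A_zero A_add A_scale)

lemma lext_combination:
  assumes z: "z \<in> prods p X" and X: "X \<subseteq> K 0" and lam: "lin lam" "\<And>i. i \<in> I \<Longrightarrow> lin (f i)"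
    and eq: "\<And>x. x \<in> X \<Longrightarrow> lam x = (\<Sum>i\<in>I. c i * f i x)"
  shows "lext lam z = (\<Sum>i\<in>I. scale (c i) (lext (f i) z))"
  using z
proof (induction rule: prods_induct)
  case (generator a x)
  then have "lext lam (act a x) = scale (lam x) a" using X lam by (auto intro: lext_generator)
  also have "\<dots> = (\<Sum>i\<in>I. scale (c i) (scale (f i x) a))"
    using eq[OF generator(2)] by (simp add: alg.scale_sum_left)
  also have "\<dots> = (\<Sum>i\<in>I. scale (c i) (lext (f i) (act a x)))"
    using generator(2) X lam by (intro sum.cong) (auto simp: lext_generator subset_iff)
  finally show ?case .
qed (simp_all add: lext_add scale_simps sum.distrib)

lemma lext_kills: "z \<in> prods p X \<Longrightarrow> X \<subseteq> K 0 \<Longrightarrow> lin lam \<Longrightarrow> (\<And>x. x \<in> X \<Longrightarrow> lam x = 0) \<Longrightarrow> lext lam z = 0"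
  using lext_combination[of z p X lam "{}"] by simp

text \<open>
  If \<open>S\<close> spans a complement of \<open>Y\<close> in \<open>X\<close>, then \<open>A \<otimes> X\<close> is the sum of \<open>A \<otimes> Y\<close> and the \<open>A s\<close> with \<open>s\<close> in \<open>S\<close>. The
  point is that the coefficient of \<open>s\<close> is obtained from a functional on \<open>X\<close> that vanishes on \<open>Y\<close>, so that
  its differential can be computed.
\<close>

lemma prods_expansion:
  assumes X: "mod.subspace X" and Y: "mod.subspace Y" and YX: "Y \<subseteq> X" and XK: "X \<subseteq> K 0"
    and z: "z \<in> prods p X"
  obtains S lam where "finite S" "S \<subseteq> X" "\<And>s. s \<in> S \<Longrightarrow> lin (lam s)"
    "\<And>s y. s \<in> S \<Longrightarrow> y \<in> Y \<Longrightarrow> lam s y = 0"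
    "z - (\<Sum>s\<in>S. act (lext (lam s) z) s) \<in> prods p Y"
proof -
  \<comment> \<open>\<open>C\<close> is a basis of a complement of \<open>Y\<close> in \<open>X\<close>, and \<open>lam\<close> gives the coordinates.\<close>
  obtain C lam where C: "C \<subseteq> X" and lam: "\<And>c. c \<in> C \<Longrightarrow> lin (lam c)"
    "\<And>c y. c \<in> C \<Longrightarrow> y \<in> Y \<Longrightarrow> lam c y = 0"
    and fin: "\<And>x. x \<in> X \<Longrightarrow> finite {c\<in>C. lam c x \<noteq> 0}"
    and dec: "\<And>x. x \<in> X \<Longrightarrow> x - (\<Sum>c | c \<in> C \<and> lam c x \<noteq> 0. act (scale (lam c x) 1) c) \<in> Y"
    by (rule mod.relative_dual_basis[OF X Y YX]) (rule that)
  \<comment> \<open>Only finitely many coordinates of \<open>z\<close> are nonzero, but the finite set depends on \<open>z\<close>. Allowing all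
    larger finite sets makes the claim additive in \<open>z\<close>.\<close>
  have "\<exists>S0. finite S0 \<and> S0 \<subseteq> C \<and> (\<forall>S. finite S \<longrightarrow> S0 \<subseteq> S \<longrightarrow> S \<subseteq> C \<longrightarrow>
      z - (\<Sum>s\<in>S. act (lext (lam s) z) s) \<in> prods p Y)"
    using z
  proof (induction rule: prods_induct)
    case zero
    show ?case by (rule exI[of _ "{}"]) (simp add: prods.zero)
  next
    case (generator a x)
    let ?S0 = "{c\<in>C. lam c x \<noteq> 0}"
    have "act a x - (\<Sum>s\<in>S. act (lext (lam s) (act a x)) s) \<in> prods p Y"
      if S: "finite S" "?S0 \<subseteq> S" "S \<subseteq> C" for S
    proof -
      have "(\<Sum>s\<in>S. act (lext (lam s) (act a x)) s) = (\<Sum>s\<in>?S0. act a (act (scale (lam s x) 1) s))"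
        using S generator XK
        by (intro sum.mono_neutral_cong_right) (auto simp: subset_iff lext_generator lam(1) scale_simps
            simp flip: act_simps(3))
      then have "act a x - (\<Sum>s\<in>S. act (lext (lam s) (act a x)) s)
          = act a (x - (\<Sum>c | c \<in> C \<and> lam c x \<noteq> 0. act (scale (lam c x) 1) c))"
        by (simp add: act_diff act_sum)
      then show ?thesis using prods_generator[OF generator(1) dec[OF generator(2)]] by simp
    qed
    then show ?case using fin[OF generator(2)] by (intro exI[of _ ?S0]) auto
  next
    case (add y z)
    then obtain S1 S2 where S: "finite S1" "S1 \<subseteq> C" "finite S2" "S2 \<subseteq> C"
      "\<And>S. finite S \<Longrightarrow> S1 \<subseteq> S \<Longrightarrow> S \<subseteq> C \<Longrightarrow> y - (\<Sum>s\<in>S. act (lext (lam s) y) s) \<in> prods p Y"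
      "\<And>S. finite S \<Longrightarrow> S2 \<subseteq> S \<Longrightarrow> S \<subseteq> C \<Longrightarrow> z - (\<Sum>s\<in>S. act (lext (lam s) z) s) \<in> prods p Y"
      by blast
    have "y + z - (\<Sum>s\<in>S. act (lext (lam s) (y + z)) s) \<in> prods p Y"
      if "finite S" "S1 \<union> S2 \<subseteq> S" "S \<subseteq> C" for S
      using prods_add[OF S(5)[of S] S(6)[of S]] that
      by (simp add: lext_add act_simps sum.distrib algebra_simps)
    then show ?case using S by (intro exI[of _ "S1 \<union> S2"]) auto
  qed
  then obtain S where "finite S" "S \<subseteq> C" "z - (\<Sum>s\<in>S. act (lext (lam s) z) s) \<in> prods p Y" by blast
  then show ?thesis using C lam by (intro that[of S lam]) auto
qed

section \<open>The socle filtration\<close>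

text \<open>
  \<open>socle 1\<close> is the space of cocycles of \<open>K\<^sup>0\<close>, a line that \<open>e\<close> identifies with \<open>k\<close>; the elements of
  \<open>socle (n + 1)\<close> have differential in \<open>A\<^sup>1\<close> times \<open>socle n\<close>.
\<close>

primrec socle :: "nat \<Rightarrow> 'm set" where
  "socle 0 = {0}"
| "socle (Suc n) = {w \<in> K 0. dK w \<in> prods 1 (socle n)}"

lemma socle_degree: "socle n \<subseteq> K 0"
  by (cases n) (auto intro: M_zero)

lemma socle_subspace: "mod.subspace (socle n)"
  by (cases n) (auto intro!: mod.subspaceI intro: M_zero prods.zero M_add prods_add M_scale prods_scale
      simp: dM_add dM_scale)

lemma socle_Suc: "socle n \<subseteq> socle (Suc n)"
proof (induction n)
  case 0
  then show ?case by (auto intro: M_zero prods.zero)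
next
  case (Suc n)
  show ?case using prods_mono[OF _ Suc] by (auto simp del: socle.simps(1) simp: socle.simps(2))
qed

lemma socle_mono: "n \<le> p \<Longrightarrow> socle n \<subseteq> socle p"
  by (rule lift_Suc_mono_le[of socle, OF socle_Suc])

text \<open>An element of \<open>socle 1\<close> is a cocycle of degree zero. If \<open>e\<close> kills it, it is a coboundary, and there is
  nothing in degree \<open>-1\<close>.\<close>

lemma socle_one: "w \<in> socle 1 \<Longrightarrow> e w = 0 \<Longrightarrow> w = 0"
proof -
  assume w: "w \<in> socle 1" "e w = 0"
  then have "w \<in> K 0" "dK w = 0" using prods_zero by auto
  then obtain y where "y \<in> K (0 - 1)" "dK y = w" using kernel_acyclic w(2) by blast
  then show "w = 0" using negative_degree[of y "-1"] by auto
qed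

lemma socle_one_unit: "\<exists>w\<in>socle 1. e w = 1"
  using e_surjective[of 1] by (auto simp: prods.zero)

lemma differential_socle:
  assumes "w \<in> K 0" shows "dK w \<in> prods 1 (K 0)"
  using degree_prods[of "dK w" 1] dM_degree[OF assms] by simp

lemma differential_socle_step: "x \<in> socle (Suc n) \<Longrightarrow> dK x \<in> prods 1 (socle n)"
  by simp

lemma lext_differential_generator:
  assumes lam: "lin lam" and a: "a \<in> A p" and w: "w \<in> K 0"
  shows "lext lam (dK (act a w)) = d (lext lam (act a w)) + ksign (int p) (a * lext lam (dK w))"
  by (simp add: dM_leibniz[OF a] lext_add lext_generator[OF lam w] lext_ksign lext_act lext_degree_zero[OF lam w] d_scale scale_simps)

text \<open>A functional on \<open>socle (n + 1) / socle n\<close> extends to a chain map from \<open>A \<otimes> (socle (n + 1) / socle n)\<close>,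
  on which the differential is that of \<open>A\<close>.\<close>

lemma lext_differential:
  assumes lam: "lin lam" and kill: "\<And>x. x \<in> socle n \<Longrightarrow> lam x = 0"
    and z: "z \<in> prods p (socle (Suc n))"
  shows "lext lam (dK z) = d (lext lam z)"
  using z
proof (induction rule: prods_induct)
  case (generator a x)
  have x: "x \<in> K 0" using generator(2) socle_degree by blast
  have "lext lam (dK x) = 0"
    using lext_kills[OF differential_socle_step[OF generator(2)] socle_degree lam kill] .
  then show ?case using lext_differential_generator[OF lam generator(1) x] by simp
qed (simp_all add: dM_add lext_add d_add)

section \<open>Endomorphisms of the resolution\<close>

definition chain_endo :: "('m \<Rightarrow> 'm) \<Rightarrow> bool" where
  "chain_endo f \<longleftrightarrow> f \<in> dg_hom act K act K 0 \<and> (\<forall>x. f (dK x) = dK (f x))"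

lemma chain_endoD:
  assumes "chain_endo f"
  shows "f (x + y) = f x + f y" "a \<in> A i \<Longrightarrow> f (act a x) = act a (f x)" "f (dK x) = dK (f x)"
    "w \<in> K 0 \<Longrightarrow> f w \<in> K 0" "f 0 = 0"
proof -
  have f: "f \<in> dg_hom act K act K 0" using assms by (simp add: chain_endo_def)
  show "f (x + y) = f x + f y" "a \<in> A i \<Longrightarrow> f (act a x) = act a (f x)" "w \<in> K 0 \<Longrightarrow> f w \<in> K 0"
    "f (dK x) = dK (f x)" for x y
    using dg_homD[OF f] assms by (auto simp: chain_endo_def)
  from additive_zero[of f, OF this(1)] show "f 0 = 0" .
qed

lemma chain_endo_prods:
  assumes "chain_endo f" "z \<in> prods p X" "\<And>x. x \<in> X \<Longrightarrow> f x \<in> Y"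
  shows "f z \<in> prods p Y"
  using assms(2)
  by (induction rule: prods_induct)
    (auto simp: chain_endoD[OF assms(1)] intro: assms(3) prods.zero prods_generator prods_add)

text \<open>
  The claim for \<open>p = 0\<close> is that \<open>f\<close> kills \<open>socle n\<close>: inductively, \<open>f w\<close> is a cocycle of degree zero, so
  it vanishes because \<open>e (f w) = 0\<close>. Then each step of the filtration is shifted by the definition of \<open>socle\<close>.
\<close>

lemma chain_endo_shift:
  assumes f: "chain_endo f" and kill: "\<And>w. w \<in> socle n \<Longrightarrow> e (f w) = 0"
  shows "w \<in> socle (p + n) \<Longrightarrow> f w \<in> socle p"
proof (induction p arbitrary: w)
  case 0
  have "w \<in> socle j \<Longrightarrow> j \<le> n \<Longrightarrow> f w = 0" for j w
  proof (induction j arbitrary: w)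
    case (Suc j)
    have "f (dK w) \<in> prods 1 {0}"
      by (rule chain_endo_prods[OF f differential_socle_step[OF Suc.prems(1)]]) (use Suc in auto)
    moreover have "f w \<in> K 0" using chain_endoD(4)[OF f] Suc.prems(1) by simp
    ultimately have "f w \<in> socle 1" by (simp add: chain_endoD[OF f])
    moreover have "e (f w) = 0" using kill socle_mono[OF Suc.prems(2)] Suc.prems(1) by blast
    ultimately show ?case by (rule socle_one)
  qed (simp add: chain_endoD[OF f])
  then show ?case using 0 by simp
next
  case (Suc p)
  have "f (dK w) \<in> prods 1 (socle p)"
    by (rule chain_endo_prods[OF f differential_socle_step]) (use Suc in auto)
  moreover have "f w \<in> K 0" using chain_endoD(4)[OF f] Suc.prems by simp
  ultimately show ?case by (simp add: chain_endoD[OF f])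
qed

end

section \<open>Words in the degree one cohomology\<close>

definition words :: "nat \<Rightarrow> nat \<Rightarrow> nat list set" where
  "words m n = {u. set u \<subseteq> {..<m} \<and> length u = n}"

lemma finite_words: "finite (words m n)"
  unfolding words_def by (rule finite_lists_length_eq) simp

lemma words_0 [simp]: "words m 0 = {[]}"
  by (auto simp: words_def)

lemma Cons_in_words: "i # u \<in> words m (Suc n) \<longleftrightarrow> i < m \<and> u \<in> words m n"
  by (auto simp: words_def)

lemma words_SucE:
  assumes "u \<in> words m (Suc n)"
  obtains i u' where "u = i # u'" "i < m" "u' \<in> words m n"
  using assms by (cases u) (auto simp: words_def)

lemma append_in_words: "u \<in> words m p \<Longrightarrow> y \<in> words m n \<Longrightarrow> u @ y \<in> words m (p + n)"
  by (auto simp: words_def)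

lemma sum_words_append:
  "(\<Sum>w\<in>words m (p + n). f w) = (\<Sum>u\<in>words m p. \<Sum>y\<in>words m n. f (u @ y))"
proof -
  have "(\<Sum>u\<in>words m p. \<Sum>y\<in>words m n. f (u @ y))
      = (\<Sum>(u, y)\<in>words m p \<times> words m n. f (u @ y))"
    by (rule sum.cartesian_product)
  also have "\<dots> = (\<Sum>w\<in>words m (p + n). f w)"
    by (rule sum.reindex_bij_witness[where j="\<lambda>(u, y). u @ y" and i="\<lambda>w. (take p w, drop p w)"])
      (auto simp: words_def dest: in_set_takeD in_set_dropD)
  finally show ?thesis by simp
qed

context connected_dg_algebra
begin

text \<open>
  Functions on words of length \<open>n\<close> all of whose two-letter slices lie in the kernel of the
  multiplication \<open>V \<otimes> V \<rightarrow> H\<^sup>2\<close>: the degree \<open>n\<close> part of the Koszul dual coalgebra.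
\<close>

definition relational :: "nat \<Rightarrow> (nat \<Rightarrow> 'a) \<Rightarrow> nat \<Rightarrow> (nat list \<Rightarrow> 'k) \<Rightarrow> bool" where
  "relational m v n r \<longleftrightarrow> (\<forall>u y. set u \<subseteq> {..<m} \<longrightarrow> set y \<subseteq> {..<m} \<longrightarrow> length u + length y + 2 = n \<longrightarrow>
     (\<Sum>i<m. \<Sum>l<m. scale (r (u @ i # l # y)) (v i * v l)) \<in> range d)"

lemma relational_Cons: "relational m v (Suc n) r \<Longrightarrow> i < m \<Longrightarrow> relational m v n (\<lambda>u. r (i # u))"
  unfolding relational_def by (fastforce dest: spec[of _ "i # _"])

lemma relationalD:
  "relational m v (Suc (Suc n)) r \<Longrightarrow> y \<in> words m n \<Longrightarrow>
    (\<Sum>i<m. \<Sum>l<m. scale (r (i # l # y)) (v i * v l)) \<in> range d"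
  unfolding relational_def by (fastforce simp: words_def dest: spec[of _ "[]"])

lemma relational_SucI:
  assumes "\<And>i. i < m \<Longrightarrow> relational m v n (\<lambda>u. r (i # u))"
    and "\<And>n' y. n = Suc n' \<Longrightarrow> y \<in> words m n' \<Longrightarrow>
      (\<Sum>i<m. \<Sum>l<m. scale (r (i # l # y)) (v i * v l)) \<in> range d"
  shows "relational m v (Suc n) r"
  unfolding relational_def
proof (intro allI impI)
  fix u y assume *: "set u \<subseteq> {..<m}" "set y \<subseteq> {..<m}" "length u + length y + 2 = Suc n"
  show "(\<Sum>i<m. \<Sum>l<m. scale (r (u @ i # l # y)) (v i * v l)) \<in> range d"
  proof (cases u)
    case Nil
    then show ?thesis using assms(2)[of "length y" y] * by (simp add: words_def)
  next
    case (Cons j u')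
    then show ?thesis using assms(1)[of j] * unfolding relational_def by auto
  qed
qed

end

text \<open>
  The \<open>v i\<close> form a basis of the space of cocycles of \<open>A\<^sup>1\<close>, and the \<open>vco i\<close> are functionals on the whole algebra
  that restrict to the dual basis.
\<close>

locale koszul_letters = koszul_resolution scale A d act K dK Bs e
  for scale :: "'k::field \<Rightarrow> 'a::ring_1 \<Rightarrow> 'a" and A d
    and act :: "'a \<Rightarrow> 'm::ab_group_add \<Rightarrow> 'm" and K dK Bs and e :: "'m \<Rightarrow> 'k" +
  fixes m :: nat and v :: "nat \<Rightarrow> 'a" and vco :: "nat \<Rightarrow> 'a \<Rightarrow> 'k"
  assumes v_in: "i < m \<Longrightarrow> v i \<in> A 1" and v_cocycle: "i < m \<Longrightarrow> d (v i) = 0"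
    and v_span: "a \<in> A 1 \<Longrightarrow> d a = 0 \<Longrightarrow> \<exists>c. a = (\<Sum>i<m. scale (c i) (v i))"
    and vco_functional: "i < m \<Longrightarrow> functional scale (vco i)"
    and vco_v: "i < m \<Longrightarrow> j < m \<Longrightarrow> vco i (v j) = (if i = j then 1 else 0)"
begin

lemma vco_combination: "i < m \<Longrightarrow> vco i (\<Sum>j<m. scale (c j) (v j)) = c i"
  by (simp add: functional_sum[OF vco_functional] functionalD(2)[OF vco_functional] vco_v
      if_distrib[of "\<lambda>x. _ * x"] cong: if_cong)

lemma vco_expansion: "a \<in> A 1 \<Longrightarrow> d a = 0 \<Longrightarrow> a = (\<Sum>i<m. scale (vco i a) (v i))"
  using v_span[of a] vco_combination by (auto intro!: sum.cong)

text \<open>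
  The coefficients of an element of \<open>K\<^sup>0\<close> in \<open>V\<^sup>\<otimes>\<^sup>n\<close> under the iterated differential
  \<open>K\<^sup>0 \<rightarrow> A\<^sup>1 \<otimes> K\<^sup>0 \<rightarrow> A\<^sup>1 \<otimes> A\<^sup>1 \<otimes> K\<^sup>0 \<rightarrow> \<dots>\<close>, the first letter belonging to the first differential.
\<close>

primrec mu :: "nat list \<Rightarrow> 'm \<Rightarrow> 'k" where
  "mu [] = e"
| "mu (i # u) = (\<lambda>w. vco i (lext (mu u) (dK w)))"

lemma mu_functional: "set u \<subseteq> {..<m} \<Longrightarrow> lin (mu u)"
proof (induction u)
  case Nil
  then show ?case using trivial_cocycle_functional[OF e_cocycle] by simp
next
  case (Cons i u)
  then have "functional scale (vco i)" using vco_functional by simp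
  then show ?case
    by (simp add: functional_def[of "\<lambda>c x. act (scale c 1) x"] dM_add dM_scale lext_add lext_act
        functionalD scale_one_mult)
qed

lemma mu_lin: "u \<in> words m n \<Longrightarrow> lin (mu u)"
  by (rule mu_functional) (simp add: words_def)

lemma mu_kills: "u \<in> words m n \<Longrightarrow> w \<in> socle n \<Longrightarrow> mu u w = 0"
proof (induction n arbitrary: u w)
  case 0
  then show ?case using functional_zero[OF mu_lin[OF 0(1)]] by simp
next
  case (Suc n)
  obtain i u' where u: "u = i # u'" "i < m" "u' \<in> words m n" using words_SucE[OF Suc.prems(1)] .
  have "lext (mu u') (dK w) = 0"
    using lext_kills[OF differential_socle_step[OF Suc.prems(2)] socle_degree mu_lin[OF u(3)]]
      Suc.IH[OF u(3)] by blast
  then show ?case using u functional_zero[OF vco_functional[OF u(2)]] by simp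
qed

lemma lext_mu_differential_socle:
  assumes u: "u \<in> words m n" and w: "w \<in> socle (Suc (Suc n))"
  shows "lext (mu u) (dK w) = (\<Sum>i<m. scale (mu (i # u) w) (v i))"
proof -
  note z = differential_socle_step[OF w]
  have "d (lext (mu u) (dK w)) = 0"
    using lext_differential[OF mu_lin[OF u] mu_kills[OF u] z] by (simp add: dM_square)
  then show ?thesis
    using vco_expansion[OF lext_degree[OF z socle_degree mu_lin[OF u]]] by simp
qed

text \<open>
  A functional that vanishes on \<open>socle n\<close> is, on \<open>socle (n + 1)\<close>, a combination of the \<open>mu u\<close> with \<open>u\<close> of
  length \<open>n\<close>, because these have the common kernel \<open>socle n\<close>.
\<close>

lemma functional_combination_mu:
  assumes detect: "\<And>w. w \<in> socle (Suc n) \<Longrightarrow> (\<And>u. u \<in> words m n \<Longrightarrow> mu u w = 0) \<Longrightarrow> w \<in> socle n"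
    and lam: "lin lam" "\<And>w. w \<in> socle n \<Longrightarrow> lam w = 0"
  shows "\<exists>c. \<forall>w\<in>socle (Suc n). lam w = (\<Sum>u\<in>words m n. c u * mu u w)"
proof (rule mod.functional_in_span[OF finite_words socle_subspace _ lam(1)])
  show "lam x = 0" if "x \<in> socle (Suc n)" "\<And>u. u \<in> words m n \<Longrightarrow> mu u x = 0" for x
    using lam(2) detect that by blast
qed (rule mu_lin)

text \<open>This reduces statements about the coefficients along a complement of \<open>socle n\<close> to statements about the
  \<open>lext (mu u)\<close>.\<close>

lemma lext_in_subspace:
  assumes detect: "\<And>w. w \<in> socle (Suc n) \<Longrightarrow> (\<And>u. u \<in> words m n \<Longrightarrow> mu u w = 0) \<Longrightarrow> w \<in> socle n"
    and lam: "lin lam" "\<And>w. w \<in> socle n \<Longrightarrow> lam w = 0"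
    and z: "z \<in> prods p (socle (Suc n))" and Y: "alg.subspace Y"
    and mu: "\<And>u. u \<in> words m n \<Longrightarrow> lext (mu u) z \<in> Y"
  shows "lext lam z \<in> Y"
proof -
  obtain c where c: "\<forall>w\<in>socle (Suc n). lam w = (\<Sum>u\<in>words m n. c u * mu u w)"
    using functional_combination_mu[OF detect lam] by blast
  have "lext lam z = (\<Sum>u\<in>words m n. scale (c u) (lext (mu u) z))"
    by (rule lext_combination[OF z socle_degree lam(1) mu_lin]) (use c in auto)
  then show ?thesis by (simp add: alg.subspace_sum[OF Y] alg.subspace_scale[OF Y] mu)
qed

text \<open>
  If all \<open>mu u w\<close> vanish, then so do all \<open>lext (mu u) (d w)\<close> with \<open>u\<close> one letter shorter. By induction these
  detect the elements of \<open>A\<^sup>1 \<otimes> socle n\<close>, so \<open>d w\<close> lies in there.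
\<close>

lemma socle_detect: "w \<in> socle (Suc n) \<Longrightarrow> (\<And>u. u \<in> words m n \<Longrightarrow> mu u w = 0) \<Longrightarrow> w \<in> socle n"
proof (induction n arbitrary: w)
  case 0
  then show ?case using socle_one[of w] by simp
next
  case (Suc n)
  note z = differential_socle_step[OF Suc.prems(1)]
  have zero: "lext (mu u) (dK w) \<in> {0}" if "u \<in> words m n" for u
    using lext_mu_differential_socle[OF that Suc.prems(1)] Suc.prems(2) that
    by (simp add: Cons_in_words del: mu.simps)
  obtain S lam where "finite S" "S \<subseteq> socle (Suc n)" and S: "\<And>s. s \<in> S \<Longrightarrow> lin (lam s)"
    "\<And>s y. s \<in> S \<Longrightarrow> y \<in> socle n \<Longrightarrow> lam s y = 0"
    "dK w - (\<Sum>s\<in>S. act (lext (lam s) (dK w)) s) \<in> prods 1 (socle n)"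
    by (rule prods_expansion[OF socle_subspace socle_subspace socle_Suc socle_degree z]) (rule that)
  have "lext (lam s) (dK w) = 0" if "s \<in> S" for s
    using lext_in_subspace[OF Suc.IH S(1)[OF that] S(2)[OF that] z _ zero] by simp
  then have "dK w \<in> prods 1 (socle n)" using S(3) by simp
  then show ?case using Suc.prems(1) by simp
qed

text \<open>The differential of \<open>A \<otimes> gr K\<^sup>0\<close>, up to the differential of \<open>A\<close>, is right multiplication by letters.\<close>

lemma lext_mu_differential:
  assumes u: "u \<in> words m n" and z: "z \<in> prods p (socle (Suc (Suc n)))"
  shows "lext (mu u) (dK z) = d (lext (mu u) z) + ksign (int p) (\<Sum>l<m. lext (mu (l # u)) z * v l)"
  using z
proof (induction rule: prods_induct)
  case (generator a x)
  have x: "x \<in> K 0" using generator(2) socle_degree by blast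
  have "lext (mu (l # u)) (act a x) = scale (mu (l # u) x) a" if "l < m" for l
    by (rule lext_generator[OF mu_lin[of _ "Suc n"] x]) (use that u in \<open>simp add: Cons_in_words\<close>)
  then have "(\<Sum>l<m. lext (mu (l # u)) (act a x) * v l) = a * lext (mu u) (dK x)"
    unfolding lext_mu_differential_socle[OF u generator(2)] sum_distrib_left
    by (intro sum.cong) (simp_all add: scale_simps del: mu.simps)
  then show ?case using lext_differential_generator[OF mu_lin[OF u] generator(1) x] by simp
qed (simp_all add: dM_add lext_add d_add distrib_right sum.distrib del: mu.simps)

lemma boundary_add: "x \<in> range d \<Longrightarrow> y \<in> range d \<Longrightarrow> x + y \<in> range d"
  and boundary_minus: "x \<in> range d \<Longrightarrow> - x \<in> range d"
  and boundary_diff: "x \<in> range d \<Longrightarrow> y \<in> range d \<Longrightarrow> x - y \<in> range d"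
  and boundary_scale: "x \<in> range d \<Longrightarrow> scale c x \<in> range d"
  using add_subgroupD[OF boundaries_subgroup] alg.subspace_scale[OF boundaries_subspace] by auto

text \<open>The relation for the first two letters is the equation \<open>d (d w) = 0\<close>.\<close>

lemma mu_relations:
  assumes u: "u \<in> words m n" and w: "w \<in> socle (Suc (Suc (Suc n)))"
  shows "(\<Sum>i<m. \<Sum>l<m. scale (mu (i # l # u) w) (v i * v l)) \<in> range d"
proof -
  have "lext (mu (l # u)) (dK w) = (\<Sum>i<m. scale (mu (i # l # u) w) (v i))" if "l < m" for l
    using lext_mu_differential_socle[of "l # u" "Suc n" w] u w that by (simp add: Cons_in_words)
  then have "(\<Sum>l<m. lext (mu (l # u)) (dK w) * v l)
      = (\<Sum>l<m. \<Sum>i<m. scale (mu (i # l # u) w) (v i * v l))"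
    by (simp add: sum_distrib_right scale_simps del: mu.simps)
  also have "\<dots> = (\<Sum>i<m. \<Sum>l<m. scale (mu (i # l # u) w) (v i * v l))" by (rule sum.swap)
  finally have "(\<Sum>i<m. \<Sum>l<m. scale (mu (i # l # u) w) (v i * v l)) = d (lext (mu u) (dK w))"
    using lext_mu_differential[OF u differential_socle_step[OF w]]
    by (simp add: dM_square ksign_def del: mu.simps)
  then show ?thesis by simp
qed

text \<open>
  The slice at the first two letters is \<open>mu_relations\<close>. The other slices of \<open>mu u w\<close> are slices for the
  elements that occur in \<open>d w\<close>, which lie in a lower step of the filtration.
\<close>

lemma mu_relational: "w \<in> socle (Suc n) \<Longrightarrow> relational m v n (\<lambda>u. mu u w)"
proof (induction n arbitrary: w)
  case 0
  then show ?case by (simp add: relational_def)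
next
  case (Suc n)
  show ?case
  proof (rule relational_SucI)
    fix j assume j: "j < m"
    show "relational m v n (\<lambda>u. mu (j # u) w)"
      unfolding relational_def
    proof (intro allI impI)
      fix u y assume uy: "set u \<subseteq> {..<m}" "set y \<subseteq> {..<m}" "length u + length y + 2 = n"
      have "(\<Sum>i<m. \<Sum>l<m. scale (vco j (lext (mu (u @ i # l # y)) z)) (v i * v l)) \<in> range d"
        if "z \<in> prods 1 (socle (Suc n))" for z
        using that
      proof (induction rule: prods_induct)
        case zero
        then show ?case
          using functional_zero[OF vco_functional[OF j]] alg.subspace_0[OF boundaries_subspace] by simp
      next
        case (generator a x)
        have x: "x \<in> K 0" using generator(2) socle_degree by blast
        have "vco j (lext (mu (u @ i # l # y)) (act a x)) = vco j a * mu (u @ i # l # y) x"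
          if "i < m" "l < m" for i l
        proof -
          have "lin (mu (u @ i # l # y))" using uy that by (intro mu_functional) auto
          then show ?thesis
            by (simp add: lext_generator x functionalD(2)[OF vco_functional[OF j]] mult.commute)
        qed
        then have "(\<Sum>i<m. \<Sum>l<m. scale (vco j (lext (mu (u @ i # l # y)) (act a x))) (v i * v l))
            = scale (vco j a) (\<Sum>i<m. \<Sum>l<m. scale (mu (u @ i # l # y) x) (v i * v l))"
          by (simp add: alg.scale_sum_right)
        then show ?case
          using Suc.IH[OF generator(2)] uy unfolding relational_def by (auto intro: boundary_scale)
      next
        case (add y' z')
        then show ?case
          using boundary_add[OF add]
          by (simp add: lext_add functionalD(1)[OF vco_functional[OF j]] scale_simps sum.distrib)
      qed
      from this[OF differential_socle_step[OF Suc.prems]]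
      show "(\<Sum>i<m. \<Sum>l<m. scale (mu (j # u @ i # l # y) w) (v i * v l)) \<in> range d" by simp
    qed
  next
    fix n' y assume "n = Suc n'" "y \<in> words m n'"
    then show "(\<Sum>i<m. \<Sum>l<m. scale (mu (i # l # y) w) (v i * v l)) \<in> range d"
      using mu_relations[of y n' w] Suc.prems by blast
  qed
qed

text \<open>
  An endomorphism \<open>f\<close> with \<open>e \<circ> f\<close> given on \<open>socle (n + 1)\<close> by a tensor \<open>t\<close> contracts the last \<open>n\<close> letters
  with \<open>t\<close>.
\<close>

lemma mu_chain_endo:
  assumes f: "chain_endo f"
    and t: "\<And>w. w \<in> socle (Suc n) \<Longrightarrow> e (f w) = (\<Sum>y\<in>words m n. t y * mu y w)"
  shows "u \<in> words m p \<Longrightarrow> w \<in> socle (Suc (p + n)) \<Longrightarrow>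
    mu u (f w) = (\<Sum>y\<in>words m n. t y * mu (u @ y) w)"
proof (induction p arbitrary: u w)
  case 0
  then show ?case using t by simp
next
  case (Suc p)
  obtain i u' where u: "u = i # u'" "i < m" "u' \<in> words m p" using words_SucE[OF Suc.prems(1)] .
  have "lext (mu u') (f z) = (\<Sum>y\<in>words m n. scale (t y) (lext (mu (u' @ y)) z))"
    if "z \<in> prods 1 (socle (Suc (p + n)))" for z
    using that
  proof (induction rule: prods_induct)
    case (generator a x)
    have x: "x \<in> K 0" using generator(2) socle_degree by blast
    have "lext (mu u') (f (act a x)) = scale (mu u' (f x)) a"
      using lext_generator[OF mu_lin[OF u(3)] chain_endoD(4)[OF f x]]
      by (simp add: chain_endoD(2)[OF f generator(1)])
    also have "\<dots> = (\<Sum>y\<in>words m n. scale (t y) (scale (mu (u' @ y) x) a))"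
      using Suc.IH[OF u(3) generator(2)] by (simp add: alg.scale_sum_left)
    also have "\<dots> = (\<Sum>y\<in>words m n. scale (t y) (lext (mu (u' @ y)) (act a x)))"
      by (intro sum.cong refl) (simp add: lext_generator[OF mu_lin[OF append_in_words[OF u(3)]] x])
    finally show ?case .
  qed (simp_all add: chain_endoD[OF f] lext_add scale_simps sum.distrib)
  from this[OF differential_socle_step] Suc.prems(2)
  have "lext (mu u') (dK (f w)) = (\<Sum>y\<in>words m n. scale (t y) (lext (mu (u' @ y)) (dK w)))"
    by (simp add: chain_endoD[OF f])
  then show ?case
    using u by (simp add: functional_sum[OF vco_functional] functionalD(2)[OF vco_functional])
qed

end

section \<open>Surjectivity onto the Koszul dual coalgebra\<close>

text \<open>
  The hypothesis is the exactness of the Koszul complex \<open>H \<otimes> C\<close> of \<open>H = H(A)\<close> at \<open>H\<^sup>2 \<otimes> C\<^sub>j\<close>, where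
  \<open>C\<^sub>j\<close> consists of the relational functions on words of length \<open>j\<close>.
\<close>

locale koszul_exactness = koszul_letters scale A d act K dK Bs e m v vco
  for scale :: "'k::field \<Rightarrow> 'a::ring_1 \<Rightarrow> 'a" and A d
    and act :: "'a \<Rightarrow> 'm::ab_group_add \<Rightarrow> 'm" and K dK Bs and e :: "'m \<Rightarrow> 'k"
    and m :: nat and v :: "nat \<Rightarrow> 'a" and vco :: "nat \<Rightarrow> 'a \<Rightarrow> 'k" +
  assumes exact: "finite (S :: 'm set) \<Longrightarrow> (\<And>s. s \<in> S \<Longrightarrow> a s \<in> A 2) \<Longrightarrow>
      (\<And>s. s \<in> S \<Longrightarrow> d (a s) = 0) \<Longrightarrow> (\<And>s. s \<in> S \<Longrightarrow> relational m v j (r s)) \<Longrightarrow>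
      (\<And>n u. j = Suc n \<Longrightarrow> u \<in> words m n \<Longrightarrow>
        (\<Sum>s\<in>S. \<Sum>l<m. scale (r s (l # u)) (a s * v l)) \<in> range d) \<Longrightarrow>
      \<exists>q. (\<forall>i<m. relational m v (Suc j) (q i)) \<and>
        (\<forall>u\<in>words m j. (\<Sum>s\<in>S. scale (r s u) (a s)) -
           (\<Sum>l<m. \<Sum>i<m. scale (q i (l # u)) (v i * v l)) \<in> range d)"
begin

text \<open>
  If the coefficients of \<open>z\<close> on the top step of the filtration are coboundaries \<open>d (b s)\<close>, then the
  differential of the sum of the \<open>(b s) s\<close> agrees with \<open>z\<close> up to the lower step.
\<close>

lemma remove_boundaries:
  assumes z: "z \<in> prods 2 (socle (Suc j))"
    and b: "\<And>u. u \<in> words m j \<Longrightarrow> lext (mu u) z \<in> range d"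
  shows "\<exists>y\<in>prods 1 (socle (Suc j)). z - dK y \<in> prods 2 (socle j)"
proof -
  obtain S lam where S: "finite S" "S \<subseteq> socle (Suc j)" "\<And>s. s \<in> S \<Longrightarrow> lin (lam s)"
    "\<And>s y. s \<in> S \<Longrightarrow> y \<in> socle j \<Longrightarrow> lam s y = 0"
    and rest: "z - (\<Sum>s\<in>S. act (lext (lam s) z) s) \<in> prods 2 (socle j)"
    by (rule prods_expansion[OF socle_subspace socle_subspace socle_Suc socle_degree z]) (rule that)
  have "\<exists>b\<in>A 1. d b = lext (lam s) z" if s: "s \<in> S" for s
  proof -
    have "lext (lam s) z \<in> range d"
      by (rule lext_in_subspace[OF socle_detect S(3)[OF s] S(4)[OF s] z boundaries_subspace b])
    moreover have "lext (lam s) z \<in> A (Suc 1)"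
      using lext_degree[OF z socle_degree S(3)[OF s]] by (simp add: numeral_2_eq_2)
    ultimately show ?thesis using boundary_homogeneous by auto
  qed
  then obtain b where b: "\<And>s. s \<in> S \<Longrightarrow> b s \<in> A 1" "\<And>s. s \<in> S \<Longrightarrow> d (b s) = lext (lam s) z"
    by metis
  let ?y = "\<Sum>s\<in>S. act (b s) s"
  have y: "?y \<in> prods 1 (socle (Suc j))"
    using S b by (intro prods_sum prods_generator) auto
  have "dK ?y = (\<Sum>s\<in>S. act (lext (lam s) z) s) - (\<Sum>s\<in>S. act (b s) (dK s))"
    using b by (simp add: dM_sum dM_leibniz[OF b(1)] ksign_def sum.distrib sum_negf sum_subtractf)
  then have dec: "z - dK ?y = (z - (\<Sum>s\<in>S. act (lext (lam s) z) s)) + (\<Sum>s\<in>S. act (b s) (dK s))"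
    by simp
  have "(\<Sum>s\<in>S. act (b s) (dK s)) \<in> prods 2 (socle j)"
  proof (rule prods_sum)
    show "act (b s) (dK s) \<in> prods 2 (socle j)" if "s \<in> S" for s
      using act_prods[OF differential_socle_step b(1)[OF that], of s j] S(2) that
      by (auto simp: numeral_2_eq_2)
  qed
  then have "z - dK ?y \<in> prods 2 (socle j)" unfolding dec by (rule prods_add[OF rest])
  then show ?thesis using y by blast
qed

lemma lext_mu_letters:
  assumes w: "\<And>i. i < m \<Longrightarrow> w i \<in> socle (Suc n)" "\<And>i u. i < m \<Longrightarrow> u \<in> words m n \<Longrightarrow> mu u (w i) = q i u"
    and u: "u \<in> words m n"
  shows "lext (mu u) (\<Sum>i<m. act (v i) (w i)) = (\<Sum>i<m. scale (q i u) (v i))"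
  unfolding lext_sum
proof (rule sum.cong[OF refl])
  fix i assume "i \<in> {..<m}"
  then have i: "i < m" by simp
  have "w i \<in> K 0" using w(1)[OF i] socle_degree by blast
  then show "lext (mu u) (act (v i) (w i)) = scale (q i u) (v i)"
    by (simp add: lext_generator[OF mu_lin[OF u]] w(2)[OF i u])
qed

lemma letters_prods:
  assumes "\<And>i. i < m \<Longrightarrow> w i \<in> socle (Suc n)"
  shows "(\<Sum>i<m. act (v i) (w i)) \<in> prods 1 (socle (Suc n))"
    and "dK (\<Sum>i<m. act (v i) (w i)) \<in> prods 2 (socle n)"
proof -
  show "(\<Sum>i<m. act (v i) (w i)) \<in> prods 1 (socle (Suc n))"
    using assms v_in by (intro prods_sum prods_generator) auto
  have "dK (act (v i) (w i)) \<in> prods 2 (socle n)" if "i < m" for i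
    using act_prods[OF differential_socle_step[OF assms[OF that]] v_in[OF that]]
      prods_minus by (simp add: dM_leibniz[OF v_in[OF that]] v_cocycle[OF that] ksign_def numeral_2_eq_2)
  then show "dK (\<Sum>i<m. act (v i) (w i)) \<in> prods 2 (socle n)"
    unfolding dM_sum by (intro prods_sum) simp
qed

text \<open>
  The differential of \<open>A \<otimes> K\<^sup>0\<close> maps a combination of letters to the combination of the two-letter
  products, up to coboundaries.
\<close>

lemma lext_mu_letters_differential:
  assumes w: "\<And>i. i < m \<Longrightarrow> w i \<in> socle (Suc (Suc n))"
    "\<And>i u. i < m \<Longrightarrow> u \<in> words m (Suc n) \<Longrightarrow> mu u (w i) = q i u"
    and u: "u \<in> words m n"
  shows "lext (mu u) (dK (\<Sum>i<m. act (v i) (w i))) +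
    (\<Sum>l<m. \<Sum>i<m. scale (q i (l # u)) (v i * v l)) \<in> range d"
proof -
  let ?y = "\<Sum>i<m. act (v i) (w i)"
  have "lext (mu (l # u)) ?y = (\<Sum>i<m. scale (q i (l # u)) (v i))" if "l < m" for l
    by (rule lext_mu_letters[of w, OF w]) (use u that in \<open>simp_all add: Cons_in_words\<close>)
  then have "(\<Sum>l<m. lext (mu (l # u)) ?y * v l) = (\<Sum>l<m. \<Sum>i<m. scale (q i (l # u)) (v i * v l))"
    by (simp add: sum_distrib_right scale_simps del: mu.simps)
  then show ?thesis
    using lext_mu_differential[OF u letters_prods(1)[of w, OF w(1)]] by (simp add: ksign_def del: mu.simps)
qed

definition realizable :: "nat \<Rightarrow> bool" where
  "realizable n \<longleftrightarrow> (\<forall>r. relational m v n r \<longrightarrow> (\<exists>w\<in>socle (Suc n). \<forall>u\<in>words m n. mu u w = r u))"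

lemma realizable_letters:
  assumes "realizable n" "\<And>i. i < m \<Longrightarrow> relational m v n (q i)"
  shows "\<exists>w. \<forall>i<m. w i \<in> socle (Suc n) \<and> (\<forall>u\<in>words m n. mu u (w i) = q i u)"
proof -
  have "\<forall>i. \<exists>x. i < m \<longrightarrow> x \<in> socle (Suc n) \<and> (\<forall>u\<in>words m n. mu u x = q i u)"
    using assms unfolding realizable_def by blast
  then show ?thesis by (rule choice)
qed

text \<open>
  A cocycle in \<open>A\<^sup>2 \<otimes> socle j\<close> has a class in \<open>H\<^sup>2 \<otimes> C\<close>, a cocycle of the Koszul complex. By exactness it can
  be moved to a lower step of the filtration, and this repeats until the filtration ends.
\<close>

lemma cocycle_is_boundary:
  assumes "\<And>i. i \<le> j \<Longrightarrow> realizable i" and "z \<in> prods 2 (socle j)" and "dK z = 0"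
  shows "\<exists>y\<in>prods 1 (socle (Suc j)). dK y = z"
  using assms
proof (induction j arbitrary: z)
  case 0
  then have "z = 0" using prods_zero by simp
  then show ?case by (intro bexI[of _ 0]) (auto intro: prods.zero)
next
  case (Suc j)
  note z = Suc.prems(2)
  obtain S lam where S: "finite S" "S \<subseteq> socle (Suc j)" "\<And>s. s \<in> S \<Longrightarrow> lin (lam s)"
    "\<And>s y. s \<in> S \<Longrightarrow> y \<in> socle j \<Longrightarrow> lam s y = 0"
    and rest: "z - (\<Sum>s\<in>S. act (lext (lam s) z) s) \<in> prods 2 (socle j)"
    by (rule prods_expansion[OF socle_subspace socle_subspace socle_Suc socle_degree z]) (rule that)
  define a where "a s = lext (lam s) z" for s
  have a: "a s \<in> A 2" "d (a s) = 0" if s: "s \<in> S" for s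
    using lext_degree[OF z socle_degree S(3)[OF s]] lext_differential[OF S(3)[OF s] S(4)[OF s] z]
      Suc.prems(3) by (simp_all add: a_def)
  have coeff: "lext (mu u) z = (\<Sum>s\<in>S. scale (mu u s) (a s))" if u: "u \<in> words m j" for u
  proof -
    have "lext (mu u) (z - (\<Sum>s\<in>S. act (a s) s)) = 0"
      using lext_kills[OF rest socle_degree mu_lin[OF u] mu_kills[OF u]] by (simp add: a_def)
    moreover have "lext (mu u) (act (a s) s) = scale (mu u s) (a s)" if "s \<in> S" for s
      using lext_generator[OF mu_lin[OF u]] that S(2) socle_degree by blast
    ultimately show ?thesis by (simp add: lext_diff lext_sum)
  qed
  \<comment> \<open>The coefficients form a cocycle of the Koszul complex, so they come from relational functions \<open>q\<close>.\<close>
  have "\<exists>q. (\<forall>i<m. relational m v (Suc j) (q i)) \<and>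
      (\<forall>u\<in>words m j. (\<Sum>s\<in>S. scale (mu u s) (a s)) -
         (\<Sum>l<m. \<Sum>i<m. scale (q i (l # u)) (v i * v l)) \<in> range d)"
  proof (rule exact[OF S(1) a])
    show "relational m v j (\<lambda>u. mu u s)" if "s \<in> S" for s
      using mu_relational that S(2) by blast
    show "(\<Sum>s\<in>S. \<Sum>l<m. scale (mu (l # u) s) (a s * v l)) \<in> range d"
      if n: "j = Suc n" and u: "u \<in> words m n" for n u
    proof -
      have "(\<Sum>l<m. lext (mu (l # u)) z * v l) \<in> range d"
        using lext_mu_differential[OF u, of z 2] z n Suc.prems(3) boundary_minus[of "d (lext (mu u) z)"]
        by (simp add: ksign_def eq_neg_iff_add_eq_0 add.commute del: mu.simps)
          (metis (no_types, lifting) add.commute eq_neg_iff_add_eq_0 d_minus rangeI)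
      moreover have "lext (mu (l # u)) z * v l = (\<Sum>s\<in>S. scale (mu (l # u) s) (a s * v l))"
        if "l < m" for l
        using coeff[of "l # u"] n u that by (simp add: Cons_in_words sum_distrib_right scale_simps del: mu.simps)
      ultimately show ?thesis by (subst sum.swap) (simp del: mu.simps)
    qed
  qed
  then obtain q where q: "\<And>i. i < m \<Longrightarrow> relational m v (Suc j) (q i)"
    "\<And>u. u \<in> words m j \<Longrightarrow> (\<Sum>s\<in>S. scale (mu u s) (a s)) -
       (\<Sum>l<m. \<Sum>i<m. scale (q i (l # u)) (v i * v l)) \<in> range d" by blast
  have "realizable (Suc j)" using Suc.prems(1) by simp
  from realizable_letters[of "Suc j" q, OF this q(1)]
  obtain w where "\<forall>i<m. w i \<in> socle (Suc (Suc j)) \<and> (\<forall>u\<in>words m (Suc j). mu u (w i) = q i u)"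
    by blast
  then have w: "\<And>i. i < m \<Longrightarrow> w i \<in> socle (Suc (Suc j))"
    "\<And>i u. i < m \<Longrightarrow> u \<in> words m (Suc j) \<Longrightarrow> mu u (w i) = q i u"
    by blast+
  let ?y = "\<Sum>i<m. act (v i) (w i)"
  have dy: "dK ?y \<in> prods 2 (socle (Suc j))" using letters_prods(2)[of w, OF w(1)] .
  \<comment> \<open>By the sign in \<open>lext_mu_letters_differential\<close>, the coefficients of \<open>z + d y\<close>, not those of \<open>z - d y\<close>, are
    coboundaries.\<close>
  have "lext (mu u) (z + dK ?y) \<in> range d" if u: "u \<in> words m j" for u
    using boundary_add[OF q(2)[OF u] lext_mu_letters_differential[of w j q, OF w u]] coeff[OF u]
    by (simp add: lext_add)
  then obtain y1 where y1: "y1 \<in> prods 1 (socle (Suc j))" "z + dK ?y - dK y1 \<in> prods 2 (socle j)"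
    using remove_boundaries[OF prods_add[OF z dy]] by blast
  have "dK (z + dK ?y - dK y1) = 0" using Suc.prems(3) by (simp add: dM_add dM_diff dM_square)
  then obtain y2 where y2: "y2 \<in> prods 1 (socle (Suc j))" "dK y2 = z + dK ?y - dK y1"
    using Suc.IH[OF _ y1(2)] Suc.prems(1) by auto
  have "y1 + y2 - ?y \<in> prods 1 (socle (Suc (Suc j)))"
    using prods_mono[OF _ socle_Suc] y1(1) y2(1) letters_prods(1)[of w, OF w(1)]
    by (blast intro: prods_diff prods_add)
  moreover have "dK (y1 + y2 - ?y) = z" using y2(2) by (simp add: dM_add dM_diff)
  ultimately show ?case by blast
qed

text \<open>
  For a word \<open>i u\<close>, first realize the functions \<open>r (i u)\<close> of \<open>u\<close> by elements \<open>w i\<close>. The combination \<open>z\<close> of the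
  \<open>(v i) (w i)\<close> has the right coefficients, and its differential lies in a lower step of the
  filtration up to coboundaries, since \<open>r\<close> is relational. There it can be corrected by
  \<open>remove_boundaries\<close> and \<open>cocycle_is_boundary\<close>. The resulting cocycle of degree one in \<open>K\<close> is the
  differential of the required element, since \<open>K\<close> has no cohomology in degree one.
\<close>

theorem all_realizable: "realizable n"
proof (induction n rule: less_induct)
  case (less n)
  show ?case unfolding realizable_def
  proof (intro allI impI)
    fix r assume r: "relational m v n r"
    show "\<exists>w\<in>socle (Suc n). \<forall>u\<in>words m n. mu u w = r u"
    proof (cases n)
      case 0
      obtain w where w: "w \<in> socle 1" "e w = 1" using socle_one_unit by blast
      have "act (scale (r []) 1) w \<in> socle 1" using mod.subspace_scale[OF socle_subspace w(1)] .
      then show ?thesis using w(2) 0 by (intro bexI[of _ "act (scale (r []) 1) w"]) (auto simp: e_simps(5))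
    next
      case (Suc l)
      have rel: "relational m v l (\<lambda>u. r (i # u))" if "i < m" for i
        using relational_Cons[OF r[unfolded Suc] that] .
      have "realizable l" using less.IH Suc by simp
      obtain w where "\<forall>i<m. w i \<in> socle (Suc l) \<and> (\<forall>u\<in>words m l. mu u (w i) = r (i # u))"
        using realizable_letters[of l "\<lambda>i u. r (i # u)"] \<open>realizable l\<close> rel by blast
      then have w: "\<And>i. i < m \<Longrightarrow> w i \<in> socle (Suc l)"
        "\<And>i u. i < m \<Longrightarrow> u \<in> words m l \<Longrightarrow> mu u (w i) = r (i # u)"
        by blast+
      \<comment> \<open>The correction \<open>y\<close> lies one step lower than \<open>z\<close>, so it does not change the coefficients \<open>mu\<close>.\<close>
      let ?z = "\<Sum>i<m. act (v i) (w i)"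
      note z = letters_prods[of w, OF w(1)]
      have "\<exists>y\<in>prods 1 (socle l). dK (?z - y) = 0"
      proof (cases l)
        case 0
        then have "dK ?z = 0" using z(2) prods_zero by simp
        then show ?thesis by (intro bexI[of _ 0]) (auto intro: prods.zero)
      next
        case l: (Suc n')
        have "lext (mu u) (dK ?z) \<in> range d" if u: "u \<in> words m n'" for u
        proof -
          have rel': "(\<Sum>l<m. \<Sum>i<m. scale (r (i # l # u)) (v i * v l)) \<in> range d"
            using relationalD[OF r[unfolded Suc l] u] by (subst sum.swap)
          have "lext (mu u) (dK ?z) +
              (\<Sum>l<m. \<Sum>i<m. scale (r (i # l # u)) (v i * v l)) \<in> range d"
            by (rule lext_mu_letters_differential[of w n' "\<lambda>i u. r (i # u)"]) (use w u l in auto)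
          from boundary_diff[OF this rel'] show ?thesis by simp
        qed
        then obtain y1 where y1: "y1 \<in> prods 1 (socle (Suc n'))" "dK ?z - dK y1 \<in> prods 2 (socle n')"
          using remove_boundaries[OF z(2)[unfolded l]] by blast
        have "\<exists>y\<in>prods 1 (socle (Suc n')). dK y = dK ?z - dK y1"
          by (rule cocycle_is_boundary[OF _ y1(2)]) (use less.IH Suc l in \<open>auto simp: dM_diff dM_square\<close>)
        then obtain y2 where "y2 \<in> prods 1 (socle (Suc n'))" "dK y2 = dK ?z - dK y1" by blast
        then show ?thesis using y1(1) l
          by (intro bexI[of _ "y1 + y2"]) (auto simp: dM_diff dM_add intro: prods_add)
      qed
      then obtain y where y: "y \<in> prods 1 (socle l)" "dK (?z - y) = 0" by blast
      have zy: "?z - y \<in> prods 1 (socle (Suc l))"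
        using prods_diff[OF z(1) prods_mono[OF y(1) socle_Suc]] .
      have deg: "?z - y \<in> K 1" using prods_degree[OF zy socle_degree] by simp
      have "e (?z - y) = 0" by (rule e_simps(3)[OF deg]) simp
      from kernel_acyclic[OF deg y(2) this] obtain x where x: "x \<in> K 0" "dK x = ?z - y" by auto
      have "mu u x = r u" if u: "u \<in> words m n" for u
      proof -
        obtain i u' where u': "u = i # u'" "i < m" "u' \<in> words m l"
          using words_SucE[OF u[unfolded Suc]] .
        have "lext (mu u') y = 0"
          using lext_kills[OF y(1) socle_degree mu_lin[OF u'(3)] mu_kills[OF u'(3)]] .
        then have "lext (mu u') (dK x) = (\<Sum>i<m. scale (r (i # u')) (v i))"
          using lext_mu_letters[of w l "\<lambda>i u. r (i # u)", OF w u'(3)] by (simp add: x(2) lext_diff)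
        then show ?thesis using vco_combination[OF u'(2)] u'(1) by simp
      qed
      moreover have "x \<in> socle (Suc n)" using x zy Suc by simp
      ultimately show ?thesis by blast
    qed
  qed
qed

end

section \<open>Quotients of algebras\<close>

lemma ground_cring: "cring (ground :: ('k::field, 'k) module)"
proof -
  have inv: "\<exists>y. y + x = 0" "\<exists>y. x + y = 0" for x :: 'k
    using add.left_inverse[of x] add.right_inverse[of x] by blast+
  show ?thesis unfolding ground_def type_alg_def
    by (intro cringI abelian_groupI comm_monoidI) (simp_all add: inv algebra_simps)
qed

lemma kalgebraI:
  fixes R (structure)
  assumes "ring R" and "\<And>c x. x \<in> carrier R \<Longrightarrow> c \<odot> x \<in> carrier R"
    and "\<And>b c x. x \<in> carrier R \<Longrightarrow> (b + c) \<odot> x = b \<odot> x \<oplus> c \<odot> x"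
    and "\<And>c x y. x \<in> carrier R \<Longrightarrow> y \<in> carrier R \<Longrightarrow> c \<odot> (x \<oplus> y) = c \<odot> x \<oplus> c \<odot> y"
    and "\<And>b c x. x \<in> carrier R \<Longrightarrow> (b * c) \<odot> x = b \<odot> (c \<odot> x)"
    and "\<And>x. x \<in> carrier R \<Longrightarrow> 1 \<odot> x = x"
    and "\<And>c x y. x \<in> carrier R \<Longrightarrow> y \<in> carrier R \<Longrightarrow> c \<odot> (x \<otimes> y) = (c \<odot> x) \<otimes> y"
    and "\<And>c x y. x \<in> carrier R \<Longrightarrow> y \<in> carrier R \<Longrightarrow> c \<odot> (x \<otimes> y) = x \<otimes> (c \<odot> y)"
  shows "kalgebra R"
proof -
  interpret ring R by fact
  have "Module.module ground R"
    by (rule moduleI[OF ground_cring is_abelian_group])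
      (use assms in \<open>simp_all add: ground_def type_alg_def\<close>)
  then show ?thesis using assms by (auto simp: kalgebra_def)
qed

locale k_algebra = ring R for R :: "('k::field, 'a) module" (structure) +
  assumes kalgebra: "kalgebra R"
begin

lemma smult_rules:
  assumes "x \<in> carrier R" "y \<in> carrier R"
  shows "c \<odot> x \<in> carrier R" "(b + c) \<odot> x = b \<odot> x \<oplus> c \<odot> x" "c \<odot> (x \<oplus> y) = c \<odot> x \<oplus> c \<odot> y"
    "(b * c) \<odot> x = b \<odot> (c \<odot> x)" "1 \<odot> x = x" "c \<odot> (x \<otimes> y) = (c \<odot> x) \<otimes> y"
    "c \<odot> (x \<otimes> y) = x \<otimes> (c \<odot> y)"
proof -
  have m: "Module.module ground R" using kalgebra by (simp add: kalgebra_def)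
  show "c \<odot> x \<in> carrier R" "(b + c) \<odot> x = b \<odot> x \<oplus> c \<odot> x" "c \<odot> (x \<oplus> y) = c \<odot> x \<oplus> c \<odot> y"
    "(b * c) \<odot> x = b \<odot> (c \<odot> x)" "1 \<odot> x = x"
    using Module.module.smult_closed[OF m, of c x] Module.module.smult_r_distr[OF m, of c x y]
      Module.module.smult_l_distr[OF m, of b c x] Module.module.smult_assoc1[OF m, of b c x]
      Module.module.smult_one[OF m, of x] assms
    by (simp_all add: ground_def type_alg_def)
  show "c \<odot> (x \<otimes> y) = (c \<odot> x) \<otimes> y" "c \<odot> (x \<otimes> y) = x \<otimes> (c \<odot> y)"
    using kalgebra assms unfolding kalgebra_def by metis+
qed

end

lemma k_algebraI: "kalgebra R \<Longrightarrow> k_algebra R"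
proof -
  assume R: "kalgebra R"
  then have "ring R" unfolding kalgebra_def by (rule conjunct1)
  then show ?thesis using R by (intro k_algebra.intro k_algebra_axioms.intro)
qed

locale algebra_ideal = k_algebra R + ideal I R for R :: "('k::field, 'a) module" (structure) and I
begin

abbreviation Q where "Q \<equiv> alg_quot R I"

lemma quot_simps:
  "carrier Q = a_rcosets I" "mult Q = rcoset_mult R I" "one Q = I +> \<one>" "zero Q = I"
  "add Q = set_add R" "smult Q = (\<lambda>c X. \<Union>x\<in>X. I +> (c \<odot> x))"
  by (simp_all add: alg_quot_def FactRing_def ring.defs module.defs)

lemma quot_carrier: "X \<in> carrier Q \<longleftrightarrow> (\<exists>x\<in>carrier R. X = I +> x)"
  by (auto simp: quot_simps A_RCOSETS_def')

lemma coset_in_quot: "x \<in> carrier R \<Longrightarrow> I +> x \<in> carrier Q"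
  by (auto simp: quot_carrier)

lemma coset_eq_iff:
  assumes "x \<in> carrier R" "y \<in> carrier R"
  shows "I +> x = I +> y \<longleftrightarrow> x \<ominus> y \<in> I"
  using assms quotient_eq_iff_same_a_r_cos[OF ideal_axioms] by blast

lemma mem_coset_iff:
  assumes "x \<in> carrier R" "y \<in> carrier R"
  shows "x \<in> I +> y \<longleftrightarrow> I +> x = I +> y"
proof
  assume "x \<in> I +> y"
  then show "I +> x = I +> y" using a_repr_independence[OF _ assms(2) a_subgroup] by simp
next
  assume "I +> x = I +> y"
  then show "x \<in> I +> y" using a_rcos_self[OF assms(1)] by simp
qed

lemma coset_subset: "x \<in> carrier R \<Longrightarrow> I +> x \<subseteq> carrier R"
  by (rule a_r_coset_subset_G[OF a_subset])

lemma smult_ideal: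
  assumes "x \<in> I" shows "c \<odot> x \<in> I"
proof -
  have x: "x \<in> carrier R" using assms a_subset by blast
  have "c \<odot> x = (c \<odot> \<one>) \<otimes> x" using smult_rules(6)[OF one_closed x, of c] x by simp
  then show ?thesis using assms smult_rules(1)[OF one_closed one_closed] by (simp add: I_l_closed)
qed

lemma quot_one: "\<one>\<^bsub>Q\<^esub> = I +> \<one>"
  and quot_zero: "\<zero>\<^bsub>Q\<^esub> = I +> \<zero>"
  by (simp_all add: quot_simps a_coset_add_zero[OF a_subset])

lemma quot_operations:
  assumes x: "x \<in> carrier R" and y: "y \<in> carrier R"
  shows "(I +> x) \<otimes>\<^bsub>Q\<^esub> (I +> y) = I +> (x \<otimes> y)" "(I +> x) \<oplus>\<^bsub>Q\<^esub> (I +> y) = I +> (x \<oplus> y)"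
    "c \<odot>\<^bsub>Q\<^esub> (I +> x) = I +> (c \<odot> x)"
proof -
  show "(I +> x) \<otimes>\<^bsub>Q\<^esub> (I +> y) = I +> (x \<otimes> y)" "(I +> x) \<oplus>\<^bsub>Q\<^esub> (I +> y) = I +> (x \<oplus> y)"
    using x y by (simp_all add: quot_simps rcoset_mult_add a_rcos_sum)
  have "I +> (c \<odot> z) = I +> (c \<odot> x)" if "z \<in> I +> x" for z
  proof -
    have z: "z \<in> carrier R" using that coset_subset[OF x] by blast
    have "z \<ominus> x \<in> I" using that mem_coset_iff[OF z x] coset_eq_iff[OF z x] by simp
    then have "c \<odot> (z \<ominus> x) \<in> I" by (rule smult_ideal)
    moreover have "c \<odot> z = c \<odot> (z \<ominus> x) \<oplus> c \<odot> x"
      using smult_rules(3)[of "z \<ominus> x" x c] z x by (simp add: a_minus_def a_assoc l_neg)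
    then have "c \<odot> z \<ominus> c \<odot> x = c \<odot> (z \<ominus> x)"
      using smult_rules(1)[of _ x] z x by (simp add: a_minus_def a_assoc r_neg)
    ultimately show ?thesis using coset_eq_iff smult_rules(1)[of _ x] z x by simp
  qed
  moreover have "x \<in> I +> x" using a_rcos_self[OF x] .
  ultimately show "c \<odot>\<^bsub>Q\<^esub> (I +> x) = I +> (c \<odot> x)" unfolding quot_simps by blast
qed

lemma quotE:
  assumes "X \<in> carrier Q" obtains x where "x \<in> carrier R" "X = I +> x"
  using assms by (auto simp: quot_carrier)

lemma quot_kalgebra: "kalgebra Q"
proof (rule kalgebraI)
  show "ring Q"
  proof (rule ringI)
    show "abelian_group Q"
    proof (rule abelian_groupI)
      fix X assume "X \<in> carrier Q"
      then obtain x where "x \<in> carrier R" "X = I +> x" by (rule quotE)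
      then show "\<exists>Y\<in>carrier Q. Y \<oplus>\<^bsub>Q\<^esub> X = \<zero>\<^bsub>Q\<^esub>"
        by (intro bexI[of _ "I +> (\<ominus> x)"]) (simp_all add: quot_operations quot_zero coset_in_quot l_neg)
    qed (auto elim!: quotE simp: quot_operations(2) quot_zero coset_in_quot a_assoc a_comm a_lcomm)
    show "Group.monoid Q"
      by (rule monoidI) (auto elim!: quotE simp: quot_operations(1) quot_one coset_in_quot m_assoc)
  qed (auto elim!: quotE simp: quot_operations coset_in_quot l_distr r_distr)
  show "c \<odot>\<^bsub>Q\<^esub> (X \<otimes>\<^bsub>Q\<^esub> Y) = (c \<odot>\<^bsub>Q\<^esub> X) \<otimes>\<^bsub>Q\<^esub> Y" if "X \<in> carrier Q" "Y \<in> carrier Q" for c X Y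
    using that by (auto elim!: quotE simp: quot_operations smult_rules(1) simp flip: smult_rules(6))
  show "c \<odot>\<^bsub>Q\<^esub> (X \<otimes>\<^bsub>Q\<^esub> Y) = X \<otimes>\<^bsub>Q\<^esub> (c \<odot>\<^bsub>Q\<^esub> Y)" if "X \<in> carrier Q" "Y \<in> carrier Q" for c X Y
    using that by (auto elim!: quotE simp: quot_operations smult_rules(1) simp flip: smult_rules(7))
qed (auto elim!: quotE simp: quot_operations coset_in_quot smult_rules(1-5))

end

section \<open>The Ext-algebra as an algebra of endomorphisms\<close>

context dg_module
begin

interpretation self: dg_module_pair scale A d act M dM act M dM ..

lemma end_part_dg_hom: "end_part n = dg_hom act M act M n"
  by (simp add: end_part_def dg_hom_def)

lemma end_cocycles_iff:
  "f \<in> end_cocycles n \<longleftrightarrow> f \<in> dg_hom act M act M n \<and> (\<forall>x. dM (f x) = ksign n (f (dM x)))"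
  by (auto simp: end_cocycles_def end_part_dg_hom end_diff_def fun_eq_iff)

lemma end_coboundaries_iff:
  "f \<in> end_coboundaries n \<longleftrightarrow>
    (\<exists>h\<in>dg_hom act M act M (n - 1). f = (\<lambda>x. dM (h x) - ksign (n - 1) (h (dM x))))"
  by (auto simp: end_coboundaries_def end_part_dg_hom end_diff_def)

lemma sum_parts_base: "f \<in> Z n \<Longrightarrow> f \<in> sum_parts Z"
  unfolding sum_parts_def by (auto intro!: exI[of _ "{n}"] exI[of _ "\<lambda>_. f"])

lemma sum_parts_add:
  assumes Z: "\<And>n. (\<lambda>_. 0) \<in> Z n" "\<And>n f g. f \<in> Z n \<Longrightarrow> g \<in> Z n \<Longrightarrow> (\<lambda>x. f x + g x) \<in> Z n"
    and f: "f \<in> sum_parts Z" and g: "g \<in> sum_parts Z"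
  shows "(\<lambda>x. f x + g x) \<in> sum_parts Z"
proof -
  obtain N F where F: "f = (\<lambda>x. \<Sum>n\<in>N. F n x)" "finite N" "\<forall>n\<in>N. F n \<in> Z n"
    using f unfolding sum_parts_def by auto
  obtain N' G where G: "g = (\<lambda>x. \<Sum>n\<in>N'. G n x)" "finite N'" "\<forall>n\<in>N'. G n \<in> Z n"
    using g unfolding sum_parts_def by auto
  define F' where "F' n = (if n \<in> N then F n else (\<lambda>_. 0))" for n
  define G' where "G' n = (if n \<in> N' then G n else (\<lambda>_. 0))" for n
  have "f x = (\<Sum>n\<in>N \<union> N'. F' n x)" "g x = (\<Sum>n\<in>N \<union> N'. G' n x)" for x
    unfolding F G using F(2) G(2) by (auto simp: F'_def G'_def intro!: sum.mono_neutral_cong_left)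
  then have "(\<lambda>x. f x + g x) = (\<lambda>x. \<Sum>n\<in>N \<union> N'. F' n x + G' n x)" by (simp add: sum.distrib)
  moreover have "F' n \<in> Z n" "G' n \<in> Z n" for n using F G Z(1) by (auto simp: F'_def G'_def)
  ultimately show ?thesis using F(2) G(2) Z(2) unfolding sum_parts_def
    by (intro CollectI exI[of _ "N \<union> N'"] exI[of _ "\<lambda>n x. F' n x + G' n x"]) auto
qed

lemma sum_parts_induct [consumes 1, case_names zero part add]:
  assumes f: "f \<in> sum_parts Z" and "P (\<lambda>_. 0)" "\<And>n f. f \<in> Z n \<Longrightarrow> P f"
    "\<And>f g. P f \<Longrightarrow> P g \<Longrightarrow> P (\<lambda>x. f x + g x)"
  shows "P f"
proof -
  obtain N F where F: "f = (\<lambda>x. \<Sum>n\<in>N. F n x)" "finite N" "\<forall>n\<in>N. F n \<in> Z n"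
    using f unfolding sum_parts_def by auto
  have "P (\<lambda>x. \<Sum>n\<in>N. F n x)" using F(2,3)
    by (induction N rule: finite_induct) (auto intro: assms)
  then show ?thesis using F by simp
qed

lemma cocycles_zero: "(\<lambda>_. 0) \<in> end_cocycles n"
  and cocycles_add: "f \<in> end_cocycles n \<Longrightarrow> g \<in> end_cocycles n \<Longrightarrow> (\<lambda>x. f x + g x) \<in> end_cocycles n"
  and cocycles_minus: "f \<in> end_cocycles n \<Longrightarrow> (\<lambda>x. - f x) \<in> end_cocycles n"
  and cocycles_smult: "f \<in> end_cocycles n \<Longrightarrow> (\<lambda>x. act (scale c 1) (f x)) \<in> end_cocycles n"
  by (simp_all add: end_cocycles_iff self.hom_zero self.hom_add self.hom_minus self.hom_smult
      dM_add dM_minus dM_scale act_ksign)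

lemma id_cocycle: "id \<in> end_cocycles 0"
  by (auto simp: end_cocycles_iff dg_hom_def)

lemma cocycles_compose:
  assumes f: "f \<in> end_cocycles m" and g: "g \<in> end_cocycles n"
  shows "f \<circ> g \<in> end_cocycles (m + n)"
proof -
  have "f (ksign n x) = ksign n (f x)" for x
    using f additive_ksign[of f] by (metis end_cocycles_iff dg_homD(1))
  then show ?thesis
    using assms dg_hom_compose[of g act M act M n f act M m] by (simp add: end_cocycles_iff)
qed

lemma cocycle_additive: "f \<in> end_cocycles n \<Longrightarrow> f (x + y) = f x + f y"
  by (metis end_cocycles_iff dg_homD(1))

lemma cocycle_at_zero: "f \<in> end_cocycles n \<Longrightarrow> f 0 = 0"
  by (rule additive_zero) (rule cocycle_additive)

lemma coboundaries_zero: "(\<lambda>_. 0) \<in> end_coboundaries n"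
  unfolding end_coboundaries_iff by (rule bexI[OF _ self.hom_zero]) simp

lemma coboundaries_add:
  assumes "f \<in> end_coboundaries n" "g \<in> end_coboundaries n"
  shows "(\<lambda>x. f x + g x) \<in> end_coboundaries n"
proof -
  obtain h h' where "h \<in> dg_hom act M act M (n - 1)" "f = (\<lambda>x. dM (h x) - ksign (n - 1) (h (dM x)))"
    "h' \<in> dg_hom act M act M (n - 1)" "g = (\<lambda>x. dM (h' x) - ksign (n - 1) (h' (dM x)))"
    using assms unfolding end_coboundaries_iff by blast
  then show ?thesis unfolding end_coboundaries_iff
    by (intro bexI[OF _ self.hom_add[of h _ h']]) (auto simp: dM_add)
qed

lemma coboundaries_cocycles: "f \<in> end_coboundaries n \<Longrightarrow> f \<in> end_cocycles n"
proof -
  assume "f \<in> end_coboundaries n"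
  then obtain h where h: "h \<in> dg_hom act M act M (n - 1)" "f = self.hom_diff (n - 1) h"
    unfolding end_coboundaries_iff self.hom_diff_def by blast
  have f: "f \<in> dg_hom act M act M n" using self.hom_diff_in[OF h(1)] h(2) by simp
  have "self.hom_diff n f = (\<lambda>_. 0)" using self.hom_diff_square[OF h(1)] h(2) by simp
  then have "dM (f x) - ksign n (f (dM x)) = 0" for x
    unfolding self.hom_diff_def by (rule fun_cong)
  then show ?thesis using f by (simp add: end_cocycles_iff)
qed

lemma coboundaries_compose:
  assumes f: "f \<in> end_coboundaries m" and g: "g \<in> end_cocycles n"
  shows "f \<circ> g \<in> end_coboundaries (m + n)" "g \<circ> f \<in> end_coboundaries (n + m)"
proof -
  obtain h where h: "h \<in> dg_hom act M act M (m - 1)" "f = (\<lambda>x. dM (h x) - ksign (m - 1) (h (dM x)))"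
    using f unfolding end_coboundaries_iff by blast
  have g': "g \<in> dg_hom act M act M n" "dM (g x) = ksign n (g (dM x))" for x
    using g by (simp_all add: end_cocycles_iff)
  have "h \<circ> g \<in> dg_hom act M act M (m + n - 1)"
    using dg_hom_compose[OF g'(1) h(1)] by (simp add: algebra_simps)
  moreover have "f \<circ> g = (\<lambda>x. dM ((h \<circ> g) x) - ksign (m + n - 1) ((h \<circ> g) (dM x)))"
    by (rule ext) (simp add: h(2) g'(2) additive_ksign[of h, OF dg_homD(1)[OF h(1)]] algebra_simps)
  ultimately show "f \<circ> g \<in> end_coboundaries (m + n)" unfolding end_coboundaries_iff by blast
  have mem: "(\<lambda>x. ksign n ((g \<circ> h) x)) \<in> dg_hom act M act M (n + m - 1)"
    using self.hom_ksign[OF dg_hom_compose[OF h(1) g'(1)], of n] by (simp add: algebra_simps)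
  have "g \<circ> f = (\<lambda>x. dM (ksign n ((g \<circ> h) x))
      - ksign (n + m - 1) (ksign n ((g \<circ> h) (dM x))))"
    by (rule ext) (auto simp: h(2) g'(2) additive_diff[of g, OF dg_homD(1)[OF g'(1)]] dM_minus
        additive_minus[of g, OF dg_homD(1)[OF g'(1)]] ksign_def)
  then show "g \<circ> f \<in> end_coboundaries (n + m)" unfolding end_coboundaries_iff
    by (rule bexI[where x="\<lambda>x. ksign n ((g \<circ> h) x)", OF _ mem])
qed

lemma end_cocycle_alg_simps:
  "carrier end_cocycle_alg = sum_parts end_cocycles" "f \<otimes>\<^bsub>end_cocycle_alg\<^esub> g = f \<circ> g"
  "\<one>\<^bsub>end_cocycle_alg\<^esub> = id" "\<zero>\<^bsub>end_cocycle_alg\<^esub> = (\<lambda>_. 0)"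
  "f \<oplus>\<^bsub>end_cocycle_alg\<^esub> g = (\<lambda>x. f x + g x)"
  "c \<odot>\<^bsub>end_cocycle_alg\<^esub> f = (\<lambda>x. act (scale c 1) (f x))"
  by (simp_all add: end_cocycle_alg_def)

lemma end_sum_add: "f \<in> sum_parts end_cocycles \<Longrightarrow> f (x + y) = f x + f y"
  by (induction rule: sum_parts_induct) (auto simp: end_cocycles_iff dg_homD(1))

lemma end_sum_scale:
  "f \<in> sum_parts end_cocycles \<Longrightarrow> f (act (scale c 1) x) = act (scale c 1) (f x)"
  by (induction rule: sum_parts_induct) (auto simp: end_cocycles_iff self.hom_scale act_simps)

lemma cocycle_in_sum: "f \<in> end_cocycles n \<Longrightarrow> f \<in> sum_parts end_cocycles"
  by (rule sum_parts_base)

lemma coboundary_in_sum: "f \<in> end_coboundaries n \<Longrightarrow> f \<in> sum_parts end_coboundaries"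
  by (rule sum_parts_base)

lemma end_sum_closed:
  assumes "f \<in> sum_parts end_cocycles"
  shows "g \<in> sum_parts end_cocycles \<Longrightarrow> (\<lambda>x. f x + g x) \<in> sum_parts end_cocycles"
    and "(\<lambda>x. - f x) \<in> sum_parts end_cocycles"
    and "(\<lambda>x. act (scale c 1) (f x)) \<in> sum_parts end_cocycles"
proof -
  have *: "(\<lambda>x. f x + g x) \<in> sum_parts end_cocycles"
    if "f \<in> sum_parts end_cocycles" "g \<in> sum_parts end_cocycles" for f g
    using that by (intro sum_parts_add cocycles_zero cocycles_add)
  show "g \<in> sum_parts end_cocycles \<Longrightarrow> (\<lambda>x. f x + g x) \<in> sum_parts end_cocycles"
    using * assms by blast
  show "(\<lambda>x. - f x) \<in> sum_parts end_cocycles" using assms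
  proof (induction rule: sum_parts_induct)
    case (add f g)
    then show ?case using *[of "\<lambda>x. - f x" "\<lambda>x. - g x"] by simp
  qed (auto intro: cocycle_in_sum[OF cocycles_zero] cocycle_in_sum[OF cocycles_minus])
  show "(\<lambda>x. act (scale c 1) (f x)) \<in> sum_parts end_cocycles" using assms
  proof (induction rule: sum_parts_induct)
    case (add f g)
    then show ?case
      using *[of "\<lambda>x. act (scale c 1) (f x)" "\<lambda>x. act (scale c 1) (g x)"] by (simp add: act_simps)
  qed (auto intro: cocycle_in_sum[OF cocycles_zero] cocycle_in_sum[OF cocycles_smult])
qed

lemma end_sum_compose:
  assumes "f \<in> sum_parts end_cocycles" and g: "g \<in> sum_parts end_cocycles"
  shows "f \<circ> g \<in> sum_parts end_cocycles"
  using assms(1)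
proof (induction rule: sum_parts_induct)
  case (part n f)
  show ?case using g
  proof (induction rule: sum_parts_induct)
    case zero
    then show ?case using cocycle_at_zero[OF part] cocycle_in_sum[OF cocycles_zero]
      by (simp add: comp_def)
  next
    case (part m g)
    then show ?case using \<open>f \<in> end_cocycles n\<close> by (intro cocycle_in_sum[OF cocycles_compose])
  next
    case (add g h)
    then show ?case using end_sum_closed(1)[of "f \<circ> g" "f \<circ> h"]
      by (simp add: comp_def cocycle_additive[OF part])
  qed
next
  case (add f h)
  then show ?case using end_sum_closed(1)[of "f \<circ> g" "h \<circ> g"] by (simp add: comp_def)
qed (use cocycle_in_sum[OF cocycles_zero] in \<open>simp add: comp_def\<close>)

lemma end_cocycle_kalgebra: "kalgebra end_cocycle_alg"
proof (rule kalgebraI)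
  show "ring end_cocycle_alg"
  proof (rule ringI)
    show "abelian_group end_cocycle_alg"
    proof (rule abelian_groupI)
      show "\<exists>y\<in>carrier end_cocycle_alg. y \<oplus>\<^bsub>end_cocycle_alg\<^esub> f = \<zero>\<^bsub>end_cocycle_alg\<^esub>"
        if "f \<in> carrier end_cocycle_alg" for f
        using that end_sum_closed(2)[of f]
        by (intro bexI[of _ "\<lambda>x. - f x"]) (auto simp: end_cocycle_alg_simps)
    qed (auto simp: end_cocycle_alg_simps end_sum_closed cocycle_in_sum[OF cocycles_zero] algebra_simps)
    show "Group.monoid end_cocycle_alg"
      by (rule monoidI)
        (auto simp: end_cocycle_alg_simps end_sum_compose cocycle_in_sum[OF id_cocycle] comp_assoc)
  qed (auto simp: end_cocycle_alg_simps fun_eq_iff end_sum_add)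
qed (auto simp: end_cocycle_alg_simps end_sum_closed fun_eq_iff end_sum_scale
    mod.scale_left_distrib mod.scale_right_distrib act_simps(4))

lemma boundary_sums_cocycles: "f \<in> sum_parts end_coboundaries \<Longrightarrow> f \<in> sum_parts end_cocycles"
  by (induction rule: sum_parts_induct)
    (auto intro: cocycle_in_sum[OF cocycles_zero] cocycle_in_sum[OF coboundaries_cocycles] end_sum_closed)

lemma boundary_sums_add:
  "f \<in> sum_parts end_coboundaries \<Longrightarrow> g \<in> sum_parts end_coboundaries \<Longrightarrow>
    (\<lambda>x. f x + g x) \<in> sum_parts end_coboundaries"
  by (intro sum_parts_add coboundaries_zero coboundaries_add)

text \<open>Composition with a cocycle preserves coboundaries; both arguments are sums of homogeneous maps.\<close>

lemma boundary_sums_compose: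
  assumes "f \<in> sum_parts end_coboundaries" "g \<in> sum_parts end_cocycles"
  shows "f \<circ> g \<in> sum_parts end_coboundaries" "g \<circ> f \<in> sum_parts end_coboundaries"
proof -
  have z0: "(\<lambda>_. 0) \<in> sum_parts end_coboundaries" by (rule coboundary_in_sum[OF coboundaries_zero])
  have 1: "f \<circ> g \<in> sum_parts end_coboundaries \<and> g \<circ> f \<in> sum_parts end_coboundaries"
    if f: "f \<in> end_coboundaries n" for f n
    using assms(2)
  proof (induction rule: sum_parts_induct)
    case zero
    have "f 0 = 0" using cocycle_at_zero[OF coboundaries_cocycles[OF f]] .
    then show ?case using z0 by (simp add: comp_def)
  next
    case (part m g)
    then show ?case using coboundaries_compose[OF f part] coboundary_in_sum by blast
  next
    case (add g h)
    then show ?case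
      using boundary_sums_add[of "f \<circ> g" "f \<circ> h"] boundary_sums_add[of "g \<circ> f" "h \<circ> f"]
      by (simp add: comp_def cocycle_additive[OF coboundaries_cocycles[OF f]])
  qed
  have "f \<circ> g \<in> sum_parts end_coboundaries \<and> g \<circ> f \<in> sum_parts end_coboundaries"
    using assms(1)
  proof (induction rule: sum_parts_induct)
    case zero
    then show ?case using z0 additive_zero[of g, OF end_sum_add[OF assms(2)]]
      by (simp add: comp_def)
  next
    case (add f h)
    then show ?case
      using boundary_sums_add[of "f \<circ> g" "h \<circ> g"] boundary_sums_add[of "g \<circ> f" "g \<circ> h"]
      by (simp add: comp_def end_sum_add[OF assms(2)])
  qed (rule 1)
  then show "f \<circ> g \<in> sum_parts end_coboundaries" "g \<circ> f \<in> sum_parts end_coboundaries" by auto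
qed

lemma ext_algebra_ideal: "algebra_ideal end_cocycle_alg (sum_parts end_coboundaries)"
proof -
  interpret E: k_algebra end_cocycle_alg by (rule k_algebraI[OF end_cocycle_kalgebra])
  have "ideal (sum_parts end_coboundaries) end_cocycle_alg"
  proof (rule idealI[OF E.ring_axioms])
    show "subgroup (sum_parts end_coboundaries) (add_monoid end_cocycle_alg)"
    proof (rule E.add.subgroupI)
      fix f assume f: "f \<in> sum_parts end_coboundaries"
      have "(\<lambda>x. - id x) \<in> sum_parts end_cocycles"
        using end_sum_closed(2)[OF cocycle_in_sum[OF id_cocycle]] .
      then have "(\<lambda>x. - id x) \<circ> f \<in> sum_parts end_coboundaries" using boundary_sums_compose(2)[OF f] by blast
      moreover have "\<ominus>\<^bsub>end_cocycle_alg\<^esub> f = (\<lambda>x. - id x) \<circ> f"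
        using boundary_sums_cocycles[OF f] end_sum_closed(2)[OF boundary_sums_cocycles[OF f]]
        by (intro E.minus_equality) (auto simp: end_cocycle_alg_simps comp_def)
      ultimately show "\<ominus>\<^bsub>end_cocycle_alg\<^esub> f \<in> sum_parts end_coboundaries" by simp
    qed (auto simp: end_cocycle_alg_simps boundary_sums_cocycles boundary_sums_add
        intro: coboundary_in_sum[OF coboundaries_zero])
  qed (auto simp: end_cocycle_alg_simps boundary_sums_compose)
  then show ?thesis by (simp add: algebra_ideal_def E.k_algebra_axioms)
qed

lemma ext_kalgebra: "kalgebra ext_alg"
  unfolding ext_alg_def by (rule algebra_ideal.quot_kalgebra[OF ext_algebra_ideal])

end

section \<open>Comparison of two resolutions\<close>

text \<open>
  \<open>M\<close> is any semifree resolution of the trivial module and \<open>K\<close> one with semibasis in degree zero;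
  \<open>phi\<close> and \<open>psi\<close> are the comparison maps, and \<open>hom\<close> is a homotopy from \<open>phi \<circ> psi\<close> to the identity.
\<close>

locale comparison = koszul_resolution scale A d actK K dK BsK eK
    + M: semifree_dg_module scale A d act M dM Bs + M: resolution scale A d act M dM e
  for scale :: "'k::field \<Rightarrow> 'a::ring_1 \<Rightarrow> 'a" and A d
    and actK :: "'a \<Rightarrow> 'p::ab_group_add \<Rightarrow> 'p" and K dK BsK and eK :: "'p \<Rightarrow> 'k"
    and act :: "'a \<Rightarrow> 'm::ab_group_add \<Rightarrow> 'm" and M dM Bs and e :: "'m \<Rightarrow> 'k" +
  fixes phi :: "'p \<Rightarrow> 'm" and psi :: "'m \<Rightarrow> 'p" and hom :: "'m \<Rightarrow> 'm"
  assumes phi: "phi \<in> dg_hom actK K act M 0" "\<And>x. dM (phi x) = phi (dK x)" "\<And>x. e (phi x) = eK x"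
    and psi: "psi \<in> dg_hom act M actK K 0" "\<And>x. dK (psi x) = psi (dM x)" "\<And>x. eK (psi x) = e x"
    and hom: "hom \<in> dg_hom act M act M (- 1)"
      "\<And>x. x - phi (psi x) = dM (hom x) + hom (dM x)"

text \<open>The map \<open>id - phi \<circ> psi\<close> is a cocycle with values in the kernel of the augmentation, so it is null-homotopic.\<close>

lemma comparison_exists:
  assumes K: "koszul_resolution scale A d actK K dK BsK eK"
    and M: "semifree_dg_module scale A d act M dM Bs" "resolution scale A d act M dM e"
  shows "\<exists>phi psi hom. comparison scale A d actK K dK BsK eK act M dM Bs e phi psi hom"
proof -
  interpret koszul_resolution scale A d actK K dK BsK eK by fact
  interpret M: semifree_dg_module scale A d act M dM Bs by fact
  interpret M: resolution scale A d act M dM e by fact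
  interpret KM: lifting_pair scale A d actK K dK BsK act M dM e ..
  interpret MK: lifting_pair scale A d act M dM Bs actK K dK eK ..
  interpret MM: lifting_pair scale A d act M dM Bs act M dM e ..
  obtain phi where phi: "phi \<in> dg_hom actK K act M 0" "\<And>x. dM (phi x) = phi (dK x)"
    "\<And>x. e (phi x) = eK x"
    using KM.lift_trivial_cocycle[OF e_cocycle] by blast
  obtain psi where psi: "psi \<in> dg_hom act M actK K 0" "\<And>x. dK (psi x) = psi (dM x)"
    "\<And>x. eK (psi x) = e x"
    using MK.lift_trivial_cocycle[OF M.e_cocycle] by blast
  have "(\<lambda>x. x) \<in> dg_hom act M act M 0" by (auto simp: dg_hom_def)
  then have g: "(\<lambda>x. x - phi (psi x)) \<in> dg_hom act M act M 0"
    using MM.hom_subtract dg_hom_compose[OF psi(1) phi(1)] by (simp add: comp_def)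
  have "\<exists>h\<in>dg_hom act M act M (0 - 1). MM.hom_diff (0 - 1) h = (\<lambda>x. x - phi (psi x)) \<and>
      (\<forall>x. e (h x) = 0)"
    by (rule MM.null_homotopic[OF g])
      (auto simp: MM.hom_diff_def M.dM_diff phi psi additive_diff[of e, OF M.e_simps(1)])
  then obtain h where h: "h \<in> dg_hom act M act M (0 - 1)" "MM.hom_diff (0 - 1) h = (\<lambda>x. x - phi (psi x))"
    by blast
  have "x - phi (psi x) = dM (h x) + h (dM x)" for x
    using fun_cong[OF h(2), of x] by (simp add: MM.hom_diff_def ksign_def)
  then have "comparison scale A d actK K dK BsK eK act M dM Bs e phi psi h"
    using phi psi h(1) by unfold_locales auto
  then show ?thesis by blast
qed

context comparison
begin

interpretation KM: lifting_pair scale A d actK K dK BsK act M dM e ..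
interpretation MK: lifting_pair scale A d act M dM Bs actK K dK eK ..
interpretation MM: lifting_pair scale A d act M dM Bs act M dM e ..
interpretation KK: lifting_pair scale A d actK K dK BsK actK K dK eK ..

lemma hom_kills_prods:
  assumes g: "g \<in> dg_hom actK K act M n" and z: "z \<in> prods 1 X"
  shows "e (g z) = 0"
  using z
proof (induction rule: prods_induct)
  case (generator a x)
  have "e (act a (g x)) = 0" using M.e_simps(6)[OF generator(1)] by simp
  then show ?case
    by (simp add: dg_homD(3)[OF g generator(1)] additive_ksign[of e, OF M.e_simps(1)])
qed (simp_all add: additive_zero[of g, OF dg_homD(1)[OF g]] additive_zero[of e, OF M.e_simps(1)]
    dg_homD(1)[OF g] M.e_simps(1))

lemma hom_kills_differential:
  "g \<in> dg_hom actK K act M n \<Longrightarrow> w \<in> K 0 \<Longrightarrow> e (g (dK w)) = 0"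
  using hom_kills_prods differential_socle by blast

text \<open>The functional on \<open>K\<^sup>0\<close> that represents an endomorphism of \<open>M\<close>.\<close>

definition Lam :: "('m \<Rightarrow> 'm) \<Rightarrow> 'p \<Rightarrow> 'k" where
  "Lam f w = e (f (phi w))"

lemma compose_phi: "f \<in> M.end_cocycles n \<Longrightarrow> f \<circ> phi \<in> dg_hom actK K act M n"
  using dg_hom_compose[OF phi(1), of f act M n] by (simp add: M.end_cocycles_iff)

lemma Lam_lin: "f \<in> M.end_cocycles n \<Longrightarrow> lin (Lam f)"
proof -
  assume "f \<in> M.end_cocycles n"
  note f = compose_phi[OF this]
  show ?thesis
    using dg_homD(1)[OF f] KM.hom_scale[OF f] by (auto simp: functional_def Lam_def M.e_simps(1,5))
qed

text \<open>On \<open>K\<^sup>0\<close>, a homotopy contributes only terms in the image of the differential or in \<open>A\<^sup>1 K\<^sup>0\<close>, and the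
  augmentation vanishes on both.\<close>

lemma Lam_coboundary:
  assumes f: "f \<in> M.end_coboundaries n" and w: "w \<in> K 0"
  shows "Lam f w = 0"
proof -
  obtain h where h: "h \<in> dg_hom act M act M (n - 1)" "f = (\<lambda>x. dM (h x) - ksign (n - 1) (h (dM x)))"
    using f unfolding M.end_coboundaries_iff by blast
  have "e ((h \<circ> phi) (dK w)) = 0"
    using hom_kills_differential[OF dg_hom_compose[OF phi(1) h(1)] w] .
  then show ?thesis
    by (simp add: Lam_def h(2) additive_diff[of e, OF M.e_simps(1)] M.e_simps(4) phi(2)
        additive_ksign[of e, OF M.e_simps(1)])
qed

lemma Lam_nonzero_degree:
  assumes f: "f \<in> M.end_cocycles n" "n \<noteq> 0" and w: "w \<in> K 0"
  shows "Lam f w = 0"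
  using dg_homD(2)[OF compose_phi[OF f(1)] w] M.e_simps(3)[of "f (phi w)" n] f(2) by (simp add: Lam_def)

text \<open>
  If \<open>Lam f = 0\<close>, then \<open>f \<circ> phi\<close> has values in \<open>ker e\<close>, so it is null-homotopic, and so is \<open>f\<close>, which is
  homotopic to \<open>f \<circ> phi \<circ> psi\<close>.
\<close>

lemma coboundary_if_Lam_zero:
  assumes f: "f \<in> M.end_cocycles n" and zero: "\<And>w. w \<in> K 0 \<Longrightarrow> Lam f w = 0"
  shows "f \<in> M.end_coboundaries n"
proof -
  have f': "f \<in> dg_hom act M act M n" "dM (f x) = ksign n (f (dM x))" for x
    using f by (simp_all add: M.end_cocycles_iff)
  note add = dg_homD(1)[OF f'(1)]
  have "\<exists>h\<in>dg_hom actK K act M (n - 1). KM.hom_diff (n - 1) h = f \<circ> phi \<and> (\<forall>x. e (h x) = 0)"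
  proof (rule KM.null_homotopic[OF compose_phi[OF f]])
    show "KM.hom_diff n (f \<circ> phi) = (\<lambda>_. 0)" by (auto simp: KM.hom_diff_def f'(2) phi(2))
    have "e ((f \<circ> phi) b) = 0" if "b \<in> (\<Union>n. BsK n)" for b
      using zero[of b] semibasis_degree that unfolding Lam_def comp_def by blast
    then show "e ((f \<circ> phi) x) = 0" for x by (rule KM.kills_resolution[OF compose_phi[OF f]])
  qed
  then obtain h where h: "h \<in> dg_hom actK K act M (n - 1)" "KM.hom_diff (n - 1) h = f \<circ> phi" by blast
  define h' where "h' = (\<lambda>x. (h \<circ> psi) x + ksign n ((f \<circ> hom) x))"
  have h': "h' \<in> dg_hom act M act M (n - 1)"
    unfolding h'_def
    using dg_hom_compose[OF psi(1) h(1)] dg_hom_compose[OF hom(1) f'(1)]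
    by (intro MM.hom_add MM.hom_ksign) (simp_all add: comp_def)
  have "f x = dM (h' x) - ksign (n - 1) (h' (dM x))" for x
  proof -
    have "f x = f (phi (psi x)) + f (x - phi (psi x))" by (simp add: additive_diff[of f, OF add])
    also have "f (phi (psi x)) = dM (h (psi x)) - ksign (n - 1) (h (psi (dM x)))"
      using fun_cong[OF h(2), of "psi x"] by (simp add: KM.hom_diff_def psi(2))
    also have "f (x - phi (psi x)) = ksign n (dM (f (hom x))) + f (hom (dM x))"
      by (simp add: hom(2) add f'(2)) (simp add: ksign_def)
    finally show ?thesis
      by (simp add: h'_def M.dM_add M.dM_minus ksign_def)
  qed
  then show ?thesis using h' unfolding M.end_coboundaries_iff by blast
qed

lemma coboundary_nonzero_degree: "f \<in> M.end_cocycles n \<Longrightarrow> n \<noteq> 0 \<Longrightarrow> f \<in> M.end_coboundaries n"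
  using coboundary_if_Lam_zero Lam_nonzero_degree by blast

text \<open>
  The extension by zero of a functional on \<open>K\<^sup>0\<close> is linear over \<open>A\<close> because \<open>K\<close> vanishes in negative degrees, so
  that elements of positive degree map nothing into \<open>K\<^sup>0\<close>.
\<close>

lemma functional_trivial_cocycle:
  assumes lam: "lin lam"
  shows "trivial_cocycle (\<lambda>x. lam (component K 0 x))"
proof -
  let ?\<eta> = "\<lambda>x. lam (component K 0 x)"
  have add: "?\<eta> (x + y) = ?\<eta> x + ?\<eta> y" for x y
    by (simp add: component_add[OF module_grading] functionalD[OF lam])
  have zero: "trivial_act (type_alg scale) A a 0 = 0" for a by (simp add: trivial_act_def)
  have act: "?\<eta> (actK a x) = trivial_act (type_alg scale) A a (?\<eta> x)" for a x
    using grading UNIV_I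
  proof (rule homogeneous_induct[of UNIV A a])
    fix i a assume a: "a \<in> A i"
    show "?\<eta> (actK a x) = trivial_act (type_alg scale) A a (?\<eta> x)"
      using module_grading UNIV_I
    proof (rule homogeneous_induct[of UNIV K x])
      fix j x assume x: "x \<in> K j"
      note ax = component_homogeneous[OF module_grading act_degree[OF a x], of 0]
      note x0 = component_homogeneous[OF module_grading x, of 0]
      consider "i = 0" | "i > 0" "j \<ge> 0" | "i > 0" "j < 0" by linarith
      then show "?\<eta> (actK a x) = trivial_act (type_alg scale) A a (?\<eta> x)"
      proof cases
        case 1
        then obtain c where "a = scale c 1" using a connected by auto
        then show ?thesis using ax x0 1
          by (simp add: trivial_act_type_alg functionalD[OF lam] functional_zero[OF lam])
      next
        case 2
        then show ?thesis using ax a by (simp add: trivial_act_type_alg(2) functional_zero[OF lam])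
      next
        case 3
        then have "x = 0" using negative_degree[OF x] by simp
        then show ?thesis
          using component_homogeneous[OF module_grading M_zero, of 0 0]
          by (simp add: functional_zero[OF lam] zero)
      qed
    next
      fix x y assume "?\<eta> (actK a x) = trivial_act (type_alg scale) A a (?\<eta> x)"
        "?\<eta> (actK a y) = trivial_act (type_alg scale) A a (?\<eta> y)"
      then show "?\<eta> (actK a (x + y)) = trivial_act (type_alg scale) A a (?\<eta> (x + y))"
        unfolding act_simps add by (simp add: trivial_act_def distrib_left)
    qed
  next
    fix a b assume "?\<eta> (actK a x) = trivial_act (type_alg scale) A a (?\<eta> x)"
      "?\<eta> (actK b x) = trivial_act (type_alg scale) A b (?\<eta> x)"
    then show "?\<eta> (actK (a + b) x) = trivial_act (type_alg scale) A (a + b) (?\<eta> x)"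
      unfolding act_simps add trivial_act_add by simp
  qed
  have deg: "?\<eta> x \<in> trivial_grading j" if "x \<in> K j" for x j
    using component_homogeneous[OF module_grading that, of 0]
    by (auto simp: trivial_grading_def functional_zero[OF lam])
  have d: "?\<eta> (dK x) = 0" for x
    using module_grading UNIV_I
  proof (rule homogeneous_induct[of UNIV K x])
    fix j x assume x: "x \<in> K j"
    show "?\<eta> (dK x) = 0"
    proof (cases "j = - 1")
      case True
      then have "dK x = 0" using negative_degree[OF x] by simp
      then show ?thesis
        using component_homogeneous[OF module_grading M_zero, of 0 0] by (simp add: functional_zero[OF lam])
    next
      case False
      then show ?thesis using component_homogeneous[OF module_grading dM_degree[OF x], of 0]
        by (simp add: functional_zero[OF lam])
    qed
  qed (simp add: dM_add add)
  show ?thesis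
    using add act deg d unfolding trivial_cocycle_def graded_hom_def by (auto simp: type_alg_def)
qed

text \<open>Lift the functional to an endomorphism of \<open>K\<close> and transport it to \<open>M\<close>.\<close>

lemma Lam_surjective:
  assumes lam: "lin lam"
  shows "\<exists>f\<in>M.end_cocycles 0. \<forall>w\<in>K 0. Lam f w = lam w"
proof -
  obtain g where g: "g \<in> dg_hom actK K actK K 0" "\<And>x. dK (g x) = g (dK x)"
    "\<And>x. eK (g x) = lam (component K 0 x)"
    using KK.lift_trivial_cocycle[OF functional_trivial_cocycle[OF lam]] by blast
  have "phi \<circ> (g \<circ> psi) \<in> dg_hom act M act M (0 + (0 + 0))"
    by (rule dg_hom_compose[OF dg_hom_compose[OF psi(1) g(1)] phi(1)])
  then have f: "phi \<circ> (g \<circ> psi) \<in> M.end_cocycles 0"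
    by (simp add: M.end_cocycles_iff phi(2) psi(2)) (simp add: g(2) flip: psi(2))
  have "Lam (phi \<circ> (g \<circ> psi)) w = lam w" if w: "w \<in> K 0" for w
  proof -
    \<comment> \<open>There is no room for homotopies in \<open>K\<close>: the map \<open>psi \<circ> phi\<close> is the identity on \<open>K\<^sup>0\<close>.\<close>
    have pp: "(\<lambda>x. psi (phi x) - x) \<in> dg_hom actK K actK K 0"
      using KK.hom_subtract[of "psi \<circ> phi" 0 "\<lambda>x. x"] dg_hom_compose[OF phi(1) psi(1)]
      by (auto simp: comp_def dg_hom_def[of actK K actK K])
    have "\<exists>h\<in>dg_hom actK K actK K (0 - 1). KK.hom_diff (0 - 1) h = (\<lambda>x. psi (phi x) - x) \<and>
        (\<forall>x. eK (h x) = 0)"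
      by (rule KK.null_homotopic[OF pp])
        (auto simp: KK.hom_diff_def dM_diff phi psi additive_diff[of eK, OF e_simps(1)])
    then obtain h where h: "h \<in> dg_hom actK K actK K (0 - 1)"
      "KK.hom_diff (0 - 1) h = (\<lambda>x. psi (phi x) - x)" by blast
    have "eK (g (psi (phi w) - w)) = 0"
    proof -
      have "h w = 0" using negative_degree[OF dg_homD(2)[OF h(1) w]] by simp
      moreover have "h (dK w) = psi (phi w) - w"
        using fun_cong[OF h(2), of w] \<open>h w = 0\<close> by (simp add: KK.hom_diff_def ksign_def)
      moreover have "eK (g (h z)) = 0" if "z \<in> prods 1 (K 0)" for z
        using that
      proof (induction rule: prods_induct)
        case (generator a x)
        have "h x = 0" using negative_degree[OF dg_homD(2)[OF h(1) generator(2)]] by simp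
        then show ?case using dg_homD(3)[OF h(1) generator(1), of x]
            additive_zero[of g, OF dg_homD(1)[OF g(1)]] additive_zero[of eK, OF e_simps(1)] by simp
      qed (simp_all add: additive_zero[of h, OF dg_homD(1)[OF h(1)]] dg_homD(1)[OF h(1)]
          additive_zero[of g, OF dg_homD(1)[OF g(1)]] dg_homD(1)[OF g(1)]
          additive_zero[of eK, OF e_simps(1)] e_simps(1))
      ultimately show ?thesis using differential_socle[OF w] by metis
    qed
    then have "eK (g (psi (phi w))) = eK (g w)"
      by (simp add: additive_diff[of g, OF dg_homD(1)[OF g(1)]] additive_diff[of eK, OF e_simps(1)])
    then show ?thesis
      using g(3)[of w] component_homogeneous[OF module_grading w, of 0] by (simp add: Lam_def phi(3))
  qed
  then show ?thesis using f by blast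
qed

text \<open>
  The last claim holds because \<open>hom\<close> induces a homotopy, up to signs \<open>f \<circ> hom \<circ> g \<circ> phi\<close>, between
  \<open>f \<circ> phi \<circ> psi \<circ> g \<circ> phi\<close> and \<open>f \<circ> g \<circ> phi\<close>, and homotopies are invisible on \<open>K\<^sup>0\<close>.
\<close>

lemma transported_endo:
  assumes g: "g \<in> M.end_cocycles 0"
  shows "chain_endo (psi \<circ> (g \<circ> phi))" and "w \<in> K 0 \<Longrightarrow> eK ((psi \<circ> (g \<circ> phi)) w) = Lam g w"
    and "f \<in> M.end_cocycles n \<Longrightarrow> w \<in> K 0 \<Longrightarrow> Lam (f \<circ> g) w = Lam f ((psi \<circ> (g \<circ> phi)) w)"
proof -
  have g': "dM (g x) = g (dM x)" for x using g by (simp add: M.end_cocycles_iff)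
  have "psi \<circ> (g \<circ> phi) \<in> dg_hom actK K actK K (0 + 0)"
    by (rule dg_hom_compose[OF compose_phi[OF g] psi(1)])
  then show "chain_endo (psi \<circ> (g \<circ> phi))"
    by (simp add: chain_endo_def psi(2) g' phi(2))
  show "eK ((psi \<circ> (g \<circ> phi)) w) = Lam g w" by (simp add: Lam_def psi(3))
  assume f: "f \<in> M.end_cocycles n" and w: "w \<in> K 0"
  have f': "f \<in> dg_hom act M act M n" "dM (f x) = ksign n (f (dM x))" for x
    using f by (simp_all add: M.end_cocycles_iff)
  note add = dg_homD(1)[OF f'(1)]
  let ?y = "g (phi w)"
  have "e (f (dM (hom ?y))) = 0"
  proof -
    have "f (dM (hom ?y)) = ksign n (dM (f (hom ?y)))" by (simp add: f'(2)) (simp add: ksign_def)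
    then show ?thesis by (simp add: additive_ksign[of e, OF M.e_simps(1)] M.e_simps(4))
  qed
  moreover have "e (f (hom (dM ?y))) = 0"
    using hom_kills_differential[OF dg_hom_compose[OF dg_hom_compose[OF compose_phi[OF g] hom(1)] f'(1)] w]
    by (simp add: g' phi(2))
  moreover have "e (f ?y) = e (f (phi (psi ?y))) + e (f (?y - phi (psi ?y)))"
    by (simp add: additive_diff[of f, OF add] M.e_simps(1)[symmetric])
  ultimately show "Lam (f \<circ> g) w = Lam f ((psi \<circ> (g \<circ> phi)) w)"
    by (simp add: Lam_def hom(2) add M.e_simps(1))
qed

section \<open>The Ext-algebra as the dual of the degree zero part of the resolution\<close>

interpretation E: algebra_ideal M.end_cocycle_alg "M.sum_parts M.end_coboundaries"
  by (rule M.ext_algebra_ideal)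

abbreviation cls :: "('m \<Rightarrow> 'm) \<Rightarrow> ('m \<Rightarrow> 'm) set" where
  "cls f \<equiv> M.sum_parts M.end_coboundaries +>\<^bsub>M.end_cocycle_alg\<^esub> f"

lemma end_minus:
  assumes "f \<in> M.sum_parts M.end_cocycles" "g \<in> M.sum_parts M.end_cocycles"
  shows "f \<ominus>\<^bsub>M.end_cocycle_alg\<^esub> g = (\<lambda>x. f x - g x)"
proof -
  have "\<ominus>\<^bsub>M.end_cocycle_alg\<^esub> g = (\<lambda>x. - g x)"
    using assms(2) M.end_sum_closed(2)[OF assms(2)]
    by (intro E.minus_equality) (auto simp: M.end_cocycle_alg_simps)
  then show ?thesis by (simp add: a_minus_def M.end_cocycle_alg_simps)
qed

text \<open>Cocycles of nonzero degree are coboundaries, so only the part of degree zero matters.\<close>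

lemma degree_zero_representative:
  assumes "X \<in> carrier M.ext_alg"
  obtains f where "f \<in> M.end_cocycles 0" "X = cls f"
proof -
  obtain f where f: "f \<in> M.sum_parts M.end_cocycles" "X = cls f"
    using assms unfolding M.ext_alg_def by (auto elim: E.quotE simp: M.end_cocycle_alg_simps)
  have "\<exists>f0\<in>M.end_cocycles 0. (\<lambda>x. f x - f0 x) \<in> M.sum_parts M.end_coboundaries"
    using f(1)
  proof (induction rule: M.sum_parts_induct)
    case zero
    then show ?case
      using M.coboundary_in_sum[OF M.coboundaries_zero] M.cocycles_zero by (intro bexI[of _ "\<lambda>_. 0"]) auto
  next
    case (part n f)
    show ?case
    proof (cases "n = 0")
      case True
      then show ?thesis using part M.coboundary_in_sum[OF M.coboundaries_zero]
        by (intro bexI[of _ f]) auto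
    next
      case False
      then show ?thesis
        using M.coboundary_in_sum[OF coboundary_nonzero_degree[OF part]] M.cocycles_zero
        by (intro bexI[of _ "\<lambda>_. 0"]) auto
    qed
  next
    case (add f g)
    then obtain f0 g0 where *: "f0 \<in> M.end_cocycles 0" "g0 \<in> M.end_cocycles 0"
      "(\<lambda>x. f x - f0 x) \<in> M.sum_parts M.end_coboundaries"
      "(\<lambda>x. g x - g0 x) \<in> M.sum_parts M.end_coboundaries" by blast
    have "(\<lambda>x. (f x + g x) - (f0 x + g0 x)) \<in> M.sum_parts M.end_coboundaries"
      using M.boundary_sums_add[OF *(3,4)] by (simp add: algebra_simps)
    then show ?case using M.cocycles_add[OF *(1,2)] by (intro bexI[of _ "\<lambda>x. f0 x + g0 x"]) auto
  qed
  then obtain f0 where f0: "f0 \<in> M.end_cocycles 0" "(\<lambda>x. f x - f0 x) \<in> M.sum_parts M.end_coboundaries"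
    by blast
  have "X = cls f0"
    using f f0 E.coset_eq_iff[of f f0] end_minus[OF f(1) M.cocycle_in_sum[OF f0(1)]]
      M.cocycle_in_sum[OF f0(1)] by (simp add: M.end_cocycle_alg_simps)
  then show ?thesis using f0(1) that by blast
qed

lemma cls_in: "f \<in> M.end_cocycles 0 \<Longrightarrow> cls f \<in> carrier M.ext_alg"
  unfolding M.ext_alg_def
  by (rule E.coset_in_quot) (simp add: M.end_cocycle_alg_simps M.cocycle_in_sum)

lemma Lam_boundary_sum: "f \<in> M.sum_parts M.end_coboundaries \<Longrightarrow> w \<in> K 0 \<Longrightarrow> Lam f w = 0"
  by (induction rule: M.sum_parts_induct)
    (auto simp: Lam_coboundary, auto simp: Lam_def M.e_simps(1) additive_zero[of e, OF M.e_simps(1)])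

text \<open>The value does not depend on the chosen representative, see \<open>ext_functional_cls\<close>.\<close>

definition ext_functional :: "('m \<Rightarrow> 'm) set \<Rightarrow> 'p \<Rightarrow> 'k" where
  "ext_functional X = Lam (SOME f. f \<in> M.end_cocycles 0 \<and> X = cls f)"

lemma ext_functional_lin: "X \<in> carrier M.ext_alg \<Longrightarrow> lin (ext_functional X)"
proof -
  assume X: "X \<in> carrier M.ext_alg"
  have "\<exists>f. f \<in> M.end_cocycles 0 \<and> X = cls f" using degree_zero_representative[OF X] by blast
  from someI_ex[OF this] show ?thesis unfolding ext_functional_def by (intro Lam_lin) blast
qed

lemma ext_functional_cls:
  assumes f: "f \<in> M.end_cocycles 0" and w: "w \<in> K 0"
  shows "ext_functional (cls f) w = Lam f w"
proof -
  define g where "g = (SOME g. g \<in> M.end_cocycles 0 \<and> cls f = cls g)"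
  have g: "g \<in> M.end_cocycles 0" "cls f = cls g"
    using someI[of "\<lambda>g. g \<in> M.end_cocycles 0 \<and> cls f = cls g" f] f unfolding g_def by auto
  have "(\<lambda>x. f x - g x) \<in> M.sum_parts M.end_coboundaries"
    using g E.coset_eq_iff[of f g] end_minus[of f g] M.cocycle_in_sum[OF f] M.cocycle_in_sum[OF g(1)]
    by (simp add: M.end_cocycle_alg_simps)
  from Lam_boundary_sum[OF this w] have "Lam f w = Lam g w"
    by (simp add: Lam_def additive_diff[of e, OF M.e_simps(1)])
  then show ?thesis by (simp add: ext_functional_def g_def)
qed

lemma cls_operations:
  assumes f: "f \<in> M.end_cocycles 0" and g: "g \<in> M.end_cocycles 0"
  shows "cls f \<otimes>\<^bsub>M.ext_alg\<^esub> cls g = cls (f \<circ> g)" "cls f \<oplus>\<^bsub>M.ext_alg\<^esub> cls g = cls (\<lambda>x. f x + g x)"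
    "c \<odot>\<^bsub>M.ext_alg\<^esub> cls f = cls (\<lambda>x. act (scale c 1) (f x))" "\<one>\<^bsub>M.ext_alg\<^esub> = cls id"
    "\<zero>\<^bsub>M.ext_alg\<^esub> = cls (\<lambda>_. 0)"
  using E.quot_operations[of f g] E.quot_one E.quot_zero M.cocycle_in_sum[OF f] M.cocycle_in_sum[OF g]
  by (simp_all add: M.ext_alg_def M.end_cocycle_alg_simps)

theorem ext_functional_rules:
  assumes X: "X \<in> carrier M.ext_alg" and Y: "Y \<in> carrier M.ext_alg" and w: "w \<in> K 0"
  shows "ext_functional (X \<oplus>\<^bsub>M.ext_alg\<^esub> Y) w = ext_functional X w + ext_functional Y w"
    and "ext_functional (c \<odot>\<^bsub>M.ext_alg\<^esub> X) w = c * ext_functional X w"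
    and "ext_functional \<one>\<^bsub>M.ext_alg\<^esub> w = eK w"
proof -
  obtain f where f: "f \<in> M.end_cocycles 0" "X = cls f" using degree_zero_representative[OF X] .
  obtain g where g: "g \<in> M.end_cocycles 0" "Y = cls g" using degree_zero_representative[OF Y] .
  show "ext_functional (X \<oplus>\<^bsub>M.ext_alg\<^esub> Y) w = ext_functional X w + ext_functional Y w"
    "ext_functional (c \<odot>\<^bsub>M.ext_alg\<^esub> X) w = c * ext_functional X w"
    "ext_functional \<one>\<^bsub>M.ext_alg\<^esub> w = eK w"
    using f g w cls_operations[OF f(1) g(1)]
    by (simp_all add: ext_functional_cls M.cocycles_add M.cocycles_smult M.id_cocycle)
      (simp_all add: Lam_def M.e_simps(1,5) phi(3))
qed

theorem ext_functional_mult: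
  assumes Y: "Y \<in> carrier M.ext_alg"
  shows "\<exists>f. chain_endo f \<and> (\<forall>w\<in>K 0. eK (f w) = ext_functional Y w) \<and>
    (\<forall>X\<in>carrier M.ext_alg. \<forall>w\<in>K 0. ext_functional (X \<otimes>\<^bsub>M.ext_alg\<^esub> Y) w = ext_functional X (f w))"
proof -
  obtain g where g: "g \<in> M.end_cocycles 0" "Y = cls g" using degree_zero_representative[OF Y] .
  let ?f = "psi \<circ> (g \<circ> phi)"
  have "ext_functional (X \<otimes>\<^bsub>M.ext_alg\<^esub> Y) w = ext_functional X (?f w)"
    if X: "X \<in> carrier M.ext_alg" and w: "w \<in> K 0" for X w
  proof -
    obtain f where f: "f \<in> M.end_cocycles 0" "X = cls f" using degree_zero_representative[OF X] .
    have "f \<circ> g \<in> M.end_cocycles 0" using M.cocycles_compose[OF f(1) g(1)] by simp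
    then show ?thesis
      using f g w transported_endo(3)[OF g(1) f(1) w] chain_endoD(4)[OF transported_endo(1)[OF g(1)] w]
        cls_operations(1)[OF f(1) g(1)]
      by (simp add: ext_functional_cls)
  qed
  then show ?thesis
    using transported_endo(1,2)[OF g(1)] ext_functional_cls[OF g(1)] g(2)
    by (intro exI[of _ ?f]) auto
qed

theorem ext_functional_surjective:
  assumes "lin lam"
  shows "\<exists>X\<in>carrier M.ext_alg. \<forall>w\<in>K 0. ext_functional X w = lam w"
proof -
  obtain f where "f \<in> M.end_cocycles 0" "\<forall>w\<in>K 0. Lam f w = lam w"
    using Lam_surjective[OF assms] by blast
  then show ?thesis using cls_in ext_functional_cls by (intro bexI[of _ "cls f"]) auto
qed

end

section \<open>The tensor algebra\<close>

lemma fun_sum_apply: "(\<Sum>i\<in>I. f i) x = (\<Sum>i\<in>I. f i x)"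
  by (induction I rule: infinite_finite_induct) auto

interpretation fun_space: vector_space "\<lambda>c (f :: nat list \<Rightarrow> 'k::field). (\<lambda>w. c * f w)"
  by unfold_locales (auto simp: fun_eq_iff algebra_simps)

definition single :: "nat list \<Rightarrow> nat list \<Rightarrow> 'k::field" where
  "single u = (\<lambda>w. if w = u then 1 else 0)"

lemma tensor_simps:
  "carrier (tensor_alg m) = {f. finite {w. f w \<noteq> 0} \<and> {w. f w \<noteq> 0} \<subseteq> lists {..<m}}"
  "f \<otimes>\<^bsub>tensor_alg m\<^esub> g = (\<lambda>w. \<Sum>i\<le>length w. f (take i w) * g (drop i w))"
  "\<one>\<^bsub>tensor_alg m\<^esub> = single []" "\<zero>\<^bsub>tensor_alg m\<^esub> = (\<lambda>_. 0)"
  "f \<oplus>\<^bsub>tensor_alg m\<^esub> g = (\<lambda>w. f w + g w)" "c \<odot>\<^bsub>tensor_alg m\<^esub> f = (\<lambda>w. c * f w)"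
  by (simp_all add: tensor_alg_def single_def)

lemma tensor_carrierD:
  "f \<in> carrier (tensor_alg m) \<Longrightarrow> f w \<noteq> 0 \<Longrightarrow> set w \<subseteq> {..<m}"
  by (auto simp: tensor_simps)

lemma tensor_mult_closed:
  assumes f: "f \<in> carrier (tensor_alg m)" and g: "g \<in> carrier (tensor_alg m)"
  shows "f \<otimes>\<^bsub>tensor_alg m\<^esub> g \<in> carrier (tensor_alg m)"
proof -
  have "\<exists>u y. w = u @ y \<and> f u \<noteq> 0 \<and> g y \<noteq> 0" if "(f \<otimes>\<^bsub>tensor_alg m\<^esub> g) w \<noteq> 0" for w
  proof -
    from that obtain i where "f (take i w) * g (drop i w) \<noteq> 0"
      unfolding tensor_simps by (metis (no_types, lifting) sum.neutral)
    then show ?thesis by (metis append_take_drop_id mult_eq_0_iff)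
  qed
  then have *: "{w. (f \<otimes>\<^bsub>tensor_alg m\<^esub> g) w \<noteq> 0}
      \<subseteq> (\<lambda>(u, y). u @ y) ` ({u. f u \<noteq> 0} \<times> {y. g y \<noteq> 0})" by fast
  have "finite ((\<lambda>(u, y). u @ y) ` ({u. f u \<noteq> 0} \<times> {y. g y \<noteq> 0}))"
    using f g by (auto simp: tensor_simps)
  with * have fin: "finite {w. (f \<otimes>\<^bsub>tensor_alg m\<^esub> g) w \<noteq> 0}" by (rule finite_subset)
  have "{w. (f \<otimes>\<^bsub>tensor_alg m\<^esub> g) w \<noteq> 0} \<subseteq> lists {..<m}"
  proof
    fix w assume "w \<in> {w. (f \<otimes>\<^bsub>tensor_alg m\<^esub> g) w \<noteq> 0}"
    then obtain u y where "w = u @ y" "f u \<noteq> 0" "g y \<noteq> 0" using * by auto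
    then show "w \<in> lists {..<m}" using tensor_carrierD[OF f] tensor_carrierD[OF g] by auto
  qed
  with fin show ?thesis unfolding tensor_simps(1) by simp
qed

lemma tensor_add_closed:
  assumes "f \<in> carrier (tensor_alg m)" "g \<in> carrier (tensor_alg m)"
  shows "(\<lambda>w. f w + g w) \<in> carrier (tensor_alg m)"
proof -
  have "{w. f w + g w \<noteq> 0} \<subseteq> {w. f w \<noteq> 0} \<union> {w. g w \<noteq> 0}" by auto
  then show ?thesis
    using assms unfolding tensor_simps(1) by (auto intro: finite_subset)
qed

lemma tensor_scale_closed:
  assumes "f \<in> carrier (tensor_alg m)" shows "(\<lambda>w. c * f w) \<in> carrier (tensor_alg m)"
proof -
  have "{w. c * f w \<noteq> 0} \<subseteq> {w. f w \<noteq> 0}" by auto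
  then show ?thesis
    using assms unfolding tensor_simps(1) by (auto intro: finite_subset)
qed

lemma single_closed: "set u \<subseteq> {..<m} \<Longrightarrow> single u \<in> carrier (tensor_alg m)"
  by (auto simp: tensor_simps single_def)

lemma tensor_assoc:
  "(f \<otimes>\<^bsub>tensor_alg m\<^esub> g) \<otimes>\<^bsub>tensor_alg m\<^esub> h = f \<otimes>\<^bsub>tensor_alg m\<^esub> (g \<otimes>\<^bsub>tensor_alg m\<^esub> h)"
proof
  fix w :: "nat list"
  let ?n = "length w"
  have "((f \<otimes>\<^bsub>tensor_alg m\<^esub> g) \<otimes>\<^bsub>tensor_alg m\<^esub> h) w
      = (\<Sum>i\<le>?n. \<Sum>j\<le>i. f (take j w) * g (drop j (take i w)) * h (drop i w))"
    by (simp add: tensor_simps(2) sum_distrib_right min_absorb2 min_absorb1)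
  also have "\<dots> = (\<Sum>(i, j)\<in>(SIGMA i:{..?n}. {..i}). f (take j w) * g (drop j (take i w)) * h (drop i w))"
    by (rule sum.Sigma) auto
  also have "\<dots> = (\<Sum>(j, l)\<in>(SIGMA j:{..?n}. {..?n - j}).
      f (take j w) * (g (take l (drop j w)) * h (drop l (drop j w))))"
    by (rule sum.reindex_bij_witness[where i="\<lambda>(j, l). (j + l, j)" and j="\<lambda>(i, j). (j, i - j)"])
      (auto simp: drop_take mult.assoc)
  also have "\<dots> = (\<Sum>j\<le>?n. \<Sum>l\<le>?n - j. f (take j w) * (g (take l (drop j w)) * h (drop l (drop j w))))"
    by (rule sum.Sigma[symmetric]) auto
  also have "\<dots> = (f \<otimes>\<^bsub>tensor_alg m\<^esub> (g \<otimes>\<^bsub>tensor_alg m\<^esub> h)) w"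
    by (simp add: tensor_simps sum_distrib_left)
  finally show "((f \<otimes>\<^bsub>tensor_alg m\<^esub> g) \<otimes>\<^bsub>tensor_alg m\<^esub> h) w
      = (f \<otimes>\<^bsub>tensor_alg m\<^esub> (g \<otimes>\<^bsub>tensor_alg m\<^esub> h)) w" .
qed

lemma single_mult:
  "(single u \<otimes>\<^bsub>tensor_alg m\<^esub> g) w
    = (if length u \<le> length w \<and> take (length u) w = u then g (drop (length u) w) else 0)"
proof -
  have "(single u \<otimes>\<^bsub>tensor_alg m\<^esub> g) w
      = (\<Sum>i\<le>length w. if i = length u then single u (take i w) * g (drop i w) else 0)"
    unfolding tensor_simps by (intro sum.cong) (auto simp: single_def)
  then show ?thesis by (auto simp: single_def)
qed

lemma mult_single:
  "(g \<otimes>\<^bsub>tensor_alg m\<^esub> single y) w = (if length y \<le> length w \<and> drop (length w - length y) w = y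
    then g (take (length w - length y) w) else 0)"
proof -
  have "(g \<otimes>\<^bsub>tensor_alg m\<^esub> single y) w
      = (\<Sum>i\<le>length w. if i = length w - length y then g (take i w) * single y (drop i w) else 0)"
    unfolding tensor_simps by (intro sum.cong) (auto simp: single_def)
  then show ?thesis by (auto simp: single_def)
qed

lemma tensor_kalgebra: "kalgebra (tensor_alg m)"
proof (rule kalgebraI)
  show "ring (tensor_alg m)"
  proof (rule ringI)
    show "abelian_group (tensor_alg m)"
    proof (rule abelian_groupI)
      show "\<exists>g\<in>carrier (tensor_alg m). g \<oplus>\<^bsub>tensor_alg m\<^esub> f = \<zero>\<^bsub>tensor_alg m\<^esub>"
        if "f \<in> carrier (tensor_alg m)" for f
        using tensor_scale_closed[OF that, of "- 1"]
        by (intro bexI[of _ "\<lambda>w. - 1 * f w"]) (simp_all add: tensor_simps(4,5))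
      show "\<zero>\<^bsub>tensor_alg m\<^esub> \<in> carrier (tensor_alg m)" by (simp add: tensor_simps)
    qed (simp_all add: tensor_simps(4,5) tensor_add_closed add_ac)
    show "Group.monoid (tensor_alg m)"
    proof (rule monoidI)
      show "\<one>\<^bsub>tensor_alg m\<^esub> \<in> carrier (tensor_alg m)"
        unfolding tensor_simps(3) by (rule single_closed) simp
      show "\<one>\<^bsub>tensor_alg m\<^esub> \<otimes>\<^bsub>tensor_alg m\<^esub> f = f" "f \<otimes>\<^bsub>tensor_alg m\<^esub> \<one>\<^bsub>tensor_alg m\<^esub> = f" for f
        unfolding tensor_simps(3) by (simp_all add: fun_eq_iff single_mult mult_single)
    qed (simp_all add: tensor_mult_closed tensor_assoc)
    show "(f \<oplus>\<^bsub>tensor_alg m\<^esub> g) \<otimes>\<^bsub>tensor_alg m\<^esub> h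
        = f \<otimes>\<^bsub>tensor_alg m\<^esub> h \<oplus>\<^bsub>tensor_alg m\<^esub> g \<otimes>\<^bsub>tensor_alg m\<^esub> h" for f g h
      by (simp add: tensor_simps(2,5) distrib_right sum.distrib)
    show "h \<otimes>\<^bsub>tensor_alg m\<^esub> (f \<oplus>\<^bsub>tensor_alg m\<^esub> g)
        = h \<otimes>\<^bsub>tensor_alg m\<^esub> f \<oplus>\<^bsub>tensor_alg m\<^esub> h \<otimes>\<^bsub>tensor_alg m\<^esub> g" for f g h
      by (simp add: tensor_simps(2,5) distrib_left sum.distrib)
  qed
  show "c \<odot>\<^bsub>tensor_alg m\<^esub> (f \<otimes>\<^bsub>tensor_alg m\<^esub> g) = (c \<odot>\<^bsub>tensor_alg m\<^esub> f) \<otimes>\<^bsub>tensor_alg m\<^esub> g"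
    for c f g
    by (simp add: tensor_simps(2,6) sum_distrib_left mult.assoc)
  show "c \<odot>\<^bsub>tensor_alg m\<^esub> (f \<otimes>\<^bsub>tensor_alg m\<^esub> g) = f \<otimes>\<^bsub>tensor_alg m\<^esub> (c \<odot>\<^bsub>tensor_alg m\<^esub> g)"
    for c f g
    by (simp add: tensor_simps(2,6) sum_distrib_left mult.left_commute)
  show "c \<odot>\<^bsub>tensor_alg m\<^esub> f \<in> carrier (tensor_alg m)" if "f \<in> carrier (tensor_alg m)" for c f
    unfolding tensor_simps(6) by (rule tensor_scale_closed[OF that])
  show "(b + c) \<odot>\<^bsub>tensor_alg m\<^esub> f = b \<odot>\<^bsub>tensor_alg m\<^esub> f \<oplus>\<^bsub>tensor_alg m\<^esub> c \<odot>\<^bsub>tensor_alg m\<^esub> f"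
    for b c f by (simp add: tensor_simps(5,6) distrib_right)
  show "c \<odot>\<^bsub>tensor_alg m\<^esub> (f \<oplus>\<^bsub>tensor_alg m\<^esub> g)
      = c \<odot>\<^bsub>tensor_alg m\<^esub> f \<oplus>\<^bsub>tensor_alg m\<^esub> c \<odot>\<^bsub>tensor_alg m\<^esub> g" for c f g
    by (simp add: tensor_simps(5,6) distrib_left)
  show "(b * c) \<odot>\<^bsub>tensor_alg m\<^esub> f = b \<odot>\<^bsub>tensor_alg m\<^esub> (c \<odot>\<^bsub>tensor_alg m\<^esub> f)" for b c f
    unfolding tensor_simps(6) by (rule ext) (rule mult.assoc)
  show "1 \<odot>\<^bsub>tensor_alg m\<^esub> f = f" for f
    by (simp add: tensor_simps(6))
qed

lemma tensor_k_algebra: "k_algebra (tensor_alg m)"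
  by (rule k_algebraI[OF tensor_kalgebra])

lemma tensor_minus:
  assumes "f \<in> carrier (tensor_alg m)" "g \<in> carrier (tensor_alg m)"
  shows "\<ominus>\<^bsub>tensor_alg m\<^esub> g = (\<lambda>w. - g w)" "f \<ominus>\<^bsub>tensor_alg m\<^esub> g = (\<lambda>w. f w - g w)"
proof -
  interpret k_algebra "tensor_alg m" by (rule tensor_k_algebra)
  have "(\<lambda>w. - g w) \<in> carrier (tensor_alg m)" using tensor_scale_closed[OF assms(2), of "- 1"] by simp
  then show "\<ominus>\<^bsub>tensor_alg m\<^esub> g = (\<lambda>w. - g w)"
    using assms(2) by (intro minus_equality) (simp_all add: tensor_simps(4,5))
  then show "f \<ominus>\<^bsub>tensor_alg m\<^esub> g = (\<lambda>w. f w - g w)" by (simp add: a_minus_def tensor_simps(5))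
qed

definition hpart :: "nat \<Rightarrow> (nat list \<Rightarrow> 'k::field) \<Rightarrow> nat list \<Rightarrow> 'k" where
  "hpart n t = (\<lambda>w. if length w = n then t w else 0)"

lemma hpart_in: "t \<in> carrier (tensor_alg m) \<Longrightarrow> hpart n t \<in> tensor_part m n"
proof -
  assume "t \<in> carrier (tensor_alg m)"
  moreover have "{w. hpart n t w \<noteq> 0} \<subseteq> {w. t w \<noteq> 0}" by (auto simp: hpart_def)
  ultimately show ?thesis
    unfolding tensor_part_def tensor_simps by (auto simp: hpart_def intro: finite_subset split: if_splits)
qed

lemma hpart_sum:
  assumes t: "t \<in> carrier (tensor_alg m)"
  shows "(\<Sum>n\<in>length ` {w. t w \<noteq> 0}. hpart n t) = t"
proof
  fix w
  have fin: "finite {w. t w \<noteq> 0}" using t by (simp add: tensor_simps)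
  have "(\<Sum>n\<in>length ` {w. t w \<noteq> 0}. hpart n t w)
      = (\<Sum>n\<in>length ` {w. t w \<noteq> 0}. if n = length w then t w else 0)"
    by (intro sum.cong) (auto simp: hpart_def)
  then show "(\<Sum>n\<in>length ` {w. t w \<noteq> 0}. hpart n t) w = t w" using fin by (auto simp: fun_sum_apply)
qed

lemma tensor_part_carrier: "t \<in> tensor_part m n \<Longrightarrow> t \<in> carrier (tensor_alg m)"
  by (simp add: tensor_part_def)

lemma hpart_tensor_part: "t \<in> tensor_part m n \<Longrightarrow> hpart k t = (if k = n then t else (\<lambda>_. 0))"
  by (auto simp: tensor_part_def hpart_def fun_eq_iff)

lemma tensor_part_iff:
  "t \<in> tensor_part m n \<longleftrightarrow> (\<forall>w. w \<notin> words m n \<longrightarrow> t w = 0)"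
proof
  assume *: "\<forall>w. w \<notin> words m n \<longrightarrow> t w = 0"
  then have "{w. t w \<noteq> 0} \<subseteq> words m n" by auto
  then have "finite {w. t w \<noteq> 0}" by (rule finite_subset[OF _ finite_words])
  then show "t \<in> tensor_part m n" using * by (auto simp: tensor_part_def tensor_simps words_def)
next
  assume "t \<in> tensor_part m n"
  then show "\<forall>w. w \<notin> words m n \<longrightarrow> t w = 0"
    using tensor_carrierD[of t m] by (auto simp: tensor_part_def words_def)
qed

lemma tensor_part_mult:
  assumes t: "t \<in> tensor_part m a" and s: "s \<in> tensor_part m b"
  shows "t \<otimes>\<^bsub>tensor_alg m\<^esub> s \<in> tensor_part m (a + b)"
proof -
  have "length w = a + b" if "(t \<otimes>\<^bsub>tensor_alg m\<^esub> s) w \<noteq> 0" for w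
  proof -
    from that obtain i where "i \<le> length w" "t (take i w) \<noteq> 0" "s (drop i w) \<noteq> 0"
      unfolding tensor_simps by (metis (no_types, lifting) atMost_iff mult_eq_0_iff sum.neutral)
    then have "length (take i w) = a" "length (drop i w) = b"
      using t s unfolding tensor_part_def by blast+
    then show ?thesis using \<open>i \<le> length w\<close> by simp
  qed
  then show ?thesis
    using tensor_mult_closed[OF tensor_part_carrier[OF t] tensor_part_carrier[OF s]]
    by (simp add: tensor_part_def)
qed

lemma hpart_mult:
  "hpart n (t \<otimes>\<^bsub>tensor_alg m\<^esub> s) = (\<Sum>i\<le>n. hpart i t \<otimes>\<^bsub>tensor_alg m\<^esub> hpart (n - i) s)"
proof
  fix w :: "nat list"
  have split: "(hpart i t \<otimes>\<^bsub>tensor_alg m\<^esub> hpart j s) w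
      = (if length w = i + j then t (take i w) * s (drop i w) else 0)" for i j
  proof -
    have "(hpart i t \<otimes>\<^bsub>tensor_alg m\<^esub> hpart j s) w
        = (\<Sum>l\<le>length w. if l = i then hpart i t (take i w) * hpart j s (drop i w) else 0)"
      unfolding tensor_simps by (intro sum.cong) (auto simp: hpart_def)
    then show ?thesis by (auto simp: hpart_def)
  qed
  show "hpart n (t \<otimes>\<^bsub>tensor_alg m\<^esub> s) w
      = (\<Sum>i\<le>n. hpart i t \<otimes>\<^bsub>tensor_alg m\<^esub> hpart (n - i) s) w"
    unfolding fun_sum_apply split by (auto simp: hpart_def tensor_simps intro!: sum.cong)
qed

section \<open>Pairing tensors with functions on words\<close>

definition pairing :: "nat \<Rightarrow> nat \<Rightarrow> (nat list \<Rightarrow> 'k::field) \<Rightarrow> (nat list \<Rightarrow> 'k) \<Rightarrow> 'k" where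
  "pairing m n t r = (\<Sum>u\<in>words m n. t u * r u)"

lemma pairing_hpart: "pairing m k (hpart n t) r = (if k = n then pairing m n t r else 0)"
  by (auto simp: pairing_def hpart_def words_def intro!: sum.cong sum.neutral)

lemma pairing_mult:
  "pairing m n (t \<otimes>\<^bsub>tensor_alg m\<^esub> s) r
    = (\<Sum>i\<le>n. \<Sum>u\<in>words m i. \<Sum>y\<in>words m (n - i). t u * s y * r (u @ y))"
proof -
  have "pairing m n (t \<otimes>\<^bsub>tensor_alg m\<^esub> s) r
      = (\<Sum>w\<in>words m n. \<Sum>i\<le>n. t (take i w) * s (drop i w) * r w)"
    unfolding pairing_def tensor_simps by (intro sum.cong) (auto simp: words_def sum_distrib_right)
  also have "\<dots> = (\<Sum>i\<le>n. \<Sum>w\<in>words m n. t (take i w) * s (drop i w) * r w)" by (rule sum.swap)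
  also have "\<dots> = (\<Sum>i\<le>n. \<Sum>u\<in>words m i. \<Sum>y\<in>words m (n - i). t u * s y * r (u @ y))"
  proof (rule sum.cong[OF refl])
    fix i assume "i \<in> {..n}"
    then have "(\<Sum>w\<in>words m n. t (take i w) * s (drop i w) * r w)
        = (\<Sum>w\<in>words m (i + (n - i)). t (take i w) * s (drop i w) * r w)" by simp
    also have "\<dots> = (\<Sum>u\<in>words m i. \<Sum>y\<in>words m (n - i). t u * s y * r (u @ y))"
      unfolding sum_words_append by (intro sum.cong refl) (auto simp: words_def)
    finally show "(\<Sum>w\<in>words m n. t (take i w) * s (drop i w) * r w)
        = (\<Sum>u\<in>words m i. \<Sum>y\<in>words m (n - i). t u * s y * r (u @ y))" .
  qed
  finally show ?thesis .
qed

lemma pairing_mult_left: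
  "pairing m n (t \<otimes>\<^bsub>tensor_alg m\<^esub> s) r
    = (\<Sum>i\<le>n. \<Sum>u\<in>words m i. t u * pairing m (n - i) s (\<lambda>y. r (u @ y)))"
  unfolding pairing_mult by (simp add: pairing_def sum_distrib_left mult.assoc)

lemma pairing_mult_right:
  "pairing m n (t \<otimes>\<^bsub>tensor_alg m\<^esub> s) r
    = (\<Sum>i\<le>n. \<Sum>y\<in>words m (n - i). s y * pairing m i t (\<lambda>u. r (u @ y)))"
  unfolding pairing_mult
  by (rule sum.cong[OF refl], subst sum.swap) (simp add: pairing_def sum_distrib_left ac_simps)

lemma pairing_single_left:
  assumes "u \<in> words m a" "a \<le> n"
  shows "pairing m n (single u \<otimes>\<^bsub>tensor_alg m\<^esub> s) r = pairing m (n - a) s (\<lambda>y. r (u @ y))"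
proof -
  have "(\<Sum>u'\<in>words m i. single u u' * pairing m (n - i) s (\<lambda>y. r (u' @ y)))
      = (if i = a then pairing m (n - a) s (\<lambda>y. r (u @ y)) else 0)" for i
  proof (cases "i = a")
    case True
    have "(\<Sum>u'\<in>words m i. single u u' * pairing m (n - i) s (\<lambda>y. r (u' @ y)))
        = (\<Sum>u'\<in>words m i. if u' = u then pairing m (n - i) s (\<lambda>y. r (u @ y)) else 0)"
      by (intro sum.cong) (auto simp: single_def)
    then show ?thesis using True assms(1) finite_words by simp
  next
    case False
    then show ?thesis using assms(1) by (auto simp: single_def words_def intro!: sum.neutral)
  qed
  then show ?thesis unfolding pairing_mult_left using assms(2) by simp
qed

lemma pairing_single_right:
  assumes "y \<in> words m b" "b \<le> n"
  shows "pairing m n (t \<otimes>\<^bsub>tensor_alg m\<^esub> single y) r = pairing m (n - b) t (\<lambda>u. r (u @ y))"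
proof -
  have "(\<Sum>y'\<in>words m (n - i). single y y' * pairing m i t (\<lambda>u. r (u @ y')))
      = (if i = n - b then pairing m (n - b) t (\<lambda>u. r (u @ y)) else 0)" if "i \<le> n" for i
  proof (cases "i = n - b")
    case True
    have "(\<Sum>y'\<in>words m (n - i). single y y' * pairing m i t (\<lambda>u. r (u @ y')))
        = (\<Sum>y'\<in>words m (n - i). if y' = y then pairing m i t (\<lambda>u. r (u @ y)) else 0)"
      by (intro sum.cong) (auto simp: single_def)
    then show ?thesis using True assms finite_words by simp
  next
    case False
    then show ?thesis using assms that by (auto simp: single_def words_def intro!: sum.neutral)
  qed
  then have "(\<Sum>i\<le>n. \<Sum>y'\<in>words m (n - i). single y y' * pairing m i t (\<lambda>u. r (u @ y')))
      = (\<Sum>i\<le>n. if i = n - b then pairing m (n - b) t (\<lambda>u. r (u @ y)) else 0)"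
    by (intro sum.cong) auto
  then show ?thesis unfolding pairing_mult_right by simp
qed

lemma functional_pairing:
  assumes \<theta>: "functional (\<lambda>c f w. c * f w) \<theta>" and t: "t \<in> tensor_part m n"
  shows "\<theta> t = pairing m n t (\<lambda>u. \<theta> (single u))"
proof -
  have "t = (\<Sum>u\<in>words m n. (\<lambda>w. t u * single u w))"
  proof
    fix w
    have "(\<Sum>u\<in>words m n. t u * single u w) = (\<Sum>u\<in>words m n. if u = w then t w else 0)"
      by (intro sum.cong) (auto simp: single_def)
    then show "t w = (\<Sum>u\<in>words m n. (\<lambda>w. t u * single u w)) w"
      using t finite_words by (auto simp: fun_sum_apply tensor_part_iff)
  qed
  then have "\<theta> t = (\<Sum>u\<in>words m n. \<theta> (\<lambda>w. t u * single u w))"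
    by (metis functional_sum[OF \<theta>])
  then show ?thesis by (simp add: functionalD(2)[OF \<theta>] pairing_def)
qed

section \<open>Annihilators of the relations\<close>

definition slice :: "nat \<Rightarrow> (nat list \<Rightarrow> 'k::field) \<Rightarrow> nat list \<Rightarrow> nat list \<Rightarrow> nat list \<Rightarrow> 'k" where
  "slice m r u y = (\<lambda>w. if w \<in> words m 2 then r (u @ w @ y) else 0)"

definition slices_in :: "nat \<Rightarrow> (nat list \<Rightarrow> 'k::field) set \<Rightarrow> nat \<Rightarrow> (nat list \<Rightarrow> 'k) \<Rightarrow> bool" where
  "slices_in m U n r \<longleftrightarrow> (\<forall>u y. set u \<subseteq> {..<m} \<longrightarrow> set y \<subseteq> {..<m} \<longrightarrow>
     length u + length y + 2 = n \<longrightarrow> slice m r u y \<in> U)"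

lemma slices_in_append:
  assumes "slices_in m U n r"
  shows "u \<in> words m i \<Longrightarrow> i \<le> n \<Longrightarrow> slices_in m U (n - i) (\<lambda>y. r (u @ y))"
    and "y \<in> words m (n - i) \<Longrightarrow> i \<le> n \<Longrightarrow> slices_in m U i (\<lambda>u. r (u @ y))"
proof -
  show "slices_in m U (n - i) (\<lambda>y. r (u @ y))" if "u \<in> words m i" "i \<le> n"
    unfolding slices_in_def
  proof (intro allI impI)
    fix u' y assume *: "set u' \<subseteq> {..<m}" "set y \<subseteq> {..<m}" "length u' + length y + 2 = n - i"
    then have "slice m r (u @ u') y \<in> U"
      using assms that unfolding slices_in_def by (auto simp: words_def)
    then show "slice m (\<lambda>y. r (u @ y)) u' y \<in> U" unfolding slice_def append_assoc .
  qed
  show "slices_in m U i (\<lambda>u. r (u @ y))" if "y \<in> words m (n - i)" "i \<le> n"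
    unfolding slices_in_def
  proof (intro allI impI)
    fix u y' assume *: "set u \<subseteq> {..<m}" "set y' \<subseteq> {..<m}" "length u + length y' + 2 = i"
    then have "slice m r u (y' @ y) \<in> U"
      using assms that unfolding slices_in_def by (auto simp: words_def)
    then show "slice m (\<lambda>u. r (u @ y)) u y' \<in> U" unfolding slice_def append_assoc .
  qed
qed

lemma sum_words_two: "(\<Sum>w\<in>words m 2. f w) = (\<Sum>i<m. \<Sum>l<m. f [i, l])"
proof -
  have one: "(\<Sum>w\<in>words m 1. g w) = (\<Sum>i<m. g [i])" for g :: "nat list \<Rightarrow> 'b::comm_monoid_add"
    by (rule sum.reindex_bij_witness[where i="\<lambda>i. [i]" and j=hd])
      (auto simp: words_def length_Suc_conv)
  have two: "words m 2 = words m (1 + 1)" by (simp add: numeral_2_eq_2)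
  show ?thesis unfolding two sum_words_append one by simp
qed

text \<open>
  The ideal of \<open>T(V\<^sup>*)\<close> generated by \<open>U\<^sup>\<bottom>\<close> is, in degree \<open>n\<close>, the annihilator of the intersection of
  all \<open>V\<^sup>\<otimes>\<^sup>i \<otimes> U \<otimes> V\<^sup>\<otimes>\<^sup>j\<close>. The annihilator is an ideal that contains \<open>U\<^sup>\<bottom>\<close>. Conversely, a functional that
  vanishes on the ideal is given by a function whose slices vanish on \<open>U\<^sup>\<bottom>\<close>, so lie in \<open>U\<close>.
\<close>

theorem orthogonal_ideal:
  assumes U: "quadratic_relations m U" and t: "t \<in> carrier (tensor_alg m)"
  shows "t \<in> Idl\<^bsub>tensor_alg m\<^esub> (orthogonal_relations m U)
    \<longleftrightarrow> (\<forall>n r. slices_in m U n r \<longrightarrow> pairing m n t r = 0)"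
proof -
  interpret k_algebra "tensor_alg m :: ('a, nat list \<Rightarrow> 'a) module" by (rule tensor_k_algebra)
  let ?T = "tensor_alg m :: ('a, nat list \<Rightarrow> 'a) module"
  let ?U = "orthogonal_relations m U"
  let ?I = "Idl\<^bsub>?T\<^esub> ?U"
  let ?J = "{t\<in>carrier ?T. \<forall>n r. slices_in m U n r \<longrightarrow> pairing m n t r = 0}"
  have Usub: "?U \<subseteq> carrier ?T" by (auto simp: orthogonal_relations_def tensor_part_def)
  \<comment> \<open>The annihilator \<open>?J\<close> is an ideal because the slices of \<open>r\<close> at the ends of a word satisfy the same condition.\<close>
  have "ideal ?J ?T"
  proof (rule idealI[OF ring_axioms])
    show "subgroup ?J (add_monoid ?T)"
    proof (rule add.subgroupI)
      show "?J \<noteq> {}" by (auto simp: pairing_def tensor_simps intro!: exI[of _ "\<lambda>_. 0"])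
      show "\<ominus>\<^bsub>?T\<^esub> s \<in> ?J" if s: "s \<in> ?J" for s
        using s a_inv_closed[of s] tensor_minus(1)[of s m s] by (auto simp: pairing_def sum_negf)
    qed (auto simp: pairing_def tensor_simps(5) tensor_add_closed sum.distrib distrib_right)
  next
    fix s t assume s: "s \<in> ?J" and t: "t \<in> carrier ?T"
    then have zero: "slices_in m U n r \<Longrightarrow> pairing m n s r = 0" for n r by blast
    have "pairing m n (t \<otimes>\<^bsub>?T\<^esub> s) r = 0 \<and> pairing m n (s \<otimes>\<^bsub>?T\<^esub> t) r = 0"
      if r: "slices_in m U n r" for n r
    proof
      have "pairing m (n - i) s (\<lambda>y. r (u @ y)) = 0" if "i \<le> n" "u \<in> words m i" for i u
        by (rule zero[OF slices_in_append(1)[OF r that(2,1)]])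
      then show "pairing m n (t \<otimes>\<^bsub>?T\<^esub> s) r = 0" by (simp add: pairing_mult_left)
      have "pairing m i s (\<lambda>u. r (u @ y)) = 0" if "i \<le> n" "y \<in> words m (n - i)" for i y
        by (rule zero[OF slices_in_append(2)[OF r that(2,1)]])
      then show "pairing m n (s \<otimes>\<^bsub>?T\<^esub> t) r = 0" by (simp add: pairing_mult_right)
    qed
    then show "t \<otimes>\<^bsub>?T\<^esub> s \<in> ?J" "s \<otimes>\<^bsub>?T\<^esub> t \<in> ?J" using s t by auto
  qed
  moreover have "?U \<subseteq> ?J"
  proof
    fix g assume g: "g \<in> ?U"
    have "pairing m n g r = 0" if r: "slices_in m U n r" for n r
    proof (cases "n = 2")
      case True
      then have "slice m r [] [] \<in> U" using r by (simp add: slices_in_def)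
      then have "(\<Sum>i<m. \<Sum>j<m. g [i, j] * slice m r [] [] [i, j]) = 0"
        using g unfolding orthogonal_relations_def by blast
      moreover have "slice m r [] [] [i, j] = r [i, j]" if "i < m" "j < m" for i j
        using that by (simp add: slice_def words_def)
      ultimately show ?thesis using True by (simp add: pairing_def sum_words_two)
    next
      case False
      then show ?thesis using g
        by (auto simp: pairing_def orthogonal_relations_def tensor_part_iff words_def intro!: sum.neutral)
    qed
    then show "g \<in> ?J" using g Usub by auto
  qed
  ultimately have IJ: "?I \<subseteq> ?J" by (rule genideal_minimal)
  interpret I: ideal ?I ?T by (rule genideal_ideal[OF Usub])
  interpret I: algebra_ideal ?T ?I ..
  have closed: "(\<lambda>w. f w + g w) \<in> ?I" "(\<lambda>w. c * f w) \<in> ?I" "(\<lambda>_. 0) \<in> ?I"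
    if "f \<in> ?I" "g \<in> ?I" for f g c
    using I.a_closed[OF that] I.smult_ideal[OF that(1), of c] I.zero_closed by (simp_all add: tensor_simps)
  have zero: "(\<lambda>_. 0) \<in> ?I" using I.zero_closed by (simp add: tensor_simps)
  \<comment> \<open>The converse for homogeneous \<open>s\<close>: separate \<open>s\<close> from the ideal by a functional \<open>\<theta>\<close> on \<open>V\<^sup>\<otimes>\<^sup>n\<close>.\<close>
  have part: "s \<in> ?I" if s: "s \<in> tensor_part m n"
    and perp: "\<And>r. slices_in m U n r \<Longrightarrow> pairing m n s r = 0" for s n
  proof (rule ccontr)
    assume "s \<notin> ?I"
    let ?S = "?I \<inter> tensor_part m n"
    have "fun_space.subspace ?S"
    proof (rule fun_space.subspaceI)
      show "0 \<in> ?S" using zero by (simp add: tensor_part_iff zero_fun_def)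
      show "x + y \<in> ?S" if "x \<in> ?S" "y \<in> ?S" for x y
        using that closed(1)[of x y] by (simp add: tensor_part_iff plus_fun_def)
      show "(\<lambda>w. c * x w) \<in> ?S" if "x \<in> ?S" for c x
        using that closed(2)[of x x c] by (simp add: tensor_part_iff)
    qed
    then obtain \<theta> where \<theta>: "functional (\<lambda>c f w. c * f w) \<theta>" "\<theta> s = 1" "\<And>x. x \<in> ?S \<Longrightarrow> \<theta> x = 0"
      using fun_space.separating_functional[of ?S s] \<open>s \<notin> ?I\<close> by blast
    define r where "r u = \<theta> (single u)" for u
    have "slices_in m U n r"
      unfolding slices_in_def
    proof (intro allI impI, rule ccontr)
      fix u y assume uy: "set u \<subseteq> {..<m}" "set y \<subseteq> {..<m}" "length u + length y + 2 = n"
        and "slice m r u y \<notin> U"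
      have "fun_space.subspace U"
      proof (rule fun_space.subspaceI)
        have sm: "submodule U ground ?T" using U by (simp add: quadratic_relations_def)
        have sg: "subgroup U (add_monoid ?T)" using sm by (rule submodule.axioms(1))
        show "0 \<in> U" using subgroup.one_closed[OF sg] by (simp add: tensor_simps zero_fun_def)
        show "x + y \<in> U" if "x \<in> U" "y \<in> U" for x y
          using subgroup.m_closed[OF sg that] by (simp add: tensor_simps plus_fun_def)
        show "(\<lambda>w. c * x w) \<in> U" if "x \<in> U" for c x
          using submodule.smult_closed[OF sm _ that, of c]
          by (simp add: tensor_simps ground_def type_alg_def)
      qed
      \<comment> \<open>A slice outside of \<open>U\<close> is separated from \<open>U\<close> by an element \<open>g\<close> of the orthogonal complement. Putting
        \<open>g\<close> between \<open>u\<close> and \<open>y\<close> gives an element of the ideal on which \<open>\<theta>\<close> is \<open>1\<close>.\<close>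
      then obtain \<theta>' where \<theta>': "functional (\<lambda>c f w. c * f w) \<theta>'" "\<theta>' (slice m r u y) = 1"
        "\<And>x. x \<in> U \<Longrightarrow> \<theta>' x = 0"
        using fun_space.separating_functional[of U "slice m r u y"] \<open>slice m r u y \<notin> U\<close> by blast
      define g where "g w = (if w \<in> words m 2 then \<theta>' (single w) else 0)" for w
      have g2: "g \<in> tensor_part m 2" by (simp add: tensor_part_iff g_def)
      have gpair: "pairing m 2 g x = \<theta>' x" if "x \<in> tensor_part m 2" for x
        unfolding functional_pairing[OF \<theta>'(1) that] pairing_def
        by (intro sum.cong) (auto simp: g_def mult.commute)
      have "g \<in> ?U"
        unfolding orthogonal_relations_def
        using g2 gpair \<theta>'(3) U
        by (auto simp: pairing_def sum_words_two quadratic_relations_def subset_iff)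
      then have gI: "g \<in> ?I" using genideal_self[OF Usub] by blast
      let ?h = "single u \<otimes>\<^bsub>?T\<^esub> (g \<otimes>\<^bsub>?T\<^esub> single y)"
      have "?h \<in> ?I"
        using gI single_closed[OF uy(1)] single_closed[OF uy(2)]
        by (intro I.I_l_closed I.I_r_closed)
      moreover have "?h \<in> tensor_part m (length u + (2 + length y))"
        using uy by (intro tensor_part_mult g2) (auto simp: tensor_part_iff single_def words_def)
      then have h: "?h \<in> tensor_part m n" using uy(3) by (simp add: algebra_simps)
      ultimately have "\<theta> ?h = 0" using \<theta>(3) by blast
      moreover have "\<theta> ?h = pairing m n ?h r" using functional_pairing[OF \<theta>(1) h] by (simp add: r_def[abs_def])
      moreover have "pairing m n ?h r = pairing m 2 g (\<lambda>w. r (u @ w @ y))"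
        using uy by (subst pairing_single_left[of u m "length u"], simp_all add: words_def,
            subst pairing_single_right[of y m "length y"]) (auto simp: words_def)
      moreover have "\<dots> = pairing m 2 g (slice m r u y)"
        unfolding pairing_def by (intro sum.cong) (auto simp: slice_def)
      moreover have "\<dots> = 1" using gpair[of "slice m r u y"] \<theta>'(2) by (simp add: tensor_part_iff slice_def)
      ultimately show False by simp
    qed
    then have "pairing m n s r = 0" by (rule perp)
    then show False using functional_pairing[OF \<theta>(1) s] \<theta>(2) by (simp add: r_def[abs_def])
  qed
  have "t \<in> ?I" if perp: "\<forall>n r. slices_in m U n r \<longrightarrow> pairing m n t r = 0"
  proof -
    have "hpart n t \<in> ?I" for n
      using hpart_in[OF t] by (rule part) (use perp in \<open>simp add: pairing_hpart\<close>)
    then have sums: "(\<Sum>n\<in>N. hpart n t) \<in> ?I" for N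
      using closed(1) zero
      by (induction N rule: infinite_finite_induct) (auto simp: zero_fun_def plus_fun_def)
    show ?thesis using sums[of "length ` {w. t w \<noteq> 0}"] hpart_sum[OF t] by simp
  qed
  then show ?thesis using IJ by blast
qed

text \<open>The conditions in the conclusion define an ideal that contains \<open>U\<close>.\<close>

lemma quadratic_ideal_low_degrees:
  assumes U: "quadratic_relations m U" and t: "t \<in> Idl\<^bsub>tensor_alg m\<^esub> U"
  shows "t [] = 0" "t [i] = 0" "hpart 2 t \<in> U"
proof -
  interpret k_algebra "tensor_alg m :: ('a, nat list \<Rightarrow> 'a) module" by (rule tensor_k_algebra)
  let ?T = "tensor_alg m :: ('a, nat list \<Rightarrow> 'a) module"
  have sm: "submodule U ground ?T" and U2: "U \<subseteq> tensor_part m 2"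
    using U by (simp_all add: quadratic_relations_def)
  have sg: "subgroup U (add_monoid ?T)" using sm by (rule submodule.axioms(1))
  have zero: "(\<lambda>_. 0) \<in> U" using subgroup.one_closed[OF sg] by (simp add: tensor_simps)
  have add: "(\<lambda>w. x w + y w) \<in> U" if "x \<in> U" "y \<in> U" for x y
    using subgroup.m_closed[OF sg that] by (simp add: tensor_simps)
  have scale: "(\<lambda>w. c * x w) \<in> U" if "x \<in> U" for c x
    using submodule.smult_closed[OF sm _ that, of c] by (simp add: tensor_simps ground_def type_alg_def)
  let ?J = "{t\<in>carrier ?T. t [] = 0 \<and> (\<forall>i. t [i] = 0) \<and> hpart 2 t \<in> U}"
  have "ideal ?J ?T"
  proof (rule idealI[OF ring_axioms])
    show "subgroup ?J (add_monoid ?T)"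
    proof (rule add.subgroupI)
      show "?J \<noteq> {}" using zero by (auto simp: tensor_simps hpart_def intro!: exI[of _ "\<lambda>_. 0"])
      fix a assume a: "a \<in> ?J"
      have "hpart 2 (\<lambda>w. - a w) = (\<lambda>w. - 1 * hpart 2 a w)" by (auto simp: hpart_def)
      then have "hpart 2 (\<lambda>w. - a w) \<in> U" using scale[of "hpart 2 a" "- 1"] a by simp
      then show "\<ominus>\<^bsub>?T\<^esub> a \<in> ?J"
        using a a_inv_closed[of a] by (auto simp: tensor_minus(1)[of a m a])
    next
      fix a b assume ab: "a \<in> ?J" "b \<in> ?J"
      have "hpart 2 (\<lambda>w. a w + b w) = (\<lambda>w. hpart 2 a w + hpart 2 b w)" by (auto simp: hpart_def)
      then show "a \<oplus>\<^bsub>?T\<^esub> b \<in> ?J" using ab add by (simp add: tensor_simps(5) tensor_add_closed)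
    qed auto
  next
    fix s t assume s: "s \<in> ?J" and t: "t \<in> carrier ?T"
    have low: "s w = 0" if "length w < 2" for w
    proof (cases w)
      case (Cons i w')
      then show ?thesis using s that by (cases w') auto
    qed (use s in auto)
    have "hpart 2 (t \<otimes>\<^bsub>?T\<^esub> s) = (\<lambda>w. t [] * hpart 2 s w)"
    proof
      fix w show "hpart 2 (t \<otimes>\<^bsub>?T\<^esub> s) w = t [] * hpart 2 s w"
      proof (cases "length w = 2")
        case True
        then have "(t \<otimes>\<^bsub>?T\<^esub> s) w = (\<Sum>i\<le>length w. if i = 0 then t [] * s w else 0)"
          unfolding tensor_simps using low by (intro sum.cong) auto
        then show ?thesis using True by (simp add: hpart_def)
      qed (simp add: hpart_def)
    qed
    moreover have "(t \<otimes>\<^bsub>?T\<^esub> s) w = 0" if "length w < 2" for w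
      unfolding tensor_simps using low that by (intro sum.neutral) auto
    ultimately show "t \<otimes>\<^bsub>?T\<^esub> s \<in> ?J" using s t scale by auto
    have "hpart 2 (s \<otimes>\<^bsub>?T\<^esub> t) = (\<lambda>w. t [] * hpart 2 s w)"
    proof
      fix w show "hpart 2 (s \<otimes>\<^bsub>?T\<^esub> t) w = t [] * hpart 2 s w"
      proof (cases "length w = 2")
        case True
        then have "(s \<otimes>\<^bsub>?T\<^esub> t) w = (\<Sum>i\<le>length w. if i = 2 then t [] * s w else 0)"
          unfolding tensor_simps using low by (intro sum.cong) auto
        then show ?thesis using True by (simp add: hpart_def)
      qed (simp add: hpart_def)
    qed
    moreover have "(s \<otimes>\<^bsub>?T\<^esub> t) w = 0" if "length w < 2" for w
      unfolding tensor_simps using low that by (intro sum.neutral) auto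
    ultimately show "s \<otimes>\<^bsub>?T\<^esub> t \<in> ?J" using s t scale by auto
  qed
  moreover have "U \<subseteq> ?J"
  proof
    fix x assume x: "x \<in> U"
    then have "x \<in> tensor_part m 2" using U2 by blast
    moreover from this have "x [] = 0" "x [i] = 0" for i by (simp_all add: tensor_part_iff words_def)
    ultimately show "x \<in> ?J" using x by (simp add: tensor_part_carrier hpart_tensor_part)
  qed
  ultimately have "Idl\<^bsub>?T\<^esub> U \<subseteq> ?J" by (rule genideal_minimal)
  then show "t [] = 0" "t [i] = 0" "hpart 2 t \<in> U" using t by auto
qed

section \<open>Associated graded algebras\<close>

context k_algebra
begin

lemma smult_zero_left: "x \<in> carrier R \<Longrightarrow> 0 \<odot> x = \<zero>"
  using smult_rules(1)[of x x 0] smult_rules(2)[of x x 0 0] by simp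

lemma smult_minus_one: "x \<in> carrier R \<Longrightarrow> (- 1) \<odot> x = \<ominus> x"
  using smult_rules(1)[of x x "- 1"] smult_rules(2)[of x x "- 1" 1] smult_rules(5)[of x x]
  by (intro minus_equality[symmetric]) (simp_all add: smult_zero_left)

end

text \<open>
  To compare \<open>gr E\<close> with a quotient \<open>T(V)/I\<close>, it suffices to know which homogeneous tensors represent
  the class of an element of \<open>F n\<close>; \<open>rho n x t\<close> expresses that \<open>t\<close> does so.
\<close>

locale symbol_relation = k_algebra E for E :: "('k::field, 'e) module" (structure) +
  fixes F :: "nat \<Rightarrow> 'e set" and m :: nat and I :: "(nat list \<Rightarrow> 'k) set"
    and rho :: "nat \<Rightarrow> 'e \<Rightarrow> (nat list \<Rightarrow> 'k) \<Rightarrow> bool"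
  assumes filtration: "alg_filtration E F" and ideal: "ideal I (tensor_alg m)"
    and rho_in: "rho n x t \<Longrightarrow> x \<in> F n" "rho n x t \<Longrightarrow> t \<in> tensor_part m n"
    and rho_left: "x \<in> F n \<Longrightarrow> \<exists>t. rho n x t"
    and rho_right: "t \<in> tensor_part m n \<Longrightarrow> \<exists>x. rho n x t"
    and rho_add: "rho n x t \<Longrightarrow> rho n y s \<Longrightarrow> rho n (x \<oplus> y) (\<lambda>w. t w + s w)"
    and rho_smult: "rho n x t \<Longrightarrow> rho n (c \<odot> x) (\<lambda>w. c * t w)"
    and rho_mult: "rho n x t \<Longrightarrow> rho l y s \<Longrightarrow> rho (n + l) (x \<otimes> y) (t \<otimes>\<^bsub>tensor_alg m\<^esub> s)"
    and rho_one: "rho 0 \<one> (single [])"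
    and rho_kernel: "x \<in> F n \<Longrightarrow> rho n x (\<lambda>_. 0) \<longleftrightarrow> x \<in> F (Suc n)"
    and rho_ideal: "rho n \<zero> t \<longleftrightarrow> t \<in> tensor_part m n \<and> t \<in> I"
    and ideal_homogeneous: "t \<in> I \<Longrightarrow> hpart n t \<in> I"
begin

lemma F_subgroup: "abelian_subgroup (F n) E"
proof (rule abelian_subgroupI3)
  have "submodule (F n) ground E" using filtration by (simp add: alg_filtration_def)
  then show "additive_subgroup (F n) E"
    by (intro additive_subgroupI) (rule submodule.axioms(1))
qed (rule is_abelian_group)

lemma F_additive: "additive_subgroup (F n) E"
  using F_subgroup by (rule abelian_subgroup.axioms(1))

lemma F_carrier: "x \<in> F n \<Longrightarrow> x \<in> carrier E"
  using additive_subgroup.a_subset[OF F_additive] by blast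

lemma F_decreasing: "x \<in> F (Suc n) \<Longrightarrow> x \<in> F n"
  using filtration by (auto simp: alg_filtration_def)

lemma T_ideal: "algebra_ideal (tensor_alg m) I"
  using tensor_k_algebra ideal by (simp add: algebra_ideal_def)

sublocale T: algebra_ideal "tensor_alg m" I
  by (rule T_ideal)

lemma ideal_closed:
  "(\<lambda>_. 0) \<in> I" "t \<in> I \<Longrightarrow> s \<in> I \<Longrightarrow> (\<lambda>w. t w + s w) \<in> I" "t \<in> I \<Longrightarrow> (\<lambda>w. c * t w) \<in> I"
  using additive_subgroup.zero_closed[OF ideal.axioms(1)[OF ideal]]
    additive_subgroup.a_closed[OF ideal.axioms(1)[OF ideal], of t s] T.smult_ideal[of t c]
  by (simp_all add: tensor_simps(4,5,6))

lemma rho_zero: "rho n \<zero> (\<lambda>_. 0)"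
  using rho_ideal ideal_closed by (simp add: tensor_part_iff)

lemma rho_uminus: "rho n x t \<Longrightarrow> rho n (\<ominus> x) (\<lambda>w. - t w)"
  using rho_smult[of n x t "- 1"] smult_minus_one[OF F_carrier[OF rho_in(1)]] by simp

lemma rho_coset: "rho n x t \<Longrightarrow> y \<in> F (Suc n) +> x \<Longrightarrow> rho n y t"
proof -
  assume x: "rho n x t" and "y \<in> F (Suc n) +> x"
  then obtain z where z: "z \<in> F (Suc n)" "y = z \<oplus> x" by (auto simp: a_r_coset_def')
  then have "rho n z (\<lambda>_. 0)" using rho_kernel F_decreasing by blast
  from rho_add[OF this x] show "rho n y t" using z by simp
qed

lemma coset_eqI:
  assumes x: "rho n x t" and y: "rho n y t"
  shows "F (Suc n) +> x = F (Suc n) +> y"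
proof -
  have c: "x \<in> carrier E" "y \<in> carrier E" using assms F_carrier rho_in(1) by blast+
  have "rho n (x \<ominus> y) (\<lambda>_. 0)" using rho_add[OF x rho_uminus[OF y]] by (simp add: a_minus_def)
  then have "x \<ominus> y \<in> F (Suc n)" using rho_kernel rho_in(1) by blast
  moreover have "x = (x \<ominus> y) \<oplus> y" using c by (simp add: a_minus_def a_assoc l_neg)
  ultimately have "x \<in> F (Suc n) +> y" by (auto simp: a_r_coset_def')
  then show ?thesis
    using a_repr_independence[OF _ c(2)] F_additive
    by (metis additive_subgroup.a_subgroup)
qed

lemma coset_self: "x \<in> F n \<Longrightarrow> x \<in> F (Suc n) +> x"
  using abelian_subgroup.a_rcos_self[OF F_subgroup F_carrier] .

lemma coset_zero: "F (Suc n) +> \<zero> = F (Suc n)"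
  by (rule a_coset_add_zero) (use F_carrier in blast)

text \<open>The element \<open>\<phi>\<close> of \<open>gr E\<close> has the symbol \<open>t\<close>.\<close>

definition represents :: "(nat \<Rightarrow> 'e set) \<Rightarrow> (nat list \<Rightarrow> 'k) \<Rightarrow> bool" where
  "represents \<phi> t \<longleftrightarrow> t \<in> carrier (tensor_alg m) \<and>
     (\<forall>n. \<exists>x. \<phi> n = F (Suc n) +> x \<and> rho n x (hpart n t))"

lemma hpart_add: "hpart n (\<lambda>w. t w + s w) = (\<lambda>w. hpart n t w + hpart n s w)"
  and hpart_scale: "hpart n (\<lambda>w. c * t w) = (\<lambda>w. c * hpart n t w)"
  by (auto simp: hpart_def)

lemma represents_add:
  assumes "represents \<phi> t" "represents \<psi> s"
  shows "represents (\<phi> \<oplus>\<^bsub>gr_alg E F\<^esub> \<psi>) (\<lambda>w. t w + s w)"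
  unfolding represents_def
proof (intro conjI allI)
  show "(\<lambda>w. t w + s w) \<in> carrier (tensor_alg m)"
    using assms tensor_add_closed by (auto simp: represents_def)
  fix n
  obtain x y where x: "\<phi> n = F (Suc n) +> x" "rho n x (hpart n t)"
    and y: "\<psi> n = F (Suc n) +> y" "rho n y (hpart n s)"
    using assms unfolding represents_def by metis
  have "(\<phi> \<oplus>\<^bsub>gr_alg E F\<^esub> \<psi>) n = F (Suc n) +> (x \<oplus> y)"
    using abelian_subgroup.a_rcos_sum[OF F_subgroup, of x y] F_carrier[OF rho_in(1)[OF x(2)]]
      F_carrier[OF rho_in(1)[OF y(2)]] by (simp add: gr_alg_def x(1) y(1))
  then show "\<exists>z. (\<phi> \<oplus>\<^bsub>gr_alg E F\<^esub> \<psi>) n = F (Suc n) +> z \<and> rho n z (hpart n (\<lambda>w. t w + s w))"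
    using rho_add[OF x(2) y(2)] by (auto simp: hpart_add)
qed

lemma represents_smult:
  assumes "represents \<phi> t"
  shows "represents (c \<odot>\<^bsub>gr_alg E F\<^esub> \<phi>) (\<lambda>w. c * t w)"
  unfolding represents_def
proof (intro conjI allI)
  show "(\<lambda>w. c * t w) \<in> carrier (tensor_alg m)"
    using assms tensor_scale_closed by (auto simp: represents_def)
  fix n
  obtain x where x: "\<phi> n = F (Suc n) +> x" "rho n x (hpart n t)"
    using assms unfolding represents_def by metis
  have "F (Suc n) +> (c \<odot> y) = F (Suc n) +> (c \<odot> x)" if "y \<in> \<phi> n" for y
    using coset_eqI[OF rho_smult rho_smult] rho_coset[OF x(2)] x that by blast
  moreover have "x \<in> \<phi> n" using coset_self[OF rho_in(1)[OF x(2)]] x(1) by simp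
  ultimately have "(\<Union>y\<in>\<phi> n. F (Suc n) +> (c \<odot> y)) = F (Suc n) +> (c \<odot> x)" by blast
  then have "(c \<odot>\<^bsub>gr_alg E F\<^esub> \<phi>) n = F (Suc n) +> (c \<odot> x)" by (simp add: gr_alg_def)
  then show "\<exists>z. (c \<odot>\<^bsub>gr_alg E F\<^esub> \<phi>) n = F (Suc n) +> z \<and> rho n z (hpart n (\<lambda>w. c * t w))"
    using rho_smult[OF x(2)] by (auto simp: hpart_scale)
qed

lemma rho_convolution:
  assumes x: "\<And>i. i \<le> n \<Longrightarrow> rho i (x i) (hpart i t)" and y: "\<And>i. i \<le> n \<Longrightarrow> rho i (y i) (hpart i s)"
  shows "rho n (\<Oplus>i\<in>{..n}. x i \<otimes> y (n - i)) (hpart n (t \<otimes>\<^bsub>tensor_alg m\<^esub> s))"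
proof -
  have xy: "x i \<otimes> y (n - i) \<in> carrier E" if "i \<le> n" for i
    using that x y F_carrier rho_in(1) by (meson diff_le_self m_closed)
  have "rho n (\<Oplus>i\<in>S. x i \<otimes> y (n - i)) (\<Sum>i\<in>S. hpart i t \<otimes>\<^bsub>tensor_alg m\<^esub> hpart (n - i) s)"
    if "finite S" "S \<subseteq> {..n}" for S
    using that
  proof (induction S rule: finite_induct)
    case empty
    then show ?case using rho_zero by (simp add: zero_fun_def)
  next
    case (insert i S)
    then have i: "i \<le> n" by simp
    have "rho (i + (n - i)) (x i \<otimes> y (n - i)) (hpart i t \<otimes>\<^bsub>tensor_alg m\<^esub> hpart (n - i) s)"
      using x[OF i] y[of "n - i"] by (intro rho_mult) auto
    then have "rho n (x i \<otimes> y (n - i)) (hpart i t \<otimes>\<^bsub>tensor_alg m\<^esub> hpart (n - i) s)" using i by simp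
    moreover have "rho n (\<Oplus>i\<in>S. x i \<otimes> y (n - i)) (\<Sum>i\<in>S. hpart i t \<otimes>\<^bsub>tensor_alg m\<^esub> hpart (n - i) s)"
      using insert by auto
    ultimately have "rho n ((x i \<otimes> y (n - i)) \<oplus> (\<Oplus>i\<in>S. x i \<otimes> y (n - i)))
        (\<lambda>w. (hpart i t \<otimes>\<^bsub>tensor_alg m\<^esub> hpart (n - i) s) w
           + (\<Sum>i\<in>S. hpart i t \<otimes>\<^bsub>tensor_alg m\<^esub> hpart (n - i) s) w)" by (rule rho_add)
    moreover have "(\<Oplus>i\<in>insert i S. x i \<otimes> y (n - i))
        = (x i \<otimes> y (n - i)) \<oplus> (\<Oplus>i\<in>S. x i \<otimes> y (n - i))"
      using insert xy by (intro finsum_insert) auto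
    ultimately show ?case using insert.hyps by (simp add: plus_fun_def)
  qed
  from this[of "{..n}"] show ?thesis by (simp add: hpart_mult)
qed

lemma represents_mult:
  assumes t: "represents \<phi> t" and s: "represents \<psi> s"
  shows "represents (\<phi> \<otimes>\<^bsub>gr_alg E F\<^esub> \<psi>) (t \<otimes>\<^bsub>tensor_alg m\<^esub> s)"
  unfolding represents_def
proof (intro conjI allI)
  show "t \<otimes>\<^bsub>tensor_alg m\<^esub> s \<in> carrier (tensor_alg m)"
    using assms by (auto simp: represents_def intro: T.m_closed)
  fix n :: nat
  have reps: "rho i x (hpart i t)" if "x \<in> \<phi> i" for i x
    using t that rho_coset unfolding represents_def by metis
  have reps': "rho i x (hpart i s)" if "x \<in> \<psi> i" for i x
    using s that rho_coset unfolding represents_def by metis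
  have "\<exists>x. x \<in> \<phi> i" "\<exists>y. y \<in> \<psi> i" for i :: nat
    using t s coset_self rho_in(1) unfolding represents_def by metis+
  then obtain x y where xy: "\<And>i. x i \<in> \<phi> i" "\<And>i. y i \<in> \<psi> i" by metis
  let ?z = "\<lambda>x y. \<Oplus>i\<in>{..n}. x i \<otimes> y (n - i)"
  have conv: "rho n (?z x y) (hpart n (t \<otimes>\<^bsub>tensor_alg m\<^esub> s))"
    if "\<forall>i\<le>n. x i \<in> \<phi> i \<and> y i \<in> \<psi> i" for x y
    using that reps reps' by (intro rho_convolution) auto
  have "F (Suc n) +> ?z x' y' = F (Suc n) +> ?z x y" if "\<forall>i\<le>n. x' i \<in> \<phi> i \<and> y' i \<in> \<psi> i" for x' y'
    using coset_eqI[OF conv[OF that] conv[of x y]] xy by simp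
  then have "{F (Suc n) +> ?z x y | x y. \<forall>i\<le>n. x i \<in> \<phi> i \<and> y i \<in> \<psi> i} = {F (Suc n) +> ?z x y}"
    using xy by blast
  then have "(\<phi> \<otimes>\<^bsub>gr_alg E F\<^esub> \<psi>) n = F (Suc n) +> ?z x y" unfolding gr_alg_def by simp
  then show "\<exists>z. (\<phi> \<otimes>\<^bsub>gr_alg E F\<^esub> \<psi>) n = F (Suc n) +> z \<and> rho n z (hpart n (t \<otimes>\<^bsub>tensor_alg m\<^esub> s))"
    using conv[of x y] xy by blast
qed

lemma hpart_single: "hpart n (single []) = (if n = 0 then single [] else (\<lambda>_. 0))"
  by (auto simp: hpart_def single_def)

lemma represents_one: "represents \<one>\<^bsub>gr_alg E F\<^esub> (single [])"
  unfolding represents_def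
proof (intro conjI allI)
  show "single [] \<in> carrier (tensor_alg m)" by (rule single_closed) simp
  show "\<exists>x. \<one>\<^bsub>gr_alg E F\<^esub> n = F (Suc n) +> x \<and> rho n x (hpart n (single []))" for n
    using rho_one rho_zero[of n] coset_zero[of n]
    by (cases "n = 0") (auto simp: gr_alg_def hpart_single)
qed

lemma represents_total:
  assumes "\<phi> \<in> carrier (gr_alg E F)"
  shows "\<exists>t. represents \<phi> t"
proof -
  have fin: "finite {n. \<phi> n \<noteq> F (Suc n)}" using assms by (simp add: gr_alg_def)
  have \<phi>: "\<exists>x\<in>F n. \<phi> n = F (Suc n) +> x" for n using assms by (auto simp: gr_alg_def)
  have "\<exists>x t. \<phi> n = F (Suc n) +> x \<and> rho n x t \<and> (\<phi> n = F (Suc n) \<longrightarrow> t = (\<lambda>_. 0))" for n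
  proof (cases "\<phi> n = F (Suc n)")
    case True
    then show ?thesis using rho_zero coset_zero by metis
  next
    case False
    then show ?thesis using \<phi>[of n] rho_left by blast
  qed
  then obtain x t where xt: "\<And>n. \<phi> n = F (Suc n) +> x n" "\<And>n. rho n (x n) (t n)"
    "\<And>n. \<phi> n = F (Suc n) \<Longrightarrow> t n = (\<lambda>_. 0)" by metis
  define s where "s = (\<lambda>w. t (length w) w)"
  have "hpart n s = t n" for n
    using rho_in(2)[OF xt(2)[of n]] by (auto simp: hpart_def s_def tensor_part_def fun_eq_iff)
  moreover have "s \<in> carrier (tensor_alg m)"
  proof -
    have "{w. s w \<noteq> 0} \<subseteq> (\<Union>n\<in>{n. \<phi> n \<noteq> F (Suc n)}. {w. t n w \<noteq> 0})"
      using xt(3) by (fastforce simp: s_def)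
    moreover have "finite {w. t n w \<noteq> 0}" for n
      using tensor_part_carrier[OF rho_in(2)[OF xt(2)]] by (simp add: tensor_simps)
    ultimately have "finite {w. s w \<noteq> 0}" using fin by (auto intro: finite_subset)
    then show ?thesis
      using tensor_carrierD[OF tensor_part_carrier[OF rho_in(2)[OF xt(2)]]]
      by (auto simp: tensor_simps(1) s_def)
  qed
  ultimately have "represents \<phi> s" using xt unfolding represents_def by metis
  then show ?thesis by blast
qed

lemma represents_surjective:
  assumes t: "t \<in> carrier (tensor_alg m)"
  shows "\<exists>\<phi>\<in>carrier (gr_alg E F). represents \<phi> t \<and> (\<forall>n. hpart n t = (\<lambda>_. 0) \<longrightarrow> \<phi> n = F (Suc n))"
proof -
  have "\<exists>x. rho n x (hpart n t) \<and> (hpart n t = (\<lambda>_. 0) \<longrightarrow> x = \<zero>)" for n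
    using rho_right[OF hpart_in[OF t]] rho_zero by (cases "hpart n t = (\<lambda>_. 0)") auto
  then obtain x where x: "\<And>n. rho n (x n) (hpart n t)" "\<And>n. hpart n t = (\<lambda>_. 0) \<Longrightarrow> x n = \<zero>" by metis
  define \<phi> where "\<phi> n = F (Suc n) +> x n" for n
  have zero: "hpart n t = (\<lambda>_. 0) \<Longrightarrow> \<phi> n = F (Suc n)" for n using x(2) coset_zero by (simp add: \<phi>_def)
  have "finite (length ` {w. t w \<noteq> 0})" using t by (simp add: tensor_simps)
  moreover have "{n. \<phi> n \<noteq> F (Suc n)} \<subseteq> length ` {w. t w \<noteq> 0}"
  proof
    fix n assume "n \<in> {n. \<phi> n \<noteq> F (Suc n)}"
    then have "hpart n t \<noteq> (\<lambda>_. 0)" using zero by blast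
    then obtain w where "hpart n t w \<noteq> 0" by auto
    then show "n \<in> length ` {w. t w \<noteq> 0}" by (auto simp: hpart_def split: if_splits)
  qed
  ultimately have "finite {n. \<phi> n \<noteq> F (Suc n)}" by (rule rev_finite_subset)
  then have "\<phi> \<in> carrier (gr_alg E F)"
    using rho_in(1)[OF x(1)] by (auto simp: gr_alg_def \<phi>_def)
  moreover have "represents \<phi> t" using x(1) t by (auto simp: represents_def \<phi>_def)
  ultimately show ?thesis using zero by blast
qed

lemma represents_injective:
  assumes "represents \<phi> t" "represents \<psi> t" shows "\<phi> = \<psi>"
proof
  fix n
  obtain x where x: "\<phi> n = F (Suc n) +> x" "rho n x (hpart n t)"
    using assms(1) unfolding represents_def by blast
  obtain y where y: "\<psi> n = F (Suc n) +> y" "rho n y (hpart n t)"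
    using assms(2) unfolding represents_def by blast
  show "\<phi> n = \<psi> n" unfolding x(1) y(1) by (rule coset_eqI[OF x(2) y(2)])
qed

lemma ideal_hparts:
  assumes t: "t \<in> carrier (tensor_alg m)" and parts: "\<And>n. hpart n t \<in> I"
  shows "t \<in> I"
proof -
  have sums: "(\<Sum>n\<in>N. hpart n t) \<in> I" for N
    using ideal_closed(1,2) parts
    by (induction N rule: infinite_finite_induct) (auto simp: zero_fun_def plus_fun_def)
  show ?thesis using sums[of "length ` {w. t w \<noteq> 0}"] hpart_sum[OF t] by simp
qed

text \<open>The tensors that represent a given element form a coset of \<open>I\<close>, as \<open>rho_ideal\<close> says in each degree.\<close>

lemma represents_ideal:
  assumes t: "represents \<phi> t" and s: "s \<in> carrier (tensor_alg m)"
  shows "represents \<phi> s \<longleftrightarrow> I +>\<^bsub>tensor_alg m\<^esub> t = I +>\<^bsub>tensor_alg m\<^esub> s"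
proof -
  have tc: "t \<in> carrier (tensor_alg m)" using t by (simp add: represents_def)
  let ?u = "\<lambda>w. t w - s w"
  have uc: "?u \<in> carrier (tensor_alg m)"
    using tensor_minus(2)[OF tc s] T.minus_closed[OF tc s] by simp
  have eq: "I +>\<^bsub>tensor_alg m\<^esub> t = I +>\<^bsub>tensor_alg m\<^esub> s \<longleftrightarrow> ?u \<in> I"
    using T.coset_eq_iff[OF tc s] tensor_minus(2)[OF tc s] by simp
  have part: "hpart n ?u = (\<lambda>w. hpart n t w + - hpart n s w)" for n by (auto simp: hpart_def)
  show ?thesis unfolding eq
  proof
    assume s: "represents \<phi> s"
    show "?u \<in> I"
    proof (rule ideal_hparts[OF uc])
      fix n
      obtain x where x: "\<phi> n = F (Suc n) +> x" "rho n x (hpart n t)" using t unfolding represents_def by metis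
      obtain y where y: "\<phi> n = F (Suc n) +> y" "rho n y (hpart n s)" using s unfolding represents_def by metis
      have "x \<in> F (Suc n) +> y" using coset_self[OF rho_in(1)[OF x(2)]] x(1) y(1) by simp
      then have "rho n x (hpart n s)" by (rule rho_coset[OF y(2)])
      from rho_add[OF x(2) rho_uminus[OF this]] have "rho n \<zero> (hpart n ?u)"
        using F_carrier[OF rho_in(1)[OF x(2)]] by (simp add: part r_neg)
      then show "hpart n ?u \<in> I" using rho_ideal by blast
    qed
  next
    assume u: "?u \<in> I"
    have "\<exists>x. \<phi> n = F (Suc n) +> x \<and> rho n x (hpart n s)" for n
    proof -
      obtain x where x: "\<phi> n = F (Suc n) +> x" "rho n x (hpart n t)" using t unfolding represents_def by metis
      have "rho n \<zero> (hpart n ?u)" using rho_ideal ideal_homogeneous[OF u] hpart_in[OF uc] by blast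
      from rho_add[OF x(2) rho_uminus[OF this]] have "rho n x (hpart n s)"
        using F_carrier[OF rho_in(1)[OF x(2)]] by (simp add: part)
      then show ?thesis using x(1) by blast
    qed
    then show "represents \<phi> s" using s by (simp add: represents_def)
  qed
qed

text \<open>By \<open>represents_ideal\<close>, mapping an element to the coset of its symbols is well defined and injective.\<close>

theorem gr_iso:
  "graded_alg_iso (gr_alg E F) (gr_part E F) (alg_quot (tensor_alg m) I)
     (\<lambda>n. {I +>\<^bsub>tensor_alg m\<^esub> f | f. f \<in> tensor_part m n})"
proof -
  define h where "h \<phi> = I +>\<^bsub>tensor_alg m\<^esub> (SOME t. represents \<phi> t)" for \<phi>
  have h: "h \<phi> = I +>\<^bsub>tensor_alg m\<^esub> t" if t: "represents \<phi> t" for \<phi> t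
  proof -
    have "represents \<phi> (SOME t. represents \<phi> t)" by (rule someI[of "represents \<phi>", OF t])
    then show ?thesis using represents_ideal[of \<phi> _ t] t unfolding h_def represents_def by blast
  qed
  have tc: "t \<in> carrier (tensor_alg m)" if "represents \<phi> t" for \<phi> t
    using that by (simp add: represents_def)
  have hom: "h \<in> alg_hom (gr_alg E F) (alg_quot (tensor_alg m) I)"
    unfolding alg_hom_def
  proof (intro CollectI conjI allI ballI ring_hom_memI)
    fix \<phi> assume "\<phi> \<in> carrier (gr_alg E F)"
    then obtain t where t: "represents \<phi> t" using represents_total by blast
    show "h \<phi> \<in> carrier (alg_quot (tensor_alg m) I)"
      using h[OF t] T.coset_in_quot[OF tc[OF t]] by simp
    show "h (c \<odot>\<^bsub>gr_alg E F\<^esub> \<phi>) = c \<odot>\<^bsub>alg_quot (tensor_alg m) I\<^esub> h \<phi>" for c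
      using h[OF t] h[OF represents_smult[OF t]] T.quot_operations(3)[OF tc[OF t] tc[OF t]]
      by (simp add: tensor_simps(6))
    fix \<psi> assume "\<psi> \<in> carrier (gr_alg E F)"
    then obtain s where s: "represents \<psi> s" using represents_total by blast
    show "h (\<phi> \<otimes>\<^bsub>gr_alg E F\<^esub> \<psi>) = h \<phi> \<otimes>\<^bsub>alg_quot (tensor_alg m) I\<^esub> h \<psi>"
      using h[OF t] h[OF s] h[OF represents_mult[OF t s]] T.quot_operations(1)[OF tc[OF t] tc[OF s]] by simp
    show "h (\<phi> \<oplus>\<^bsub>gr_alg E F\<^esub> \<psi>) = h \<phi> \<oplus>\<^bsub>alg_quot (tensor_alg m) I\<^esub> h \<psi>"
      using h[OF t] h[OF s] h[OF represents_add[OF t s]] T.quot_operations(2)[OF tc[OF t] tc[OF s]]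
      by (simp add: tensor_simps(5))
  next
    show "h \<one>\<^bsub>gr_alg E F\<^esub> = \<one>\<^bsub>alg_quot (tensor_alg m) I\<^esub>"
      using h[OF represents_one] T.quot_one by (simp add: tensor_simps(3))
  qed
  have inj: "inj_on h (carrier (gr_alg E F))"
  proof (rule inj_onI)
    fix \<phi> \<psi> assume *: "\<phi> \<in> carrier (gr_alg E F)" "\<psi> \<in> carrier (gr_alg E F)" "h \<phi> = h \<psi>"
    obtain t where t: "represents \<phi> t" using represents_total[OF *(1)] by blast
    obtain s where s: "represents \<psi> s" using represents_total[OF *(2)] by blast
    have "represents \<phi> s" using represents_ideal[OF t tc[OF s]] *(3) h[OF t] h[OF s] by simp
    then show "\<phi> = \<psi>" using s by (rule represents_injective)
  qed
  have surj: "h ` carrier (gr_alg E F) = carrier (alg_quot (tensor_alg m) I)"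
  proof
    show "h ` carrier (gr_alg E F) \<subseteq> carrier (alg_quot (tensor_alg m) I)"
    proof (rule image_subsetI)
      show "h \<phi> \<in> carrier (alg_quot (tensor_alg m) I)" if "\<phi> \<in> carrier (gr_alg E F)" for \<phi>
        using represents_total[OF that] h T.coset_in_quot[OF tc] by metis
    qed
    show "carrier (alg_quot (tensor_alg m) I) \<subseteq> h ` carrier (gr_alg E F)"
    proof
      fix X assume "X \<in> carrier (alg_quot (tensor_alg m) I)"
      then obtain t where t: "t \<in> carrier (tensor_alg m)" "X = I +>\<^bsub>tensor_alg m\<^esub> t" by (rule T.quotE)
      obtain \<phi> where "\<phi> \<in> carrier (gr_alg E F)" "represents \<phi> t"
        using represents_surjective[OF t(1)] by blast
      then show "X \<in> h ` carrier (gr_alg E F)" using h t(2) by blast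
    qed
  qed
  have parts: "h ` gr_part E F n = {I +>\<^bsub>tensor_alg m\<^esub> f | f. f \<in> tensor_part m n}" for n
  proof
    show "h ` gr_part E F n \<subseteq> {I +>\<^bsub>tensor_alg m\<^esub> f | f. f \<in> tensor_part m n}"
    proof
      fix X assume "X \<in> h ` gr_part E F n"
      then obtain \<phi> where \<phi>: "\<phi> \<in> carrier (gr_alg E F)" "\<And>k. k \<noteq> n \<Longrightarrow> \<phi> k = F (Suc k)" "X = h \<phi>"
        by (auto simp: gr_part_def)
      obtain t where t: "represents \<phi> t" using represents_total[OF \<phi>(1)] by blast
      have f: "hpart n t \<in> tensor_part m n" using hpart_in[OF tc[OF t]] .
      have "represents \<phi> (hpart n t)"
        unfolding represents_def
      proof (intro conjI allI)
        show "hpart n t \<in> carrier (tensor_alg m)" using tensor_part_carrier[OF f] .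
        show "\<exists>x. \<phi> k = F (Suc k) +> x \<and> rho k x (hpart k (hpart n t))" for k
        proof (cases "k = n")
          case True
          then show ?thesis
            using t hpart_tensor_part[OF f, of k] unfolding represents_def by simp
        next
          case False
          then have "\<phi> k = F (Suc k) +> \<zero>" using \<phi>(2) coset_zero by simp
          then show ?thesis using False rho_zero[of k] hpart_tensor_part[OF f, of k] by auto
        qed
      qed
      from h[OF this] show "X \<in> {I +>\<^bsub>tensor_alg m\<^esub> f | f. f \<in> tensor_part m n}"
        using \<phi>(3) f by blast
    qed
    show "{I +>\<^bsub>tensor_alg m\<^esub> f | f. f \<in> tensor_part m n} \<subseteq> h ` gr_part E F n"
    proof
      fix X assume "X \<in> {I +>\<^bsub>tensor_alg m\<^esub> f | f. f \<in> tensor_part m n}"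
      then obtain f where f: "f \<in> tensor_part m n" "X = I +>\<^bsub>tensor_alg m\<^esub> f" by blast
      obtain \<phi> where \<phi>: "\<phi> \<in> carrier (gr_alg E F)" "represents \<phi> f"
        "\<And>k. hpart k f = (\<lambda>_. 0) \<Longrightarrow> \<phi> k = F (Suc k)"
        using represents_surjective[OF tensor_part_carrier[OF f(1)]] by blast
      then have "\<phi> \<in> gr_part E F n" using hpart_tensor_part[OF f(1)] by (auto simp: gr_part_def)
      then show "X \<in> h ` gr_part E F n" using h[OF \<phi>(2)] f(2) by blast
    qed
  qed
  show ?thesis
    unfolding graded_alg_iso_def bij_betw_def using hom inj surj parts by blast
qed

end

section \<open>The cohomology algebra\<close>

context connected_dg_algebra
begin

lemma d_mult: "d (x * y) = d x * y + twist 1 x * d y"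
  using grading UNIV_I
proof (rule homogeneous_induct[of UNIV A x])
  fix i x assume x: "x \<in> A i"
  show "d (x * y) = d x * y + twist 1 x * d y"
    by (simp add: d_leibniz[OF x] twist_homogeneous[OF x] ksign_mult)
qed (simp add: distrib_right d_add twist_add algebra_simps)

lemma d_twist: "d (twist 1 x) = - twist 1 (d x)"
  using grading UNIV_I
proof (rule homogeneous_induct[of UNIV A x])
  fix i x assume x: "x \<in> A i"
  show "d (twist 1 x) = - twist 1 (d x)"
    by (simp add: twist_homogeneous[OF x] twist_homogeneous[OF d_degree[OF x]] ksign_def d_minus)
qed (simp add: d_add twist_add)

lemma twist_twist: "twist 1 (twist 1 x) = x"
  using grading UNIV_I
proof (rule homogeneous_induct[of UNIV A x])
  fix i x assume x: "x \<in> A i"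
  then have "ksign (int i) x \<in> A i" by (rule ksign_mem[OF A_subgroup])
  then show "twist 1 (twist 1 x) = x"
    by (simp add: twist_homogeneous[OF x] twist_homogeneous) (simp add: ksign_def)
qed (simp add: twist_add)

lemma cocycle_mult: "d x = 0 \<Longrightarrow> d y = 0 \<Longrightarrow> d (x * y) = 0"
  by (simp add: d_mult)

lemma boundary_mult:
  assumes "d x = 0" "y \<in> range d"
  shows "x * y \<in> range d" "y * x \<in> range d"
proof -
  obtain z where z: "y = d z" using assms(2) by blast
  have "d (twist 1 x * z) = x * y" using assms(1) by (simp add: d_mult d_twist twist_twist z)
  then show "x * y \<in> range d" by (metis rangeI)
  have "d (z * x) = y * x" using assms(1) by (simp add: d_mult z)
  then show "y * x \<in> range d" by (metis rangeI)
qed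

lemma component_boundary: "component A 0 (d x) = 0"
  "component A (Suc n) (d x) = d (component A n x)"
proof -
  show "component A 0 (d x) = 0"
    using grading UNIV_I
  proof (rule homogeneous_induct[of UNIV A x])
    fix i y assume "y \<in> A i"
    then show "component A 0 (d y) = 0" using component_homogeneous[OF grading d_degree] by simp
  qed (simp add: component_add[OF grading] d_add)
  show "component A (Suc n) (d x) = d (component A n x)"
    using grading UNIV_I
  proof (rule homogeneous_induct[of UNIV A x])
    fix i y assume "y \<in> A i"
    then show "component A (Suc n) (d y) = d (component A n y)"
      using component_homogeneous[OF grading d_degree] component_homogeneous[OF grading] by simp
  qed (simp add: component_add[OF grading] d_add)
qed

lemma component_cocycle: "d x = 0 \<Longrightarrow> d (component A n x) = 0"
  using component_boundary(2)[of n x] component_homogeneous[OF grading A_zero, of "Suc n" 0] by simp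

lemma one_not_boundary: "1 \<notin> range d"
proof
  assume "1 \<in> range d"
  then obtain x where x: "1 = d x" by blast
  then have "d x = 0" using boundary_degree_zero[of x] one_in by simp
  then show False using x by simp
qed

lemma cocycle_alg_simps:
  "carrier cocycle_alg = {x. d x = 0}" "x \<otimes>\<^bsub>cocycle_alg\<^esub> y = x * y" "x \<oplus>\<^bsub>cocycle_alg\<^esub> y = x + y"
  "\<one>\<^bsub>cocycle_alg\<^esub> = 1" "\<zero>\<^bsub>cocycle_alg\<^esub> = 0" "c \<odot>\<^bsub>cocycle_alg\<^esub> x = scale c x"
  by (simp_all add: cocycle_alg_def type_alg_def)

lemma cohomology_ideal: "algebra_ideal cocycle_alg (range d)"
proof -
  have "ring cocycle_alg"
  proof (rule ringI)
    show "abelian_group cocycle_alg"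
    proof (rule abelian_groupI)
      show "\<exists>y\<in>carrier cocycle_alg. y \<oplus>\<^bsub>cocycle_alg\<^esub> x = \<zero>\<^bsub>cocycle_alg\<^esub>"
        if "x \<in> carrier cocycle_alg" for x
        using that by (intro bexI[of _ "- x"]) (simp_all add: cocycle_alg_simps d_minus)
    qed (simp_all add: cocycle_alg_simps d_add add_ac)
    show "Group.monoid cocycle_alg"
      by (rule monoidI) (simp_all add: cocycle_alg_simps cocycle_mult d_one mult.assoc)
  qed (simp_all add: cocycle_alg_simps distrib_left distrib_right)
  then have "kalgebra cocycle_alg"
    by (rule kalgebraI) (simp_all add: cocycle_alg_simps d_scale scale_simps)
  then interpret k_algebra cocycle_alg by (rule k_algebraI)
  have "ideal (range d) cocycle_alg"
  proof (rule idealI[OF ring_axioms])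
    show "subgroup (range d) (add_monoid cocycle_alg)"
    proof (rule add.subgroupI)
      fix x assume x: "x \<in> range d"
      have "\<ominus>\<^bsub>cocycle_alg\<^esub> x = - x"
        using x by (intro minus_equality) (auto simp: cocycle_alg_simps d_minus d_square)
      then show "\<ominus>\<^bsub>cocycle_alg\<^esub> x \<in> range d" using x add_subgroupD(2)[OF boundaries_subgroup] by simp
    qed (auto simp: cocycle_alg_simps d_square simp flip: d_add)
  qed (simp_all add: cocycle_alg_simps boundary_mult)
  then show ?thesis by (simp add: algebra_ideal_def k_algebra_axioms)
qed

sublocale coh: algebra_ideal cocycle_alg "range d"
  by (rule cohomology_ideal)

abbreviation cl :: "'a \<Rightarrow> 'a set" where
  "cl x \<equiv> range d +>\<^bsub>cocycle_alg\<^esub> x"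

lemma cohomology_carrier: "X \<in> carrier cohomology_alg \<longleftrightarrow> (\<exists>x. d x = 0 \<and> X = cl x)"
  unfolding cohomology_alg_def coh.quot_carrier by (auto simp: cocycle_alg_simps)

lemma cl_operations:
  assumes "d x = 0" "d y = 0"
  shows "cl x \<otimes>\<^bsub>cohomology_alg\<^esub> cl y = cl (x * y)" "cl x \<oplus>\<^bsub>cohomology_alg\<^esub> cl y = cl (x + y)"
  using coh.quot_operations[of x y] assms by (simp_all add: cohomology_alg_def cocycle_alg_simps)

lemma cl_smult: "d x = 0 \<Longrightarrow> c \<odot>\<^bsub>cohomology_alg\<^esub> cl x = cl (scale c x)"
  using coh.quot_operations(3)[of x x c] by (simp add: cohomology_alg_def cocycle_alg_simps)

lemma cl_in: "d x = 0 \<Longrightarrow> cl x \<in> carrier cohomology_alg"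
  using cohomology_carrier by blast

lemma cl_units: "\<one>\<^bsub>cohomology_alg\<^esub> = cl 1" "\<zero>\<^bsub>cohomology_alg\<^esub> = cl 0"
  using coh.quot_one coh.quot_zero by (simp_all add: cohomology_alg_def cocycle_alg_simps)

lemma cl_eq_iff:
  assumes "d x = 0" "d y = 0"
  shows "cl x = cl y \<longleftrightarrow> x - y \<in> range d"
proof -
  have "\<ominus>\<^bsub>cocycle_alg\<^esub> y = - y"
    using assms by (intro coh.minus_equality) (auto simp: cocycle_alg_simps d_minus)
  then show ?thesis
    using coh.coset_eq_iff[of x y] assms by (simp add: cocycle_alg_simps a_minus_def)
qed

lemma cohomology_kalgebra: "kalgebra cohomology_alg"
  unfolding cohomology_alg_def by (rule coh.quot_kalgebra)

text \<open>Elements of positive degree have representatives without a component of degree zero, and nonzero scalars are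
  not coboundaries; so the scalar in the definition of the trivial module is unique.\<close>

lemma trivial_act_cohomology:
  "trivial_act cohomology_alg cohomology_part (cl (scale c 1)) x = c * x"
proof -
  interpret H: k_algebra cohomology_alg by (rule k_algebraI[OF cohomology_kalgebra])
  have neg: "\<ominus>\<^bsub>cohomology_alg\<^esub> (cl y) = cl (- y)" if "d y = 0" for y
    using that
    by (intro H.minus_equality) (simp_all add: cl_in cl_operations cl_units d_minus)
  have pos: "\<exists>y. X = cl y \<and> d y = 0 \<and> component A 0 y = 0" if "X \<in> pos_part cohomology_alg cohomology_part" for X
    using that unfolding pos_part_def
  proof (induction rule: generate.induct)
    case one
    show ?case using component_homogeneous[OF grading A_zero, of 0 0]
      by (intro exI[of _ 0]) (simp add: cl_units)
  next
    case (incl h)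
    then show ?case using component_homogeneous[OF grading] by (fastforce simp: cohomology_part_def)
  next
    case (inv h)
    then obtain n y where y: "n > 0" "h = cl y" "y \<in> A n" "d y = 0" by (auto simp: cohomology_part_def)
    have "inv\<^bsub>add_monoid cohomology_alg\<^esub> h = cl (- y)" using neg[OF y(4)] y(2) by (simp add: a_inv_def)
    then show ?case using y component_homogeneous[OF grading A_minus[OF y(3)], of 0]
      by (intro exI[of _ "- y"]) (simp add: d_minus)
  next
    case (eng h1 h2)
    then obtain y z where "h1 = cl y" "d y = 0" "component A 0 y = 0" "h2 = cl z" "d z = 0"
      "component A 0 z = 0" by blast
    then show ?case
      by (intro exI[of _ "y + z"]) (simp add: cl_operations d_add component_add[OF grading])
  qed
  have diff: "cl (scale c 1) \<ominus>\<^bsub>cohomology_alg\<^esub> (c' \<odot>\<^bsub>cohomology_alg\<^esub> \<one>\<^bsub>cohomology_alg\<^esub>)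
      = cl (scale (c - c') 1)" for c'
    by (simp add: cl_units cl_operations cl_smult d_one a_minus_def neg d_scale d_minus
        alg.scale_left_diff_distrib)
  have "(THE c'. cl (scale c 1) \<ominus>\<^bsub>cohomology_alg\<^esub> (c' \<odot>\<^bsub>cohomology_alg\<^esub> \<one>\<^bsub>cohomology_alg\<^esub>)
      \<in> pos_part cohomology_alg cohomology_part) = c"
  proof (rule the_equality)
    show "cl (scale c 1) \<ominus>\<^bsub>cohomology_alg\<^esub> (c \<odot>\<^bsub>cohomology_alg\<^esub> \<one>\<^bsub>cohomology_alg\<^esub>)
        \<in> pos_part cohomology_alg cohomology_part"
      using generate.one[of "add_monoid cohomology_alg"] unfolding diff pos_part_def
      by (simp add: cl_units)
    fix c' assume "cl (scale c 1) \<ominus>\<^bsub>cohomology_alg\<^esub> (c' \<odot>\<^bsub>cohomology_alg\<^esub> \<one>\<^bsub>cohomology_alg\<^esub>)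
        \<in> pos_part cohomology_alg cohomology_part"
    then obtain y where y: "cl (scale (c - c') 1) = cl y" "d y = 0" "component A 0 y = 0"
      using pos unfolding diff by blast
    then obtain z where "scale (c - c') 1 - y = d z"
      using cl_eq_iff[of "scale (c - c') 1" y] by (auto simp: d_scale d_one)
    then have "scale (c - c') 1 = d z + y" by (simp add: algebra_simps)
    then have "component A 0 (scale (c - c') 1) = 0"
      using y(3) component_boundary(1) by (simp add: component_add[OF grading])
    then show "c' = c" by (simp add: component_homogeneous[OF grading scale_one_in])
  qed
  then show ?thesis by (simp add: trivial_act_def)
qed

section \<open>Generators and relations of the cohomology algebra\<close>

text \<open>
  A graded isomorphism with \<open>T(V)/(U)\<close> picks out a basis of \<open>H\<^sup>1 = Z\<^sup>1\<close> whose products satisfy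
  exactly the relations \<open>U\<close>.
\<close>

lemma letters_exist:
  assumes U: "quadratic_relations m U"
    and iso: "graded_alg_iso cohomology_alg cohomology_part (quadratic_alg m U) (quadratic_part m U)"
  obtains v where "\<And>i. i < m \<Longrightarrow> v i \<in> A 1" "\<And>i. i < m \<Longrightarrow> d (v i) = 0"
    "\<And>a. a \<in> A 1 \<Longrightarrow> d a = 0 \<Longrightarrow> \<exists>c. a = (\<Sum>i<m. scale (c i) (v i))"
    "\<And>c. (\<Sum>i<m. scale (c i) (v i)) \<in> range d \<Longrightarrow> \<forall>i<m. c i = 0"
    "\<And>g. g \<in> tensor_part m 2 \<Longrightarrow>
       (\<Sum>i<m. \<Sum>l<m. scale (g [i, l]) (v i * v l)) \<in> range d \<longleftrightarrow> g \<in> U"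
proof -
  let ?T = "tensor_alg m :: ('k, nat list \<Rightarrow> 'k) module"
  let ?I = "Idl\<^bsub>?T\<^esub> U"
  let ?Q = "alg_quot ?T ?I"
  interpret k_algebra ?T by (rule tensor_k_algebra)
  have U2: "U \<subseteq> tensor_part m 2" using U by (simp add: quadratic_relations_def)
  then have Uc: "U \<subseteq> carrier ?T" using tensor_part_carrier by blast
  interpret I: ideal ?I ?T by (rule genideal_ideal[OF Uc])
  interpret I: algebra_ideal ?T ?I ..
  obtain h where h: "h \<in> alg_hom cohomology_alg ?Q" "bij_betw h (carrier cohomology_alg) (carrier ?Q)"
    and parts: "\<And>n. h ` cohomology_part n = quadratic_part m U n"
    using iso unfolding graded_alg_iso_def quadratic_alg_def by blast
  have hom: "h (X \<otimes>\<^bsub>cohomology_alg\<^esub> Y) = h X \<otimes>\<^bsub>?Q\<^esub> h Y" "h (X \<oplus>\<^bsub>cohomology_alg\<^esub> Y) = h X \<oplus>\<^bsub>?Q\<^esub> h Y"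
    "h \<one>\<^bsub>cohomology_alg\<^esub> = \<one>\<^bsub>?Q\<^esub>" "h (c \<odot>\<^bsub>cohomology_alg\<^esub> X) = c \<odot>\<^bsub>?Q\<^esub> h X"
    if "X \<in> carrier cohomology_alg" "Y \<in> carrier cohomology_alg" for X Y c
    using h(1) that unfolding alg_hom_def ring_hom_def by auto
  \<comment> \<open>\<open>P a t\<close>: the cocycle \<open>a\<close> and the tensor \<open>t\<close> correspond to each other.\<close>
  define P where "P a t \<longleftrightarrow> d a = 0 \<and> t \<in> carrier ?T \<and> h (cl a) = ?I +>\<^bsub>?T\<^esub> t" for a t
  have cc: "d a = 0 \<Longrightarrow> cl a \<in> carrier cohomology_alg" for a using cohomology_carrier by blast
  have P_add: "P (a + b) (\<lambda>w. t w + s w)" if "P a t" "P b s" for a b t s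
    using that hom(2)[OF cc cc, of a b] I.quot_operations(2)[of t s] tensor_add_closed[of t m s]
    by (simp add: P_def d_add cl_operations tensor_simps(5))
  have P_mult: "P (a * b) (t \<otimes>\<^bsub>?T\<^esub> s)" if "P a t" "P b s" for a b t s
    using that hom(1)[OF cc cc, of a b] I.quot_operations(1)[of t s] m_closed[of t s]
    by (simp add: P_def cocycle_mult cl_operations)
  have P_scale: "P (scale c a) (\<lambda>w. c * t w)" if "P a t" for a t c
    using that hom(4)[OF cc cc, of a a c] I.quot_operations(3)[of t t c] tensor_scale_closed[of t m c]
    by (simp add: P_def d_scale cl_smult tensor_simps(6))
  have "P 1 (single [])"
    using hom(3)[OF cc cc, of 0 0] I.quot_one one_closed
    by (simp add: P_def d_one cl_units tensor_simps(3))
  from P_scale[OF this, of 0] have P_zero: "P 0 (\<lambda>_. 0)" by simp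
  have P_sum: "P (\<Sum>i\<in>S. a i) (\<Sum>i\<in>S. t i)" if "\<And>i. i \<in> S \<Longrightarrow> P (a i) (t i)" "finite S"
    for S :: "nat set" and a t
    using that(2,1)
  proof (induction S rule: finite_induct)
    case empty
    then show ?case using P_zero by (simp add: zero_fun_def)
  next
    case (insert i S)
    then show ?case using P_add[of "a i" "t i" "\<Sum>i\<in>S. a i" "\<Sum>i\<in>S. t i"] by (simp add: plus_fun_def)
  qed
  have P_eq: "a - b \<in> range d \<longleftrightarrow> (\<lambda>w. t w - s w) \<in> ?I" if "P a t" "P b s" for a b t s
  proof -
    have "a - b \<in> range d \<longleftrightarrow> cl a = cl b" using that cl_eq_iff[of a b] by (simp add: P_def)
    also have "\<dots> \<longleftrightarrow> h (cl a) = h (cl b)"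
      using inj_on_eq_iff[OF bij_betw_imp_inj_on[OF h(2)] cc cc, of a b] that by (simp add: P_def)
    also have "\<dots> \<longleftrightarrow> (\<lambda>w. t w - s w) \<in> ?I"
      using that I.coset_eq_iff[of t s] tensor_minus(2)[of t m s] by (simp add: P_def)
    finally show ?thesis .
  qed
  have "\<exists>a. a \<in> A 1 \<and> d a = 0 \<and> P a (single [i])" if i: "i < m" for i
  proof -
    have s: "single [i] \<in> tensor_part m 1" using i by (auto simp: tensor_part_iff single_def words_def)
    then have "?I +>\<^bsub>?T\<^esub> single [i] \<in> h ` cohomology_part 1"
      unfolding parts quadratic_part_def by blast
    then obtain a where "a \<in> A 1" "d a = 0" "h (cl a) = ?I +>\<^bsub>?T\<^esub> single [i]"
      unfolding cohomology_part_def by auto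
    then show ?thesis using tensor_part_carrier[OF s] by (auto simp: P_def)
  qed
  then obtain v where v: "\<And>i. i < m \<Longrightarrow> v i \<in> A 1" "\<And>i. i < m \<Longrightarrow> d (v i) = 0"
    "\<And>i. i < m \<Longrightarrow> P (v i) (single [i])" by metis
  have P1: "P (\<Sum>i<m. scale (c i) (v i)) (\<Sum>i<m. (\<lambda>w. c i * single [i] w))" for c
    by (rule P_sum) (use P_scale v(3) in auto)
  have one_letter: "(\<Sum>i<m. (\<lambda>w. c i * single [i] w)) w = (case w of [i] \<Rightarrow> if i < m then c i else 0 | _ \<Rightarrow> 0)"
    for c and w :: "nat list"
  proof -
    have "(\<Sum>i<m. c i * single [i] w) = (\<Sum>i<m. if w = [i] then c i else 0)"
      by (intro sum.cong) (auto simp: single_def)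
    then show ?thesis unfolding fun_sum_apply by (auto split: list.splits)
  qed
  have span: "\<exists>c. a = (\<Sum>i<m. scale (c i) (v i))" if a: "a \<in> A 1" "d a = 0" for a
  proof -
    have "h (cl a) \<in> quadratic_part m U 1" unfolding parts[symmetric] cohomology_part_def using a by blast
    then obtain f where f: "f \<in> tensor_part m 1" "h (cl a) = ?I +>\<^bsub>?T\<^esub> f"
      by (auto simp: quadratic_part_def)
    have "f = (\<Sum>i<m. (\<lambda>w. f [i] * single [i] w))"
      unfolding fun_eq_iff one_letter
      using f(1) by (auto simp: tensor_part_iff words_def split: list.splits)
    then have "P (\<Sum>i<m. scale (f [i]) (v i)) f" using P1[of "\<lambda>i. f [i]"] by simp
    moreover have "P a f" using a f tensor_part_carrier by (simp add: P_def)
    ultimately have "a - (\<Sum>i<m. scale (f [i]) (v i)) \<in> range d"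
      using P_eq[of a f _ f] I.zero_closed by (simp add: tensor_simps(4))
    then obtain y where y: "a - (\<Sum>i<m. scale (f [i]) (v i)) = d y" by blast
    have "a - (\<Sum>i<m. scale (f [i]) (v i)) \<in> A 1" using a v by (intro A_diff A_sum A_scale) auto
    then have "d y = 0" using boundary_degree_one y by simp
    then show ?thesis using y by (intro exI[of _ "\<lambda>i. f [i]"]) simp
  qed
  have ind: "\<forall>i<m. c i = 0" if "(\<Sum>i<m. scale (c i) (v i)) \<in> range d" for c
  proof -
    let ?t = "\<Sum>i<m. (\<lambda>w. c i * single [i] w)"
    have "?t \<in> ?I" using P_eq[OF P1[of c] P_zero] that by simp
    from quadratic_ideal_low_degrees(2)[OF U this] have "?t [i] = 0" for i .
    then have z: "(if i < m then c i else 0) = 0" for i unfolding one_letter by simp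
    show ?thesis
    proof (intro allI impI)
      fix i assume "i < m"
      then show "c i = 0" using z[of i] by simp
    qed
  qed
  have rel: "(\<Sum>i<m. \<Sum>l<m. scale (g [i, l]) (v i * v l)) \<in> range d \<longleftrightarrow> g \<in> U"
    if g: "g \<in> tensor_part m 2" for g
  proof -
    have ss: "single [i] \<otimes>\<^bsub>?T\<^esub> single [l] = single [i, l]" for i l
    proof
      fix w show "(single [i] \<otimes>\<^bsub>?T\<^esub> single [l]) w = single [i, l] w"
        unfolding single_mult by (cases w) (auto simp: single_def)
    qed
    have "P (scale (g [i, l]) (v i * v l)) (\<lambda>w. g [i, l] * single [i, l] w)" if "i < m" "l < m" for i l
      using P_scale[OF P_mult[OF v(3)[OF that(1)] v(3)[OF that(2)]]] by (simp add: ss)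
    then have "P (\<Sum>i<m. \<Sum>l<m. scale (g [i, l]) (v i * v l)) (\<Sum>i<m. \<Sum>l<m. (\<lambda>w. g [i, l] * single [i, l] w))"
      by (intro P_sum) auto
    moreover have "(\<Sum>i<m. \<Sum>l<m. (\<lambda>w. g [i, l] * single [i, l] w)) = g"
    proof
      fix w
      have "(\<Sum>i<m. \<Sum>l<m. (\<lambda>w. g [i, l] * single [i, l] w)) w
          = (\<Sum>u\<in>words m 2. g u * single u w)"
        by (simp add: fun_sum_apply sum_words_two)
      also have "\<dots> = (\<Sum>u\<in>words m 2. if u = w then g w else 0)"
        by (intro sum.cong) (auto simp: single_def)
      also have "\<dots> = g w" using g finite_words by (auto simp: tensor_part_iff)
      finally show "(\<Sum>i<m. \<Sum>l<m. (\<lambda>w. g [i, l] * single [i, l] w)) w = g w" .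
    qed
    ultimately have "P (\<Sum>i<m. \<Sum>l<m. scale (g [i, l]) (v i * v l)) g" by simp
    from P_eq[OF this P_zero]
    have "(\<Sum>i<m. \<Sum>l<m. scale (g [i, l]) (v i * v l)) \<in> range d \<longleftrightarrow> g \<in> ?I" by simp
    also have "\<dots> \<longleftrightarrow> g \<in> U"
      using quadratic_ideal_low_degrees(3)[OF U, of g] hpart_tensor_part[OF g, of 2] genideal_self[OF Uc]
      by auto
    finally show ?thesis .
  qed
  show ?thesis using v(1,2) span ind rel by (rule that)
qed

end

section \<open>Exactness of the Koszul complex\<close>

context connected_dg_algebra
begin

text \<open>Equality of cohomology classes, on the level of cocycles.\<close>

definition cohomologous :: "'a \<Rightarrow> 'a \<Rightarrow> bool" (infix \<open>\<approx>\<close> 50) where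
  "x \<approx> y \<longleftrightarrow> x - y \<in> range d"

lemma cohomologous_rules:
  "x \<approx> x" "x \<approx> y \<Longrightarrow> y \<approx> x" "x \<approx> y \<Longrightarrow> y \<approx> z \<Longrightarrow> x \<approx> z"
  "x \<approx> y \<Longrightarrow> x' \<approx> y' \<Longrightarrow> x + x' \<approx> y + y'" "x \<approx> y \<Longrightarrow> scale c x \<approx> scale c y"
proof -
  note sub = add_subgroupD[OF boundaries_subgroup]
  show "x \<approx> x" using sub(1) by (simp add: cohomologous_def)
  show "x \<approx> y \<Longrightarrow> y \<approx> x" using sub(2)[of "x - y"] by (simp add: cohomologous_def)
  show "x \<approx> y \<Longrightarrow> y \<approx> z \<Longrightarrow> x \<approx> z" using sub(3)[of "x - y" "y - z"] by (simp add: cohomologous_def)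
  show "x \<approx> y \<Longrightarrow> x' \<approx> y' \<Longrightarrow> x + x' \<approx> y + y'"
    using sub(3)[of "x - y" "x' - y'"] by (simp add: cohomologous_def algebra_simps)
  show "x \<approx> y \<Longrightarrow> scale c x \<approx> scale c y"
    using alg.subspace_scale[OF boundaries_subspace, of "x - y" c]
    by (simp add: cohomologous_def alg.scale_right_diff_distrib)
qed

lemmas cohomologous_refl = cohomologous_rules(1)
  and cohomologous_sym = cohomologous_rules(2)
  and cohomologous_trans [trans] = cohomologous_rules(3)
  and cohomologous_add = cohomologous_rules(4)
  and cohomologous_scale = cohomologous_rules(5)

lemma cohomologous_sum: "(\<And>i. i \<in> I \<Longrightarrow> x i \<approx> y i) \<Longrightarrow> (\<Sum>i\<in>I. x i) \<approx> (\<Sum>i\<in>I. y i)"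
  by (induction I rule: infinite_finite_induct) (auto intro: cohomologous_refl cohomologous_add)

lemma cohomologous_mult: "d a = 0 \<Longrightarrow> x \<approx> y \<Longrightarrow> a * x \<approx> a * y"
  "d a = 0 \<Longrightarrow> x \<approx> y \<Longrightarrow> x * a \<approx> y * a"
  using boundary_mult[of a "x - y"] by (simp_all add: cohomologous_def algebra_simps)

lemma cohomologous_zero_iff: "x \<approx> 0 \<longleftrightarrow> x \<in> range d"
  by (simp add: cohomologous_def)

lemma relational_cong:
  assumes "\<And>u. u \<in> words m n \<Longrightarrow> r u = r' u" "relational m v n r"
  shows "relational m v n r'"
  unfolding relational_def
proof (intro allI impI)
  fix u y assume *: "set u \<subseteq> {..<m}" "set y \<subseteq> {..<m}" "length u + length y + 2 = n"
  have "(\<Sum>i<m. \<Sum>l<m. scale (r' (u @ i # l # y)) (v i * v l))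
      = (\<Sum>i<m. \<Sum>l<m. scale (r (u @ i # l # y)) (v i * v l))"
    by (intro sum.cong refl arg_cong2[where f=scale] assms(1)[symmetric]) (use * in \<open>auto simp: words_def\<close>)
  then show "(\<Sum>i<m. \<Sum>l<m. scale (r' (u @ i # l # y)) (v i * v l)) \<in> range d"
    using assms(2) * unfolding relational_def by simp
qed

end

text \<open>
  A linear resolution of the trivial module over \<open>H(A)\<close>, together with a basis \<open>v\<close> of \<open>H\<^sup>1\<close>. Classes in
  \<open>H(A)\<close> are represented by cocycles, which act on the resolution through \<open>ac\<close>.
\<close>

locale koszul_complex = connected_dg_algebra scale A d
  for scale :: "'k::field \<Rightarrow> 'a::ring_1 \<Rightarrow> 'a" and A d +
  fixes hact :: "nat \<Rightarrow> 'a set \<Rightarrow> 'q::ab_group_add \<Rightarrow> 'q" and Q :: "nat \<Rightarrow> 'q set"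
    and G :: "nat \<Rightarrow> int \<Rightarrow> 'q set" and dQ :: "nat \<Rightarrow> 'q \<Rightarrow> 'q" and e :: "'q \<Rightarrow> 'k"
    and B :: "nat \<Rightarrow> 'q set" and m :: nat and v :: "nat \<Rightarrow> 'a" and vco :: "nat \<Rightarrow> 'a \<Rightarrow> 'k"
  assumes graded: "graded_left_module cohomology_alg cohomology_part (hact n) (Q n) (G n)"
    and basis: "module_basis cohomology_alg (hact n) (Q n) (B n)"
    and basis_homogeneous: "B n \<subseteq> (\<Union>j. G n j)"
    and generated: "Q n = left_span cohomology_alg (hact n) (G n (int n))"
    and dQ_hom: "graded_hom cohomology_alg (hact (Suc n)) (Q (Suc n)) (G (Suc n)) (hact n) (Q n) (G n) (dQ n)"
    and e_hom: "graded_hom cohomology_alg (hact 0) (Q 0) (G 0)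
      (trivial_act cohomology_alg cohomology_part) UNIV trivial_grading e"
    and e_onto: "e ` Q 0 = UNIV"
    and exact_zero: "{x \<in> Q 0. e x = 0} = dQ 0 ` Q (Suc 0)"
    and exact_Suc: "{x \<in> Q (Suc n). dQ n x = 0} = dQ (Suc n) ` Q (Suc (Suc n))"
    and v_in: "i < m \<Longrightarrow> v i \<in> A 1" and v_cocycle: "i < m \<Longrightarrow> d (v i) = 0"
    and v_span: "a \<in> A 1 \<Longrightarrow> d a = 0 \<Longrightarrow> \<exists>c. a = (\<Sum>i<m. scale (c i) (v i))"
    and vco_functional: "i < m \<Longrightarrow> functional scale (vco i)"
    and vco_boundary: "i < m \<Longrightarrow> y \<in> range d \<Longrightarrow> vco i y = 0"
    and vco_v: "i < m \<Longrightarrow> j < m \<Longrightarrow> vco i (v j) = (if i = j then 1 else 0)"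
begin

definition ac :: "nat \<Rightarrow> 'a \<Rightarrow> 'q \<Rightarrow> 'q" where
  "ac n a = hact n (cl a)"

lemma Q_subgroup: "add_subgroup (Q n)"
  using graded[of n] by (simp add: graded_left_module_def left_module_def)

lemma Q_grading: "internal_direct_sum (Q n) (G n)"
  using graded[of n] by (simp add: graded_left_module_def)

lemmas Q_zero = add_subgroupD(1)[OF Q_subgroup]
  and Q_sum = add_subgroup_sum[OF Q_subgroup]

lemma G_subgroup: "add_subgroup (G n j)"
  by (rule direct_sum_subgroup[OF Q_grading])

lemma G_Q: "x \<in> G n j \<Longrightarrow> x \<in> Q n"
  using direct_sum_subset[OF Q_grading] by blast

lemma ac_closed: "d a = 0 \<Longrightarrow> x \<in> Q n \<Longrightarrow> ac n a x \<in> Q n"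
  and ac_add_right: "d a = 0 \<Longrightarrow> x \<in> Q n \<Longrightarrow> y \<in> Q n \<Longrightarrow> ac n a (x + y) = ac n a x + ac n a y"
  and ac_add_left: "d a = 0 \<Longrightarrow> d b = 0 \<Longrightarrow> x \<in> Q n \<Longrightarrow> ac n (a + b) x = ac n a x + ac n b x"
  and ac_mult: "d a = 0 \<Longrightarrow> d b = 0 \<Longrightarrow> x \<in> Q n \<Longrightarrow> ac n (a * b) x = ac n a (ac n b x)"
  and ac_one: "x \<in> Q n \<Longrightarrow> ac n 1 x = x"
  using graded[of n] cl_in
  by (auto simp: graded_left_module_def left_module_def ac_def cl_units simp flip: cl_operations)

lemma ac_degree: "d a = 0 \<Longrightarrow> a \<in> A i \<Longrightarrow> x \<in> G n j \<Longrightarrow> ac n a x \<in> G n (int i + j)"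
  using graded[of n] by (auto simp: graded_left_module_def cohomology_part_def ac_def)

lemma ac_cong: "d a = 0 \<Longrightarrow> d b = 0 \<Longrightarrow> a \<approx> b \<Longrightarrow> ac n a x = ac n b x"
  using cl_eq_iff[of a b] by (simp add: ac_def cohomologous_def)

lemma ac_zero_left: "x \<in> Q n \<Longrightarrow> ac n 0 x = 0"
  using ac_add_left[of 0 0 x n] by simp

lemma ac_zero_right: "d a = 0 \<Longrightarrow> ac n a 0 = 0"
  using ac_add_right[OF _ Q_zero Q_zero, of a n] by simp

lemma ac_boundary: "a \<in> range d \<Longrightarrow> x \<in> Q n \<Longrightarrow> ac n a x = 0"
  using ac_cong[of a 0 n x] ac_zero_left[of x n] by (auto simp: cohomologous_def d_square)

lemma ac_sum_right:
  "d a = 0 \<Longrightarrow> (\<And>i. i \<in> I \<Longrightarrow> x i \<in> Q n) \<Longrightarrow> ac n a (\<Sum>i\<in>I. x i) = (\<Sum>i\<in>I. ac n a (x i))"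
  by (induction I rule: infinite_finite_induct) (auto simp: ac_zero_right ac_add_right Q_sum)

lemma ac_sum_left:
  "(\<And>i. i \<in> I \<Longrightarrow> d (a i) = 0) \<Longrightarrow> x \<in> Q n \<Longrightarrow> ac n (\<Sum>i\<in>I. a i) x = (\<Sum>i\<in>I. ac n (a i) x)"
  by (induction I rule: infinite_finite_induct) (auto simp: ac_zero_left ac_add_left d_sum)

lemma component_Q_sum:
  "(\<And>k. k \<in> K \<Longrightarrow> f k \<in> Q n) \<Longrightarrow>
    component (G n) j (\<Sum>k\<in>K. f k) = (\<Sum>k\<in>K. component (G n) j (f k))"
  by (rule component_sum_commute[OF Q_grading Q_subgroup])

lemma cohomology_representative: "X \<in> carrier cohomology_alg \<Longrightarrow> \<exists>a. d a = 0 \<and> X = cl a"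
  using cohomology_carrier by blast

lemma component_ac:
  assumes a: "d a = 0" and x: "x \<in> G n l"
  shows "component (G n) j (ac n a x) = (if j < l then 0 else ac n (component A (nat (j - l)) a) x)"
proof -
  let ?I = "{i. component A i a \<noteq> 0}"
  have fin: "finite ?I" by (rule component_finite[OF grading UNIV_I])
  note ca = component_cocycle[OF a] component_in[OF grading UNIV_I, of _ a]
  have deg: "ac n (component A i a) x \<in> G n (int i + l)" for i using ac_degree[OF ca x] .
  have "ac n a x = ac n (\<Sum>i\<in>?I. component A i a) x"
    by (simp flip: component_sum[OF grading UNIV_I])
  also have "\<dots> = (\<Sum>i\<in>?I. ac n (component A i a) x)"
    using ca G_Q[OF x] by (intro ac_sum_left) auto
  finally have "component (G n) j (ac n a x) = (\<Sum>i\<in>?I. component (G n) j (ac n (component A i a) x))"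
    using component_Q_sum[OF G_Q[OF deg]] by simp
  also have "\<dots> = (\<Sum>i\<in>?I. if j = int i + l then ac n (component A i a) x else 0)"
    using component_homogeneous[OF Q_grading deg] by simp
  also have "\<dots> = (if j < l then 0 else ac n (component A (nat (j - l)) a) x)"
  proof (cases "j < l")
    case True
    then show ?thesis by (intro trans[OF sum.neutral]) auto
  next
    case False
    then have "(\<Sum>i\<in>?I. if j = int i + l then ac n (component A i a) x else 0)
        = (\<Sum>i\<in>?I. if i = nat (j - l) then ac n (component A i a) x else 0)"
      by (intro sum.cong) auto
    then show ?thesis using False fin ac_zero_left[OF G_Q[OF x]] by (auto simp: sum.delta)
  qed
  finally show ?thesis .
qed

section \<open>Coordinates in a free module over the cohomology algebra\<close>

definition expands :: "nat \<Rightarrow> 'q \<Rightarrow> 'q set \<Rightarrow> ('q \<Rightarrow> 'a) \<Rightarrow> bool" where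
  "expands n q F c \<longleftrightarrow> finite F \<and> F \<subseteq> B n \<and> (\<forall>b. d (c b) = 0) \<and> q = (\<Sum>b\<in>F. ac n (c b) b)"

lemma basis_in: "b \<in> B n \<Longrightarrow> b \<in> Q n"
  using basis[of n] by (auto simp: module_basis_def)

lemma expansion_exists:
  assumes "q \<in> Q n" shows "\<exists>F c. expands n q F c"
proof -
  obtain h where h: "\<And>b. h b \<in> carrier cohomology_alg" "finite {b. h b \<noteq> \<zero>\<^bsub>cohomology_alg\<^esub>}"
    "{b. h b \<noteq> \<zero>\<^bsub>cohomology_alg\<^esub>} \<subseteq> B n" "q = (\<Sum>b | h b \<noteq> \<zero>\<^bsub>cohomology_alg\<^esub>. hact n (h b) b)"
    using basis[of n] assms unfolding module_basis_def by blast
  obtain c where c: "\<And>b. d (c b) = 0" "\<And>b. h b = cl (c b)"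
    using cohomology_representative[OF h(1)] by metis
  have "expands n q {b. h b \<noteq> \<zero>\<^bsub>cohomology_alg\<^esub>} c"
    using h c unfolding expands_def ac_def by simp
  then show ?thesis by blast
qed

lemma expansion_of_zero:
  assumes F: "finite F" "F \<subseteq> B n" and c: "\<And>b. b \<in> F \<Longrightarrow> d (c b) = 0"
    and zero: "(\<Sum>b\<in>F. ac n (c b) b) = 0" and b: "b \<in> F"
  shows "c b \<in> range d"
proof -
  define h where "h b = (if b \<in> F then cl (c b) else cl 0)" for b
  have supp: "{b. h b \<noteq> \<zero>\<^bsub>cohomology_alg\<^esub>} \<subseteq> F" by (auto simp: h_def cl_units)
  have "(\<Sum>b | h b \<noteq> \<zero>\<^bsub>cohomology_alg\<^esub>. hact n (h b) b) = (\<Sum>b\<in>F. hact n (h b) b)"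
  proof (rule sum.mono_neutral_left[OF F(1) supp], rule ballI)
    fix b assume "b \<in> F - {b. h b \<noteq> \<zero>\<^bsub>cohomology_alg\<^esub>}"
    then have "h b = cl 0" "b \<in> Q n" using F(2) basis_in by (auto simp: cl_units)
    then show "hact n (h b) b = 0" using ac_zero_left[of b n] by (simp add: ac_def)
  qed
  also have "\<dots> = 0" unfolding zero[symmetric] by (intro sum.cong) (auto simp: h_def ac_def)
  finally have 1: "0 = (\<Sum>b | h b \<noteq> \<zero>\<^bsub>cohomology_alg\<^esub>. hact n (h b) b)" by simp
  have ex1: "\<exists>!c. (\<forall>b. c b \<in> carrier cohomology_alg) \<and> finite {b. c b \<noteq> \<zero>\<^bsub>cohomology_alg\<^esub>} \<and>
      {b. c b \<noteq> \<zero>\<^bsub>cohomology_alg\<^esub>} \<subseteq> B n \<and> 0 = (\<Sum>b | c b \<noteq> \<zero>\<^bsub>cohomology_alg\<^esub>. hact n (c b) b)"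
    by (rule bspec[OF conjunct2[OF basis[of n, unfolded module_basis_def]] Q_zero])
  have h: "(\<forall>b. h b \<in> carrier cohomology_alg) \<and> finite {b. h b \<noteq> \<zero>\<^bsub>cohomology_alg\<^esub>} \<and>
      {b. h b \<noteq> \<zero>\<^bsub>cohomology_alg\<^esub>} \<subseteq> B n \<and> 0 = (\<Sum>b | h b \<noteq> \<zero>\<^bsub>cohomology_alg\<^esub>. hact n (h b) b)"
  proof (intro conjI allI)
    show "h b \<in> carrier cohomology_alg" for b using c cl_in by (simp add: h_def)
    show "finite {b. h b \<noteq> \<zero>\<^bsub>cohomology_alg\<^esub>}" by (rule finite_subset[OF supp F(1)])
    show "{b. h b \<noteq> \<zero>\<^bsub>cohomology_alg\<^esub>} \<subseteq> B n" using supp F(2) by blast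
  qed (rule 1)
  have z: "(\<forall>b. \<zero>\<^bsub>cohomology_alg\<^esub> \<in> carrier cohomology_alg) \<and>
      finite {b :: 'q. \<zero>\<^bsub>cohomology_alg\<^esub> \<noteq> \<zero>\<^bsub>cohomology_alg\<^esub>} \<and>
      {b. \<zero>\<^bsub>cohomology_alg\<^esub> \<noteq> \<zero>\<^bsub>cohomology_alg\<^esub>} \<subseteq> B n \<and>
      0 = (\<Sum>b | \<zero>\<^bsub>cohomology_alg\<^esub> \<noteq> \<zero>\<^bsub>cohomology_alg\<^esub>. hact n \<zero>\<^bsub>cohomology_alg\<^esub> b)"
    using cl_in[of 0] by (simp add: cl_units)
  have "h = (\<lambda>_. \<zero>\<^bsub>cohomology_alg\<^esub>)"
    using the1_equality[OF ex1, of h] the1_equality[OF ex1, of "\<lambda>_. \<zero>\<^bsub>cohomology_alg\<^esub>"] h z by simp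
  then have "cl (c b) = cl 0" using b by (metis cl_units(2) h_def)
  then show ?thesis using cl_eq_iff[of "c b" 0] c[OF b] by simp
qed

lemma expands_superset:
  assumes "expands n q F c" "F \<subseteq> F'" "finite F'" "F' \<subseteq> B n"
  shows "expands n q F' (\<lambda>b. if b \<in> F then c b else 0)"
proof -
  have "(\<Sum>b\<in>F'. ac n (if b \<in> F then c b else 0) b) = (\<Sum>b\<in>F. ac n (c b) b)"
    using assms basis_in ac_zero_left by (intro sum.mono_neutral_cong_right) auto
  then show ?thesis using assms by (auto simp: expands_def)
qed

text \<open>
  The linear extension \<open>Q n \<rightarrow> H(A)\<close> of a scalar function on the basis. Its values are represented by elements
  of \<open>A\<close>, so it is linear only up to cohomology.
\<close>

definition functional_ext :: "nat \<Rightarrow> ('q \<Rightarrow> 'k) \<Rightarrow> 'q \<Rightarrow> 'a" where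
  "functional_ext n s q = (case (SOME Fc. expands n q (fst Fc) (snd Fc)) of (F, c) \<Rightarrow>
     \<Sum>b\<in>F. scale (s b) (c b))"

text \<open>Two expansions of the same element have the same coefficients up to coboundaries, since the basis elements
  are independent over \<open>H(A)\<close>.\<close>

lemma functional_ext_cohomologous:
  assumes "expands n q F c"
  shows "functional_ext n s q \<approx> (\<Sum>b\<in>F. scale (s b) (c b))"
proof -
  obtain F' c' where Fc: "(SOME Fc. expands n q (fst Fc) (snd Fc)) = (F', c')" by fastforce
  have "expands n q (fst (F, c)) (snd (F, c))" using assms by simp
  from someI[of "\<lambda>Fc. expands n q (fst Fc) (snd Fc)", OF this]
  have e': "expands n q F' c'" by (simp add: Fc)
  let ?F = "F \<union> F'"
  let ?c = "\<lambda>b. if b \<in> F then c b else 0" and ?c' = "\<lambda>b. if b \<in> F' then c' b else 0"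
  have F: "finite ?F" "?F \<subseteq> B n" using assms e' by (auto simp: expands_def)
  have ex: "expands n q ?F ?c" "expands n q ?F ?c'"
    using expands_superset[OF assms _ F] expands_superset[OF e' _ F] by auto
  have coc: "d (?c b) = 0" "d (?c' b) = 0" for b using ex by (auto simp: expands_def)
  have "(\<Sum>b\<in>?F. ac n (?c' b - ?c b) b) = 0"
  proof -
    have "ac n (?c' b) b = ac n (?c' b - ?c b) b + ac n (?c b) b" if "b \<in> ?F" for b
    proof -
      have "d (?c' b - ?c b) = 0" unfolding d_diff coc by simp
      moreover have "b \<in> Q n" using that F(2) basis_in by blast
      ultimately show ?thesis using ac_add_left[of "?c' b - ?c b" "?c b" b n] coc(1)
        unfolding diff_add_cancel by blast
    qed
    then have "(\<Sum>b\<in>?F. ac n (?c' b) b) = (\<Sum>b\<in>?F. ac n (?c' b - ?c b) b) + (\<Sum>b\<in>?F. ac n (?c b) b)"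
      by (simp add: sum.distrib[symmetric])
    then show ?thesis using ex by (simp add: expands_def)
  qed
  then have "?c' b - ?c b \<in> range d" if "b \<in> ?F" for b
    using expansion_of_zero[OF F, of "\<lambda>b. ?c' b - ?c b" b] coc that by (simp add: d_diff)
  then have "(\<Sum>b\<in>?F. scale (s b) (?c' b)) \<approx> (\<Sum>b\<in>?F. scale (s b) (?c b))"
    by (intro cohomologous_sum cohomologous_scale) (simp only: cohomologous_def)
  moreover have "(\<Sum>b\<in>?F. scale (s b) (?c' b)) = (\<Sum>b\<in>F'. scale (s b) (c' b))"
    using F(1) by (intro sum.mono_neutral_cong_right) auto
  moreover have "(\<Sum>b\<in>?F. scale (s b) (?c b)) = (\<Sum>b\<in>F. scale (s b) (c b))"
    using F(1) by (intro sum.mono_neutral_cong_right) auto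
  ultimately show ?thesis by (simp add: functional_ext_def Fc)
qed

lemma functional_ext_add:
  assumes "q \<in> Q n" "q' \<in> Q n"
  shows "functional_ext n s (q + q') \<approx> functional_ext n s q + functional_ext n s q'"
proof -
  obtain F c F' c' where e: "expands n q F c" and e': "expands n q' F' c'"
    using expansion_exists assms by blast
  let ?F = "F \<union> F'"
  let ?c = "\<lambda>b. if b \<in> F then c b else 0" and ?c' = "\<lambda>b. if b \<in> F' then c' b else 0"
  have F: "finite ?F" "?F \<subseteq> B n" using e e' by (auto simp: expands_def)
  have ex: "expands n q ?F ?c" "expands n q' ?F ?c'"
    using expands_superset[OF e _ F] expands_superset[OF e' _ F] by auto
  then have coc: "d (?c b) = 0" "d (?c' b) = 0" for b by (auto simp: expands_def)
  have "(\<Sum>b\<in>?F. ac n (?c b + ?c' b) b) = (\<Sum>b\<in>?F. ac n (?c b) b + ac n (?c' b) b)"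
    using F(2) basis_in by (intro sum.cong refl ac_add_left coc) auto
  then have "expands n (q + q') ?F (\<lambda>b. ?c b + ?c' b)"
    using ex coc F unfolding expands_def by (simp only: sum.distrib d_add) simp
  from functional_ext_cohomologous[OF this, of s]
  have "functional_ext n s (q + q') \<approx> (\<Sum>b\<in>?F. scale (s b) (?c b)) + (\<Sum>b\<in>?F. scale (s b) (?c' b))"
    by (simp only: scale_simps sum.distrib)
  also have "\<dots> \<approx> functional_ext n s q + functional_ext n s q'"
    by (intro cohomologous_add cohomologous_sym[OF functional_ext_cohomologous] ex)
  finally show ?thesis .
qed

lemma functional_ext_ac:
  assumes a: "d a = 0" and q: "q \<in> Q n"
  shows "functional_ext n s (ac n a q) \<approx> a * functional_ext n s q"
proof -
  obtain F c where e: "expands n q F c" using expansion_exists q by blast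
  then have c: "d (c b) = 0" and F: "F \<subseteq> B n" for b by (auto simp: expands_def)
  have "ac n a q = (\<Sum>b\<in>F. ac n a (ac n (c b) b))"
    using e F basis_in ac_closed[OF c] by (auto simp: expands_def intro!: ac_sum_right[OF a])
  also have "\<dots> = (\<Sum>b\<in>F. ac n (a * c b) b)"
    using F basis_in ac_mult[OF a c] by (intro sum.cong) auto
  finally have "expands n (ac n a q) F (\<lambda>b. a * c b)"
    using e a by (simp add: expands_def cocycle_mult)
  from functional_ext_cohomologous[OF this, of s]
  have "functional_ext n s (ac n a q) \<approx> a * (\<Sum>b\<in>F. scale (s b) (c b))"
    by (simp add: scale_simps sum_distrib_left)
  also have "\<dots> \<approx> a * functional_ext n s q"
    by (rule cohomologous_mult(1)[OF a cohomologous_sym[OF functional_ext_cohomologous[OF e]]])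
  finally show ?thesis .
qed

lemma functional_ext_basis: "b \<in> B n \<Longrightarrow> functional_ext n s b \<approx> scale (s b) 1"
  using functional_ext_cohomologous[of n b "{b}" "\<lambda>_. 1" s] ac_one[OF basis_in]
  by (simp add: expands_def d_one)

lemma functional_ext_zero: "functional_ext n s 0 \<approx> 0"
  using functional_ext_cohomologous[of n 0 "{}" "\<lambda>_. 0" s] by (simp add: expands_def)

lemma functional_ext_sum:
  "(\<And>k. k \<in> S \<Longrightarrow> q k \<in> Q n) \<Longrightarrow> functional_ext n s (\<Sum>k\<in>S. q k) \<approx> (\<Sum>k\<in>S. functional_ext n s (q k))"
proof (induction S rule: infinite_finite_induct)
  case (insert k S)
  have "functional_ext n s (q k + (\<Sum>k\<in>S. q k))
      \<approx> functional_ext n s (q k) + functional_ext n s (\<Sum>k\<in>S. q k)"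
    using insert.prems by (intro functional_ext_add Q_sum) auto
  also have "\<dots> \<approx> functional_ext n s (q k) + (\<Sum>k\<in>S. functional_ext n s (q k))"
    using insert by (intro cohomologous_add cohomologous_refl) auto
  finally show ?case using insert.hyps by simp
qed (simp_all add: functional_ext_zero)

text \<open>
  Since \<open>Q n\<close> is generated in degree \<open>n\<close>, a homogeneous basis lies in degree \<open>n\<close>: the coordinate of a
  basis element of higher degree along itself would have positive degree, but it is \<open>1\<close>.
\<close>

lemma basis_degree: "B n \<subseteq> G n (int n)"
proof
  fix b assume b: "b \<in> B n"
  obtain j where j: "b \<in> G n j" using basis_homogeneous b by blast
  let ?\<kappa> = "functional_ext n (\<lambda>b'. if b' = b then 1 else 0)"
  have "b \<in> left_span cohomology_alg (hact n) (G n (int n))" using generated[of n] basis_in[OF b] by simp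
  then have "\<exists>F h. b = (\<Sum>x\<in>F. hact n (h x) x) \<and> finite F \<and> F \<subseteq> G n (int n) \<and>
      (\<forall>x. h x \<in> carrier cohomology_alg)"
    unfolding left_span_def mem_Collect_eq .
  then obtain F h where "b = (\<Sum>x\<in>F. hact n (h x) x) \<and> finite F \<and> F \<subseteq> G n (int n) \<and>
      (\<forall>x. h x \<in> carrier cohomology_alg)"
    by (elim exE)
  then have F: "finite F" "F \<subseteq> G n (int n)" "h x \<in> carrier cohomology_alg"
    "b = (\<Sum>x\<in>F. hact n (h x) x)" for x
    by simp_all
  obtain a where a: "\<And>x. d (a x) = 0" "\<And>x. h x = cl (a x)"
    using cohomology_representative[OF F(3)] by metis
  have FQ: "x \<in> Q n" if "x \<in> F" for x using G_Q F(2) that by blast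
  have "b = component (G n) j b" using component_homogeneous[OF Q_grading j] by simp
  also have "\<dots> = (\<Sum>x\<in>F. component (G n) j (ac n (a x) x))"
    using component_sum_commute[OF Q_grading Q_subgroup, of F "\<lambda>x. ac n (a x) x" n j] ac_closed[OF a(1) FQ]
      F(4) a(2) by (simp add: ac_def)
  also have "\<dots> = (\<Sum>x\<in>F. if j < int n then 0 else ac n (component A (nat (j - int n)) (a x)) x)"
    using F(2) by (intro sum.cong refl component_ac a) auto
  finally have sum: "b = (\<Sum>x\<in>F. if j < int n then 0 else ac n (component A (nat (j - int n)) (a x)) x)" .
  have \<kappa>b: "?\<kappa> b \<approx> 1" using functional_ext_basis[OF b, of "\<lambda>b'. if b' = b then 1 else 0"] by simp
  have "j = int n"
  proof (rule ccontr)
    assume ne: "j \<noteq> int n"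
    let ?a = "\<lambda>x. component A (nat (j - int n)) (a x)"
    have "\<exists>z. ?\<kappa> b \<approx> z \<and> component A 0 z = 0"
    proof (cases "j < int n")
      case True
      then have "b = 0" using sum by simp
      then show ?thesis using functional_ext_zero component_homogeneous[OF grading A_zero, of 0 0]
        by (intro exI[of _ 0]) auto
    next
      case False
      let ?i = "nat (j - int n)"
      have i: "?i > 0" using False ne by simp
      have ca: "d (?a x) = 0" for x using component_cocycle[OF a(1)] .
      have "b = (\<Sum>x\<in>F. ac n (?a x) x)" using sum False by simp
      then have "?\<kappa> b = ?\<kappa> (\<Sum>x\<in>F. ac n (?a x) x)" by (rule arg_cong)
      also have "\<dots> \<approx> (\<Sum>x\<in>F. ?\<kappa> (ac n (?a x) x))"
        using ac_closed[OF ca] FQ by (intro functional_ext_sum) auto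
      also have "\<dots> \<approx> (\<Sum>x\<in>F. ?a x * ?\<kappa> x)"
        using FQ by (intro cohomologous_sum functional_ext_ac ca) auto
      finally have "?\<kappa> b \<approx> (\<Sum>x\<in>F. ?a x * ?\<kappa> x)" .
      moreover have "component A 0 (y * z) = 0" if y: "y \<in> A ?i" for y z
        using grading UNIV_I
      proof (rule homogeneous_induct[of UNIV A z])
        fix l z assume "z \<in> A l"
        then have "y * z \<in> A (?i + l)" using grading_mult[OF y] by blast
        then show "component A 0 (y * z) = 0" using component_homogeneous[OF grading] i by simp
      qed (simp add: distrib_left component_add[OF grading])
      then have "component A 0 (\<Sum>x\<in>F. ?a x * ?\<kappa> x) = 0"
        using component_in[OF grading UNIV_I]
        by (subst component_sum_commute[OF grading]) (auto simp: add_subgroup_def)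
      ultimately show ?thesis by blast
    qed
    then obtain z where z: "?\<kappa> b \<approx> z" "component A 0 z = 0" by blast
    then obtain y where "1 - z = d y"
      using cohomologous_trans[OF cohomologous_sym[OF \<kappa>b] z(1)] unfolding cohomologous_def by blast
    then have "1 = d y + z" by (simp add: algebra_simps)
    then have "component A 0 1 = component A 0 (d y + z)" by (rule arg_cong)
    then have "component A 0 1 = 0"
      using z(2) component_boundary(1) by (simp add: component_add[OF grading])
    then show False using component_homogeneous[OF grading one_in] by simp
  qed
  then show "b \<in> G n (int n)" using j by simp
qed

lemma homogeneous_expansion:
  assumes q: "q \<in> G n (int n + int i)"
  shows "\<exists>F c. expands n q F c \<and> (\<forall>b. c b \<in> A i)"
proof -
  obtain F c where e: "expands n q F c" using expansion_exists[OF G_Q[OF q]] by blast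
  then have c: "d (c b) = 0" and F: "F \<subseteq> B n" for b by (auto simp: expands_def)
  have "q = component (G n) (int n + int i) q" using component_homogeneous[OF Q_grading q] by simp
  also have "\<dots> = (\<Sum>b\<in>F. component (G n) (int n + int i) (ac n (c b) b))"
    using component_Q_sum[of F "\<lambda>b. ac n (c b) b" n] F basis_in ac_closed[OF c] e
    by (simp add: expands_def subset_iff)
  also have "\<dots> = (\<Sum>b\<in>F. ac n (component A i (c b)) b)"
    using F basis_degree[of n] component_ac[OF c, of _ n "int n" "int n + int i"] by (intro sum.cong) auto
  finally have "expands n q F (\<lambda>b. component A i (c b))"
    using e component_cocycle[OF c] by (simp add: expands_def)
  then show ?thesis using component_in[OF grading UNIV_I] by blast
qed

lemma low_degree: "q \<in> G n j \<Longrightarrow> j < int n \<Longrightarrow> q = 0"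
proof -
  assume q: "q \<in> G n j" and j: "j < int n"
  obtain F c where e: "expands n q F c" using expansion_exists[OF G_Q[OF q]] by blast
  then have c: "d (c b) = 0" and F: "F \<subseteq> B n" for b by (auto simp: expands_def)
  have "q = component (G n) j q" using component_homogeneous[OF Q_grading q] by simp
  also have "\<dots> = (\<Sum>b\<in>F. component (G n) j (ac n (c b) b))"
    using component_Q_sum[of F "\<lambda>b. ac n (c b) b" n] F basis_in ac_closed[OF c] e
    by (simp add: expands_def subset_iff)
  also have "\<dots> = 0"
    using F basis_degree[of n] component_ac[OF c, of _ n "int n" j] j by (intro sum.neutral) auto
  finally show "q = 0" .
qed

lemma functional_ext_degree:
  assumes q: "q \<in> G n (int n + int i)"
  shows "\<exists>a\<in>A i. d a = 0 \<and> functional_ext n s q \<approx> a"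
proof -
  obtain F c where e: "expands n q F c" "\<forall>b. c b \<in> A i" using homogeneous_expansion[OF q] by blast
  then have "(\<Sum>b\<in>F. scale (s b) (c b)) \<in> A i" "d (\<Sum>b\<in>F. scale (s b) (c b)) = 0"
    by (auto simp: d_sum d_scale expands_def intro!: A_sum A_scale)
  then show ?thesis using functional_ext_cohomologous[OF e(1)] by blast
qed

end

context koszul_complex
begin

section \<open>Symbols of elements of the resolution\<close>

lemma dQ_closed: "q \<in> Q (Suc n) \<Longrightarrow> dQ n q \<in> Q n"
  and dQ_degree: "q \<in> G (Suc n) j \<Longrightarrow> dQ n q \<in> G n j"
  and dQ_add: "q \<in> Q (Suc n) \<Longrightarrow> q' \<in> Q (Suc n) \<Longrightarrow> dQ n (q + q') = dQ n q + dQ n q'"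
  using dQ_hom[of n] by (auto simp: graded_hom_def image_subset_iff)

lemma dQ_ac: "d a = 0 \<Longrightarrow> q \<in> Q (Suc n) \<Longrightarrow> dQ n (ac (Suc n) a q) = ac n a (dQ n q)"
  using dQ_hom[of n] cl_in[of a] by (auto simp: graded_hom_def ac_def)

lemma dQ_zero: "dQ n 0 = 0"
  using dQ_add[OF Q_zero Q_zero, of n] by simp

lemma dQ_sum: "(\<And>k. k \<in> S \<Longrightarrow> q k \<in> Q (Suc n)) \<Longrightarrow> dQ n (\<Sum>k\<in>S. q k) = (\<Sum>k\<in>S. dQ n (q k))"
  by (induction S rule: infinite_finite_induct) (auto simp: dQ_zero dQ_add Q_sum)

lemma dQ_dQ: "q \<in> Q (Suc (Suc n)) \<Longrightarrow> dQ n (dQ (Suc n) q) = 0"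
  using exact_Suc[of n] by blast

lemma dQ_component:
  assumes q: "q \<in> Q (Suc n)"
  shows "component (G n) j (dQ n q) = dQ n (component (G (Suc n)) j q)"
proof -
  note c = component_in[OF Q_grading q]
  have "dQ n q = dQ n (\<Sum>i | component (G (Suc n)) i q \<noteq> 0. component (G (Suc n)) i q)"
    by (simp flip: component_sum[OF Q_grading q])
  also have "\<dots> = (\<Sum>i | component (G (Suc n)) i q \<noteq> 0. dQ n (component (G (Suc n)) i q))"
    using G_Q[OF c] by (intro dQ_sum) auto
  finally have "component (G n) j (dQ n q)
      = (\<Sum>i | component (G (Suc n)) i q \<noteq> 0. component (G n) j (dQ n (component (G (Suc n)) i q)))"
    using component_Q_sum[OF G_Q[OF dQ_degree[OF c]]] by simp
  also have "\<dots> = (\<Sum>i | component (G (Suc n)) i q \<noteq> 0.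
      if i = j then dQ n (component (G (Suc n)) j q) else 0)"
    using component_homogeneous[OF Q_grading dQ_degree[OF c], of j] by (intro sum.cong) auto
  also have "\<dots> = dQ n (component (G (Suc n)) j q)"
    using component_finite[OF Q_grading q] by (auto simp: dQ_zero)
  finally show ?thesis .
qed

lemma homogeneous_preimage:
  assumes "q \<in> G n j" "q \<in> dQ n ` Q (Suc n)"
  shows "\<exists>y\<in>G (Suc n) j. dQ n y = q"
proof -
  obtain y where y: "y \<in> Q (Suc n)" "q = dQ n y" using assms(2) by blast
  have "dQ n (component (G (Suc n)) j y) = q"
    using dQ_component[OF y(1), of j] component_homogeneous[OF Q_grading assms(1), of j] y(2) by simp
  then show ?thesis using component_in[OF Q_grading y(1)] by blast
qed

lemma boundary_lowest_degree: "q \<in> G n (int n) \<Longrightarrow> q \<in> dQ n ` Q (Suc n) \<Longrightarrow> q = 0"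
  using homogeneous_preimage[of q n "int n"] low_degree[of _ "Suc n" "int n"] dQ_zero by fastforce

text \<open>
  The coefficient at the word \<open>u\<close> under the embedding of the resolution into \<open>H \<otimes> V\<^sup>\<otimes>\<^sup>n\<close>, with the
  differential given by multiplication with the first letter.
\<close>

primrec basis_symbol :: "nat list \<Rightarrow> 'q \<Rightarrow> 'k" where
  "basis_symbol [] b = e b"
| "basis_symbol (i # u) b = vco i (functional_ext (length u) (basis_symbol u) (dQ (length u) b))"

definition symbol :: "nat list \<Rightarrow> 'q \<Rightarrow> 'a" where
  "symbol u = functional_ext (length u) (basis_symbol u)"

lemma symbol_eq: "u \<in> words m n \<Longrightarrow> symbol u = functional_ext n (basis_symbol u)"
  by (simp add: symbol_def words_def)

lemma vco_combination: "i < m \<Longrightarrow> vco i (\<Sum>j<m. scale (c j) (v j)) = c i"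
  by (simp add: functional_sum[OF vco_functional] functionalD(2)[OF vco_functional] vco_v
      if_distrib[of "\<lambda>x. _ * x"] cong: if_cong)

lemma vco_cong: "i < m \<Longrightarrow> x \<approx> y \<Longrightarrow> vco i x = vco i y"
  using vco_boundary[of i "x - y"] functional_diff[OF vco_functional, of i x y]
  by (simp add: cohomologous_def)

lemma combination_cong:
  assumes "(\<Sum>i<m. scale (c i) (v i)) \<approx> (\<Sum>i<m. scale (c' i) (v i))" "i < m"
  shows "c i = c' i"
  using vco_cong[OF assms(2,1)] by (simp add: vco_combination[OF assms(2)])

lemma letters_mult_cong:
  "(\<And>i. i < m \<Longrightarrow> x i \<approx> y i) \<Longrightarrow> (\<Sum>i<m. x i * v i) \<approx> (\<Sum>i<m. y i * v i)"
  using v_cocycle by (intro cohomologous_sum cohomologous_mult(2)) auto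

text \<open>On basis elements this is the definition of the symbol of a longer word. The general case is a consequence,
  because \<open>symbol\<close> and the differential are linear over \<open>H(A)\<close>.\<close>

lemma symbol_dQ:
  assumes u: "u \<in> words m n" and q: "q \<in> Q (Suc n)"
  shows "symbol u (dQ n q) \<approx> (\<Sum>i<m. symbol (i # u) q * v i)"
proof -
  let ?s = "functional_ext n (basis_symbol u)"
  have lu: "length u = n" using u by (simp add: words_def)
  have on_basis: "?s (dQ n b) \<approx> (\<Sum>i<m. scale (basis_symbol (i # u) b) (v i))" if b: "b \<in> B (Suc n)" for b
  proof -
    have "dQ n b \<in> G n (int n + int 1)"
      using dQ_degree[of b n "int (Suc n)"] basis_degree[of "Suc n"] b by (auto simp: algebra_simps)
    then obtain a where a: "a \<in> A 1" "d a = 0" "?s (dQ n b) \<approx> a" using functional_ext_degree by blast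
    obtain c where c: "a = (\<Sum>i<m. scale (c i) (v i))" using v_span[OF a(1,2)] by blast
    have "basis_symbol (i # u) b = c i" if "i < m" for i
      using vco_cong[OF that a(3)] vco_combination[OF that, of c] c lu by simp
    then show ?thesis using a(3) c by simp
  qed
  obtain F c where e: "expands (Suc n) q F c" using expansion_exists[OF q] by blast
  then have c: "d (c b) = 0" and F: "F \<subseteq> B (Suc n)" "q = (\<Sum>b\<in>F. ac (Suc n) (c b) b)" for b
    by (auto simp: expands_def)
  have FQ: "b \<in> Q (Suc n)" if "b \<in> F" for b using F(1) basis_in that by blast
  have "dQ n q = (\<Sum>b\<in>F. dQ n (ac (Suc n) (c b) b))"
    unfolding F(2) using ac_closed[OF c FQ] by (intro dQ_sum) auto
  also have "\<dots> = (\<Sum>b\<in>F. ac n (c b) (dQ n b))" using dQ_ac[OF c FQ] by simp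
  finally have "?s (dQ n q) = ?s (\<Sum>b\<in>F. ac n (c b) (dQ n b))" by (rule arg_cong)
  then have "?s (dQ n q) \<approx> ?s (\<Sum>b\<in>F. ac n (c b) (dQ n b))" using cohomologous_refl by simp
  also have "\<dots> \<approx> (\<Sum>b\<in>F. ?s (ac n (c b) (dQ n b)))"
    using ac_closed[OF c dQ_closed[OF FQ]] by (intro functional_ext_sum) auto
  also have "\<dots> \<approx> (\<Sum>b\<in>F. c b * ?s (dQ n b))"
    by (rule cohomologous_sum) (rule functional_ext_ac[OF c dQ_closed[OF FQ]])
  also have "\<dots> \<approx> (\<Sum>b\<in>F. c b * (\<Sum>i<m. scale (basis_symbol (i # u) b) (v i)))"
    by (rule cohomologous_sum) (rule cohomologous_mult(1)[OF c on_basis[OF subsetD[OF F(1)]]])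
  also have "(\<Sum>b\<in>F. c b * (\<Sum>i<m. scale (basis_symbol (i # u) b) (v i)))
      = (\<Sum>i<m. (\<Sum>b\<in>F. scale (basis_symbol (i # u) b) (c b)) * v i)"
    unfolding sum_distrib_left sum_distrib_right
    by (subst sum.swap) (simp add: scale_simps del: basis_symbol.simps)
  also have "\<dots> \<approx> (\<Sum>i<m. symbol (i # u) q * v i)"
  proof (rule cohomologous_sum)
    fix i assume "i \<in> {..<m}"
    then have "d (v i) = 0" using v_cocycle by simp
    moreover have "(\<Sum>b\<in>F. scale (basis_symbol (i # u) b) (c b)) \<approx> symbol (i # u) q"
      unfolding symbol_def length_Cons lu by (rule cohomologous_sym[OF functional_ext_cohomologous[OF e]])
    ultimately show "(\<Sum>b\<in>F. scale (basis_symbol (i # u) b) (c b)) * v i \<approx> symbol (i # u) q * v i"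
      by (rule cohomologous_mult(2))
  qed
  finally show ?thesis using symbol_eq[OF u] by simp
qed

lemma symbol_ac: "u \<in> words m n \<Longrightarrow> d a = 0 \<Longrightarrow> q \<in> Q n \<Longrightarrow> symbol u (ac n a q) \<approx> a * symbol u q"
  using functional_ext_ac by (simp add: symbol_eq)

lemma symbol_sum: "u \<in> words m n \<Longrightarrow> (\<And>k. k \<in> S \<Longrightarrow> q k \<in> Q n) \<Longrightarrow>
    symbol u (\<Sum>k\<in>S. q k) \<approx> (\<Sum>k\<in>S. symbol u (q k))"
  using functional_ext_sum[of S q n] by (simp add: symbol_eq)

lemma symbol_zero: "u \<in> words m n \<Longrightarrow> symbol u 0 \<approx> 0"
  using functional_ext_zero by (simp add: symbol_eq)

lemma symbol_scalar: "u \<in> words m n \<Longrightarrow> x \<in> G n (int n) \<Longrightarrow> \<exists>c. symbol u x \<approx> scale c 1"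
  using functional_ext_degree[of x n 0 "basis_symbol u"] connected by (auto simp: symbol_eq)

lemma e_simps:
  "x \<in> Q 0 \<Longrightarrow> y \<in> Q 0 \<Longrightarrow> e (x + y) = e x + e y" "x \<in> Q 0 \<Longrightarrow> e (ac 0 (scale c 1) x) = c * e x"
  "x \<in> G 0 j \<Longrightarrow> j \<noteq> 0 \<Longrightarrow> e x = 0"
proof -
  show "e (x + y) = e x + e y" if "x \<in> Q 0" "y \<in> Q 0" using e_hom that by (auto simp: graded_hom_def)
  show "e (ac 0 (scale c 1) x) = c * e x" if "x \<in> Q 0"
    using e_hom that cl_in[of "scale c 1"]
    by (auto simp: graded_hom_def ac_def trivial_act_cohomology d_scale d_one)
  have "e ` G 0 j \<subseteq> trivial_grading j" using e_hom unfolding graded_hom_def by blast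
  then show "e x = 0" if "x \<in> G 0 j" "j \<noteq> 0" using that by (auto simp: trivial_grading_def)
qed

lemma e_zero: "e 0 = 0"
  using e_simps(1)[OF Q_zero Q_zero] by (simp only: add_0 add_cancel_right_right)

lemma e_sum: "(\<And>k. k \<in> S \<Longrightarrow> q k \<in> Q 0) \<Longrightarrow> e (\<Sum>k\<in>S. q k) = (\<Sum>k\<in>S. e (q k))"
  by (induction S rule: infinite_finite_induct) (auto simp: e_zero e_simps(1) Q_sum)

lemma symbol_empty:
  assumes x: "x \<in> G 0 0" shows "symbol [] x \<approx> scale (e x) 1"
proof -
  have "x \<in> G 0 (int 0 + int 0)" using x by simp
  from homogeneous_expansion[OF this]
  obtain F c where e: "expands 0 x F c" "\<forall>b. c b \<in> A 0" by blast
  have "\<forall>b. \<exists>r. c b = scale r 1" using e(2) connected by blast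
  then obtain g where g: "\<And>b. c b = scale (g b) 1" by metis
  have F: "b \<in> Q 0" if "b \<in> F" for b using e(1) basis_in that by (auto simp: expands_def)
  have sc: "d (scale c 1) = 0" for c by (simp add: d_scale d_one)
  have "e x = (\<Sum>b\<in>F. e (ac 0 (scale (g b) 1) b))"
    using e(1) g ac_closed[OF sc F] by (auto simp: expands_def intro!: e_sum)
  also have "\<dots> = (\<Sum>b\<in>F. g b * e b)" using e_simps(2)[OF F] by simp
  finally have "scale (e x) 1 = (\<Sum>b\<in>F. scale (basis_symbol [] b) (c b))"
    by (simp add: g alg.scale_sum_left mult.commute)
  then show ?thesis using functional_ext_cohomologous[OF e(1), of "basis_symbol []"] by (simp add: symbol_def)
qed

text \<open>
  This says that \<open>Q n\<close> embeds into \<open>H \<otimes> V\<^sup>\<otimes>\<^sup>n\<close>. On generators of degree \<open>n\<close>, the symbols of the differential vanish, so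
  the differential vanishes by induction, and by exactness the generator is the image of an
  element of degree \<open>n\<close> in the next module, which is generated in degree \<open>n + 1\<close>; so it is zero. The
  general case follows by applying functionals to the coefficients.
\<close>

lemma symbols_injective:
  "q \<in> Q n \<Longrightarrow> (\<And>u. u \<in> words m n \<Longrightarrow> symbol u q \<approx> 0) \<Longrightarrow> q = 0"
proof (induction n arbitrary: q)
  \<comment> \<open>The reduction to generators: a functional \<open>\<theta>\<close> applied to the coefficients commutes with the symbols.\<close>
  have from_generators: "q = 0" if gen: "\<And>x. x \<in> G n (int n) \<Longrightarrow> (\<And>u. u \<in> words m n \<Longrightarrow> symbol u x \<approx> 0) \<Longrightarrow> x = 0"
    and q: "q \<in> Q n" and zero: "\<And>u. u \<in> words m n \<Longrightarrow> symbol u q \<approx> 0" for n q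
  proof -
    obtain F c where e: "expands n q F c" using expansion_exists[OF q] by blast
    then have c: "d (c b) = 0" and F: "finite F" "F \<subseteq> B n" "q = (\<Sum>b\<in>F. ac n (c b) b)" for b
      by (auto simp: expands_def)
    have "c b \<in> range d" if b: "b \<in> F" for b
    proof (rule ccontr)
      assume "c b \<notin> range d"
      from alg.separating_functional[OF boundaries_subspace this] obtain \<theta> where
        \<theta>: "functional scale \<theta>" "\<theta> (c b) = 1" "\<And>y. y \<in> range d \<Longrightarrow> \<theta> y = 0" by blast
      \<comment> \<open>A generator of degree \<open>n\<close> whose coefficient at \<open>b\<close> is \<open>1\<close>.\<close>
      let ?x = "\<Sum>b\<in>F. ac n (scale (\<theta> (c b)) 1) b"
      have sc: "d (scale r 1) = 0" for r by (simp add: d_scale d_one)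
      have ex: "expands n ?x F (\<lambda>b. scale (\<theta> (c b)) 1)" using F sc by (simp add: expands_def)
      have "ac n (scale r 1) b \<in> G n (int n)" if "b \<in> F" for r b
        using ac_degree[OF sc scale_one_in] basis_degree[of n] F(2) that by fastforce
      then have "?x \<in> G n (int n)" by (rule add_subgroup_sum[OF G_subgroup])
      moreover have "symbol u ?x \<approx> 0" if u: "u \<in> words m n" for u
      proof -
        have "(\<Sum>b\<in>F. scale (basis_symbol u b) (c b)) \<approx> 0"
          using cohomologous_trans[OF cohomologous_sym[OF functional_ext_cohomologous[OF e]]]
            zero[OF u] by (simp add: symbol_eq[OF u])
        then have "(\<Sum>b\<in>F. basis_symbol u b * \<theta> (c b)) = 0"
          using \<theta>(3)[of "\<Sum>b\<in>F. scale (basis_symbol u b) (c b)"]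
          by (simp add: cohomologous_zero_iff functional_sum[OF \<theta>(1)] functionalD(2)[OF \<theta>(1)])
        moreover have "(\<Sum>b\<in>F. scale (basis_symbol u b) (scale (\<theta> (c b)) 1))
            = scale (\<Sum>b\<in>F. basis_symbol u b * \<theta> (c b)) 1" by (simp add: alg.scale_sum_left)
        ultimately show ?thesis
          using functional_ext_cohomologous[OF ex, of "basis_symbol u"] by (simp add: symbol_eq[OF u])
      qed
      ultimately have "?x = 0" by (rule gen)
      then have "scale (\<theta> (c b)) 1 \<in> range d"
        using expansion_of_zero[OF F(1,2), of "\<lambda>b. scale (\<theta> (c b)) 1" b] sc b by simp
      then show False using \<theta>(2) one_not_boundary by simp
    qed
    then show "q = 0" unfolding F(3)
      using F(2) basis_in by (intro sum.neutral ballI ac_boundary) auto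
  qed
  {
    case 0
    have "x = 0" if x: "x \<in> G 0 (int 0)" and "\<And>u. u \<in> words m 0 \<Longrightarrow> symbol u x \<approx> 0" for x
    proof -
      have "scale (e x) 1 \<approx> 0"
        using cohomologous_trans[OF cohomologous_sym[OF symbol_empty]] that by simp
      then have "scale (e x) 1 \<in> range d" by (simp add: cohomologous_zero_iff)
      then obtain y where "scale (e x) 1 = d y" by blast
      then have "scale (e x) 1 = 0" using boundary_degree_zero[of y] scale_one_in[of "e x"] by simp
      then have "e x = 0" by simp
      then have "x \<in> dQ 0 ` Q (Suc 0)" using exact_zero G_Q[OF x] by blast
      then show "x = 0" using boundary_lowest_degree[OF x] by simp
    qed
    then show ?case using from_generators[of 0 q] 0 by blast
  next
    case (Suc n)
    have "x = 0" if x: "x \<in> G (Suc n) (int (Suc n))"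
      and zero: "\<And>u. u \<in> words m (Suc n) \<Longrightarrow> symbol u x \<approx> 0" for x
    proof -
      have xQ: "x \<in> Q (Suc n)" using G_Q[OF x] .
      have "symbol u (dQ n x) \<approx> 0" if u: "u \<in> words m n" for u
      proof -
        have "(\<Sum>i<m. symbol (i # u) x * v i) \<approx> (\<Sum>i<m. 0 * v i)"
          using zero u v_cocycle by (intro cohomologous_sum cohomologous_mult(2)) (auto simp: Cons_in_words)
        then show ?thesis using cohomologous_trans[OF symbol_dQ[OF u xQ]] by simp
      qed
      then have "dQ n x = 0" using Suc.IH[OF dQ_closed[OF xQ]] by blast
      then have "x \<in> dQ (Suc n) ` Q (Suc (Suc n))" using exact_Suc[of n] xQ by blast
      then show "x = 0" using boundary_lowest_degree[OF x] by simp
    qed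
    then show ?case using from_generators[of "Suc n" q] Suc.prems by blast
  }
qed

lemma homogeneous_kernel:
  assumes q: "q \<in> G n (int n + int (Suc i))"
    and zero: "\<And>l u. n = Suc l \<Longrightarrow> u \<in> words m l \<Longrightarrow> symbol u (dQ l q) \<approx> 0"
  shows "\<exists>y\<in>G (Suc n) (int (Suc n) + int i). dQ n y = q"
proof -
  have "q \<in> dQ n ` Q (Suc n)"
  proof (cases n)
    case 0
    then have "e q = 0" using e_simps(3)[of q "int (Suc i)"] q by simp
    then show ?thesis using exact_zero G_Q[OF q] 0 by blast
  next
    case (Suc l)
    have qQ: "q \<in> Q (Suc l)" using G_Q[OF q] Suc by simp
    have "dQ l q = 0" using symbols_injective[OF dQ_closed[OF qQ]] zero[OF Suc] by blast
    then show ?thesis using exact_Suc[of l] qQ Suc by blast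
  qed
  from homogeneous_preimage[OF q this] show ?thesis by (simp add: algebra_simps)
qed

lemma letters_combination:
  assumes x: "\<And>i. i < m \<Longrightarrow> x i \<in> G n (int n)"
    and r: "\<And>i u. i < m \<Longrightarrow> u \<in> words m n \<Longrightarrow> symbol u (x i) \<approx> scale (r i u) 1"
  shows "(\<Sum>i<m. ac n (v i) (x i)) \<in> G n (int n + int 1)"
    and "u \<in> words m n \<Longrightarrow> symbol u (\<Sum>i<m. ac n (v i) (x i)) \<approx> (\<Sum>i<m. scale (r i u) (v i))"
proof -
  show "(\<Sum>i<m. ac n (v i) (x i)) \<in> G n (int n + int 1)"
    using ac_degree[OF v_cocycle v_in x]
    by (intro add_subgroup_sum[OF G_subgroup]) (simp add: add.commute)
  assume u: "u \<in> words m n"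
  have "symbol u (\<Sum>i<m. ac n (v i) (x i)) \<approx> (\<Sum>i<m. symbol u (ac n (v i) (x i)))"
    using ac_closed[OF v_cocycle G_Q[OF x]] by (intro symbol_sum[OF u]) auto
  also have "\<dots> \<approx> (\<Sum>i<m. v i * symbol u (x i))"
    using G_Q[OF x] by (intro cohomologous_sum symbol_ac[OF u] v_cocycle) auto
  also have "\<dots> \<approx> (\<Sum>i<m. v i * scale (r i u) 1)"
    using r u v_cocycle by (intro cohomologous_sum cohomologous_mult(1)) auto
  also have "\<dots> = (\<Sum>i<m. scale (r i u) (v i))" by (simp add: scale_simps)
  finally show "symbol u (\<Sum>i<m. ac n (v i) (x i)) \<approx> (\<Sum>i<m. scale (r i u) (v i))" .
qed

lemma degree_one_combination:
  assumes q: "q \<in> G n (int n + int 1)"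
  shows "\<exists>x. (\<forall>i<m. x i \<in> G n (int n)) \<and> q = (\<Sum>i<m. ac n (v i) (x i))"
proof -
  obtain F c where e: "expands n q F c" "\<forall>b. c b \<in> A 1" using homogeneous_expansion[OF q] by blast
  then have c: "d (c b) = 0" and F: "F \<subseteq> B n" "q = (\<Sum>b\<in>F. ac n (c b) b)" for b
    by (auto simp: expands_def)
  have "\<exists>g. c b = (\<Sum>i<m. scale (g i) (v i))" for b using v_span c e(2) by blast
  then obtain g where g: "\<And>b. c b = (\<Sum>i<m. scale (g b i) (v i))" by metis
  have sc: "d (scale r 1) = 0" for r by (simp add: d_scale d_one)
  have FG: "ac n (scale r 1) b \<in> G n (int n)" if "b \<in> F" for r b
    using ac_degree[OF sc scale_one_in] basis_degree[of n] F(1) that by fastforce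
  have FQ: "b \<in> Q n" if "b \<in> F" for b using F(1) basis_in that by blast
  have "ac n (c b) b = (\<Sum>i<m. ac n (v i) (ac n (scale (g b i) 1) b))" if b: "b \<in> F" for b
  proof -
    have "ac n (c b) b = (\<Sum>i<m. ac n (scale (g b i) (v i)) b)"
      unfolding g using FQ[OF b] v_cocycle by (intro ac_sum_left) (auto simp: d_scale)
    also have "\<dots> = (\<Sum>i<m. ac n (v i * scale (g b i) 1) b)" by (simp add: scale_simps)
    also have "\<dots> = (\<Sum>i<m. ac n (v i) (ac n (scale (g b i) 1) b))"
      using FQ[OF b] v_cocycle by (intro sum.cong refl ac_mult sc) auto
    finally show ?thesis .
  qed
  then have "q = (\<Sum>b\<in>F. \<Sum>i<m. ac n (v i) (ac n (scale (g b i) 1) b))" using F(2) by simp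
  also have "\<dots> = (\<Sum>i<m. \<Sum>b\<in>F. ac n (v i) (ac n (scale (g b i) 1) b))" by (rule sum.swap)
  also have "\<dots> = (\<Sum>i<m. ac n (v i) (\<Sum>b\<in>F. ac n (scale (g b i) 1) b))"
    using v_cocycle G_Q[OF FG] by (intro sum.cong refl ac_sum_right[symmetric]) auto
  finally show ?thesis
    using add_subgroup_sum[OF G_subgroup, of F "\<lambda>b. ac n (scale (g b _) 1) b" n "int n"] FG
    by (intro exI[of _ "\<lambda>i. \<Sum>b\<in>F. ac n (scale (g b i) 1) b"]) (auto intro: add_subgroup_sum[OF G_subgroup])
qed

text \<open>
  For a relational function on words of length \<open>n + 1\<close>, the inductively given generators \<open>x i\<close> combine to an
  element of \<open>Q n\<close> whose differential has zero symbols, because the relations hold. By exactness, this element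
  is a differential, and the letters can be read off from it.
\<close>

lemma relational_realized:
  "relational m v n r \<Longrightarrow> \<exists>x\<in>G n (int n). \<forall>u\<in>words m n. symbol u x \<approx> scale (r u) 1"
proof (induction n arbitrary: r)
  case 0
  obtain y where y: "y \<in> Q 0" "e y = r []" using e_onto by (metis UNIV_I imageE)
  have "e y = e (\<Sum>j | component (G 0) j y \<noteq> 0. component (G 0) j y)"
    by (simp flip: component_sum[OF Q_grading y(1)])
  also have "\<dots> = (\<Sum>j | component (G 0) j y \<noteq> 0. e (component (G 0) j y))"
    using G_Q[OF component_in[OF Q_grading y(1)]] by (intro e_sum) auto
  also have "\<dots> = (\<Sum>j | component (G 0) j y \<noteq> 0. if j = 0 then e (component (G 0) 0 y) else 0)"
    using e_simps(3)[OF component_in[OF Q_grading y(1)]] by (intro sum.cong) auto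
  also have "\<dots> = e (component (G 0) 0 y)" using component_finite[OF Q_grading y(1)] by (auto simp: e_zero)
  finally have "e (component (G 0) 0 y) = r []" using y(2) by simp
  moreover have "component (G 0) 0 y \<in> G 0 0" by (rule component_in[OF Q_grading y(1)])
  ultimately show ?case
    using symbol_empty[of "component (G 0) 0 y"] by (intro bexI[of _ "component (G 0) 0 y"]) auto
next
  case (Suc n)
  have "\<exists>x\<in>G n (int n). \<forall>u\<in>words m n. symbol u x \<approx> scale (r (i # u)) 1" if "i < m" for i
    using Suc.IH[OF relational_Cons[OF Suc.prems that]] by simp
  then obtain x where x: "\<And>i. i < m \<Longrightarrow> x i \<in> G n (int n)"
    "\<And>i u. i < m \<Longrightarrow> u \<in> words m n \<Longrightarrow> symbol u (x i) \<approx> scale (r (i # u)) 1" by metis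
  let ?p = "\<Sum>i<m. ac n (v i) (x i)"
  have p: "?p \<in> G n (int n + int 1)" using letters_combination(1)[of x n "\<lambda>i u. r (i # u)"] x by blast
  have sp: "symbol u ?p \<approx> (\<Sum>i<m. scale (r (i # u)) (v i))" if "u \<in> words m n" for u
    using letters_combination(2)[of x n "\<lambda>i u. r (i # u)"] x that by blast
  have "\<exists>y\<in>G (Suc n) (int (Suc n) + int 0). dQ n y = ?p"
  proof (rule homogeneous_kernel)
    show "?p \<in> G n (int n + int (Suc 0))" using p by simp
    fix l u assume n: "n = Suc l" and u: "u \<in> words m l"
    have pQ: "?p \<in> Q (Suc l)" using G_Q[OF p] n by simp
    have "symbol u (dQ l ?p) \<approx> (\<Sum>i<m. symbol (i # u) ?p * v i)" by (rule symbol_dQ[OF u pQ])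
    also have "\<dots> \<approx> (\<Sum>l<m. (\<Sum>i<m. scale (r (i # l # u)) (v i)) * v l)"
      using sp u n v_cocycle by (intro cohomologous_sum cohomologous_mult(2)) (auto simp: Cons_in_words)
    also have "\<dots> = (\<Sum>i<m. \<Sum>l<m. scale (r (i # l # u)) (v i * v l))"
      unfolding sum_distrib_right by (subst sum.swap) (simp add: scale_simps)
    also have "\<dots> \<approx> 0" using relationalD[OF Suc.prems[unfolded n] u] by (simp add: cohomologous_zero_iff)
    finally show "symbol u (dQ l ?p) \<approx> 0" .
  qed
  then obtain y where y: "y \<in> G (Suc n) (int (Suc n))" "dQ n y = ?p" by auto
  have "symbol w y \<approx> scale (r w) 1" if w: "w \<in> words m (Suc n)" for w
  proof -
    obtain j u where u: "w = j # u" "j < m" "u \<in> words m n" using words_SucE[OF w] .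
    have "\<exists>c. symbol (i # u) y \<approx> scale c 1" if "i < m" for i
      using symbol_scalar[OF _ y(1)] that u(3) by (simp add: Cons_in_words)
    then obtain c where c: "\<And>i. i < m \<Longrightarrow> symbol (i # u) y \<approx> scale (c i) 1" by metis
    have "(\<Sum>i<m. scale (c i) (v i)) \<approx> (\<Sum>i<m. scale (c i) 1 * v i)"
      by (simp add: scale_simps cohomologous_refl)
    also have "\<dots> \<approx> (\<Sum>i<m. symbol (i # u) y * v i)"
      by (rule letters_mult_cong) (rule cohomologous_sym[OF c])
    also have "\<dots> \<approx> symbol u ?p" using cohomologous_sym[OF symbol_dQ[OF u(3) G_Q[OF y(1)]]] y(2) by simp
    also have "\<dots> \<approx> (\<Sum>i<m. scale (r (i # u)) (v i))" by (rule sp[OF u(3)])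
    finally have "c j = r (j # u)" using combination_cong[of c "\<lambda>i. r (i # u)" j] u(2) by blast
    then show ?thesis using c[OF u(2)] u(1) by simp
  qed
  then show ?case using y(1) by blast
qed

text \<open>The converse: the relations express that the differential squares to zero.\<close>

lemma symbols_relational:
  "x \<in> G n (int n) \<Longrightarrow> \<exists>r. relational m v n r \<and> (\<forall>u\<in>words m n. symbol u x \<approx> scale (r u) 1)"
proof (induction n arbitrary: x)
  case 0
  have "relational m v 0 (\<lambda>_. e x)" by (simp add: relational_def)
  then show ?case using symbol_empty[of x] 0 by (intro exI[of _ "\<lambda>_. e x"]) simp
next
  case (Suc n)
  note xQ = G_Q[OF Suc.prems]
  have "\<exists>c. u \<in> words m (Suc n) \<longrightarrow> symbol u x \<approx> scale c 1" for u
    using symbol_scalar[OF _ Suc.prems] by blast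
  then obtain r where r: "\<And>u. u \<in> words m (Suc n) \<Longrightarrow> symbol u x \<approx> scale (r u) 1" by metis
  have dx: "symbol u (dQ n x) \<approx> (\<Sum>i<m. scale (r (i # u)) (v i))" if u: "u \<in> words m n" for u
  proof -
    have "symbol u (dQ n x) \<approx> (\<Sum>i<m. symbol (i # u) x * v i)" by (rule symbol_dQ[OF u xQ])
    also have "\<dots> \<approx> (\<Sum>i<m. scale (r (i # u)) 1 * v i)"
      using r u v_cocycle by (intro cohomologous_sum cohomologous_mult(2)) (auto simp: Cons_in_words)
    also have "\<dots> = (\<Sum>i<m. scale (r (i # u)) (v i))" by (simp add: scale_simps)
    finally show ?thesis .
  qed
  have "dQ n x \<in> G n (int n + int 1)" using dQ_degree[OF Suc.prems] by (simp add: algebra_simps)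
  then obtain y where y: "\<And>i. i < m \<Longrightarrow> y i \<in> G n (int n)" "dQ n x = (\<Sum>i<m. ac n (v i) (y i))"
    using degree_one_combination by blast
  have "\<exists>r. relational m v n r \<and> (\<forall>u\<in>words m n. symbol u (y i) \<approx> scale (r u) 1)" if "i < m" for i
    using Suc.IH y(1)[OF that] by blast
  then obtain r' where r': "\<And>i. i < m \<Longrightarrow> relational m v n (r' i)"
    "\<And>i u. i < m \<Longrightarrow> u \<in> words m n \<Longrightarrow> symbol u (y i) \<approx> scale (r' i u) 1" by metis
  have eq: "r' i u = r (i # u)" if "i < m" "u \<in> words m n" for i u
  proof (rule combination_cong[of "\<lambda>i. r' i u" "\<lambda>i. r (i # u)", OF _ that(1)])
    show "(\<Sum>i<m. scale (r' i u) (v i)) \<approx> (\<Sum>i<m. scale (r (i # u)) (v i))"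
    proof (rule cohomologous_trans[OF cohomologous_sym])
      show "symbol u (dQ n x) \<approx> (\<Sum>i<m. scale (r' i u) (v i))"
        unfolding y(2) by (rule letters_combination(2)) (use y(1) r'(2) that(2) in auto)
    qed (rule dx[OF that(2)])
  qed
  have "relational m v (Suc n) r"
  proof (rule relational_SucI)
    show "relational m v n (\<lambda>u. r (i # u))" if "i < m" for i
      by (rule relational_cong[OF eq[OF that] r'(1)[OF that]])
    fix l u assume n: "n = Suc l" and u: "u \<in> words m l"
    have dQ': "dQ n x \<in> Q (Suc l)" using dQ_closed[OF xQ] n by simp
    have "(\<Sum>i<m. \<Sum>l<m. scale (r (i # l # u)) (v i * v l))
        \<approx> (\<Sum>l<m. (\<Sum>i<m. scale (r (i # l # u)) (v i)) * v l)"
      unfolding sum_distrib_right by (subst sum.swap) (simp add: scale_simps cohomologous_refl)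
    also have "\<dots> \<approx> (\<Sum>l<m. symbol (l # u) (dQ n x) * v l)"
      by (rule letters_mult_cong, rule cohomologous_sym[OF dx]) (use u n in \<open>simp add: Cons_in_words\<close>)
    also have "\<dots> \<approx> symbol u (dQ l (dQ n x))" by (rule cohomologous_sym[OF symbol_dQ[OF u dQ']])
    also have "dQ l (dQ n x) = 0" using dQ_dQ[of x l] xQ n by simp
    also have "symbol u 0 \<approx> 0" by (rule symbol_zero[OF u])
    finally show "(\<Sum>i<m. \<Sum>l<m. scale (r (i # l # u)) (v i * v l)) \<in> range d"
      by (simp add: cohomologous_zero_iff)
  qed
  then show ?case using r by blast
qed

text \<open>
  Represent \<open>r\<close> by generators \<open>x s\<close> of \<open>Q j\<close>. The assumption says that the sum of the \<open>(a s) (x s)\<close> is a cycle, so it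
  is the differential of a combination of letters and generators of \<open>Q (j + 1)\<close>, whose symbols are the \<open>q i\<close>.
\<close>

theorem koszul_complex_exact:
  fixes S :: "'s set"
  assumes S: "finite S" and a: "\<And>s. s \<in> S \<Longrightarrow> a s \<in> A 2" "\<And>s. s \<in> S \<Longrightarrow> d (a s) = 0"
    and r: "\<And>s. s \<in> S \<Longrightarrow> relational m v j (r s)"
    and closed: "\<And>n u. j = Suc n \<Longrightarrow> u \<in> words m n \<Longrightarrow>
      (\<Sum>s\<in>S. \<Sum>l<m. scale (r s (l # u)) (a s * v l)) \<in> range d"
  shows "\<exists>q. (\<forall>i<m. relational m v (Suc j) (q i)) \<and>
    (\<forall>u\<in>words m j. (\<Sum>s\<in>S. scale (r s u) (a s)) -
       (\<Sum>l<m. \<Sum>i<m. scale (q i (l # u)) (v i * v l)) \<in> range d)"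
proof -
  have "\<exists>x\<in>G j (int j). \<forall>u\<in>words m j. symbol u x \<approx> scale (r s u) 1" if "s \<in> S" for s
    using relational_realized[OF r[OF that]] .
  then obtain x where x: "\<And>s. s \<in> S \<Longrightarrow> x s \<in> G j (int j)"
    "\<And>s u. s \<in> S \<Longrightarrow> u \<in> words m j \<Longrightarrow> symbol u (x s) \<approx> scale (r s u) 1" by metis
  let ?p = "\<Sum>s\<in>S. ac j (a s) (x s)"
  have p: "?p \<in> G j (int j + int (Suc 1))"
  proof (rule add_subgroup_sum[OF G_subgroup])
    show "ac j (a s) (x s) \<in> G j (int j + int (Suc 1))" if "s \<in> S" for s
      using ac_degree[OF a(2)[OF that] a(1)[OF that] x(1)[OF that]] by (simp add: algebra_simps)
  qed
  have sp: "symbol u ?p \<approx> (\<Sum>s\<in>S. scale (r s u) (a s))" if u: "u \<in> words m j" for u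
  proof -
    have "symbol u ?p \<approx> (\<Sum>s\<in>S. symbol u (ac j (a s) (x s)))"
      using ac_closed[OF a(2) G_Q[OF x(1)]] by (intro symbol_sum[OF u]) auto
    also have "\<dots> \<approx> (\<Sum>s\<in>S. a s * symbol u (x s))"
      using G_Q[OF x(1)] by (intro cohomologous_sum symbol_ac[OF u] a(2)) auto
    also have "\<dots> \<approx> (\<Sum>s\<in>S. a s * scale (r s u) 1)"
      using x(2) u a(2) by (intro cohomologous_sum cohomologous_mult(1)) auto
    also have "\<dots> = (\<Sum>s\<in>S. scale (r s u) (a s))" by (simp add: scale_simps)
    finally show ?thesis .
  qed
  have "\<exists>y\<in>G (Suc j) (int (Suc j) + int 1). dQ j y = ?p"
  proof (rule homogeneous_kernel[OF p])
    fix n u assume n: "j = Suc n" and u: "u \<in> words m n"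
    have pQ: "?p \<in> Q (Suc n)" using G_Q[OF p] n by simp
    have "symbol u (dQ n ?p) \<approx> (\<Sum>l<m. symbol (l # u) ?p * v l)" by (rule symbol_dQ[OF u pQ])
    also have "\<dots> \<approx> (\<Sum>l<m. (\<Sum>s\<in>S. scale (r s (l # u)) (a s)) * v l)"
      using sp u n v_cocycle by (intro cohomologous_sum cohomologous_mult(2)) (auto simp: Cons_in_words)
    also have "\<dots> = (\<Sum>s\<in>S. \<Sum>l<m. scale (r s (l # u)) (a s * v l))"
      unfolding sum_distrib_right by (subst sum.swap) (simp add: scale_simps)
    also have "\<dots> \<approx> 0" using closed[OF n u] by (simp add: cohomologous_zero_iff)
    finally show "symbol u (dQ n ?p) \<approx> 0" .
  qed
  then obtain y where y: "y \<in> G (Suc j) (int (Suc j) + int 1)" "dQ j y = ?p" by blast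
  obtain z where z: "\<And>i. i < m \<Longrightarrow> z i \<in> G (Suc j) (int (Suc j))" "y = (\<Sum>i<m. ac (Suc j) (v i) (z i))"
    using degree_one_combination[OF y(1)] by blast
  have "\<exists>r. relational m v (Suc j) r \<and> (\<forall>u\<in>words m (Suc j). symbol u (z i) \<approx> scale (r u) 1)"
    if "i < m" for i using symbols_relational[OF z(1)[OF that]] .
  then obtain q where q: "\<And>i. i < m \<Longrightarrow> relational m v (Suc j) (q i)"
    "\<And>i u. i < m \<Longrightarrow> u \<in> words m (Suc j) \<Longrightarrow> symbol u (z i) \<approx> scale (q i u) 1" by metis
  have "(\<Sum>s\<in>S. scale (r s u) (a s)) \<approx> (\<Sum>l<m. \<Sum>i<m. scale (q i (l # u)) (v i * v l))"
    if u: "u \<in> words m j" for u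
  proof -
    have "(\<Sum>s\<in>S. scale (r s u) (a s)) \<approx> symbol u (dQ j y)"
      using cohomologous_sym[OF sp[OF u]] y(2) by simp
    also have "\<dots> \<approx> (\<Sum>l<m. symbol (l # u) y * v l)" by (rule symbol_dQ[OF u G_Q[OF y(1)]])
    also have "\<dots> \<approx> (\<Sum>l<m. (\<Sum>i<m. scale (q i (l # u)) (v i)) * v l)"
      using letters_combination(2)[of z "Suc j" q, OF z(1) q(2)] u v_cocycle z(2)
      by (intro cohomologous_sum cohomologous_mult(2)) (auto simp: Cons_in_words)
    also have "\<dots> = (\<Sum>l<m. \<Sum>i<m. scale (q i (l # u)) (v i * v l))"
      by (simp add: sum_distrib_right scale_simps)
    finally show ?thesis .
  qed
  then show ?thesis using q(1) by (auto simp: cohomologous_def)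
qed

end

section \<open>The filtration on the Ext-algebra\<close>

lemma pairing_tensor_mult:
  assumes t: "t \<in> tensor_part m n" and s: "s \<in> tensor_part m l"
  shows "pairing m (n + l) (t \<otimes>\<^bsub>tensor_alg m\<^esub> s) r
    = (\<Sum>u\<in>words m n. t u * (\<Sum>y\<in>words m l. s y * r (u @ y)))"
proof -
  have "t u = 0" if "u \<in> words m i" "i \<noteq> n" for u i
    using t that by (auto simp: tensor_part_iff words_def)
  then have "(\<Sum>i\<le>n + l. \<Sum>u\<in>words m i. \<Sum>y\<in>words m (n + l - i). t u * s y * r (u @ y))
      = (\<Sum>i\<in>{n}. \<Sum>u\<in>words m i. \<Sum>y\<in>words m (n + l - i). t u * s y * r (u @ y))"
    by (intro sum.mono_neutral_right) auto
  then show ?thesis by (simp add: pairing_mult sum_distrib_left mult.assoc)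
qed

context comparison
begin

lemma ext_functional_unit: "w \<in> K 0 \<Longrightarrow> ext_functional \<zero>\<^bsub>M.ext_alg\<^esub> w = 0"
proof -
  interpret X: k_algebra M.ext_alg by (rule k_algebraI[OF M.ext_kalgebra])
  assume "w \<in> K 0"
  from ext_functional_rules(1)[OF X.zero_closed X.zero_closed this] show ?thesis
    by (simp only: X.l_zero[OF X.zero_closed] add_cancel_right_right)
qed

text \<open>
  An endomorphism of the resolution multiplies the line \<open>socle 1\<close> by a scalar, and this scalar is
  the augmentation of its class.
\<close>

lemma ext_augmented: "augmented_algebra M.ext_alg"
proof -
  obtain w where w: "w \<in> socle 1" "eK w = 1" using socle_one_unit by blast
  have wK: "w \<in> K 0" using w(1) socle_degree by blast
  let ?h = "\<lambda>X. ext_functional X w"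
  have mult: "?h (X \<otimes>\<^bsub>M.ext_alg\<^esub> Y) = ?h X * ?h Y"
    if X: "X \<in> carrier M.ext_alg" and Y: "Y \<in> carrier M.ext_alg" for X Y
  proof -
    obtain f where f: "chain_endo f" "\<forall>w\<in>K 0. eK (f w) = ext_functional Y w"
      "\<forall>X\<in>carrier M.ext_alg. \<forall>w\<in>K 0. ext_functional (X \<otimes>\<^bsub>M.ext_alg\<^esub> Y) w = ext_functional X (f w)"
      using ext_functional_mult[OF Y] by blast
    have "f w \<in> socle 1"
      using chain_endo_shift[OF f(1), of 0 w 1] w(1) chain_endoD(5)[OF f(1)]
        functional_zero[OF trivial_cocycle_functional[OF e_cocycle]] by simp
    moreover have "actK (scale (eK (f w)) 1) w \<in> socle 1"
      using mod.subspace_scale[OF socle_subspace w(1)] .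
    ultimately have "f w - actK (scale (eK (f w)) 1) w \<in> socle 1"
      by (rule mod.subspace_diff[OF socle_subspace])
    moreover have "eK (f w - actK (scale (eK (f w)) 1) w) = 0"
      using functional_diff[OF trivial_cocycle_functional[OF e_cocycle]] e_simps(5) w(2) by simp
    ultimately have "f w = actK (scale (eK (f w)) 1) w" using socle_one by fastforce
    then have "ext_functional X (f w) = eK (f w) * ext_functional X w"
      using functionalD(2)[OF ext_functional_lin[OF X]] by metis
    then show ?thesis using f(2,3) X wK by (simp add: mult.commute)
  qed
  interpret X: k_algebra M.ext_alg by (rule k_algebraI[OF M.ext_kalgebra])
  have "?h \<in> ring_hom M.ext_alg ground"
    using mult ext_functional_rules(1)[OF _ _ wK] ext_functional_rules(3)[OF X.one_closed X.one_closed wK] w(2)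
    by (intro ring_hom_memI) (auto simp: ground_def type_alg_def)
  then have "?h \<in> alg_hom M.ext_alg ground"
    using ext_functional_rules(2)[OF _ _ wK] by (auto simp: alg_hom_def ground_def type_alg_def)
  then show ?thesis using M.ext_kalgebra unfolding augmented_algebra_def by blast
qed

definition ext_filtration :: "nat \<Rightarrow> ('m \<Rightarrow> 'm) set set" where
  "ext_filtration n = {X \<in> carrier M.ext_alg. \<forall>w\<in>socle n. ext_functional X w = 0}"

lemma ext_filtration_mult:
  assumes X: "X \<in> ext_filtration p" and Y: "Y \<in> ext_filtration n"
  shows "X \<otimes>\<^bsub>M.ext_alg\<^esub> Y \<in> ext_filtration (p + n)"
proof -
  interpret X: k_algebra M.ext_alg by (rule k_algebraI[OF M.ext_kalgebra])
  have XY: "X \<in> carrier M.ext_alg" "Y \<in> carrier M.ext_alg" using X Y by (auto simp: ext_filtration_def)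
  obtain f where f: "chain_endo f" "\<forall>w\<in>K 0. eK (f w) = ext_functional Y w"
    "\<forall>X\<in>carrier M.ext_alg. \<forall>w\<in>K 0. ext_functional (X \<otimes>\<^bsub>M.ext_alg\<^esub> Y) w = ext_functional X (f w)"
    using ext_functional_mult[OF XY(2)] by blast
  have "ext_functional (X \<otimes>\<^bsub>M.ext_alg\<^esub> Y) w = 0" if w: "w \<in> socle (p + n)" for w
  proof -
    have wK: "w \<in> K 0" using w socle_degree by blast
    have "eK (f w) = 0" if "w \<in> socle n" for w
    proof -
      have "w \<in> K 0" using that socle_degree by blast
      then show ?thesis using f(2) Y that by (simp add: ext_filtration_def)
    qed
    from chain_endo_shift[OF f(1) this w] have "f w \<in> socle p" .
    then have "ext_functional X (f w) = 0" using X by (simp add: ext_filtration_def)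
    then show ?thesis using f(3) XY(1) wK by simp
  qed
  then show ?thesis using XY by (simp add: ext_filtration_def)
qed

lemma ext_filtration_filters: "alg_filtration M.ext_alg ext_filtration"
  unfolding alg_filtration_def
proof (intro conjI allI ballI)
  interpret X: k_algebra M.ext_alg by (rule k_algebraI[OF M.ext_kalgebra])
  have wK: "w \<in> K 0" if "w \<in> socle n" for w n using socle_degree that by blast
  show "ext_filtration 0 = carrier M.ext_alg"
    using functional_zero[OF ext_functional_lin] by (auto simp: ext_filtration_def)
  show "ext_filtration (Suc n) \<subseteq> ext_filtration n" for n
    using socle_Suc[of n] unfolding ext_filtration_def by blast
  show "submodule (ext_filtration n) ground M.ext_alg" for n
  proof (intro submodule.intro submodule_axioms.intro)
    have smult: "c \<odot>\<^bsub>M.ext_alg\<^esub> X \<in> ext_filtration n" if "X \<in> ext_filtration n" for c X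
      using that X.smult_rules(1) ext_functional_rules(2)[of X X] wK by (auto simp: ext_filtration_def)
    then show "c \<odot>\<^bsub>M.ext_alg\<^esub> X \<in> ext_filtration n" if "X \<in> ext_filtration n" for c X using that .
    show "subgroup (ext_filtration n) (add_monoid M.ext_alg)"
    proof (rule X.add.subgroupI)
      show "ext_filtration n \<subseteq> carrier M.ext_alg" by (auto simp: ext_filtration_def)
      have "\<zero>\<^bsub>M.ext_alg\<^esub> \<in> ext_filtration n"
        using ext_functional_unit wK by (auto simp: ext_filtration_def)
      then show "ext_filtration n \<noteq> {}" by blast
      show "\<ominus>\<^bsub>M.ext_alg\<^esub> X \<in> ext_filtration n" if "X \<in> ext_filtration n" for X
        using smult[OF that, of "- 1"] X.smult_minus_one[of X] that by (simp add: ext_filtration_def)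
      show "X \<oplus>\<^bsub>M.ext_alg\<^esub> Y \<in> ext_filtration n" if "X \<in> ext_filtration n" "Y \<in> ext_filtration n" for X Y
        using that ext_functional_rules(1)[of X Y] wK by (auto simp: ext_filtration_def)
    qed
  qed
  show "X \<otimes>\<^bsub>M.ext_alg\<^esub> Y \<in> ext_filtration (p + n)"
    if "X \<in> ext_filtration p" "Y \<in> ext_filtration n" for p n X Y
    using that by (rule ext_filtration_mult)
qed

text \<open>
  The relation \<open>rho n X t\<close> says that the functional of \<open>X\<close> is given on \<open>socle (n + 1)\<close> by pairing the tensor \<open>t\<close> with
  \<open>mu\<close>. It determines \<open>t\<close> up to tensors that annihilate the image of \<open>mu\<close>; since this image consists of
  all relational functions, these are the elements of the ideal generated by the orthogonal complement.
\<close>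

lemma ext_graded_iso:
  assumes L: "koszul_exactness scale A d actK K dK BsK eK m v vco"
    and U: "quadratic_relations m U"
    and rel: "\<And>g. g \<in> tensor_part m 2 \<Longrightarrow>
      (\<Sum>i<m. \<Sum>l<m. scale (g [i, l]) (v i * v l)) \<in> range d \<longleftrightarrow> g \<in> U"
  shows "graded_alg_iso (gr_alg M.ext_alg ext_filtration) (gr_part M.ext_alg ext_filtration)
    (quadratic_alg m (orthogonal_relations m U)) (quadratic_part m (orthogonal_relations m U))"
proof -
  interpret L: koszul_exactness scale A d actK K dK BsK eK m v vco by (rule L)
  interpret X: k_algebra M.ext_alg by (rule k_algebraI[OF M.ext_kalgebra])
  interpret T: k_algebra "tensor_alg m :: ('k, nat list \<Rightarrow> 'k) module" by (rule tensor_k_algebra)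
  let ?I = "Idl\<^bsub>tensor_alg m\<^esub> (orthogonal_relations m U)"
  have wK: "w \<in> K 0" if "w \<in> socle n" for w n using socle_degree that by blast
  have relational_slices: "relational m v n r \<longleftrightarrow> slices_in m U n r" for n r
  proof -
    have "slice m r u y \<in> U \<longleftrightarrow> (\<Sum>i<m. \<Sum>l<m. scale (r (u @ i # l # y)) (v i * v l)) \<in> range d" for u y
    proof -
      have "slice m r u y \<in> tensor_part m 2" by (simp add: tensor_part_iff slice_def)
      moreover have "(\<Sum>i<m. \<Sum>l<m. scale (slice m r u y [i, l]) (v i * v l))
          = (\<Sum>i<m. \<Sum>l<m. scale (r (u @ i # l # y)) (v i * v l))"
        by (intro sum.cong) (auto simp: slice_def words_def)
      ultimately show ?thesis using rel[of "slice m r u y"] by simp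
    qed
    then show ?thesis by (simp add: relational_def slices_in_def)
  qed
  define rho where "rho n X t \<longleftrightarrow> X \<in> ext_filtration n \<and> t \<in> tensor_part m n \<and>
    (\<forall>w\<in>socle (Suc n). ext_functional X w = pairing m n t (\<lambda>u. L.mu u w))" for n X t
  have carrier: "X \<in> carrier M.ext_alg" if "X \<in> ext_filtration n" for X n
    using that by (simp add: ext_filtration_def)
  have sub: "submodule (ext_filtration n) ground M.ext_alg" for n
    using ext_filtration_filters by (simp add: alg_filtration_def)
  have ideal_iff: "t \<in> ?I \<longleftrightarrow> (\<forall>r. slices_in m U n r \<longrightarrow> pairing m n t r = 0)" if t: "t \<in> tensor_part m n" for t n
  proof -
    have "pairing m k t r = 0" if "k \<noteq> n" for k r
      using pairing_hpart[of m k n t r] hpart_tensor_part[OF t, of n] that by simp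
    then show ?thesis using orthogonal_ideal[OF U tensor_part_carrier[OF t]] by metis
  qed
  have "symbol_relation M.ext_alg ext_filtration m ?I rho"
  proof (intro symbol_relation.intro symbol_relation_axioms.intro X.k_algebra_axioms)
    show "alg_filtration M.ext_alg ext_filtration" by (rule ext_filtration_filters)
    show "ideal ?I (tensor_alg m)"
      by (rule T.genideal_ideal) (auto simp: orthogonal_relations_def intro: tensor_part_carrier)
    fix n X t assume "rho n X t"
    then show "X \<in> ext_filtration n" "t \<in> tensor_part m n" by (simp_all add: rho_def)
  next
    fix n X assume X: "X \<in> ext_filtration n"
    have "\<exists>c. \<forall>w\<in>socle (Suc n). ext_functional X w = (\<Sum>u\<in>words m n. c u * L.mu u w)"
    proof (rule L.functional_combination_mu)
      show "w \<in> socle n" if "w \<in> socle (Suc n)" "\<And>u. u \<in> words m n \<Longrightarrow> L.mu u w = 0" for w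
        using that by (rule L.socle_detect)
      show "lin (ext_functional X)" by (rule ext_functional_lin[OF carrier[OF X]])
      show "ext_functional X w = 0" if "w \<in> socle n" for w using X that by (simp add: ext_filtration_def)
    qed
    then obtain c where c: "\<forall>w\<in>socle (Suc n). ext_functional X w = (\<Sum>u\<in>words m n. c u * L.mu u w)" by blast
    have "rho n X (\<lambda>u. if u \<in> words m n then c u else 0)"
      using X c by (simp add: rho_def tensor_part_iff pairing_def)
    then show "\<exists>t. rho n X t" by blast
  next
    fix n and t :: "nat list \<Rightarrow> 'k" assume t: "t \<in> tensor_part m n"
    have "lin (\<lambda>w. \<Sum>u\<in>words m n. t u * L.mu u w)"
      by (rule functional_combination) (rule L.mu_lin)
    from ext_functional_surjective[OF this] obtain X where
      X: "X \<in> carrier M.ext_alg" "\<forall>w\<in>K 0. ext_functional X w = (\<Sum>u\<in>words m n. t u * L.mu u w)" by blast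
    have "ext_functional X w = 0" if "w \<in> socle n" for w
      using X(2) wK[OF that] L.mu_kills[OF _ that] by simp
    then have "rho n X t" using X t wK by (auto simp: rho_def ext_filtration_def pairing_def)
    then show "\<exists>X. rho n X t" by blast
  next
    fix n X Y t s assume X: "rho n X t" and Y: "rho n Y s"
    then have "X \<oplus>\<^bsub>M.ext_alg\<^esub> Y \<in> ext_filtration n"
      using subgroup.m_closed[OF submodule.axioms(1)[OF sub[of n]], of X Y] by (simp add: rho_def)
    moreover have "(\<lambda>w. t w + s w) \<in> tensor_part m n" using X Y by (simp add: rho_def tensor_part_iff)
    moreover have "ext_functional (X \<oplus>\<^bsub>M.ext_alg\<^esub> Y) w = pairing m n (\<lambda>w. t w + s w) (\<lambda>u. L.mu u w)"
      if "w \<in> socle (Suc n)" for w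
    proof -
      have "X \<in> carrier M.ext_alg" "Y \<in> carrier M.ext_alg" using X Y carrier by (auto simp: rho_def)
      from ext_functional_rules(1)[OF this wK[OF that]] X Y that show ?thesis
        by (simp add: rho_def pairing_def distrib_right sum.distrib)
    qed
    ultimately show "rho n (X \<oplus>\<^bsub>M.ext_alg\<^esub> Y) (\<lambda>w. t w + s w)" by (simp add: rho_def)
  next
    fix n X t c assume X: "rho n X t"
    then have "c \<odot>\<^bsub>M.ext_alg\<^esub> X \<in> ext_filtration n"
      using submodule.smult_closed[OF sub[of n], of c X] by (simp add: rho_def ground_def type_alg_def)
    moreover have "(\<lambda>w. c * t w) \<in> tensor_part m n" using X by (simp add: rho_def tensor_part_iff)
    moreover have "ext_functional (c \<odot>\<^bsub>M.ext_alg\<^esub> X) w = pairing m n (\<lambda>w. c * t w) (\<lambda>u. L.mu u w)"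
      if "w \<in> socle (Suc n)" for w
    proof -
      have "X \<in> carrier M.ext_alg" using X carrier by (auto simp: rho_def)
      from ext_functional_rules(2)[OF this this wK[OF that]] X that show ?thesis
        by (simp add: rho_def pairing_def sum_distrib_left mult.assoc)
    qed
    ultimately show "rho n (c \<odot>\<^bsub>M.ext_alg\<^esub> X) (\<lambda>w. c * t w)" by (simp add: rho_def)
  next
    fix n l X Y t s assume X: "rho n X t" and Y: "rho l Y s"
    have XY: "X \<in> carrier M.ext_alg" "Y \<in> carrier M.ext_alg" using X Y carrier by (auto simp: rho_def)
    obtain f where f: "chain_endo f" "\<forall>w\<in>K 0. eK (f w) = ext_functional Y w"
      "\<forall>X\<in>carrier M.ext_alg. \<forall>w\<in>K 0. ext_functional (X \<otimes>\<^bsub>M.ext_alg\<^esub> Y) w = ext_functional X (f w)"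
      using ext_functional_mult[OF XY(2)] by blast
    have ef: "eK (f w) = (\<Sum>y\<in>words m l. s y * L.mu y w)" if "w \<in> socle (Suc l)" for w
      using f(2) wK[OF that] Y that by (simp add: rho_def pairing_def)
    have kill: "eK (f w) = 0" if "w \<in> socle l" for w
      using f(2) wK[OF that] Y that by (simp add: rho_def ext_filtration_def)
    have "ext_functional (X \<otimes>\<^bsub>M.ext_alg\<^esub> Y) w
        = pairing m (n + l) (t \<otimes>\<^bsub>tensor_alg m\<^esub> s) (\<lambda>u. L.mu u w)" if w: "w \<in> socle (Suc (n + l))" for w
    proof -
      have fw: "f w \<in> socle (Suc n)" using chain_endo_shift[OF f(1), of l w "Suc n"] kill w by simp
      have "ext_functional (X \<otimes>\<^bsub>M.ext_alg\<^esub> Y) w = ext_functional X (f w)" using f(3) XY(1) wK[OF w] by blast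
      also have "\<dots> = (\<Sum>u\<in>words m n. t u * L.mu u (f w))" using X fw by (simp add: rho_def pairing_def)
      also have "\<dots> = (\<Sum>u\<in>words m n. t u * (\<Sum>y\<in>words m l. s y * L.mu (u @ y) w))"
        using L.mu_chain_endo[OF f(1) ef _ w] by (intro sum.cong) auto
      finally show ?thesis using X Y by (simp add: rho_def pairing_tensor_mult)
    qed
    then show "rho (n + l) (X \<otimes>\<^bsub>M.ext_alg\<^esub> Y) (t \<otimes>\<^bsub>tensor_alg m\<^esub> s)"
      using X Y ext_filtration_mult[of X n Y l] tensor_part_mult[of t m n s l] by (simp add: rho_def)
  next
    have "\<one>\<^bsub>M.ext_alg\<^esub> \<in> ext_filtration 0"
      using ext_filtration_filters X.one_closed by (simp add: alg_filtration_def)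
    moreover have "single [] \<in> tensor_part m 0" by (simp add: tensor_part_iff single_def)
    moreover have "ext_functional \<one>\<^bsub>M.ext_alg\<^esub> w = pairing m 0 (single []) (\<lambda>u. L.mu u w)"
      if "w \<in> socle (Suc 0)" for w
      using ext_functional_rules(3)[OF X.one_closed X.one_closed wK[OF that]]
      by (simp add: pairing_def single_def)
    ultimately show "rho 0 \<one>\<^bsub>M.ext_alg\<^esub> (single [])" by (simp add: rho_def)
  next
    fix n X assume X: "X \<in> ext_filtration n"
    have "pairing m n (\<lambda>_. 0) r = 0" for r :: "nat list \<Rightarrow> 'k" by (simp add: pairing_def)
    then show "rho n X (\<lambda>_. 0) \<longleftrightarrow> X \<in> ext_filtration (Suc n)"
      using X by (simp add: rho_def tensor_part_iff ext_filtration_def)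
  next
    fix n t
    have "rho n \<zero>\<^bsub>M.ext_alg\<^esub> t \<longleftrightarrow> t \<in> tensor_part m n \<and>
        (\<forall>w\<in>socle (Suc n). pairing m n t (\<lambda>u. L.mu u w) = 0)"
      using subgroup.one_closed[OF submodule.axioms(1)[OF sub[of n]]] ext_functional_unit wK
      by (fastforce simp: rho_def)
    moreover have "(\<forall>w\<in>socle (Suc n). pairing m n t (\<lambda>u. L.mu u w) = 0) \<longleftrightarrow>
        (\<forall>r. slices_in m U n r \<longrightarrow> pairing m n t r = 0)"
    proof (intro iffI ballI allI impI)
      fix r assume zero: "\<forall>w\<in>socle (Suc n). pairing m n t (\<lambda>u. L.mu u w) = 0" and r: "slices_in m U n r"
      obtain w where w: "w \<in> socle (Suc n)" "\<forall>u\<in>words m n. L.mu u w = r u"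
        using L.all_realizable[of n] r unfolding L.realizable_def relational_slices by blast
      have "pairing m n t r = pairing m n t (\<lambda>u. L.mu u w)" using w(2) by (simp add: pairing_def)
      then show "pairing m n t r = 0" using zero w(1) by simp
    next
      fix w assume zero: "\<forall>r. slices_in m U n r \<longrightarrow> pairing m n t r = 0" and w: "w \<in> socle (Suc n)"
      from L.mu_relational[OF w] show "pairing m n t (\<lambda>u. L.mu u w) = 0"
        using zero unfolding relational_slices by blast
    qed
    ultimately show "rho n \<zero>\<^bsub>M.ext_alg\<^esub> t \<longleftrightarrow> t \<in> tensor_part m n \<and> t \<in> ?I"
      using ideal_iff[of t n] by blast
  next
    fix t n assume t: "t \<in> ?I"
    have "orthogonal_relations m U \<subseteq> carrier (tensor_alg m)"
      by (auto simp: orthogonal_relations_def intro: tensor_part_carrier)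
    then have tc: "t \<in> carrier (tensor_alg m)"
      using t ideal.Icarr[OF T.genideal_ideal] by blast
    have "pairing m n (hpart n t) r = 0" if "slices_in m U n r" for r
      using orthogonal_ideal[OF U tc] t that pairing_hpart[of m n n t r] by simp
    then show "hpart n t \<in> ?I" using ideal_iff[OF hpart_in[OF tc]] by blast
  qed
  then interpret S: symbol_relation M.ext_alg ext_filtration m ?I rho .
  have "quadratic_part m (orthogonal_relations m U) = (\<lambda>n. {?I +>\<^bsub>tensor_alg m\<^esub> f | f. f \<in> tensor_part m n})"
    by (rule ext) (simp add: quadratic_part_def)
  then show ?thesis using S.gr_iso by (simp add: quadratic_alg_def)
qed

end

theorem theorem3p3:
  fixes scale :: "'k::field \<Rightarrow> 'a::ring_1 \<Rightarrow> 'a" and A :: "nat \<Rightarrow> 'a set" and d :: "'a \<Rightarrow> 'a"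
    and act :: "'a \<Rightarrow> 'm::ab_group_add \<Rightarrow> 'm" and M :: "int \<Rightarrow> 'm set" and dM :: "'m \<Rightarrow> 'm"
  assumes "connected_dg_algebra scale A d"
    and "connected_dg_algebra.koszul_dg scale A d TYPE('p::ab_group_add)"
    and "connected_dg_algebra.semifree_resolution scale A d act M dM"
  shows "augmented_algebra (dg_module.ext_alg scale A act M dM) \<and>
    (\<exists>F. alg_filtration (dg_module.ext_alg scale A act M dM) F \<and>
      (\<forall>m U.
        quadratic_relations m U \<longrightarrow>
        graded_alg_iso
          (connected_dg_algebra.cohomology_alg scale d)
          (connected_dg_algebra.cohomology_part scale A d)
          (quadratic_alg m U) (quadratic_part m U) \<longrightarrow>
        has_koszul_resolution TYPE('q::ab_group_add)
          (connected_dg_algebra.cohomology_alg scale d)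
          (connected_dg_algebra.cohomology_part scale A d) \<longrightarrow>
        graded_alg_iso
          (gr_alg (dg_module.ext_alg scale A act M dM) F)
          (gr_part (dg_module.ext_alg scale A act M dM) F)
          (quadratic_alg m (orthogonal_relations m U))
          (quadratic_part m (orthogonal_relations m U))))"
proof -
  interpret connected_dg_algebra scale A d by (rule assms(1))
  obtain actK :: "'a \<Rightarrow> 'p \<Rightarrow> 'p" and K dK eK BsK where
    K: "dg_module scale A d actK K dK" "semibasis actK K dK BsK" "(\<Union>n. BsK n) \<subseteq> K 0"
      "resolves_trivial actK K dK eK"
    using assms(2) unfolding koszul_dg_def by blast
  obtain Bs e where M: "dg_module scale A d act M dM" "semibasis act M dM Bs" "resolves_trivial act M dM e"
    using assms(3) unfolding semifree_resolution_def by blast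
  have KR: "koszul_resolution scale A d actK K dK BsK eK"
    using K by (intro koszul_resolution.intro koszul_resolution_axioms.intro semifree_dg_module.intro
        semifree_dg_module_axioms.intro resolution.intro resolution_axioms.intro)
  have "semifree_dg_module scale A d act M dM Bs" "resolution scale A d act M dM e"
    using M by (simp_all add: semifree_dg_module_def semifree_dg_module_axioms_def resolution_def
        resolution_axioms_def)
  from comparison_exists[OF KR this] obtain phi psi hom where
    "comparison scale A d actK K dK BsK eK act M dM Bs e phi psi hom" by blast
  then interpret comparison scale A d actK K dK BsK eK act M dM Bs e phi psi hom .
  have "graded_alg_iso (gr_alg M.ext_alg ext_filtration) (gr_part M.ext_alg ext_filtration)
      (quadratic_alg m (orthogonal_relations m U)) (quadratic_part m (orthogonal_relations m U))"
    if U: "quadratic_relations m U"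
      and iso: "graded_alg_iso cohomology_alg cohomology_part (quadratic_alg m U) (quadratic_part m U)"
      and res: "has_koszul_resolution TYPE('q) cohomology_alg cohomology_part" for m U
  proof -
    obtain v where
      v: "\<And>i. i < m \<Longrightarrow> v i \<in> A 1" "\<And>i. i < m \<Longrightarrow> d (v i) = 0"
        "\<And>a. a \<in> A 1 \<Longrightarrow> d a = 0 \<Longrightarrow> \<exists>c. a = (\<Sum>i<m. scale (c i) (v i))"
      and ind: "\<And>c. (\<Sum>i<m. scale (c i) (v i)) \<in> range d \<Longrightarrow> \<forall>i<m. c i = 0"
      and rel: "\<And>g. g \<in> tensor_part m 2 \<Longrightarrow>
        (\<Sum>i<m. \<Sum>l<m. scale (g [i, l]) (v i * v l)) \<in> range d \<longleftrightarrow> g \<in> U"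
      by (rule letters_exist[OF U iso]) ((rule that; assumption) | (rule that; blast))
    obtain vco where
      vco: "\<And>i. i < m \<Longrightarrow> functional scale (vco i)" "\<And>i y. i < m \<Longrightarrow> y \<in> range d \<Longrightarrow> vco i y = 0"
        "\<And>i j. i < m \<Longrightarrow> j < m \<Longrightarrow> vco i (v j) = (if i = j then 1 else 0)"
      by (rule alg.coordinate_functionals[OF boundaries_subspace, of v m, OF ind])
        (assumption | (rule that; assumption) | (rule that; blast))+
    have letters: "koszul_letters scale A d actK K dK BsK eK m v vco"
      by (intro koszul_letters.intro koszul_letters_axioms.intro KR v vco)
    obtain hact :: "nat \<Rightarrow> 'a set \<Rightarrow> 'q \<Rightarrow> 'q" and Q G dQ e' where res:
      "\<And>n. graded_left_module cohomology_alg cohomology_part (hact n) (Q n) (G n) \<and>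
         (\<exists>B. module_basis cohomology_alg (hact n) (Q n) B \<and> B \<subseteq> (\<Union>j. G n j)) \<and>
         Q n = left_span cohomology_alg (hact n) (G n (int n))"
      "\<And>n. graded_hom cohomology_alg (hact (Suc n)) (Q (Suc n)) (G (Suc n)) (hact n) (Q n) (G n) (dQ n)"
      "graded_hom cohomology_alg (hact 0) (Q 0) (G 0)
        (trivial_act cohomology_alg cohomology_part) UNIV trivial_grading e'"
      "e' ` Q 0 = UNIV" "{x \<in> Q 0. e' x = 0} = dQ 0 ` Q (Suc 0)"
      "\<And>n. {x \<in> Q (Suc n). dQ n x = 0} = dQ (Suc n) ` Q (Suc (Suc n))"
      using res unfolding has_koszul_resolution_def by (elim exE conjE) (rule that; (assumption | (drule spec, assumption)))
    have "\<exists>B. module_basis cohomology_alg (hact n) (Q n) B \<and> B \<subseteq> (\<Union>j. G n j)" for n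
      using res(1)[of n] by (elim conjE)
    then obtain B where B: "\<And>n. module_basis cohomology_alg (hact n) (Q n) (B n)"
      "\<And>n. B n \<subseteq> (\<Union>j. G n j)" by metis
    have modules: "graded_left_module cohomology_alg cohomology_part (hact n) (Q n) (G n)"
      "Q n = left_span cohomology_alg (hact n) (G n (int n))" for n
      using res(1)[of n] by blast+
    interpret C: koszul_complex scale A d hact Q G dQ e' B m v vco
      by (intro koszul_complex.intro koszul_complex_axioms.intro assms(1) modules res(2-6) B v vco)
    have "koszul_exactness scale A d actK K dK BsK eK m v vco"
      by (intro koszul_exactness.intro koszul_exactness_axioms.intro letters C.koszul_complex_exact)
    then show ?thesis using U rel by (rule ext_graded_iso)
  qed
  then show ?thesis using ext_augmented ext_filtration_filters by blast
qed

end
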